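(* Let $k$ be a commutative rig and let $(\mathcal C,\otimes,I)$ be a $k$-linear symmetric monoidal category with finite biproducts which admits algebraically-free commutative monoids, with data $(SX,\ \mathsf d^S_X\colon SX\otimes X\to SX,\ \mathsf u^S_X\colon I\to SX)$ for $X\in\mathcal C$. For any coalgebra modality $(!,\delta,\varepsilon,\Delta,\mathsf e)$ on $\mathcal C$, the free differential modality $!^\partial$ on $!$ exists: there are a differential modality $!^\partial$ on $\mathcal C$ and a morphism of coalgebra modalities $\zeta\colon !\to !^\partial$ such that for every differential modality $!'$ on $\mathcal C$ and every morphism of coalgebra modalities $\psi\colon !\to !'$ there is a unique morphism of differential modalities $\psi^\sharp\colon !^\partial\to !'$ with $\psi^\sharp\circ\zeta=\psi$. Its structure $(!^\partial,\delta^\partial,\varepsilon^\partial,\Delta^\partial,\mathsf e^\partial,\mathsf d^\partial)$ is given as follows. (1) The functor: $!^\partial X = !X\otimes SX$ and $!^\partial f = !f\otimes Sf$, where for $f\colon X\to Y$, $Sf\colon SX\to SY$ is the unique map with $Sf\circ\mathsf u^S_X=\mathsf u^S_Y$ and $Sf\circ\mathsf d^S_X=\mathsf d^S_Y\circ(Sf\otimes f)$. (2) The deriving transformation: $\mathsf d^\partial_X = !X\otimes\mathsf d^S_X\colon !X\otimes SX\otimes X\to !X\otimes SX$. (3) The unit map $\zeta\colon !\to !^\partial$ exhibiting freeness has components $\zeta_X = !X\otimes\mathsf u^S_X\colon !X\to !X\otimes SX$. (4) The comonoid structure maps $\mathsf e^\partial_X\colon !^\partial X\to I$ and $\Delta^\partial_X\colon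 !^\partial X\to !^\partial X\otimes !^\partial X$ are the unique maps such that $\mathsf e^\partial_X\circ\zeta_X=\mathsf e_X$ and $\Delta^\partial_X\circ\zeta_X=(\zeta_X\otimes\zeta_X)\circ\Delta_X$ and such that the constant and product rules for $\mathsf d^\partial$ hold. (5) The comonad structure maps $\varepsilon^\partial_X\colon !^\partial X\to X$ and $\delta^\partial_X\colon !^\partial X\to !^\partial !^\partial X$ are the unique maps such that $\varepsilon^\partial_X\circ\zeta_X=\varepsilon_X$ and $\delta^\partial_X\circ\zeta_X=(\zeta\zeta)_X\circ\delta_X$ and such that the linear and chain rules for $\mathsf d^\partial$ hold.
   Context: Associativity and unit constraints are suppressed; $\sigma$ denotes the symmetry; an object's name also denotes its identity map. A commutative rig is a commutative "ring without negatives" (commutative semiring). A symmetric monoidal category is $k$-linear if each hom-set is a $k$-module and composition and tensor product of morphisms are $k$-linear in each variable. Algebraically-free commutative monoids. For $X\in\mathcal C$, a commuting $X$-action is a pair $(A,\alpha\colon A\otimes X\to A)$ with $\alpha\circ(\alpha\otimes X)\circ(A\otimes\sigma_{X,X})=\alpha\circ(\alpha\otimes X)$; a map $(A,\alpha)\to(B,\beta)$ is $f\colon A\to B$ with $f\circ\alpha=\beta\circ(f\otimes X)$; these form the category $\mathsf{CAct}[X]$. $\mathcal C$ admits algebraically-free commutative monoids if for each $X$ there is given a commutative monoid $(SX,\mathsf u^S_X\colon I\to SX,\nabla^S_X\colon SX\otimes SX\to SX)$ and a map $\eta^S_X\colon X\to SX$ exhibiting it as the free commutative monoid on $X$, such that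 the functor $\mathsf{Mod}[SX]\to\mathsf{CAct}[X]$ sending a right $SX$-module $(A,\rho)$ to $(A,\rho\circ(A\otimes\eta^S_X))$ is an isomorphism of categories. One writes $\mathsf d^S_X=\nabla^S_X\circ(SX\otimes\eta^S_X)\colon SX\otimes X\to SX$. A coalgebra modality on $\mathcal C$ is a comonad $(!,\varepsilon,\delta)$, with $\varepsilon_X\colon !X\to X$ and $\delta_X\colon !X\to !!X$, together with natural maps $\mathsf e_X\colon !X\to I$, $\Delta_X\colon !X\to !X\otimes !X$ making each $!X$ a cocommutative comonoid, such that each $\delta_X\colon(!X,\Delta_X,\mathsf e_X)\to(!!X,\Delta_{!X},\mathsf e_{!X})$ is a comonoid morphism. A morphism of coalgebra modalities $\varphi\colon !^1\to !^2$ is a comonad morphism (a natural transformation with $\varepsilon^2\varphi=\varepsilon^1$ and $\delta^2\varphi=(\varphi\varphi)\delta^1$) each of whose components is a comonoid homomorphism. Here $(\zeta\zeta)_X\colon !!X\to !^\partial!^\partial X$ denotes the horizontal composite. A differential modality is a coalgebra modality with a deriving transformation: a natural family $\mathsf d_X\colon !X\otimes X\to !X$ satisfying - constant rule: $\mathsf e_X\circ\mathsf d_X=0$; - product rule: $\Delta_X\circ\mathsf d_X=\big[(!X\otimes\mathsf d_X)+(\mathsf d_X\otimes !X)\circ(!X\otimes\sigma_{!X,X})\big]\circ(\Delta_X\otimes X)$; - linear rule: $\varepsilon_X\circ\mathsf d_X=\mathsf e_X\otimes X$; - chain rule: $\delta_X\circ\mathsf d_X=\mathsf d_{!X}\circ(\delta_X\otimes\mathsf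 d_X)\circ(\Delta_X\otimes X)$; - interchange rule: $\mathsf d_X\circ(\mathsf d_X\otimes X)\circ(!X\otimes\sigma_{X,X})=\mathsf d_X\circ(\mathsf d_X\otimes X)$. A morphism of differential modalities is a morphism $\varphi$ of the underlying coalgebra modalities with $\varphi_X\circ\mathsf d^1_X=\mathsf d^2_X\circ(\varphi_X\otimes X)$. *)

theory Defs
  imports Main
begin

section \<open>Categories, functors, natural transformations\<close>

record ('o, 'm) cat =
  Ob :: "'o set"
  Arr :: "'m set"
  Dom :: "'m \<Rightarrow> 'o"
  Cod :: "'m \<Rightarrow> 'o"
  Ident :: "'o \<Rightarrow> 'm" ("\<one>\<index>_" [1000] 999)
  Comp :: "'m \<Rightarrow> 'm \<Rightarrow> 'm" (infixr "\<cdot>\<index>" 55)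

definition hom :: "('o, 'm, 'x) cat_scheme \<Rightarrow> 'o \<Rightarrow> 'o \<Rightarrow> 'm set" where
  "hom C A B = {f \<in> Arr C. Dom C f = A \<and> Cod C f = B}"

locale category =
  fixes C :: "('o, 'm, 'x) cat_scheme" (structure)
  assumes Dom_Ob: "f \<in> Arr C \<Longrightarrow> Dom C f \<in> Ob C"
    and Cod_Ob: "f \<in> Arr C \<Longrightarrow> Cod C f \<in> Ob C"
    and Ident_hom: "A \<in> Ob C \<Longrightarrow> \<one>A \<in> hom C A A"
    and Comp_hom: "f \<in> hom C A B \<Longrightarrow> g \<in> hom C B D \<Longrightarrow> g \<cdot> f \<in> hom C A D"
    and Comp_Ident: "f \<in> hom C A B \<Longrightarrow> f \<cdot> \<one>A = f"
    and Ident_Comp: "f \<in> hom C A B \<Longrightarrow> \<one>B \<cdot> f = f"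
    and Comp_assoc: "f \<in> hom C A B \<Longrightarrow> g \<in> hom C B D \<Longrightarrow> h \<in> hom C D E
      \<Longrightarrow> (h \<cdot> g) \<cdot> f = h \<cdot> (g \<cdot> f)"

definition is_functor ::
  "('o, 'm, 'x) cat_scheme \<Rightarrow> ('p, 'n, 'y) cat_scheme \<Rightarrow> ('o \<Rightarrow> 'p) \<Rightarrow> ('m \<Rightarrow> 'n) \<Rightarrow> bool" where
  "is_functor C D Fo Fa \<longleftrightarrow>
     (\<forall>A\<in>Ob C. Fo A \<in> Ob D) \<and>
     (\<forall>A\<in>Ob C. \<forall>B\<in>Ob C. \<forall>f\<in>hom C A B. Fa f \<in> hom D (Fo A) (Fo B)) \<and>
     (\<forall>A\<in>Ob C. Fa (\<one>\<^bsub>C\<^esub>A) = \<one>\<^bsub>D\<^esub>(Fo A)) \<and>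
     (\<forall>A\<in>Ob C. \<forall>B\<in>Ob C. \<forall>E\<in>Ob C. \<forall>f\<in>hom C A B. \<forall>g\<in>hom C B E.
        Fa (g \<cdot>\<^bsub>C\<^esub> f) = Fa g \<cdot>\<^bsub>D\<^esub> Fa f)"

definition is_iso_of_categories ::
  "('o, 'm, 'x) cat_scheme \<Rightarrow> ('p, 'n, 'y) cat_scheme \<Rightarrow> ('o \<Rightarrow> 'p) \<Rightarrow> ('m \<Rightarrow> 'n) \<Rightarrow> bool" where
  "is_iso_of_categories C D Fo Fa \<longleftrightarrow>
     is_functor C D Fo Fa \<and> bij_betw Fo (Ob C) (Ob D) \<and> bij_betw Fa (Arr C) (Arr D)"

definition is_natural ::
  "('o, 'm, 'x) cat_scheme \<Rightarrow> ('p, 'n, 'y) cat_scheme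
   \<Rightarrow> ('o \<Rightarrow> 'p) \<Rightarrow> ('m \<Rightarrow> 'n) \<Rightarrow> ('o \<Rightarrow> 'p) \<Rightarrow> ('m \<Rightarrow> 'n) \<Rightarrow> ('o \<Rightarrow> 'n) \<Rightarrow> bool" where
  "is_natural C D Fo Fa Go Ga t \<longleftrightarrow>
     (\<forall>A\<in>Ob C. t A \<in> hom D (Fo A) (Go A)) \<and>
     (\<forall>A\<in>Ob C. \<forall>B\<in>Ob C. \<forall>f\<in>hom C A B. t B \<cdot>\<^bsub>D\<^esub> Fa f = Ga f \<cdot>\<^bsub>D\<^esub> t A)"


section \<open>Linear symmetric monoidal categories with finite biproducts\<close>

text \<open>Monoidal categories are not assumed to be strict. The structural isomorphisms are
  \<open>Assoc A B D : (A \<otimes> B) \<otimes> D \<rightarrow> A \<otimes> (B \<otimes> D)\<close>, \<open>LUnit A : I \<otimes> A \<rightarrow> A\<close>,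
  \<open>RUnit A : A \<otimes> I \<rightarrow> A\<close>, with chosen inverses. The tensor product is written \<open>\<boxtimes>\<close> on objects
  and \<open>\<otimes>\<close> on arrows.\<close>

record ('o, 'm) smc = "('o, 'm) cat" +
  TensO :: "'o \<Rightarrow> 'o \<Rightarrow> 'o" (infix "\<boxtimes>\<index>" 70)
  TensA :: "'m \<Rightarrow> 'm \<Rightarrow> 'm" (infix "\<otimes>\<index>" 70)
  Unit :: "'o" ("\<I>\<index>")
  Assoc :: "'o \<Rightarrow> 'o \<Rightarrow> 'o \<Rightarrow> 'm"
  Assoc_inv :: "'o \<Rightarrow> 'o \<Rightarrow> 'o \<Rightarrow> 'm"
  LUnit :: "'o \<Rightarrow> 'm"
  LUnit_inv :: "'o \<Rightarrow> 'm"
  RUnit :: "'o \<Rightarrow> 'm"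
  RUnit_inv :: "'o \<Rightarrow> 'm"
  Sym :: "'o \<Rightarrow> 'o \<Rightarrow> 'm"

definition mutually_inverse :: "('o, 'm, 'x) cat_scheme \<Rightarrow> 'o \<Rightarrow> 'o \<Rightarrow> 'm \<Rightarrow> 'm \<Rightarrow> bool" where
  "mutually_inverse C A B f g \<longleftrightarrow> f \<in> hom C A B \<and> g \<in> hom C B A \<and>
     g \<cdot>\<^bsub>C\<^esub> f = \<one>\<^bsub>C\<^esub>A \<and> f \<cdot>\<^bsub>C\<^esub> g = \<one>\<^bsub>C\<^esub>B"

locale symmetric_monoidal_category = category C
  for C :: "('o, 'm, 'x) smc_scheme" (structure) +
  assumes Unit_Ob: "\<I> \<in> Ob C"
    and TensO_Ob: "A \<in> Ob C \<Longrightarrow> B \<in> Ob C \<Longrightarrow> A \<boxtimes> B \<in> Ob C"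
    and TensA_hom: "f \<in> hom C A B \<Longrightarrow> g \<in> hom C D E \<Longrightarrow> f \<otimes> g \<in> hom C (A \<boxtimes> D) (B \<boxtimes> E)"
    and TensA_Ident: "A \<in> Ob C \<Longrightarrow> B \<in> Ob C \<Longrightarrow> \<one>A \<otimes> \<one>B = \<one>(A \<boxtimes> B)"
    and TensA_Comp: "f \<in> hom C A B \<Longrightarrow> g \<in> hom C B D \<Longrightarrow> f' \<in> hom C A' B' \<Longrightarrow> g' \<in> hom C B' D'
      \<Longrightarrow> (g \<cdot> f) \<otimes> (g' \<cdot> f') = (g \<otimes> g') \<cdot> (f \<otimes> f')"
    and Assoc_iso: "A \<in> Ob C \<Longrightarrow> B \<in> Ob C \<Longrightarrow> D \<in> Ob C
      \<Longrightarrow> mutually_inverse C ((A \<boxtimes> B) \<boxtimes> D) (A \<boxtimes> (B \<boxtimes> D)) (Assoc C A B D) (Assoc_inv C A B D)"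
    and LUnit_iso: "A \<in> Ob C \<Longrightarrow> mutually_inverse C (\<I> \<boxtimes> A) A (LUnit C A) (LUnit_inv C A)"
    and RUnit_iso: "A \<in> Ob C \<Longrightarrow> mutually_inverse C (A \<boxtimes> \<I>) A (RUnit C A) (RUnit_inv C A)"
    and Assoc_natural: "f \<in> hom C A A' \<Longrightarrow> g \<in> hom C B B' \<Longrightarrow> h \<in> hom C D D'
      \<Longrightarrow> Assoc C A' B' D' \<cdot> ((f \<otimes> g) \<otimes> h) = (f \<otimes> (g \<otimes> h)) \<cdot> Assoc C A B D"
    and LUnit_natural: "f \<in> hom C A B \<Longrightarrow> LUnit C B \<cdot> (\<one>\<I> \<otimes> f) = f \<cdot> LUnit C A"
    and RUnit_natural: "f \<in> hom C A B \<Longrightarrow> RUnit C B \<cdot> (f \<otimes> \<one>\<I>) = f \<cdot> RUnit C A"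
    and pentagon: "A \<in> Ob C \<Longrightarrow> B \<in> Ob C \<Longrightarrow> D \<in> Ob C \<Longrightarrow> E \<in> Ob C
      \<Longrightarrow> Assoc C A B (D \<boxtimes> E) \<cdot> Assoc C (A \<boxtimes> B) D E
        = (\<one>A \<otimes> Assoc C B D E) \<cdot> Assoc C A (B \<boxtimes> D) E \<cdot> (Assoc C A B D \<otimes> \<one>E)"
    and triangle: "A \<in> Ob C \<Longrightarrow> B \<in> Ob C
      \<Longrightarrow> (\<one>A \<otimes> LUnit C B) \<cdot> Assoc C A \<I> B = RUnit C A \<otimes> \<one>B"
    and Sym_hom: "A \<in> Ob C \<Longrightarrow> B \<in> Ob C \<Longrightarrow> Sym C A B \<in> hom C (A \<boxtimes> B) (B \<boxtimes> A)"
    and Sym_natural: "f \<in> hom C A A' \<Longrightarrow> g \<in> hom C B B'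
      \<Longrightarrow> Sym C A' B' \<cdot> (f \<otimes> g) = (g \<otimes> f) \<cdot> Sym C A B"
    and Sym_Sym: "A \<in> Ob C \<Longrightarrow> B \<in> Ob C \<Longrightarrow> Sym C B A \<cdot> Sym C A B = \<one>(A \<boxtimes> B)"
    and hexagon: "A \<in> Ob C \<Longrightarrow> B \<in> Ob C \<Longrightarrow> D \<in> Ob C
      \<Longrightarrow> Assoc C B D A \<cdot> Sym C A (B \<boxtimes> D) \<cdot> Assoc C A B D
        = (\<one>B \<otimes> Sym C A D) \<cdot> Assoc C B A D \<cdot> (Sym C A B \<otimes> \<one>D)"

text \<open>The sort of \<open>'k\<close> is that of commutative rigs; unlike \<open>comm_semiring_1\<close> it does not
  exclude \<open>0 = 1\<close>.\<close>

record ('o, 'm, 'k) linear_smc = "('o, 'm) smc" +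
  Add :: "'m \<Rightarrow> 'm \<Rightarrow> 'm" (infixl "\<oplus>\<index>" 52)
  Zero :: "'o \<Rightarrow> 'o \<Rightarrow> 'm"
  Scale :: "'k \<Rightarrow> 'm \<Rightarrow> 'm" (infixr "\<odot>\<index>" 60)

locale linear_symmetric_monoidal_category = symmetric_monoidal_category C
  for C :: "('o, 'm, 'k :: {comm_semiring_0, comm_monoid_mult}, 'x) linear_smc_scheme" (structure) +
  assumes Add_hom: "f \<in> hom C A B \<Longrightarrow> g \<in> hom C A B \<Longrightarrow> f \<oplus> g \<in> hom C A B"
    and Zero_hom: "A \<in> Ob C \<Longrightarrow> B \<in> Ob C \<Longrightarrow> Zero C A B \<in> hom C A B"
    and Scale_hom: "f \<in> hom C A B \<Longrightarrow> r \<odot> f \<in> hom C A B"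
    and Add_assoc: "f \<in> hom C A B \<Longrightarrow> g \<in> hom C A B \<Longrightarrow> h \<in> hom C A B
      \<Longrightarrow> (f \<oplus> g) \<oplus> h = f \<oplus> (g \<oplus> h)"
    and Add_commute: "f \<in> hom C A B \<Longrightarrow> g \<in> hom C A B \<Longrightarrow> f \<oplus> g = g \<oplus> f"
    and Add_Zero: "f \<in> hom C A B \<Longrightarrow> f \<oplus> Zero C A B = f"
    and Scale_Add: "f \<in> hom C A B \<Longrightarrow> g \<in> hom C A B \<Longrightarrow> r \<odot> (f \<oplus> g) = (r \<odot> f) \<oplus> (r \<odot> g)"
    and Scale_Zero: "A \<in> Ob C \<Longrightarrow> B \<in> Ob C \<Longrightarrow> r \<odot> Zero C A B = Zero C A B"
    and add_Scale: "f \<in> hom C A B \<Longrightarrow> (r + s) \<odot> f = (r \<odot> f) \<oplus> (s \<odot> f)"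
    and zero_Scale: "f \<in> hom C A B \<Longrightarrow> 0 \<odot> f = Zero C A B"
    and mult_Scale: "f \<in> hom C A B \<Longrightarrow> (r * s) \<odot> f = r \<odot> (s \<odot> f)"
    and one_Scale: "f \<in> hom C A B \<Longrightarrow> 1 \<odot> f = f"
    and Comp_Add_left: "f \<in> hom C A B \<Longrightarrow> g \<in> hom C B D \<Longrightarrow> g' \<in> hom C B D
      \<Longrightarrow> (g \<oplus> g') \<cdot> f = (g \<cdot> f) \<oplus> (g' \<cdot> f)"
    and Comp_Add_right: "f \<in> hom C A B \<Longrightarrow> f' \<in> hom C A B \<Longrightarrow> g \<in> hom C B D
      \<Longrightarrow> g \<cdot> (f \<oplus> f') = (g \<cdot> f) \<oplus> (g \<cdot> f')"
    and Comp_Scale_left: "f \<in> hom C A B \<Longrightarrow> g \<in> hom C B D \<Longrightarrow> (r \<odot> g) \<cdot> f = r \<odot> (g \<cdot> f)"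
    and Comp_Scale_right: "f \<in> hom C A B \<Longrightarrow> g \<in> hom C B D \<Longrightarrow> g \<cdot> (r \<odot> f) = r \<odot> (g \<cdot> f)"
    and TensA_Add_left: "f \<in> hom C A B \<Longrightarrow> f' \<in> hom C A B \<Longrightarrow> g \<in> hom C D E
      \<Longrightarrow> (f \<oplus> f') \<otimes> g = (f \<otimes> g) \<oplus> (f' \<otimes> g)"
    and TensA_Add_right: "f \<in> hom C A B \<Longrightarrow> g \<in> hom C D E \<Longrightarrow> g' \<in> hom C D E
      \<Longrightarrow> f \<otimes> (g \<oplus> g') = (f \<otimes> g) \<oplus> (f \<otimes> g')"
    and TensA_Scale_left: "f \<in> hom C A B \<Longrightarrow> g \<in> hom C D E \<Longrightarrow> (r \<odot> f) \<otimes> g = r \<odot> (f \<otimes> g)"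
    and TensA_Scale_right: "f \<in> hom C A B \<Longrightarrow> g \<in> hom C D E \<Longrightarrow> f \<otimes> (r \<odot> g) = r \<odot> (f \<otimes> g)"

context
  fixes C :: "('o, 'm, 'k, 'x) linear_smc_scheme" (structure)
begin

definition is_zero_object :: "'o \<Rightarrow> bool" where
  "is_zero_object Z \<longleftrightarrow> Z \<in> Ob C \<and> (\<forall>A\<in>Ob C. (\<exists>!f. f \<in> hom C Z A) \<and> (\<exists>!f. f \<in> hom C A Z))"

definition is_biproduct :: "'o \<Rightarrow> 'o \<Rightarrow> 'o \<Rightarrow> 'm \<Rightarrow> 'm \<Rightarrow> 'm \<Rightarrow> 'm \<Rightarrow> bool" where
  "is_biproduct A B P p1 p2 i1 i2 \<longleftrightarrow>
     p1 \<in> hom C P A \<and> p2 \<in> hom C P B \<and> i1 \<in> hom C A P \<and> i2 \<in> hom C B P \<and>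
     p1 \<cdot> i1 = \<one>A \<and> p2 \<cdot> i2 = \<one>B \<and> p1 \<cdot> i2 = Zero C B A \<and> p2 \<cdot> i1 = Zero C A B \<and>
     (i1 \<cdot> p1) \<oplus> (i2 \<cdot> p2) = \<one>P"

definition has_finite_biproducts :: bool where
  "has_finite_biproducts \<longleftrightarrow> (\<exists>Z. is_zero_object Z) \<and>
     (\<forall>A\<in>Ob C. \<forall>B\<in>Ob C. \<exists>P p1 p2 i1 i2. is_biproduct A B P p1 p2 i1 i2)"

end


section \<open>Algebraically-free commutative monoids\<close>

context
  fixes C :: "('o, 'm, 'x) smc_scheme" (structure)
begin

definition is_commutative_monoid :: "'o \<Rightarrow> 'm \<Rightarrow> 'm \<Rightarrow> bool" where
  "is_commutative_monoid M u m \<longleftrightarrow>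
     M \<in> Ob C \<and> u \<in> hom C \<I> M \<and> m \<in> hom C (M \<boxtimes> M) M \<and>
     m \<cdot> (m \<otimes> \<one>M) = m \<cdot> (\<one>M \<otimes> m) \<cdot> Assoc C M M M \<and>
     m \<cdot> (u \<otimes> \<one>M) = LUnit C M \<and>
     m \<cdot> (\<one>M \<otimes> u) = RUnit C M \<and>
     m \<cdot> Sym C M M = m"

definition is_monoid_morphism :: "'o \<Rightarrow> 'm \<Rightarrow> 'm \<Rightarrow> 'o \<Rightarrow> 'm \<Rightarrow> 'm \<Rightarrow> 'm \<Rightarrow> bool" where
  "is_monoid_morphism M u m N v n h \<longleftrightarrow>
     h \<in> hom C M N \<and> h \<cdot> u = v \<and> h \<cdot> m = n \<cdot> (h \<otimes> h)"

definition is_free_commutative_monoid :: "'o \<Rightarrow> 'o \<Rightarrow> 'm \<Rightarrow> 'm \<Rightarrow> 'm \<Rightarrow> bool" where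
  "is_free_commutative_monoid X M u m \<eta> \<longleftrightarrow>
     is_commutative_monoid M u m \<and> \<eta> \<in> hom C X M \<and>
     (\<forall>N v n f. is_commutative_monoid N v n \<and> f \<in> hom C X N \<longrightarrow>
        (\<exists>!h. is_monoid_morphism M u m N v n h \<and> h \<cdot> \<eta> = f))"

definition is_right_module :: "'o \<Rightarrow> 'm \<Rightarrow> 'm \<Rightarrow> 'o \<Rightarrow> 'm \<Rightarrow> bool" where
  "is_right_module M u m A r \<longleftrightarrow>
     A \<in> Ob C \<and> r \<in> hom C (A \<boxtimes> M) A \<and>
     r \<cdot> (r \<otimes> \<one>M) = r \<cdot> (\<one>A \<otimes> m) \<cdot> Assoc C A M M \<and>
     r \<cdot> (\<one>A \<otimes> u) = RUnit C A"

definition commutes_with_itself :: "'o \<Rightarrow> 'o \<Rightarrow> 'm \<Rightarrow> bool" where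
  "commutes_with_itself X A a \<longleftrightarrow>
     a \<cdot> (a \<otimes> \<one>X) \<cdot> Assoc_inv C A X X \<cdot> (\<one>A \<otimes> Sym C X X) \<cdot> Assoc C A X X = a \<cdot> (a \<otimes> \<one>X)"

definition is_commuting_action :: "'o \<Rightarrow> 'o \<Rightarrow> 'm \<Rightarrow> bool" where
  "is_commuting_action X A a \<longleftrightarrow>
     A \<in> Ob C \<and> a \<in> hom C (A \<boxtimes> X) A \<and> commutes_with_itself X A a"

text \<open>Objects are pairs \<open>(A, a : A \<otimes> X \<rightarrow> A)\<close> in the given set; an arrow carries its source and
  target, which are not determined by the underlying arrow of \<open>C\<close>.\<close>

definition action_category ::
  "'o \<Rightarrow> ('o \<times> 'm) set \<Rightarrow> ('o \<times> 'm, ('o \<times> 'm) \<times> 'm \<times> ('o \<times> 'm)) cat" where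
  "action_category X Acts =
     \<lparr> Ob = Acts,
       Arr = {((A, a), f, (B, b)) | A a f B b. (A, a) \<in> Acts \<and> (B, b) \<in> Acts \<and>
                f \<in> hom C A B \<and> f \<cdot> a = b \<cdot> (f \<otimes> \<one>X)},
       Dom = (\<lambda>(P, f, Q). P),
       Cod = (\<lambda>(P, f, Q). Q),
       Ident = (\<lambda>(A, a). ((A, a), \<one>A, (A, a))),
       Comp = (\<lambda>(P', g, Q') (P, f, Q). (P, g \<cdot> f, Q')) \<rparr>"

definition Mod :: "'o \<Rightarrow> 'm \<Rightarrow> 'm \<Rightarrow> ('o \<times> 'm, ('o \<times> 'm) \<times> 'm \<times> ('o \<times> 'm)) cat" where
  "Mod M u m = action_category M {(A, r). is_right_module M u m A r}"

definition CAct :: "'o \<Rightarrow> ('o \<times> 'm, ('o \<times> 'm) \<times> 'm \<times> ('o \<times> 'm)) cat" where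
  "CAct X = action_category X {(A, a). is_commuting_action X A a}"

definition restrict_ob :: "'m \<Rightarrow> 'o \<times> 'm \<Rightarrow> 'o \<times> 'm" where
  "restrict_ob \<eta> = (\<lambda>(A, r). (A, r \<cdot> (\<one>A \<otimes> \<eta>)))"

definition restrict_arr ::
  "'m \<Rightarrow> ('o \<times> 'm) \<times> 'm \<times> ('o \<times> 'm) \<Rightarrow> ('o \<times> 'm) \<times> 'm \<times> ('o \<times> 'm)" where
  "restrict_arr \<eta> = (\<lambda>(P, f, Q). (restrict_ob \<eta> P, f, restrict_ob \<eta> Q))"

end

record ('o, 'm) free_monoids =
  S_ob :: "'o \<Rightarrow> 'o"
  S_unit :: "'o \<Rightarrow> 'm"
  S_mult :: "'o \<Rightarrow> 'm"
  S_eta :: "'o \<Rightarrow> 'm"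

definition algebraically_free_commutative_monoids ::
  "('o, 'm, 'x) smc_scheme \<Rightarrow> ('o, 'm) free_monoids \<Rightarrow> bool" where
  "algebraically_free_commutative_monoids C S \<longleftrightarrow>
     (\<forall>X\<in>Ob C.
        is_free_commutative_monoid C X (S_ob S X) (S_unit S X) (S_mult S X) (S_eta S X) \<and>
        is_iso_of_categories (Mod C (S_ob S X) (S_unit S X) (S_mult S X)) (CAct C X)
          (restrict_ob C (S_eta S X)) (restrict_arr C (S_eta S X)))"

definition S_deriv :: "('o, 'm, 'x) smc_scheme \<Rightarrow> ('o, 'm) free_monoids \<Rightarrow> 'o \<Rightarrow> 'm" where
  "S_deriv C S X = S_mult S X \<cdot>\<^bsub>C\<^esub> (\<one>\<^bsub>C\<^esub>(S_ob S X) \<otimes>\<^bsub>C\<^esub> S_eta S X)"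

definition is_S_map ::
  "('o, 'm, 'x) smc_scheme \<Rightarrow> ('o, 'm) free_monoids \<Rightarrow> 'o \<Rightarrow> 'o \<Rightarrow> 'm \<Rightarrow> 'm \<Rightarrow> bool" where
  "is_S_map C S X Y f g \<longleftrightarrow>
     g \<in> hom C (S_ob S X) (S_ob S Y) \<and>
     g \<cdot>\<^bsub>C\<^esub> S_unit S X = S_unit S Y \<and>
     g \<cdot>\<^bsub>C\<^esub> S_deriv C S X = S_deriv C S Y \<cdot>\<^bsub>C\<^esub> (g \<otimes>\<^bsub>C\<^esub> f)"


section \<open>Coalgebra modalities\<close>

record ('o, 'm) coalg_mod =
  bang_ob :: "'o \<Rightarrow> 'o"
  bang_arr :: "'m \<Rightarrow> 'm"
  dereliction :: "'o \<Rightarrow> 'm" (* \<epsilon> *)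
  digging :: "'o \<Rightarrow> 'm"     (* \<delta> *)
  counit :: "'o \<Rightarrow> 'm"      (* e *)
  comult :: "'o \<Rightarrow> 'm"      (* \<Delta> *)

context
  fixes C :: "('o, 'm, 'x) smc_scheme" (structure)
begin

definition is_cocommutative_comonoid :: "'o \<Rightarrow> 'm \<Rightarrow> 'm \<Rightarrow> bool" where
  "is_cocommutative_comonoid K e D \<longleftrightarrow>
     K \<in> Ob C \<and> e \<in> hom C K \<I> \<and> D \<in> hom C K (K \<boxtimes> K) \<and>
     Assoc C K K K \<cdot> (D \<otimes> \<one>K) \<cdot> D = (\<one>K \<otimes> D) \<cdot> D \<and>
     LUnit C K \<cdot> (e \<otimes> \<one>K) \<cdot> D = \<one>K \<and>
     RUnit C K \<cdot> (\<one>K \<otimes> e) \<cdot> D = \<one>K \<and>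
     Sym C K K \<cdot> D = D"

definition is_comonoid_morphism :: "'o \<Rightarrow> 'm \<Rightarrow> 'm \<Rightarrow> 'o \<Rightarrow> 'm \<Rightarrow> 'm \<Rightarrow> 'm \<Rightarrow> bool" where
  "is_comonoid_morphism K e D K' e' D' f \<longleftrightarrow>
     f \<in> hom C K K' \<and> e' \<cdot> f = e \<and> D' \<cdot> f = (f \<otimes> f) \<cdot> D"

definition is_comonad :: "('o, 'm, 'y) coalg_mod_scheme \<Rightarrow> bool" where
  "is_comonad T \<longleftrightarrow>
     is_functor C C (bang_ob T) (bang_arr T) \<and>
     is_natural C C (bang_ob T) (bang_arr T) (\<lambda>X. X) (\<lambda>f. f) (dereliction T) \<and>
     is_natural C C (bang_ob T) (bang_arr T)
       (\<lambda>X. bang_ob T (bang_ob T X)) (\<lambda>f. bang_arr T (bang_arr T f)) (digging T) \<and>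
     (\<forall>X\<in>Ob C.
        dereliction T (bang_ob T X) \<cdot> digging T X = \<one>(bang_ob T X) \<and>
        bang_arr T (dereliction T X) \<cdot> digging T X = \<one>(bang_ob T X) \<and>
        digging T (bang_ob T X) \<cdot> digging T X = bang_arr T (digging T X) \<cdot> digging T X)"

definition is_coalgebra_modality :: "('o, 'm, 'y) coalg_mod_scheme \<Rightarrow> bool" where
  "is_coalgebra_modality T \<longleftrightarrow>
     is_comonad T \<and>
     is_natural C C (bang_ob T) (bang_arr T) (\<lambda>X. \<I>) (\<lambda>f. \<one>\<I>) (counit T) \<and>
     is_natural C C (bang_ob T) (bang_arr T)
       (\<lambda>X. bang_ob T X \<boxtimes> bang_ob T X) (\<lambda>f. bang_arr T f \<otimes> bang_arr T f) (comult T) \<and>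
     (\<forall>X\<in>Ob C. is_cocommutative_comonoid (bang_ob T X) (counit T X) (comult T X)) \<and>
     (\<forall>X\<in>Ob C. is_comonoid_morphism
        (bang_ob T X) (counit T X) (comult T X)
        (bang_ob T (bang_ob T X)) (counit T (bang_ob T X)) (comult T (bang_ob T X))
        (digging T X))"

text \<open>The \<open>X\<close>-component \<open>T T X \<rightarrow> T T' X \<rightarrow> T' T' X\<close> of the horizontal composite of a natural
  transformation \<open>T \<rightarrow> T'\<close> with itself.\<close>

definition hcomp_self ::
  "('o, 'm, 'y) coalg_mod_scheme \<Rightarrow> ('o, 'm, 'z) coalg_mod_scheme \<Rightarrow> ('o \<Rightarrow> 'm) \<Rightarrow> 'o \<Rightarrow> 'm" where
  "hcomp_self T T' \<phi> X = \<phi> (bang_ob T' X) \<cdot> bang_arr T (\<phi> X)"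

definition is_comonad_morphism ::
  "('o, 'm, 'y) coalg_mod_scheme \<Rightarrow> ('o, 'm, 'z) coalg_mod_scheme \<Rightarrow> ('o \<Rightarrow> 'm) \<Rightarrow> bool" where
  "is_comonad_morphism T T' \<phi> \<longleftrightarrow>
     is_natural C C (bang_ob T) (bang_arr T) (bang_ob T') (bang_arr T') \<phi> \<and>
     (\<forall>X\<in>Ob C.
        dereliction T' X \<cdot> \<phi> X = dereliction T X \<and>
        digging T' X \<cdot> \<phi> X = hcomp_self T T' \<phi> X \<cdot> digging T X)"

definition is_coalgebra_modality_morphism ::
  "('o, 'm, 'y) coalg_mod_scheme \<Rightarrow> ('o, 'm, 'z) coalg_mod_scheme \<Rightarrow> ('o \<Rightarrow> 'm) \<Rightarrow> bool" where
  "is_coalgebra_modality_morphism T T' \<phi> \<longleftrightarrow>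
     is_comonad_morphism T T' \<phi> \<and>
     (\<forall>X\<in>Ob C. is_comonoid_morphism
        (bang_ob T X) (counit T X) (comult T X)
        (bang_ob T' X) (counit T' X) (comult T' X) (\<phi> X))"

end


section \<open>Differential modalities\<close>

record ('o, 'm) diff_mod = "('o, 'm) coalg_mod" +
  deriv :: "'o \<Rightarrow> 'm"

context
  fixes C :: "('o, 'm, 'k, 'x) linear_smc_scheme" (structure)
begin

text \<open>The first four rules are phrased for individual components: \<open>K\<close> stands for \<open>!X\<close>,
  \<open>d\<close>, \<open>e\<close>, \<open>D\<close>, \<open>\<epsilon>\<close>, \<open>\<delta>\<close> for the components at \<open>X\<close>, and \<open>d'\<close> for the component of the
  deriving transformation at \<open>!X\<close>.\<close>

definition constant_rule :: "'o \<Rightarrow> 'o \<Rightarrow> 'm \<Rightarrow> 'm \<Rightarrow> bool" where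
  "constant_rule X K d e \<longleftrightarrow> e \<cdot> d = Zero C (K \<boxtimes> X) \<I>"

definition product_rule :: "'o \<Rightarrow> 'o \<Rightarrow> 'm \<Rightarrow> 'm \<Rightarrow> bool" where
  "product_rule X K d D \<longleftrightarrow>
     D \<cdot> d =
       (((\<one>K \<otimes> d) \<cdot> Assoc C K K X) \<oplus>
        ((d \<otimes> \<one>K) \<cdot> Assoc_inv C K X K \<cdot> (\<one>K \<otimes> Sym C K X) \<cdot> Assoc C K K X))
       \<cdot> (D \<otimes> \<one>X)"

definition linear_rule :: "'o \<Rightarrow> 'm \<Rightarrow> 'm \<Rightarrow> 'm \<Rightarrow> bool" where
  "linear_rule X d e \<epsilon> \<longleftrightarrow> \<epsilon> \<cdot> d = LUnit C X \<cdot> (e \<otimes> \<one>X)"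

definition chain_rule :: "'o \<Rightarrow> 'o \<Rightarrow> 'm \<Rightarrow> 'm \<Rightarrow> 'm \<Rightarrow> 'm \<Rightarrow> bool" where
  "chain_rule X K d d' D \<delta> \<longleftrightarrow> \<delta> \<cdot> d = d' \<cdot> (\<delta> \<otimes> d) \<cdot> Assoc C K K X \<cdot> (D \<otimes> \<one>X)"

definition is_deriving_transformation :: "('o, 'm, 'y) coalg_mod_scheme \<Rightarrow> ('o \<Rightarrow> 'm) \<Rightarrow> bool" where
  "is_deriving_transformation T d \<longleftrightarrow>
     is_natural C C (\<lambda>X. bang_ob T X \<boxtimes> X) (\<lambda>f. bang_arr T f \<otimes> f) (bang_ob T) (bang_arr T) d \<and>
     (\<forall>X\<in>Ob C.
        constant_rule X (bang_ob T X) (d X) (counit T X) \<and>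
        product_rule X (bang_ob T X) (d X) (comult T X) \<and>
        linear_rule X (d X) (counit T X) (dereliction T X) \<and>
        chain_rule X (bang_ob T X) (d X) (d (bang_ob T X)) (comult T X) (digging T X) \<and>
        commutes_with_itself C X (bang_ob T X) (d X))"  (* interchange rule *)

definition is_differential_modality :: "('o, 'm, 'y) diff_mod_scheme \<Rightarrow> bool" where
  "is_differential_modality T \<longleftrightarrow>
     is_coalgebra_modality C T \<and> is_deriving_transformation T (deriv T)"

definition is_differential_modality_morphism ::
  "('o, 'm, 'y) diff_mod_scheme \<Rightarrow> ('o, 'm, 'z) diff_mod_scheme \<Rightarrow> ('o \<Rightarrow> 'm) \<Rightarrow> bool" where
  "is_differential_modality_morphism T T' \<phi> \<longleftrightarrow>
     is_coalgebra_modality_morphism C T T' \<phi> \<and>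
     (\<forall>X\<in>Ob C. \<phi> X \<cdot> deriv T X = deriv T' X \<cdot> (\<phi> X \<otimes> \<one>X))"

text \<open>Families of components are only meaningful on \<open>Ob C\<close>, so uniqueness is equality there.\<close>

definition is_free_differential_modality ::
  "('o, 'm, 'y) coalg_mod_scheme \<Rightarrow> ('o, 'm) diff_mod \<Rightarrow> ('o \<Rightarrow> 'm) \<Rightarrow> bool" where
  "is_free_differential_modality T T\<^sub>d \<zeta> \<longleftrightarrow>
     is_differential_modality T\<^sub>d \<and>
     is_coalgebra_modality_morphism C T T\<^sub>d \<zeta> \<and>
     (\<forall>(T' :: ('o, 'm) diff_mod) \<psi>.
        is_differential_modality T' \<and> is_coalgebra_modality_morphism C T T' \<psi> \<longrightarrow>
        (\<exists>\<chi>. is_differential_modality_morphism T\<^sub>d T' \<chi> \<and> (\<forall>X\<in>Ob C. \<chi> X \<cdot> \<zeta> X = \<psi> X) \<and>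
           (\<forall>\<chi>'. is_differential_modality_morphism T\<^sub>d T' \<chi>' \<and> (\<forall>X\<in>Ob C. \<chi>' X \<cdot> \<zeta> X = \<psi> X) \<longrightarrow>
              (\<forall>X\<in>Ob C. \<chi>' X = \<chi> X))))"

end

end

theory Submission
  imports Defs
begin

text \<open>
  The interchange rule says that a deriving transformation at \<open>X\<close> is a commuting action of \<open>X\<close> on \<open>!X\<close>.
  Adjoining one freely therefore means passing to the free commuting \<open>X\<close>-action on \<open>!X\<close>. Algebraic freeness
  identifies commuting \<open>X\<close>-actions with \<open>SX\<close>-modules, so that this is the free module \<open>P X = !X \<otimes> SX\<close>
  (\<open>free_action_tensor\<close>). All further structure, and every law, comes from this universal property, taken
  at one object at a time.

  A rule for \<open>d\<close> describes how a structure map \<open>h\<close> behaves on the image of \<open>d\<close>, and there are three cases.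

  The constant and product rules say that \<open>h\<close> is equivariant, for the zero action on \<open>\<I>\<close> and for the Leibniz
  action on a tensor product. Leibniz actions commute again (\<open>commuting_leibniz\<close>), so the counit and
  the comultiplication exist, are unique, and satisfy the comonoid laws (\<open>comonoid_extension\<close>).

  The linear rule prescribes \<open>h \<circ> d\<close> outright. Biproducts turn this primitive recursion into an iteration
  (\<open>recursion\<close>); in particular \<open>\<zeta>\<close> and \<open>d\<close> are jointly epimorphic (\<open>joint_epi\<close>).

  The chain rule has the form \<open>h \<circ> d = c \<circ> (h \<otimes> d) \<circ> (\<Delta> \<otimes> X)\<close> with a commuting action \<open>c\<close> of \<open>P X\<close> on \<open>Z\<close>. It is not
  an equivariance of \<open>h\<close>, but it is one of the graph \<open>(h \<otimes> P X) \<circ> \<Delta>\<close>, for an action of \<open>X\<close> on \<open>Z \<otimes> P X\<close> induced by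
  \<open>c\<close>. The main calculation is that the induced action commutes (\<open>induced_commuting\<close>, based on
  \<open>\<theta>_\<theta>\<close> and \<open>\<theta>_d\<close>). Hence solutions of the chain rule exist and are unique
  (\<open>chain_exists\<close>, \<open>chain_unique\<close>).

  The comonad laws, naturality and the comparison with another differential modality are then
  equations between maps out of \<open>P X\<close> which agree on \<open>!X\<close> and obey the same rule.

  Since the monoidal category is not strict, calculations are carried out with diagrams: natural families of
  arrows between right-nested tensor products that end in a parameter. Constraints become identities there
  (\<open>rep_Assoc\<close>, \<open>rep_LUnit\<close>, \<open>rep_RUnit\<close>), boxes on disjoint wires slide past each other (\<open>interchange\<close>), and
  equations between diagrams can be read back as equations between arrows (\<open>rep_faithful\<close>).
\<close>

section \<open>Composition and unit constraints\<close>

context category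
begin

lemma hom_iff: "f \<in> hom C A B \<longleftrightarrow> f \<in> Arr C \<and> Dom C f = A \<and> Cod C f = B"
  by (simp add: hom_def)

lemma Dom_Cod_Ob [simp]: "f \<in> Arr C \<Longrightarrow> Dom C f \<in> Ob C" "f \<in> Arr C \<Longrightarrow> Cod C f \<in> Ob C"
  by (simp_all add: Dom_Ob Cod_Ob)

lemma hom_Ob: "f \<in> hom C A B \<Longrightarrow> A \<in> Ob C \<and> B \<in> Ob C"
  by (auto simp: hom_iff)

lemma Ident_typing [simp]:
  "A \<in> Ob C \<Longrightarrow> \<one>A \<in> Arr C" "A \<in> Ob C \<Longrightarrow> Dom C (\<one>A) = A" "A \<in> Ob C \<Longrightarrow> Cod C (\<one>A) = A"
  using Ident_hom by (auto simp: hom_iff)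

lemma Comp_typing [simp]:
  assumes "f \<in> Arr C" "g \<in> Arr C" "Dom C g = Cod C f"
  shows "g \<cdot> f \<in> Arr C" "Dom C (g \<cdot> f) = Dom C f" "Cod C (g \<cdot> f) = Cod C g"
  using Comp_hom[of f "Dom C f" "Cod C f" g "Cod C g"] assms by (auto simp: hom_iff)

lemma Comp_assoc_arr [simp]:
  assumes "f \<in> Arr C" "g \<in> Arr C" "h \<in> Arr C" "Dom C g = Cod C f" "Dom C h = Cod C g"
  shows "(h \<cdot> g) \<cdot> f = h \<cdot> (g \<cdot> f)"
  using Comp_assoc[of f _ _ g _ h] assms by (auto simp: hom_iff)

lemma Comp_Ident_arr [simp]:
  "f \<in> Arr C \<Longrightarrow> Dom C f = A \<Longrightarrow> f \<cdot> \<one>A = f" "f \<in> Arr C \<Longrightarrow> Cod C f = A \<Longrightarrow> \<one>A \<cdot> f = f"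
  using Comp_Ident[of f] Ident_Comp[of f] by (auto simp: hom_iff)

text \<open>A commuting triangle at the head of a composite; the form in which equations between
  composites are used once composites are bracketed to the right.\<close>

lemma Comp_eq_extend:
  assumes "g \<cdot> f = h" "f \<in> Arr C" "g \<in> Arr C" "Dom C g = Cod C f" "k \<in> Arr C" "Cod C k = Dom C f"
  shows "g \<cdot> (f \<cdot> k) = h \<cdot> k"
  using assms Comp_assoc_arr[of k f g] by auto

lemma mutually_inverse_typing:
  assumes "mutually_inverse C A B f g"
  shows "f \<in> Arr C" "g \<in> Arr C" "Dom C f = A" "Cod C f = B" "Dom C g = B" "Cod C g = A"
    "g \<cdot> f = \<one>A" "f \<cdot> g = \<one>B"
  using assms by (auto simp: mutually_inverse_def hom_iff)

lemma mutually_inverse_cancel: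
  assumes "mutually_inverse C A B f g"
  shows "x \<in> Arr C \<Longrightarrow> Cod C x = A \<Longrightarrow> g \<cdot> (f \<cdot> x) = x"
    "x \<in> Arr C \<Longrightarrow> Cod C x = B \<Longrightarrow> f \<cdot> (g \<cdot> x) = x"
  using mutually_inverse_typing[OF assms] Comp_assoc_arr[of x f g] Comp_assoc_arr[of x g f]
  by auto

end

context symmetric_monoidal_category
begin

lemma TensO_Ob_simp [simp]: "\<I> \<in> Ob C" "A \<in> Ob C \<Longrightarrow> B \<in> Ob C \<Longrightarrow> A \<boxtimes> B \<in> Ob C"
  by (simp_all add: Unit_Ob TensO_Ob)

lemma TensA_typing [simp]:
  assumes "f \<in> Arr C" "g \<in> Arr C"
  shows "f \<otimes> g \<in> Arr C" "Dom C (f \<otimes> g) = Dom C f \<boxtimes> Dom C g" "Cod C (f \<otimes> g) = Cod C f \<boxtimes> Cod C g"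
  using TensA_hom[of f "Dom C f" "Cod C f" g "Dom C g" "Cod C g"] assms by (auto simp: hom_iff)

lemma TensA_Ident_simp [simp]: "A \<in> Ob C \<Longrightarrow> B \<in> Ob C \<Longrightarrow> \<one>A \<otimes> \<one>B = \<one>(A \<boxtimes> B)"
  by (rule TensA_Ident)

lemma TensA_Comp_arr:
  assumes "f \<in> Arr C" "g \<in> Arr C" "f' \<in> Arr C" "g' \<in> Arr C" "Dom C g = Cod C f" "Dom C g' = Cod C f'"
  shows "(g \<otimes> g') \<cdot> (f \<otimes> f') = (g \<cdot> f) \<otimes> (g' \<cdot> f')"
  using TensA_Comp[of f _ _ g _ f' _ _ g'] assms by (auto simp: hom_iff)

lemma TensA_Comp_arr':
  assumes "f \<in> Arr C" "g \<in> Arr C" "f' \<in> Arr C" "g' \<in> Arr C" "Dom C g = Cod C f" "Dom C g' = Cod C f'"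
    "x \<in> Arr C" "Cod C x = Dom C f \<boxtimes> Dom C f'"
  shows "(g \<otimes> g') \<cdot> ((f \<otimes> f') \<cdot> x) = ((g \<cdot> f) \<otimes> (g' \<cdot> f')) \<cdot> x"
  by (rule Comp_eq_extend[OF TensA_Comp_arr]) (use assms in simp_all)

lemma Assoc_typing [simp]:
  assumes "A \<in> Ob C" "B \<in> Ob C" "D \<in> Ob C"
  shows "Assoc C A B D \<in> Arr C" "Dom C (Assoc C A B D) = (A \<boxtimes> B) \<boxtimes> D"
    "Cod C (Assoc C A B D) = A \<boxtimes> (B \<boxtimes> D)" "Assoc_inv C A B D \<in> Arr C"
    "Dom C (Assoc_inv C A B D) = A \<boxtimes> (B \<boxtimes> D)" "Cod C (Assoc_inv C A B D) = (A \<boxtimes> B) \<boxtimes> D"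
    "Assoc_inv C A B D \<cdot> Assoc C A B D = \<one>((A \<boxtimes> B) \<boxtimes> D)"
    "Assoc C A B D \<cdot> Assoc_inv C A B D = \<one>(A \<boxtimes> (B \<boxtimes> D))"
    "x \<in> Arr C \<Longrightarrow> Cod C x = (A \<boxtimes> B) \<boxtimes> D \<Longrightarrow> Assoc_inv C A B D \<cdot> (Assoc C A B D \<cdot> x) = x"
    "x \<in> Arr C \<Longrightarrow> Cod C x = A \<boxtimes> (B \<boxtimes> D) \<Longrightarrow> Assoc C A B D \<cdot> (Assoc_inv C A B D \<cdot> x) = x"
  using mutually_inverse_typing[OF Assoc_iso[OF assms]] mutually_inverse_cancel[OF Assoc_iso[OF assms]]
  by auto

lemma Unit_typing [simp]:
  assumes "A \<in> Ob C"
  shows "LUnit C A \<in> Arr C" "Dom C (LUnit C A) = \<I> \<boxtimes> A" "Cod C (LUnit C A) = A"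
    "LUnit_inv C A \<in> Arr C" "Dom C (LUnit_inv C A) = A" "Cod C (LUnit_inv C A) = \<I> \<boxtimes> A"
    "RUnit C A \<in> Arr C" "Dom C (RUnit C A) = A \<boxtimes> \<I>" "Cod C (RUnit C A) = A"
    "RUnit_inv C A \<in> Arr C" "Dom C (RUnit_inv C A) = A" "Cod C (RUnit_inv C A) = A \<boxtimes> \<I>"
    "LUnit_inv C A \<cdot> LUnit C A = \<one>(\<I> \<boxtimes> A)" "LUnit C A \<cdot> LUnit_inv C A = \<one>A"
    "RUnit_inv C A \<cdot> RUnit C A = \<one>(A \<boxtimes> \<I>)" "RUnit C A \<cdot> RUnit_inv C A = \<one>A"
    "x \<in> Arr C \<Longrightarrow> Cod C x = \<I> \<boxtimes> A \<Longrightarrow> LUnit_inv C A \<cdot> (LUnit C A \<cdot> x) = x"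
    "x \<in> Arr C \<Longrightarrow> Cod C x = A \<Longrightarrow> LUnit C A \<cdot> (LUnit_inv C A \<cdot> x) = x"
    "x \<in> Arr C \<Longrightarrow> Cod C x = A \<boxtimes> \<I> \<Longrightarrow> RUnit_inv C A \<cdot> (RUnit C A \<cdot> x) = x"
    "x \<in> Arr C \<Longrightarrow> Cod C x = A \<Longrightarrow> RUnit C A \<cdot> (RUnit_inv C A \<cdot> x) = x"
  using mutually_inverse_typing[OF LUnit_iso[OF assms]] mutually_inverse_cancel[OF LUnit_iso[OF assms]]
    mutually_inverse_typing[OF RUnit_iso[OF assms]] mutually_inverse_cancel[OF RUnit_iso[OF assms]]
  by auto

lemma Sym_typing [simp]:
  assumes "A \<in> Ob C" "B \<in> Ob C"
  shows "Sym C A B \<in> Arr C" "Dom C (Sym C A B) = A \<boxtimes> B" "Cod C (Sym C A B) = B \<boxtimes> A"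
    "Sym C B A \<cdot> Sym C A B = \<one>(A \<boxtimes> B)"
    "x \<in> Arr C \<Longrightarrow> Cod C x = A \<boxtimes> B \<Longrightarrow> Sym C B A \<cdot> (Sym C A B \<cdot> x) = x"
proof -
  show t: "Sym C A B \<in> Arr C" "Dom C (Sym C A B) = A \<boxtimes> B" "Cod C (Sym C A B) = B \<boxtimes> A"
    using Sym_hom[OF assms] by (auto simp: hom_iff)
  show e: "Sym C B A \<cdot> Sym C A B = \<one>(A \<boxtimes> B)"
    by (rule Sym_Sym[OF assms])
  have "Sym C B A \<in> hom C (B \<boxtimes> A) (A \<boxtimes> B)"
    using Sym_hom assms by auto
  then show "x \<in> Arr C \<Longrightarrow> Cod C x = A \<boxtimes> B \<Longrightarrow> Sym C B A \<cdot> (Sym C A B \<cdot> x) = x"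
    using Comp_eq_extend[OF e, of x] t assms by (simp add: hom_iff)
qed

lemma Assoc_natural_arr:
  assumes "f \<in> Arr C" "g \<in> Arr C" "h \<in> Arr C"
  shows "Assoc C (Cod C f) (Cod C g) (Cod C h) \<cdot> ((f \<otimes> g) \<otimes> h)
    = (f \<otimes> (g \<otimes> h)) \<cdot> Assoc C (Dom C f) (Dom C g) (Dom C h)"
  using Assoc_natural[of f _ _ g _ _ h] assms by (auto simp: hom_iff)

lemma LUnit_natural_arr: "f \<in> Arr C \<Longrightarrow> LUnit C (Cod C f) \<cdot> (\<one>\<I> \<otimes> f) = f \<cdot> LUnit C (Dom C f)"
  using LUnit_natural[of f] by (auto simp: hom_iff)

lemma RUnit_natural_arr: "f \<in> Arr C \<Longrightarrow> RUnit C (Cod C f) \<cdot> (f \<otimes> \<one>\<I>) = f \<cdot> RUnit C (Dom C f)"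
  using RUnit_natural[of f] by (auto simp: hom_iff)

lemma Sym_natural_arr:
  "f \<in> Arr C \<Longrightarrow> g \<in> Arr C \<Longrightarrow>
    Sym C (Cod C f) (Cod C g) \<cdot> (f \<otimes> g) = (g \<otimes> f) \<cdot> Sym C (Dom C f) (Dom C g)"
  using Sym_natural[of f _ _ g] by (auto simp: hom_iff)

text \<open>Tensoring with the unit is faithful, being naturally isomorphic to the identity functor.\<close>

lemma TensA_unit_right_faithful:
  assumes "f \<in> Arr C" "g \<in> Arr C" "Dom C f = Dom C g" "Cod C f = Cod C g" "f \<otimes> \<one>\<I> = g \<otimes> \<one>\<I>"
  shows "f = g"
proof -
  have "f \<cdot> RUnit C (Dom C g) = g \<cdot> RUnit C (Dom C g)"
    using RUnit_natural_arr[of f] RUnit_natural_arr[of g] assms by simp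
  then have "(f \<cdot> RUnit C (Dom C g)) \<cdot> RUnit_inv C (Dom C g) = (g \<cdot> RUnit C (Dom C g)) \<cdot> RUnit_inv C (Dom C g)"
    by simp
  then show ?thesis using assms by simp
qed

lemma TensA_unit_left_faithful:
  assumes "f \<in> Arr C" "g \<in> Arr C" "Dom C f = Dom C g" "Cod C f = Cod C g" "\<one>\<I> \<otimes> f = \<one>\<I> \<otimes> g"
  shows "f = g"
proof -
  have "f \<cdot> LUnit C (Dom C g) = g \<cdot> LUnit C (Dom C g)"
    using LUnit_natural_arr[of f] LUnit_natural_arr[of g] assms by simp
  then have "(f \<cdot> LUnit C (Dom C g)) \<cdot> LUnit_inv C (Dom C g) = (g \<cdot> LUnit C (Dom C g)) \<cdot> LUnit_inv C (Dom C g)"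
    by simp
  then show ?thesis using assms by simp
qed

lemma iso_right_cancel:
  assumes "mutually_inverse C A B u v" "f \<in> Arr C" "g \<in> Arr C" "Dom C f = B" "Dom C g = B"
    "f \<cdot> u = g \<cdot> u"
  shows "f = g"
proof -
  note t = mutually_inverse_typing[OF assms(1)]
  have "f \<cdot> (u \<cdot> v) = g \<cdot> (u \<cdot> v)"
    using Comp_assoc_arr[of v u f] Comp_assoc_arr[of v u g] t assms(2-6) by metis
  then show ?thesis using t assms by simp
qed

text \<open>After tensoring with the unit object, which is faithful, the two sides become two ways around the
  pentagon for \<open>\<I>, \<I>, A, B\<close> with its unit factors removed by triangles.\<close>

lemma LUnit_tensor:
  assumes [simp]: "A \<in> Ob C" "B \<in> Ob C"
  shows "LUnit C (A \<boxtimes> B) \<cdot> Assoc C \<I> A B = LUnit C A \<otimes> \<one>B"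
proof (rule TensA_unit_left_faithful, goal_cases)
  case 5
  let ?X = \<I>
  have "(\<one>?X \<otimes> (LUnit C (A \<boxtimes> B) \<cdot> Assoc C \<I> A B)) \<cdot> (Assoc C ?X (\<I> \<boxtimes> A) B \<cdot> (Assoc C ?X \<I> A \<otimes> \<one>B))
     = (\<one>?X \<otimes> LUnit C (A \<boxtimes> B)) \<cdot> ((\<one>?X \<otimes> Assoc C \<I> A B) \<cdot> Assoc C ?X (\<I> \<boxtimes> A) B \<cdot> (Assoc C ?X \<I> A \<otimes> \<one>B))"
    using TensA_Comp_arr[of "Assoc C \<I> A B" "LUnit C (A \<boxtimes> B)" "\<one>?X" "\<one>?X"]
    by (subst TensA_Comp_arr') auto
  also have "\<dots> = (\<one>?X \<otimes> LUnit C (A \<boxtimes> B)) \<cdot> (Assoc C ?X \<I> (A \<boxtimes> B) \<cdot> Assoc C (?X \<boxtimes> \<I>) A B)"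
    by (subst pentagon[symmetric]) simp_all
  also have "\<dots> = (RUnit C ?X \<otimes> \<one>(A \<boxtimes> B)) \<cdot> Assoc C (?X \<boxtimes> \<I>) A B"
    using triangle[of ?X "A \<boxtimes> B"] by (subst Comp_eq_extend[OF triangle]) auto
  also have "\<dots> = Assoc C ?X A B \<cdot> ((RUnit C ?X \<otimes> \<one>A) \<otimes> \<one>B)"
    using Assoc_natural_arr[of "RUnit C ?X" "\<one>A" "\<one>B"] by simp
  also have "\<dots> = Assoc C ?X A B \<cdot> ((\<one>?X \<otimes> LUnit C A) \<otimes> \<one>B) \<cdot> (Assoc C ?X \<I> A \<otimes> \<one>B)"
    by (simp add: TensA_Comp_arr triangle)
  also have "\<dots> = (\<one>?X \<otimes> (LUnit C A \<otimes> \<one>B)) \<cdot> Assoc C ?X (\<I> \<boxtimes> A) B \<cdot> (Assoc C ?X \<I> A \<otimes> \<one>B)"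
    using Assoc_natural_arr[of "\<one>?X" "LUnit C A" "\<one>B"]
    by (subst Comp_eq_extend[where h = "(\<one>?X \<otimes> (LUnit C A \<otimes> \<one>B)) \<cdot> Assoc C ?X (\<I> \<boxtimes> A) B"]) simp_all
  finally have eq: "(\<one>?X \<otimes> (LUnit C (A \<boxtimes> B) \<cdot> Assoc C \<I> A B)) \<cdot> (Assoc C ?X (\<I> \<boxtimes> A) B \<cdot> (Assoc C ?X \<I> A \<otimes> \<one>B))
     = (\<one>?X \<otimes> (LUnit C A \<otimes> \<one>B)) \<cdot> Assoc C ?X (\<I> \<boxtimes> A) B \<cdot> (Assoc C ?X \<I> A \<otimes> \<one>B)" .
  have iso: "mutually_inverse C (((?X \<boxtimes> \<I>) \<boxtimes> A) \<boxtimes> B) (?X \<boxtimes> ((\<I> \<boxtimes> A) \<boxtimes> B))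
      (Assoc C ?X (\<I> \<boxtimes> A) B \<cdot> (Assoc C ?X \<I> A \<otimes> \<one>B))
      ((Assoc_inv C ?X \<I> A \<otimes> \<one>B) \<cdot> Assoc_inv C ?X (\<I> \<boxtimes> A) B)"
    by (simp add: mutually_inverse_def hom_iff TensA_Comp_arr TensA_Comp_arr')
  show ?case
    by (rule iso_right_cancel[OF iso _ _ _ _ eq]) simp_all
qed simp_all

text \<open>This is the hexagon with two unit objects, contracted by left unit constraints.\<close>

lemma LUnit_Sym:
  assumes [simp]: "A \<in> Ob C"
  shows "LUnit C A \<cdot> Sym C A \<I> = RUnit C A"
proof (rule TensA_unit_right_faithful, goal_cases)
  case 5
  let ?s = "Sym C A \<I>"
  have "?s \<cdot> ((LUnit C A \<cdot> ?s) \<otimes> \<one>\<I>) = ?s \<cdot> ((LUnit C A \<otimes> \<one>\<I>) \<cdot> (?s \<otimes> \<one>\<I>))"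
    by (simp add: TensA_Comp_arr)
  also have "\<dots> = ?s \<cdot> (LUnit C (A \<boxtimes> \<I>) \<cdot> (Assoc C \<I> A \<I> \<cdot> (?s \<otimes> \<one>\<I>)))"
    by (subst Comp_eq_extend[OF LUnit_tensor]) simp_all
  also have "\<dots> = LUnit C (\<I> \<boxtimes> A) \<cdot> ((\<one>\<I> \<otimes> ?s) \<cdot> (Assoc C \<I> A \<I> \<cdot> (?s \<otimes> \<one>\<I>)))"
    using LUnit_natural_arr[of ?s]
    by (subst Comp_eq_extend[where g = "LUnit C (\<I> \<boxtimes> A)" and h = "?s \<cdot> LUnit C (A \<boxtimes> \<I>)"]) simp_all
  also have "\<dots> = LUnit C (\<I> \<boxtimes> A) \<cdot> (Assoc C \<I> \<I> A \<cdot> (Sym C A (\<I> \<boxtimes> \<I>) \<cdot> Assoc C A \<I> \<I>))"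
    by (simp add: hexagon)
  also have "\<dots> = (LUnit C \<I> \<otimes> \<one>A) \<cdot> (Sym C A (\<I> \<boxtimes> \<I>) \<cdot> Assoc C A \<I> \<I>)"
    by (subst Comp_eq_extend[OF LUnit_tensor]) simp_all
  also have "\<dots> = ?s \<cdot> ((\<one>A \<otimes> LUnit C \<I>) \<cdot> Assoc C A \<I> \<I>)"
    using Comp_eq_extend[OF Sym_natural_arr[of "\<one>A" "LUnit C \<I>", symmetric], of "Assoc C A \<I> \<I>"]
    by simp
  also have "\<dots> = ?s \<cdot> (RUnit C A \<otimes> \<one>\<I>)"
    by (simp add: triangle)
  finally have "Sym C \<I> A \<cdot> (?s \<cdot> ((LUnit C A \<cdot> ?s) \<otimes> \<one>\<I>)) = Sym C \<I> A \<cdot> (?s \<cdot> (RUnit C A \<otimes> \<one>\<I>))"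
    by simp
  then show ?case by simp
qed simp_all

end

section \<open>Diagrams\<close>

text \<open>Bracketings are kept as syntax because different bracketed products may be the same object.\<close>

datatype 'o shape = Atom 'o ("\<langle>_\<rangle>") | Null | Join "'o shape" "'o shape" (infixl "\<star>" 70)

primrec word :: "'o shape \<Rightarrow> 'o list" where
  "word \<langle>A\<rangle> = [A]"
| "word Null = []"
| "word (s \<star> t) = word s @ word t"

text \<open>A diagram from the word \<open>l\<close> to the word \<open>m\<close> is a family of arrows between the right-nested products
  of \<open>l\<close> and of \<open>m\<close>, both ending in a parameter \<open>Z\<close>. The parameter stands for further wires on the
  right: putting a box to the left of a wire is a substitution for \<open>Z\<close>, and no associativity
  constraint enters. The value \<open>Bad\<close> absorbs ill-typed composites, which makes the operations on
  diagrams total and their laws free of typing conditions.\<close>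

datatype ('o, 'm) diagram =
  Bad | Diag (ins: "'o list") (component: "'o \<Rightarrow> 'm") (outs: "'o list")

context symmetric_monoidal_category
begin

primrec obj :: "'o shape \<Rightarrow> 'o" where
  "obj \<langle>A\<rangle> = A"
| "obj Null = \<I>"
| "obj (s \<star> t) = obj s \<boxtimes> obj t"

definition pad :: "'o list \<Rightarrow> 'o \<Rightarrow> 'o" where
  "pad l Z = foldr (\<boxtimes>) l Z"

definition pad_arr :: "'o list \<Rightarrow> 'm \<Rightarrow> 'm" where
  "pad_arr l h = foldr (\<lambda>A h. \<one>A \<otimes> h) l h"

definition objs :: "'o list \<Rightarrow> bool" where
  "objs l \<longleftrightarrow> set l \<subseteq> Ob C"

lemma objs_simps [simp]:
  "objs []" "objs (A # l) \<longleftrightarrow> A \<in> Ob C \<and> objs l" "objs (l @ m) \<longleftrightarrow> objs l \<and> objs m"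
  by (auto simp: objs_def)

lemma pad_simps [simp]:
  "pad [] Z = Z" "pad (A # l) Z = A \<boxtimes> pad l Z" "pad (l @ m) Z = pad l (pad m Z)"
  "pad_arr [] h = h" "pad_arr (A # l) h = \<one>A \<otimes> pad_arr l h" "pad_arr (l @ m) h = pad_arr l (pad_arr m h)"
  by (simp_all add: pad_def pad_arr_def)

lemma pad_Ob [simp]: "objs l \<Longrightarrow> Z \<in> Ob C \<Longrightarrow> pad l Z \<in> Ob C"
  by (induct l) auto

lemma pad_arr_typing [simp]:
  assumes "objs l" "h \<in> Arr C"
  shows "pad_arr l h \<in> Arr C" "Dom C (pad_arr l h) = pad l (Dom C h)" "Cod C (pad_arr l h) = pad l (Cod C h)"
  using assms by (induct l) auto

lemma pad_arr_Comp:
  "objs l \<Longrightarrow> f \<in> Arr C \<Longrightarrow> g \<in> Arr C \<Longrightarrow> Dom C g = Cod C f \<Longrightarrow>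
    pad_arr l (g \<cdot> f) = pad_arr l g \<cdot> pad_arr l f"
  by (induct l) (auto simp: TensA_Comp_arr)

lemma pad_arr_Ident [simp]: "objs l \<Longrightarrow> Z \<in> Ob C \<Longrightarrow> pad_arr l (\<one>Z) = \<one>(pad l Z)"
  by (induct l) auto

lemma obj_Ob [simp]: "objs (word t) \<Longrightarrow> obj t \<in> Ob C"
  by (induct t) auto

text \<open>The canonical isomorphism from \<open>obj t \<otimes> Z\<close> to \<open>pad (word t) Z\<close>, which removes brackets and units.\<close>

primrec can :: "'o shape \<Rightarrow> 'o \<Rightarrow> 'm" where
  "can \<langle>A\<rangle> Z = \<one>(A \<boxtimes> Z)"
| "can Null Z = LUnit C Z"
| "can (s \<star> t) Z = can s (pad (word t) Z) \<cdot> (\<one>(obj s) \<otimes> can t Z) \<cdot> Assoc C (obj s) (obj t) Z"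

primrec can_inv :: "'o shape \<Rightarrow> 'o \<Rightarrow> 'm" where
  "can_inv \<langle>A\<rangle> Z = \<one>(A \<boxtimes> Z)"
| "can_inv Null Z = LUnit_inv C Z"
| "can_inv (s \<star> t) Z = Assoc_inv C (obj s) (obj t) Z \<cdot> (\<one>(obj s) \<otimes> can_inv t Z) \<cdot> can_inv s (pad (word t) Z)"

lemma can_typing [simp]:
  assumes "objs (word t)" "Z \<in> Ob C"
  shows "can t Z \<in> Arr C" "Dom C (can t Z) = obj t \<boxtimes> Z" "Cod C (can t Z) = pad (word t) Z"
    "can_inv t Z \<in> Arr C" "Dom C (can_inv t Z) = pad (word t) Z" "Cod C (can_inv t Z) = obj t \<boxtimes> Z"
  using assms by (induct t arbitrary: Z) auto

lemma can_inverse_simp [simp]: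
  assumes "objs (word t)" "Z \<in> Ob C"
  shows "can_inv t Z \<cdot> can t Z = \<one>(obj t \<boxtimes> Z)" "can t Z \<cdot> can_inv t Z = \<one>(pad (word t) Z)"
    "x \<in> Arr C \<Longrightarrow> Cod C x = obj t \<boxtimes> Z \<Longrightarrow> can_inv t Z \<cdot> (can t Z \<cdot> x) = x"
    "x \<in> Arr C \<Longrightarrow> Cod C x = pad (word t) Z \<Longrightarrow> can t Z \<cdot> (can_inv t Z \<cdot> x) = x"
proof -
  have "can_inv t Z \<cdot> can t Z = \<one>(obj t \<boxtimes> Z) \<and> can t Z \<cdot> can_inv t Z = \<one>(pad (word t) Z)"
    using assms
  proof (induct t arbitrary: Z)
    case (Join s t)
    then have [simp]: "can_inv s (pad (word t) Z) \<cdot> (can s (pad (word t) Z) \<cdot> x) = x"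
      if "x \<in> Arr C" "Cod C x = obj s \<boxtimes> pad (word t) Z" for x
      using that Comp_eq_extend[of "can_inv s (pad (word t) Z)" "can s (pad (word t) Z)"] by simp
    show ?case using Join by (simp add: TensA_Comp_arr TensA_Comp_arr')
  qed auto
  then show e: "can_inv t Z \<cdot> can t Z = \<one>(obj t \<boxtimes> Z)" "can t Z \<cdot> can_inv t Z = \<one>(pad (word t) Z)"
    by auto
  show "x \<in> Arr C \<Longrightarrow> Cod C x = obj t \<boxtimes> Z \<Longrightarrow> can_inv t Z \<cdot> (can t Z \<cdot> x) = x"
    "x \<in> Arr C \<Longrightarrow> Cod C x = pad (word t) Z \<Longrightarrow> can t Z \<cdot> (can_inv t Z \<cdot> x) = x"
    using Comp_eq_extend[OF e(1)] Comp_eq_extend[OF e(2)] assms by auto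
qed

lemma can_natural:
  "objs (word t) \<Longrightarrow> h \<in> Arr C \<Longrightarrow>
    can t (Cod C h) \<cdot> (\<one>(obj t) \<otimes> h) = pad_arr (word t) h \<cdot> can t (Dom C h)"
proof (induct t arbitrary: h)
  case (Join s t)
  let ?W = "Cod C h" and ?Z = "Dom C h"
  have [simp]: "objs (word s)" "objs (word t)" "h \<in> Arr C" using Join.prems by auto
  have "can (s \<star> t) ?W \<cdot> (\<one>(obj s \<boxtimes> obj t) \<otimes> h)
      = can s (pad (word t) ?W) \<cdot> (\<one>(obj s) \<otimes> can t ?W) \<cdot> Assoc C (obj s) (obj t) ?W \<cdot> ((\<one>(obj s) \<otimes> \<one>(obj t)) \<otimes> h)"
    by simp
  also have "\<dots> = can s (pad (word t) ?W) \<cdot> (\<one>(obj s) \<otimes> (can t ?W \<cdot> (\<one>(obj t) \<otimes> h))) \<cdot> Assoc C (obj s) (obj t) ?Z"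
    using Assoc_natural_arr[of "\<one>(obj s)" "\<one>(obj t)" h] by (simp add: TensA_Comp_arr')
  also have "\<dots> = (can s (pad (word t) ?W) \<cdot> (\<one>(obj s) \<otimes> pad_arr (word t) h)) \<cdot> (\<one>(obj s) \<otimes> can t ?Z) \<cdot> Assoc C (obj s) (obj t) ?Z"
    using Join.hyps(2)[of h] TensA_Comp_arr[of "can t ?Z" "pad_arr (word t) h" "\<one>(obj s)" "\<one>(obj s)"]
    by (simp add: TensA_Comp_arr')
  also have "\<dots> = pad_arr (word (s \<star> t)) h \<cdot> can (s \<star> t) ?Z"
    using Join.hyps(1)[of "pad_arr (word t) h"] by simp
  finally show ?case by simp
qed (auto simp: LUnit_natural_arr)

subsection \<open>The algebra of diagrams\<close>

text \<open>Naturality in the parameter is what makes boxes on disjoint wires independent of each other. Outside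
  the objects the components are fixed, so that diagrams are equal when their components agree.\<close>

definition good :: "('o, 'm) diagram \<Rightarrow> bool" where
  "good F \<longleftrightarrow> F \<noteq> Bad \<and> objs (ins F) \<and> objs (outs F) \<and>
     (\<forall>Z. Z \<notin> Ob C \<longrightarrow> component F Z = undefined) \<and>
     (\<forall>Z\<in>Ob C. component F Z \<in> Arr C \<and> Dom C (component F Z) = pad (ins F) Z \<and>
        Cod C (component F Z) = pad (outs F) Z) \<and>
     (\<forall>h\<in>Arr C. component F (Cod C h) \<cdot> pad_arr (ins F) h = pad_arr (outs F) h \<cdot> component F (Dom C h))"

definition diag :: "'o list \<Rightarrow> ('o \<Rightarrow> 'm) \<Rightarrow> 'o list \<Rightarrow> ('o, 'm) diagram" where
  "diag l f m = Diag l (\<lambda>Z. if Z \<in> Ob C then f Z else undefined) m"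

lemma diag_sel [simp]:
  "diag l f m \<noteq> Bad" "ins (diag l f m) = l" "outs (diag l f m) = m"
  "component (diag l f m) Z = (if Z \<in> Ob C then f Z else undefined)"
  by (simp_all add: diag_def)

lemma not_good_Bad [simp]: "\<not> good Bad"
  by (simp add: good_def)

lemma goodD [simp]:
  assumes "good F"
  shows "objs (ins F)" "objs (outs F)"
    "Z \<in> Ob C \<Longrightarrow> component F Z \<in> Arr C" "Z \<in> Ob C \<Longrightarrow> Dom C (component F Z) = pad (ins F) Z"
    "Z \<in> Ob C \<Longrightarrow> Cod C (component F Z) = pad (outs F) Z"
  using assms by (auto simp: good_def)

lemma good_natural:
  "good F \<Longrightarrow> h \<in> Arr C \<Longrightarrow>
    component F (Cod C h) \<cdot> pad_arr (ins F) h = pad_arr (outs F) h \<cdot> component F (Dom C h)"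
  unfolding good_def by blast

lemma goodI:
  assumes "F = diag l f m" "objs l" "objs m"
    "\<And>Z. Z \<in> Ob C \<Longrightarrow> f Z \<in> Arr C \<and> Dom C (f Z) = pad l Z \<and> Cod C (f Z) = pad m Z"
    "\<And>h. h \<in> Arr C \<Longrightarrow> f (Cod C h) \<cdot> pad_arr l h = pad_arr m h \<cdot> f (Dom C h)"
  shows "good F"
  using assms unfolding good_def by simp

lemma diagram_eqI:
  assumes "good F" "good G" "ins F = ins G" "outs F = outs G"
    "\<And>Z. Z \<in> Ob C \<Longrightarrow> component F Z = component G Z"
  shows "F = G"
proof -
  have "component F = component G"
    using assms by (intro ext) (metis good_def)
  then show ?thesis using assms(1-4) by (cases F; cases G) auto
qed

definition wire :: "'o list \<Rightarrow> ('o, 'm) diagram" where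
  "wire l = (if objs l then diag l (\<lambda>Z. \<one>(pad l Z)) l else Bad)"

definition seq :: "('o, 'm) diagram \<Rightarrow> ('o, 'm) diagram \<Rightarrow> ('o, 'm) diagram" (infixr "\<bullet>" 55) where
  "G \<bullet> F = (if good G \<and> good F \<and> ins G = outs F
     then diag (ins F) (\<lambda>Z. component G Z \<cdot> component F Z) (outs G) else Bad)"

text \<open>The box \<open>F\<close> with the wires \<open>l\<close> on its left and \<open>r\<close> on its right.\<close>

definition beside :: "'o list \<Rightarrow> ('o, 'm) diagram \<Rightarrow> 'o list \<Rightarrow> ('o, 'm) diagram" where
  "beside l F r = (if good F \<and> objs l \<and> objs r
     then diag (l @ ins F @ r) (\<lambda>Z. pad_arr l (component F (pad r Z))) (l @ outs F @ r) else Bad)"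

lemma good_wire [simp]: "good (wire l) \<longleftrightarrow> objs l"
proof
  show "good (wire l)" if "objs l"
    using that by (intro goodI) (auto simp: wire_def)
qed (auto simp: wire_def split: if_splits)

lemma wire_good_or_Bad: "good (wire l) \<or> wire l = Bad"
  unfolding good_wire by (auto simp: wire_def)

lemma wire_sel [simp]:
  "objs l \<Longrightarrow> ins (wire l) = l" "objs l \<Longrightarrow> outs (wire l) = l"
  "objs l \<Longrightarrow> Z \<in> Ob C \<Longrightarrow> component (wire l) Z = \<one>(pad l Z)"
  by (simp_all add: wire_def)

lemma good_seq [simp]: "good (G \<bullet> F) \<longleftrightarrow> good G \<and> good F \<and> ins G = outs F"
proof
  assume a: "good G \<and> good F \<and> ins G = outs F"
  show "good (G \<bullet> F)"
  proof (rule goodI)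
    show "G \<bullet> F = diag (ins F) (\<lambda>Z. component G Z \<cdot> component F Z) (outs G)"
      using a by (simp add: seq_def)
    show "(component G (Cod C h) \<cdot> component F (Cod C h)) \<cdot> pad_arr (ins F) h
        = pad_arr (outs G) h \<cdot> component G (Dom C h) \<cdot> component F (Dom C h)" if h: "h \<in> Arr C" for h
    proof -
      note [simp] = h
      have "(component G (Cod C h) \<cdot> component F (Cod C h)) \<cdot> pad_arr (ins F) h
        = component G (Cod C h) \<cdot> pad_arr (outs F) h \<cdot> component F (Dom C h)"
        using a good_natural[of F h] by simp
      also have "\<dots> = (component G (Cod C h) \<cdot> pad_arr (ins G) h) \<cdot> component F (Dom C h)"
        using a by simp
      also have "\<dots> = pad_arr (outs G) h \<cdot> component G (Dom C h) \<cdot> component F (Dom C h)"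
        using a good_natural[of G h] by simp
      finally show ?thesis .
    qed
  qed (use a in auto)
qed (auto simp: seq_def split: if_splits)

lemma seq_sel [simp]:
  assumes "good G" "good F" "ins G = outs F"
  shows "ins (G \<bullet> F) = ins F" "outs (G \<bullet> F) = outs G"
    "Z \<in> Ob C \<Longrightarrow> component (G \<bullet> F) Z = component G Z \<cdot> component F Z"
  using assms by (simp_all add: seq_def)

lemma seq_good_or_Bad: "good (G \<bullet> F) \<or> G \<bullet> F = Bad"
  unfolding good_seq by (auto simp: seq_def)

lemma good_beside [simp]: "good (beside l F r) \<longleftrightarrow> good F \<and> objs l \<and> objs r"
proof
  assume a: "good F \<and> objs l \<and> objs r"
  show "good (beside l F r)"
  proof (rule goodI)
    show "pad_arr l (component F (pad r (Cod C h))) \<cdot> pad_arr (l @ ins F @ r) h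
       = pad_arr (l @ outs F @ r) h \<cdot> pad_arr l (component F (pad r (Dom C h)))" if "h \<in> Arr C" for h
      using a that good_natural[of F "pad_arr r h"] by (simp add: pad_arr_Comp[symmetric])
  qed (use a in \<open>auto simp: beside_def\<close>)
qed (auto simp: beside_def split: if_splits)

lemma beside_sel [simp]:
  assumes "good F" "objs l" "objs r"
  shows "ins (beside l F r) = l @ ins F @ r" "outs (beside l F r) = l @ outs F @ r"
    "Z \<in> Ob C \<Longrightarrow> component (beside l F r) Z = pad_arr l (component F (pad r Z))"
  using assms by (simp_all add: beside_def)

lemma beside_good_or_Bad: "good (beside l F r) \<or> beside l F r = Bad"
  unfolding good_beside by (auto simp: beside_def)

text \<open>Laws between composites hold without typing conditions because both sides are \<open>Bad\<close> together.\<close>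

lemma diagram_eq_cases:
  assumes "good F \<or> F = Bad" "good G \<or> G = Bad" "good F \<longleftrightarrow> good G"
    "good F \<Longrightarrow> ins F = ins G" "good F \<Longrightarrow> outs F = outs G"
    "\<And>Z. good F \<Longrightarrow> Z \<in> Ob C \<Longrightarrow> component F Z = component G Z"
  shows "F = G"
  using assms diagram_eqI by blast

lemma seq_assoc [simp]: "(H \<bullet> G) \<bullet> F = H \<bullet> (G \<bullet> F)"
proof (rule diagram_eq_cases, goal_cases)
  case 1
  show ?case by (rule seq_good_or_Bad)
next
  case 2
  show ?case by (rule seq_good_or_Bad)
next
  case (6 Z)
  then show ?case
    unfolding good_seq by (elim conjE) (simp)
qed auto

lemma wire_seq [simp]: "good F \<Longrightarrow> outs F = l \<Longrightarrow> wire l \<bullet> F = F"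
  by (rule diagram_eqI) auto

lemma seq_wire [simp]: "good F \<Longrightarrow> ins F = l \<Longrightarrow> F \<bullet> wire l = F"
  by (rule diagram_eqI) auto

lemma beside_seq [simp]: "beside l (G \<bullet> F) r = beside l G r \<bullet> beside l F r"
proof (rule diagram_eq_cases, goal_cases)
  case 1
  show ?case by (rule beside_good_or_Bad)
next
  case 2
  show ?case by (rule seq_good_or_Bad)
next
  case (6 Z)
  then show ?case
    unfolding good_beside good_seq by (elim conjE) (simp add: pad_arr_Comp)
qed auto

lemma beside_beside [simp]: "beside l (beside l' F r') r = beside (l @ l') F (r' @ r)"
proof (rule diagram_eq_cases, goal_cases)
  case 1
  show ?case by (rule beside_good_or_Bad)
next
  case 2
  show ?case by (rule beside_good_or_Bad)
next
  case (6 Z)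
  then show ?case
    unfolding good_beside by (elim conjE) (simp)
qed auto

lemma beside_Nil [simp]: "good F \<Longrightarrow> beside [] F [] = F"
  by (rule diagram_eqI) auto

lemma beside_wire [simp]: "beside l (wire m) r = wire (l @ m @ r)"
proof (rule diagram_eq_cases, goal_cases)
  case 1
  show ?case by (rule beside_good_or_Bad)
next
  case 2
  show ?case by (rule wire_good_or_Bad)
next
  case (6 Z)
  then show ?case
    unfolding good_beside good_wire by (elim conjE) (simp)
qed auto

text \<open>The interchange law: boxes on disjoint wires slide past each other. It is naturality of the
  components of \<open>F\<close> in their parameter.\<close>

lemma interchange:
  "beside l F (n @ outs G @ r) \<bullet> beside (l @ ins F @ n) G r
    = beside (l @ outs F @ n) G r \<bullet> beside l F (n @ ins G @ r)"
proof (rule diagram_eq_cases, goal_cases)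
  case 1
  show ?case by (rule seq_good_or_Bad)
next
  case 2
  show ?case by (rule seq_good_or_Bad)
next
  case (6 Z)
  then have [simp]: "good F" "good G" "objs l" "objs n" "objs r" by auto
  show ?case
    using 6(2) good_natural[of F "pad_arr n (component G (pad r Z))"]
    by (simp add: pad_arr_Comp[symmetric])
qed auto

end

section \<open>Drawing arrows as diagrams\<close>

context symmetric_monoidal_category
begin

definition picture :: "'o shape \<Rightarrow> 'm \<Rightarrow> 'o shape \<Rightarrow> ('o, 'm) diagram" where
  "picture s f t = diag (word s) (\<lambda>Z. can t Z \<cdot> (f \<otimes> \<one>Z) \<cdot> can_inv s Z) (word t)"

definition rep :: "'m \<Rightarrow> 'o shape \<Rightarrow> 'o shape \<Rightarrow> ('o, 'm) diagram \<Rightarrow> bool" where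
  "rep f s t F \<longleftrightarrow> f \<in> hom C (obj s) (obj t) \<and> objs (word s) \<and> objs (word t) \<and>
     F = picture s f t"

lemma rep_typing:
  assumes "rep f s t F"
  shows "objs (word s)" "objs (word t)" "f \<in> Arr C" "Dom C f = obj s" "Cod C f = obj t"
    "ins F = word s" "outs F = word t"
  using assms by (auto simp: rep_def picture_def hom_iff)

lemma rep_component:
  assumes "rep f s t F" "Z \<in> Ob C"
  shows "component F Z \<cdot> can s Z = can t Z \<cdot> (f \<otimes> \<one>Z)"
  using assms rep_typing[OF assms(1)] by (simp add: rep_def picture_def)

lemma rep_good:
  assumes "rep f s t F"
  shows "good F"
proof (rule goodI)
  note [simp] = rep_typing[OF assms]
  show "F = diag (word s) (\<lambda>Z. can t Z \<cdot> (f \<otimes> \<one>Z) \<cdot> can_inv s Z) (word t)"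
    using assms by (simp add: rep_def picture_def)
  fix h assume h [simp]: "h \<in> Arr C"
  let ?W = "Cod C h" and ?Z = "Dom C h"
  have "pad_arr (word t) h \<cdot> can t ?Z \<cdot> (f \<otimes> \<one>?Z) \<cdot> can_inv s ?Z
      = (pad_arr (word t) h \<cdot> can t ?Z) \<cdot> (f \<otimes> \<one>?Z) \<cdot> can_inv s ?Z" by simp
  also have "\<dots> = can t ?W \<cdot> (f \<otimes> \<one>?W) \<cdot> (\<one>(obj s) \<otimes> h) \<cdot> can_inv s ?Z"
    by (simp add: can_natural[symmetric] TensA_Comp_arr')
  also have "\<dots> = can t ?W \<cdot> (f \<otimes> \<one>?W) \<cdot> can_inv s ?W \<cdot> (can s ?W \<cdot> (\<one>(obj s) \<otimes> h)) \<cdot> can_inv s ?Z"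
    by simp
  also have "\<dots> = can t ?W \<cdot> (f \<otimes> \<one>?W) \<cdot> can_inv s ?W \<cdot> pad_arr (word s) h"
    by (simp add: can_natural)
  finally show "(can t ?W \<cdot> (f \<otimes> \<one>?W) \<cdot> can_inv s ?W) \<cdot> pad_arr (word s) h
      = pad_arr (word t) h \<cdot> can t ?Z \<cdot> (f \<otimes> \<one>?Z) \<cdot> can_inv s ?Z" by simp
qed (use rep_typing[OF assms] in simp_all)

lemmas rep_simps = rep_typing rep_good

text \<open>Canonical isomorphisms are invertible, so a picture can be recognised by composing with them.\<close>

lemma repI:
  assumes "f \<in> hom C (obj s) (obj t)" "good F" "ins F = word s" "outs F = word t"
    "\<And>Z. Z \<in> Ob C \<Longrightarrow> component F Z \<cdot> can s Z = can t Z \<cdot> (f \<otimes> \<one>Z)"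
  shows "rep f s t F"
proof -
  let ?G = "diag (word s) (\<lambda>Z. can t Z \<cdot> (f \<otimes> \<one>Z) \<cdot> can_inv s Z) (word t)"
  have w [simp]: "objs (word s)" "objs (word t)"
    using goodD(1,2)[OF assms(2)] assms(3,4) by simp_all
  have f: "f \<in> Arr C" "Dom C f = obj s" "Cod C f = obj t"
    using assms(1) by (auto simp: hom_iff)
  have r: "rep f s t ?G" using assms(1) w by (simp add: rep_def picture_def)
  have "F = ?G"
  proof (rule diagram_eqI)
    fix Z assume Z [simp]: "Z \<in> Ob C"
    have F: "component F Z \<in> Arr C" "Dom C (component F Z) = pad (word s) Z"
      using assms(2,3) by simp_all
    have "(component F Z \<cdot> can s Z) \<cdot> can_inv s Z = (can t Z \<cdot> (f \<otimes> \<one>Z)) \<cdot> can_inv s Z"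
      using assms(5) by simp
    then show "component F Z = component ?G Z"
      using F f by simp
  qed (use assms rep_good[OF r] in simp_all)
  then show ?thesis using r by simp
qed

lemma rep_unique: "rep f s t F \<Longrightarrow> rep f s t G \<Longrightarrow> F = G"
  by (simp add: rep_def picture_def)

lemma rep_exists:
  "f \<in> hom C (obj s) (obj t) \<Longrightarrow> objs (word s) \<Longrightarrow> objs (word t) \<Longrightarrow> \<exists>F. rep f s t F"
  by (simp add: rep_def picture_def)

lemma rep_picture:
  "f \<in> hom C (obj s) (obj t) \<Longrightarrow> objs (word s) \<Longrightarrow> objs (word t) \<Longrightarrow> rep f s t (picture s f t)"
  by (simp add: rep_def)

lemma rep_cong: "rep f s t F \<Longrightarrow> F = G \<Longrightarrow> rep f s t G"
  by simp

text \<open>Faithfulness is what carries equations between diagrams back to arrows: the component at the unit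
  object, with canonical isomorphisms removed, is the arrow tensored with the unit.\<close>

lemma rep_faithful:
  assumes "rep f s t F" "rep g s t F"
  shows "f = g"
proof (rule TensA_unit_right_faithful)
  note [simp] = rep_typing[OF assms(1)] rep_typing[OF assms(2)]
  have "can_inv t \<I> \<cdot> can t \<I> \<cdot> (f \<otimes> \<one>\<I>) = can_inv t \<I> \<cdot> can t \<I> \<cdot> (g \<otimes> \<one>\<I>)"
    using rep_component[OF assms(1)] rep_component[OF assms(2)] by simp
  then show "f \<otimes> \<one>\<I> = g \<otimes> \<one>\<I>"
    by simp
qed (use rep_typing[OF assms(1)] rep_typing[OF assms(2)] in simp_all)

lemma rep_Ident: "objs (word s) \<Longrightarrow> A = obj s \<Longrightarrow> rep (\<one>A) s s (wire (word s))"
  by (rule repI) (simp_all add: hom_iff)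

lemma rep_Comp:
  assumes "rep f s t F" "rep g t u G"
  shows "rep (g \<cdot> f) s u (G \<bullet> F)"
proof (rule repI)
  note [simp] = rep_simps[OF assms(1)] rep_simps[OF assms(2)]
  fix Z assume Z [simp]: "Z \<in> Ob C"
  have "component (G \<bullet> F) Z \<cdot> can s Z = component G Z \<cdot> can t Z \<cdot> (f \<otimes> \<one>Z)"
    using rep_component[OF assms(1) Z] by simp
  also have "\<dots> = (component G Z \<cdot> can t Z) \<cdot> (f \<otimes> \<one>Z)"
    by (rule Comp_assoc_arr[symmetric]) simp_all
  also have "\<dots> = can u Z \<cdot> ((g \<cdot> f) \<otimes> \<one>Z)"
    by (simp add: rep_component[OF assms(2) Z] TensA_Comp_arr)
  finally show "component (G \<bullet> F) Z \<cdot> can s Z = can u Z \<cdot> ((g \<cdot> f) \<otimes> \<one>Z)" .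
qed (use rep_simps[OF assms(1)] rep_simps[OF assms(2)] in \<open>simp_all add: hom_iff\<close>)

lemma rep_left:
  assumes "objs (word r)" "A = obj r" "rep f s t F"
  shows "rep (\<one>A \<otimes> f) (r \<star> s) (r \<star> t) (beside (word r) F [])"
proof (rule repI)
  note [simp] = rep_simps[OF assms(3)] assms(1,2)
  fix Z assume Z [simp]: "Z \<in> Ob C"
  have "component (beside (word r) F []) Z \<cdot> can (r \<star> s) Z
      = (pad_arr (word r) (component F Z) \<cdot> can r (pad (word s) Z)) \<cdot> (\<one>A \<otimes> can s Z) \<cdot> Assoc C A (obj s) Z"
    by simp
  also have "\<dots> = can r (pad (word t) Z) \<cdot> (\<one>A \<otimes> (component F Z \<cdot> can s Z)) \<cdot> Assoc C A (obj s) Z"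
    using Comp_eq_extend[OF can_natural[of r "component F Z", symmetric], of "(\<one>A \<otimes> can s Z) \<cdot> Assoc C A (obj s) Z"]
    by (simp add: TensA_Comp_arr')
  also have "\<dots> = can r (pad (word t) Z) \<cdot> (\<one>A \<otimes> can t Z) \<cdot> (\<one>A \<otimes> (f \<otimes> \<one>Z)) \<cdot> Assoc C A (obj s) Z"
    using rep_component[OF assms(3) Z] by (simp add: TensA_Comp_arr')
  also have "\<dots> = can (r \<star> t) Z \<cdot> ((\<one>A \<otimes> f) \<otimes> \<one>Z)"
    using Assoc_natural_arr[of "\<one>A" f "\<one>Z"] by simp
  finally show "component (beside (word r) F []) Z \<cdot> can (r \<star> s) Z = can (r \<star> t) Z \<cdot> ((\<one>A \<otimes> f) \<otimes> \<one>Z)" .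
qed (use rep_simps[OF assms(3)] assms in \<open>simp_all add: hom_iff\<close>)

lemma rep_right:
  assumes "objs (word r)" "A = obj r" "rep f s t F"
  shows "rep (f \<otimes> \<one>A) (s \<star> r) (t \<star> r) (beside [] F (word r))"
proof (rule repI)
  note [simp] = rep_simps[OF assms(3)] assms(1,2)
  fix Z assume Z [simp]: "Z \<in> Ob C"
  let ?rZ = "pad (word r) Z"
  have "component (beside [] F (word r)) Z \<cdot> can (s \<star> r) Z
      = (component F ?rZ \<cdot> can s ?rZ) \<cdot> (\<one>(obj s) \<otimes> can r Z) \<cdot> Assoc C (obj s) A Z"
    by simp
  also have "\<dots> = can t ?rZ \<cdot> (f \<otimes> can r Z) \<cdot> Assoc C (obj s) A Z"
    using rep_component[OF assms(3), of ?rZ] by (simp add: TensA_Comp_arr')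
  also have "\<dots> = can t ?rZ \<cdot> (\<one>(obj t) \<otimes> can r Z) \<cdot> (f \<otimes> (\<one>A \<otimes> \<one>Z)) \<cdot> Assoc C (obj s) A Z"
    by (simp add: TensA_Comp_arr')
  also have "\<dots> = can (t \<star> r) Z \<cdot> ((f \<otimes> \<one>A) \<otimes> \<one>Z)"
    using Assoc_natural_arr[of f "\<one>A" "\<one>Z"] by simp
  finally show "component (beside [] F (word r)) Z \<cdot> can (s \<star> r) Z = can (t \<star> r) Z \<cdot> ((f \<otimes> \<one>A) \<otimes> \<one>Z)" .
qed (use rep_simps[OF assms(3)] assms in \<open>simp_all add: hom_iff\<close>)

lemma rep_tensor:
  assumes "rep f s t F" "rep g u v G"
  shows "rep (f \<otimes> g) (s \<star> u) (t \<star> v) (beside [] F (word v) \<bullet> beside (word s) G [])"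
proof -
  note [simp] = rep_simps[OF assms(1)] rep_simps[OF assms(2)]
  have "f \<otimes> g = (f \<otimes> \<one>(obj v)) \<cdot> (\<one>(obj s) \<otimes> g)"
    by (simp add: TensA_Comp_arr)
  moreover have "rep ((f \<otimes> \<one>(obj v)) \<cdot> (\<one>(obj s) \<otimes> g)) (s \<star> u) (t \<star> v) (beside [] F (word v) \<bullet> beside (word s) G [])"
    by (rule rep_Comp[OF rep_left rep_right]) (use assms in simp_all)
  ultimately show ?thesis by simp
qed

text \<open>Coherence: by the pentagon, the triangle and its left-handed form, the constraints are drawn as bare
  wires, so that they vanish from pictures.\<close>

lemma rep_Assoc:
  assumes "objs (word r)" "objs (word s)" "objs (word t)" "A = obj r" "B = obj s" "D = obj t"
  shows "rep (Assoc C A B D) ((r \<star> s) \<star> t) (r \<star> (s \<star> t)) (wire (word r @ word s @ word t))"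
proof (rule repI)
  note [simp] = assms
  fix Z assume Z [simp]: "Z \<in> Ob C"
  have "can ((r \<star> s) \<star> t) Z
      = can r (pad (word s) (pad (word t) Z)) \<cdot> (\<one>A \<otimes> can s (pad (word t) Z)) \<cdot>
        (Assoc C A B (pad (word t) Z) \<cdot> ((\<one>A \<otimes> \<one>B) \<otimes> can t Z)) \<cdot> Assoc C (A \<boxtimes> B) D Z"
    by simp
  also have "\<dots> = can r (pad (word s) (pad (word t) Z)) \<cdot> (\<one>A \<otimes> can s (pad (word t) Z)) \<cdot>
        (\<one>A \<otimes> (\<one>B \<otimes> can t Z)) \<cdot> (Assoc C A B (D \<boxtimes> Z) \<cdot> Assoc C (A \<boxtimes> B) D Z)"
    using Assoc_natural_arr[of "\<one>A" "\<one>B" "can t Z"] by simp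
  also have "\<dots> = can (r \<star> (s \<star> t)) Z \<cdot> (Assoc C A B D \<otimes> \<one>Z)"
    using pentagon[of A B D Z]
      TensA_Comp_arr[of "(\<one>B \<otimes> can t Z) \<cdot> Assoc C B D Z" "can s (pad (word t) Z)" "\<one>A" "\<one>A"]
    by (simp add: TensA_Comp_arr')
  finally show "component (wire (word r @ word s @ word t)) Z \<cdot> can ((r \<star> s) \<star> t) Z
      = can (r \<star> (s \<star> t)) Z \<cdot> (Assoc C A B D \<otimes> \<one>Z)" by simp
qed (use assms in \<open>simp_all add: hom_iff\<close>)

lemma rep_LUnit:
  assumes "objs (word t)" "A = obj t"
  shows "rep (LUnit C A) (Null \<star> t) t (wire (word t))"
proof (rule repI)
  note [simp] = assms
  fix Z assume Z [simp]: "Z \<in> Ob C"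
  have "can (Null \<star> t) Z = (LUnit C (pad (word t) Z) \<cdot> (\<one>\<I> \<otimes> can t Z)) \<cdot> Assoc C \<I> A Z"
    by simp
  also have "\<dots> = can t Z \<cdot> (LUnit C A \<otimes> \<one>Z)"
    using LUnit_natural_arr[of "can t Z"] by (simp add: LUnit_tensor)
  finally show "component (wire (word t)) Z \<cdot> can (Null \<star> t) Z = can t Z \<cdot> (LUnit C A \<otimes> \<one>Z)" by simp
qed (use assms in \<open>simp_all add: hom_iff\<close>)

lemma rep_RUnit:
  assumes "objs (word t)" "A = obj t"
  shows "rep (RUnit C A) (t \<star> Null) t (wire (word t))"
  by (rule repI) (use assms in \<open>simp_all add: hom_iff triangle\<close>)

lemma rep_inverse:
  assumes "rep f s t (wire (word t))" "mutually_inverse C (obj s) (obj t) f g" "word s = word t"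
  shows "rep g t s (wire (word t))"
proof -
  have w: "objs (word s)" "objs (word t)" using rep_typing[OF assms(1)] by auto
  obtain G where G: "rep g t s G"
    using rep_exists[of g t s] w assms(2) by (auto simp: mutually_inverse_def)
  have "rep (g \<cdot> f) s s (G \<bullet> wire (word t))"
    by (rule rep_Comp[OF assms(1) G])
  moreover have "rep (g \<cdot> f) s s (wire (word s))"
    using rep_Ident[OF w(1) refl] assms(2) by (simp add: mutually_inverse_def)
  ultimately have "G = wire (word t)"
    using rep_unique[of "g \<cdot> f" s s] rep_simps[OF G] assms(3) by fastforce
  then show ?thesis using G by simp
qed

lemma rep_Assoc_inv:
  assumes "objs (word r)" "objs (word s)" "objs (word t)" "A = obj r" "B = obj s" "D = obj t"
  shows "rep (Assoc_inv C A B D) (r \<star> (s \<star> t)) ((r \<star> s) \<star> t) (wire (word r @ word s @ word t))"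
  using rep_inverse[of _ "(r \<star> s) \<star> t" "r \<star> (s \<star> t)"] rep_Assoc[OF assms] Assoc_iso[of A B D] assms
  by simp

lemma rep_LUnit_inv:
  assumes "objs (word t)" "A = obj t"
  shows "rep (LUnit_inv C A) t (Null \<star> t) (wire (word t))"
  using rep_inverse[of _ "Null \<star> t" t] rep_LUnit[OF assms] LUnit_iso[of A] assms by simp

lemma rep_RUnit_inv:
  assumes "objs (word t)" "A = obj t"
  shows "rep (RUnit_inv C A) t (t \<star> Null) (wire (word t))"
  using rep_inverse[of _ "t \<star> Null" t] rep_RUnit[OF assms] RUnit_iso[of A] assms by simp

text \<open>Read from the source to the target, the shape of the source and the form of the arrow determine the
  shape of the target and the picture; resolution with these rules computes both.\<close>

lemmas rep_rules = rep_Comp rep_Assoc rep_Assoc_inv rep_LUnit rep_LUnit_inv rep_RUnit rep_RUnit_inv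
  rep_left rep_right rep_tensor rep_Ident

subsection \<open>Crossings\<close>

definition cross :: "'o \<Rightarrow> 'o \<Rightarrow> ('o, 'm) diagram" where
  "cross A B = (THE F. rep (Sym C A B) (\<langle>A\<rangle> \<star> \<langle>B\<rangle>) (\<langle>B\<rangle> \<star> \<langle>A\<rangle>) F)"

lemma rep_cross: "A \<in> Ob C \<Longrightarrow> B \<in> Ob C \<Longrightarrow> rep (Sym C A B) (\<langle>A\<rangle> \<star> \<langle>B\<rangle>) (\<langle>B\<rangle> \<star> \<langle>A\<rangle>) (cross A B)"
  unfolding cross_def
  by (rule theI') (use rep_exists[of "Sym C A B" "\<langle>A\<rangle> \<star> \<langle>B\<rangle>" "\<langle>B\<rangle> \<star> \<langle>A\<rangle>"] rep_unique in \<open>auto simp: hom_iff\<close>)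

lemma cross_sel [simp]:
  assumes "A \<in> Ob C" "B \<in> Ob C"
  shows "good (cross A B)" "ins (cross A B) = [A, B]" "outs (cross A B) = [B, A]"
  using rep_simps[OF rep_cross[OF assms]] by auto

lemma cross_cross:
  assumes "A \<in> Ob C" "B \<in> Ob C"
  shows "cross B A \<bullet> cross A B = wire [A, B]"
proof (rule rep_unique)
  show "rep (\<one>(A \<boxtimes> B)) (\<langle>A\<rangle> \<star> \<langle>B\<rangle>) (\<langle>A\<rangle> \<star> \<langle>B\<rangle>) (cross B A \<bullet> cross A B)"
    using rep_Comp[OF rep_cross rep_cross, of A B] assms by simp
  show "rep (\<one>(A \<boxtimes> B)) (\<langle>A\<rangle> \<star> \<langle>B\<rangle>) (\<langle>A\<rangle> \<star> \<langle>B\<rangle>) (wire [A, B])"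
    using rep_Ident[of "\<langle>A\<rangle> \<star> \<langle>B\<rangle>"] assms by simp
qed

lemma cross_cross_in [simp]:
  assumes "A \<in> Ob C" "B \<in> Ob C" "good F" "outs F = l @ A # B # r"
  shows "beside l (cross B A) r \<bullet> (beside l (cross A B) r \<bullet> F) = F"
proof -
  have "beside l (cross B A) r \<bullet> beside l (cross A B) r = wire (l @ [A, B] @ r)"
    using assms by (simp flip: beside_seq add: cross_cross)
  then show ?thesis
    using assms by (simp flip: seq_assoc)
qed

text \<open>A single wire crossing a whole word, from left to right for \<open>push\<close> and from right to left for \<open>pull\<close>.\<close>

primrec push :: "'o \<Rightarrow> 'o list \<Rightarrow> ('o, 'm) diagram" where
  "push A [] = wire [A]"
| "push A (B # l) = beside [B] (push A l) [] \<bullet> beside [] (cross A B) l"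

primrec pull :: "'o list \<Rightarrow> 'o \<Rightarrow> ('o, 'm) diagram" where
  "pull [] A = wire [A]"
| "pull (B # l) A = beside [] (cross B A) l \<bullet> beside [B] (pull l A) []"

lemma push_sel [simp]:
  assumes "A \<in> Ob C" "objs l"
  shows "good (push A l)" "ins (push A l) = A # l" "outs (push A l) = l @ [A]"
proof -
  have "good (push A l) \<and> ins (push A l) = A # l \<and> outs (push A l) = l @ [A]"
    using assms by (induct l) simp_all
  then show "good (push A l)" "ins (push A l) = A # l" "outs (push A l) = l @ [A]" by auto
qed

lemma pull_sel [simp]:
  assumes "A \<in> Ob C" "objs l"
  shows "good (pull l A)" "ins (pull l A) = l @ [A]" "outs (pull l A) = A # l"
proof -
  have "good (pull l A) \<and> ins (pull l A) = l @ [A] \<and> outs (pull l A) = A # l"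
    using assms by (induct l) simp_all
  then show "good (pull l A)" "ins (pull l A) = l @ [A]" "outs (pull l A) = A # l" by auto
qed

lemma push_append:
  assumes "A \<in> Ob C" "objs l" "objs m"
  shows "push A (l @ m) = beside l (push A m) [] \<bullet> beside [] (push A l) m"
  using assms
proof (induct l)
  case (Cons B l)
  then show ?case by simp
qed simp

lemma push_pull: "A \<in> Ob C \<Longrightarrow> objs l \<Longrightarrow> push A l \<bullet> pull l A = wire (l @ [A])"
proof (induct l)
  case (Cons B l)
  have "push A (B # l) \<bullet> pull (B # l) A = beside [B] (push A l \<bullet> pull l A) []"
    using Cons.prems cross_cross_in[of B A "beside [B] (pull l A) []" "[]" l] by simp
  also have "\<dots> = wire ((B # l) @ [A])"
    using Cons by (simp del: beside_seq)
  finally show ?case .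
qed simp

text \<open>The hexagon is the induction step for products; for the unit object, the symmetry is a composite of
  unit constraints.\<close>

lemma rep_push:
  assumes "A \<in> Ob C" "objs (word t)"
  shows "rep (Sym C A (obj t)) (\<langle>A\<rangle> \<star> t) (t \<star> \<langle>A\<rangle>) (push A (word t))"
  using assms
proof (induct t)
  case (Atom B)
  then show ?case using rep_cross[of A B] by simp
next
  case Null
  have "Sym C A \<I> = LUnit_inv C A \<cdot> RUnit C A"
    using LUnit_Sym[of A] Null by (simp flip: LUnit_Sym)
  moreover have "rep (LUnit_inv C A \<cdot> RUnit C A) (\<langle>A\<rangle> \<star> Null) (Null \<star> \<langle>A\<rangle>) (wire [A] \<bullet> wire [A])"
    by (rule rep_Comp) (use rep_LUnit_inv[of "\<langle>A\<rangle>"] rep_RUnit[of "\<langle>A\<rangle>"] Null in simp_all)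
  ultimately show ?case using Null by simp
next
  case (Join s t)
  let ?s = "obj s" and ?t = "obj t"
  have [simp]: "A \<in> Ob C" "objs (word s)" "objs (word t)" using Join.prems by auto
  let ?R = "Assoc_inv C ?s ?t A \<cdot> ((\<one>?s \<otimes> Sym C A ?t) \<cdot> Assoc C ?s A ?t \<cdot> (Sym C A ?s \<otimes> \<one>?t)) \<cdot> Assoc_inv C A ?s ?t"
  have "Sym C A (?s \<boxtimes> ?t) = Assoc_inv C ?s ?t A \<cdot> (Assoc C ?s ?t A \<cdot> Sym C A (?s \<boxtimes> ?t) \<cdot> Assoc C A ?s ?t) \<cdot> Assoc_inv C A ?s ?t"
    by simp
  also have "\<dots> = ?R"
    by (subst hexagon) simp_all
  finally have R: "Sym C A (obj (s \<star> t)) = ?R" by simp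
  note hyps = Join.hyps(1)[OF \<open>A \<in> Ob C\<close> \<open>objs (word s)\<close>] Join.hyps(2)[OF \<open>A \<in> Ob C\<close> \<open>objs (word t)\<close>]
  show ?case unfolding R
    by (rule rep_cong, (rule rep_rules hyps | (simp; fail))+, simp add: push_append)
qed

text \<open>Both \<open>pull\<close> and the symmetry drawn here are inverse to \<open>push\<close>.\<close>

lemma rep_pull:
  assumes [simp]: "A \<in> Ob C" "objs (word t)"
  shows "rep (Sym C (obj t) A) (t \<star> \<langle>A\<rangle>) (\<langle>A\<rangle> \<star> t) (pull (word t) A)"
proof -
  obtain F where F: "rep (Sym C (obj t) A) (t \<star> \<langle>A\<rangle>) (\<langle>A\<rangle> \<star> t) F"
    using rep_exists[of "Sym C (obj t) A" "t \<star> \<langle>A\<rangle>" "\<langle>A\<rangle> \<star> t"] by (auto simp: hom_iff)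
  note [simp] = rep_simps[OF F]
  have "rep (Sym C (obj t) A \<cdot> Sym C A (obj t)) (\<langle>A\<rangle> \<star> t) (\<langle>A\<rangle> \<star> t) (F \<bullet> push A (word t))"
    by (rule rep_Comp[OF rep_push F]) simp_all
  moreover have "rep (Sym C (obj t) A \<cdot> Sym C A (obj t)) (\<langle>A\<rangle> \<star> t) (\<langle>A\<rangle> \<star> t) (wire (A # word t))"
    using rep_Ident[of "\<langle>A\<rangle> \<star> t"] by simp
  ultimately have "F \<bullet> push A (word t) = wire (A # word t)"
    by (rule rep_unique)
  then have "(F \<bullet> push A (word t)) \<bullet> pull (word t) A = pull (word t) A"
    by simp
  then have "F = pull (word t) A"
    by (simp add: push_pull)
  then show ?thesis using F by simp
qed

text \<open>This is naturality of the symmetry, which pictures of arrows inherit; naturality in the parameter alone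
  would not give it.\<close>

lemma push_natural:
  assumes "rep f s t F" "A \<in> Ob C"
  shows "push A (word t) \<bullet> beside [A] F [] = beside [] F [A] \<bullet> push A (word s)"
proof (rule rep_unique)
  note [simp] = rep_simps[OF assms(1)] assms(2)
  show "rep (Sym C A (obj t) \<cdot> (\<one>A \<otimes> f)) (\<langle>A\<rangle> \<star> s) (t \<star> \<langle>A\<rangle>) (push A (word t) \<bullet> beside [A] F [])"
    by (rule rep_cong, (rule rep_push rep_rules assms | (simp; fail))+)
  have "Sym C A (obj t) \<cdot> (\<one>A \<otimes> f) = (f \<otimes> \<one>A) \<cdot> Sym C A (obj s)"
    using Sym_natural_arr[of "\<one>A" f] by simp
  moreover have "rep ((f \<otimes> \<one>A) \<cdot> Sym C A (obj s)) (\<langle>A\<rangle> \<star> s) (t \<star> \<langle>A\<rangle>) (beside [] F [A] \<bullet> push A (word s))"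
    by (rule rep_cong, (rule rep_push rep_rules assms | (simp; fail))+)
  ultimately show "rep (Sym C A (obj t) \<cdot> (\<one>A \<otimes> f)) (\<langle>A\<rangle> \<star> s) (t \<star> \<langle>A\<rangle>) (beside [] F [A] \<bullet> push A (word s))"
    by simp
qed

lemma pull_natural:
  assumes "rep f s t F" "A \<in> Ob C"
  shows "pull (word t) A \<bullet> beside [] F [A] = beside [A] F [] \<bullet> pull (word s) A"
proof (rule rep_unique)
  note [simp] = rep_simps[OF assms(1)] assms(2)
  show "rep (Sym C (obj t) A \<cdot> (f \<otimes> \<one>A)) (s \<star> \<langle>A\<rangle>) (\<langle>A\<rangle> \<star> t) (pull (word t) A \<bullet> beside [] F [A])"
    by (rule rep_cong, (rule rep_pull rep_rules assms | (simp; fail))+)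
  have "Sym C (obj t) A \<cdot> (f \<otimes> \<one>A) = (\<one>A \<otimes> f) \<cdot> Sym C (obj s) A"
    using Sym_natural_arr[of f "\<one>A"] by simp
  moreover have "rep ((\<one>A \<otimes> f) \<cdot> Sym C (obj s) A) (s \<star> \<langle>A\<rangle>) (\<langle>A\<rangle> \<star> t) (beside [A] F [] \<bullet> pull (word s) A)"
    by (rule rep_cong, (rule rep_pull rep_rules assms | (simp; fail))+)
  ultimately show "rep (Sym C (obj t) A \<cdot> (f \<otimes> \<one>A)) (s \<star> \<langle>A\<rangle>) (\<langle>A\<rangle> \<star> t) (beside [A] F [] \<bullet> pull (word s) A)"
    by simp
qed

end

section \<open>Sums of diagrams\<close>

context linear_symmetric_monoidal_category
begin

lemma Add_typing [simp]:
  assumes "f \<in> Arr C" "g \<in> Arr C" "Dom C g = Dom C f" "Cod C g = Cod C f"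
  shows "f \<oplus> g \<in> Arr C" "Dom C (f \<oplus> g) = Dom C f" "Cod C (f \<oplus> g) = Cod C f"
  using Add_hom[of f "Dom C f" "Cod C f" g] assms by (auto simp: hom_iff)

lemma Zero_typing [simp]:
  assumes "A \<in> Ob C" "B \<in> Ob C"
  shows "Zero C A B \<in> Arr C" "Dom C (Zero C A B) = A" "Cod C (Zero C A B) = B"
  using Zero_hom[OF assms] by (auto simp: hom_iff)

lemma bilinear_arr:
  assumes "f \<in> Arr C" "f' \<in> Arr C" "Dom C f' = Dom C f" "Cod C f' = Cod C f" "g \<in> Arr C"
  shows "Dom C g = Cod C f \<Longrightarrow> g \<cdot> (f \<oplus> f') = g \<cdot> f \<oplus> g \<cdot> f'"
    "Cod C g = Dom C f \<Longrightarrow> (f \<oplus> f') \<cdot> g = f \<cdot> g \<oplus> f' \<cdot> g"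
    "g \<otimes> (f \<oplus> f') = (g \<otimes> f) \<oplus> (g \<otimes> f')" "(f \<oplus> f') \<otimes> g = (f \<otimes> g) \<oplus> (f' \<otimes> g)"
  using assms by (auto simp: hom_iff intro!: Comp_Add_left Comp_Add_right TensA_Add_left TensA_Add_right)

text \<open>A zero arrow is a scalar multiple, with scalar \<open>0\<close>, of any arrow parallel to it.\<close>

lemma Zero_bilinear:
  assumes "g \<in> Arr C" "A \<in> Ob C" "B \<in> Ob C"
  shows "Dom C g = B \<Longrightarrow> g \<cdot> Zero C A B = Zero C A (Cod C g)"
    "Cod C g = A \<Longrightarrow> Zero C A B \<cdot> g = Zero C (Dom C g) B"
    "g \<otimes> Zero C A B = Zero C (Dom C g \<boxtimes> A) (Cod C g \<boxtimes> B)"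
    "Zero C A B \<otimes> g = Zero C (A \<boxtimes> Dom C g) (B \<boxtimes> Cod C g)"
proof -
  have s: "Zero C A B = 0 \<odot> Zero C A B"
    using zero_Scale[of "Zero C A B" A B] assms by (simp add: hom_iff)
  have z: "0 \<odot> f = Zero C (Dom C f) (Cod C f)" if "f \<in> Arr C" for f
    using zero_Scale[of f "Dom C f" "Cod C f"] that by (simp add: hom_iff)
  show "g \<cdot> Zero C A B = Zero C A (Cod C g)" if "Dom C g = B"
    using Comp_Scale_right[of "Zero C A B" A B g "Cod C g" 0] that assms z[of "g \<cdot> Zero C A B"] s
    by (simp add: hom_iff)
  show "Zero C A B \<cdot> g = Zero C (Dom C g) B" if "Cod C g = A"
    using Comp_Scale_left[of g "Dom C g" A "Zero C A B" B 0] that assms z[of "Zero C A B \<cdot> g"] s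
    by (simp add: hom_iff)
  show "g \<otimes> Zero C A B = Zero C (Dom C g \<boxtimes> A) (Cod C g \<boxtimes> B)"
    using TensA_Scale_right[of g "Dom C g" "Cod C g" "Zero C A B" A B 0] assms z[of "g \<otimes> Zero C A B"] s
    by (simp add: hom_iff)
  show "Zero C A B \<otimes> g = Zero C (A \<boxtimes> Dom C g) (B \<boxtimes> Cod C g)"
    using TensA_Scale_left[of "Zero C A B" A B g "Dom C g" "Cod C g" 0] assms z[of "Zero C A B \<otimes> g"] s
    by (simp add: hom_iff)
qed

lemma pad_arr_linear:
  assumes "objs l"
  shows "f \<in> Arr C \<Longrightarrow> g \<in> Arr C \<Longrightarrow> Dom C g = Dom C f \<Longrightarrow> Cod C g = Cod C f \<Longrightarrow>
      pad_arr l (f \<oplus> g) = pad_arr l f \<oplus> pad_arr l g"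
    "A \<in> Ob C \<Longrightarrow> B \<in> Ob C \<Longrightarrow> pad_arr l (Zero C A B) = Zero C (pad l A) (pad l B)"
  using assms by (induct l) (simp_all add: bilinear_arr Zero_bilinear)

definition plus :: "('o, 'm) diagram \<Rightarrow> ('o, 'm) diagram \<Rightarrow> ('o, 'm) diagram" (infixl "\<boxplus>" 52) where
  "F \<boxplus> G = (if good F \<and> good G \<and> ins F = ins G \<and> outs F = outs G
     then diag (ins F) (\<lambda>Z. component F Z \<oplus> component G Z) (outs F) else Bad)"

definition none :: "'o list \<Rightarrow> 'o list \<Rightarrow> ('o, 'm) diagram" where
  "none l m = (if objs l \<and> objs m then diag l (\<lambda>Z. Zero C (pad l Z) (pad m Z)) m else Bad)"

lemma good_plus [simp]: "good (F \<boxplus> G) \<longleftrightarrow> good F \<and> good G \<and> ins F = ins G \<and> outs F = outs G"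
proof
  assume a: "good F \<and> good G \<and> ins F = ins G \<and> outs F = outs G"
  then have [simp]: "good F" "good G" "ins F = ins G" "outs F = outs G" by auto
  show "good (F \<boxplus> G)"
  proof (rule goodI)
    show "(component F (Cod C h) \<oplus> component G (Cod C h)) \<cdot> pad_arr (ins F) h
       = pad_arr (outs F) h \<cdot> (component F (Dom C h) \<oplus> component G (Dom C h))" if "h \<in> Arr C" for h
      using that good_natural[of F h] good_natural[of G h] by (simp add: bilinear_arr)
  qed (simp_all add: plus_def)
qed (auto simp: plus_def split: if_splits)

lemma plus_sel [simp]:
  assumes "good F" "good G" "ins F = ins G" "outs F = outs G"
  shows "ins (F \<boxplus> G) = ins G" "outs (F \<boxplus> G) = outs G"
    "Z \<in> Ob C \<Longrightarrow> component (F \<boxplus> G) Z = component F Z \<oplus> component G Z"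
  using assms by (simp_all add: plus_def)

lemma plus_good_or_Bad: "good (F \<boxplus> G) \<or> F \<boxplus> G = Bad"
  unfolding good_plus by (auto simp: plus_def)

lemma good_none [simp]: "good (none l m) \<longleftrightarrow> objs l \<and> objs m"
proof
  show "good (none l m)" if "objs l \<and> objs m"
    using that by (intro goodI) (auto simp: none_def Zero_bilinear)
qed (auto simp: none_def split: if_splits)

lemma none_sel [simp]:
  assumes "objs l" "objs m"
  shows "ins (none l m) = l" "outs (none l m) = m"
    "Z \<in> Ob C \<Longrightarrow> component (none l m) Z = Zero C (pad l Z) (pad m Z)"
  using assms by (simp_all add: none_def)

lemma plus_assoc: "(F \<boxplus> G) \<boxplus> H = F \<boxplus> (G \<boxplus> H)"
proof (rule diagram_eq_cases, goal_cases)
  case (6 Z)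
  then have [simp]: "good F" "good G" "good H" "ins F = ins H" "ins G = ins H" "outs F = outs H" "outs G = outs H"
    by auto
  show ?case using 6(2) Add_assoc[of "component F Z" _ _ "component G Z" "component H Z"]
    by (simp add: hom_iff)
qed (rule plus_good_or_Bad | auto)+

lemma plus_commute: "F \<boxplus> G = G \<boxplus> F"
proof (rule diagram_eq_cases, goal_cases)
  case (6 Z)
  then have [simp]: "good F" "good G" "ins F = ins G" "outs F = outs G" by auto
  show ?case using 6(2) Add_commute[of "component F Z" _ _ "component G Z"] by (simp add: hom_iff)
qed (rule plus_good_or_Bad | auto)+

lemma plus_left_commute: "F \<boxplus> (G \<boxplus> H) = G \<boxplus> (F \<boxplus> H)"
  using plus_assoc plus_commute by metis

lemmas plus_ac = plus_assoc plus_commute plus_left_commute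

lemma plus_seq [simp]: "(F \<boxplus> G) \<bullet> H = F \<bullet> H \<boxplus> G \<bullet> H"
proof (rule diagram_eq_cases, goal_cases)
  case (6 Z)
  then have [simp]: "good F" "good G" "good H" "ins F = outs H" "ins G = outs H" "outs F = outs G" by auto
  show ?case using 6(2) by (simp add: bilinear_arr)
qed (rule plus_good_or_Bad seq_good_or_Bad | auto)+

lemma seq_plus [simp]: "H \<bullet> (F \<boxplus> G) = H \<bullet> F \<boxplus> H \<bullet> G"
proof (rule diagram_eq_cases, goal_cases)
  case (6 Z)
  then have [simp]: "good F" "good G" "good H" "ins H = outs G" "ins F = ins G" "outs F = outs G" by auto
  show ?case using 6(2) by (simp add: bilinear_arr)
qed (rule plus_good_or_Bad seq_good_or_Bad | auto)+

lemma beside_plus [simp]: "beside l (F \<boxplus> G) r = beside l F r \<boxplus> beside l G r"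
proof (rule diagram_eq_cases, goal_cases)
  case (6 Z)
  then have [simp]: "good F" "good G" "objs l" "objs r" "ins F = ins G" "outs F = outs G" by auto
  show ?case using 6(2) by (simp add: pad_arr_linear)
qed (rule plus_good_or_Bad beside_good_or_Bad | auto)+

lemma plus_none [simp]:
  assumes "good F" "ins F = l" "outs F = m"
  shows "F \<boxplus> none l m = F" "none l m \<boxplus> F = F"
proof -
  have l: "objs l" "objs m" using assms by auto
  show "F \<boxplus> none l m = F"
  proof (rule diagram_eqI)
    show "component (F \<boxplus> none l m) Z = component F Z" if "Z \<in> Ob C" for Z
      using that assms l Add_Zero[of "component F Z"] by (simp add: hom_iff)
  qed (use assms l in auto)
  then show "none l m \<boxplus> F = F" by (simp add: plus_commute)
qed

lemma seq_none [simp]: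
  assumes "good F" "ins F = m" "objs l"
  shows "F \<bullet> none l m = none l (outs F)"
proof -
  have "objs m" using assms by auto
  then show ?thesis
    by (intro diagram_eqI) (use assms in \<open>simp_all add: Zero_bilinear\<close>)
qed

lemma none_seq [simp]:
  assumes "good F" "outs F = l" "objs m"
  shows "none l m \<bullet> F = none (ins F) m"
proof -
  have "objs l" using assms by auto
  then show ?thesis
    by (intro diagram_eqI) (use assms in \<open>simp_all add: Zero_bilinear\<close>)
qed

lemma beside_none [simp]:
  assumes "objs l" "objs m" "objs p" "objs r"
  shows "beside p (none l m) r = none (p @ l @ r) (p @ m @ r)"
  by (intro diagram_eqI) (use assms in \<open>simp_all add: pad_arr_linear\<close>)

lemma rep_Add:
  assumes "rep f s t F" "rep g s t G"
  shows "rep (f \<oplus> g) s t (F \<boxplus> G)"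
proof (rule repI)
  note [simp] = rep_simps[OF assms(1)] rep_simps[OF assms(2)]
  show "component (F \<boxplus> G) Z \<cdot> can s Z = can t Z \<cdot> ((f \<oplus> g) \<otimes> \<one>Z)" if "Z \<in> Ob C" for Z
    using that rep_component[OF assms(1)] rep_component[OF assms(2)] by (simp add: bilinear_arr)
qed (use rep_simps[OF assms(1)] rep_simps[OF assms(2)] in \<open>simp_all add: hom_iff\<close>)

lemma rep_Zero:
  assumes "objs (word s)" "objs (word t)" "A = obj s" "B = obj t"
  shows "rep (Zero C A B) s t (none (word s) (word t))"
  by (rule repI) (use assms in \<open>simp_all add: hom_iff Zero_bilinear\<close>)

end

section \<open>Commuting actions\<close>

context symmetric_monoidal_category
begin

text \<open>Composites are normalised to right-nested form, where an equation between two-step composites has to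
  be applied in front of a further diagram.\<close>

lemma seq_eq_extend: "G \<bullet> F = H \<Longrightarrow> G \<bullet> (F \<bullet> K) = H \<bullet> K"
  by (metis seq_assoc)

lemma rep_eq_iff: "rep f s t F \<Longrightarrow> rep g s t G \<Longrightarrow> f = g \<longleftrightarrow> F = G"
  using rep_faithful rep_unique by metis

text \<open>Commuting actions on the tensor product of the word \<open>outs a\<close>, without reference to its bracketing.\<close>

definition commuting :: "'o \<Rightarrow> ('o, 'm) diagram \<Rightarrow> bool" where
  "commuting X a \<longleftrightarrow> X \<in> Ob C \<and> good a \<and> ins a = outs a @ [X] \<and>
     a \<bullet> (beside [] a [X] \<bullet> beside (outs a) (cross X X) []) = a \<bullet> beside [] a [X]"

lemma commuting_sel:
  assumes "commuting X a"
  shows "X \<in> Ob C" "good a" "ins a = outs a @ [X]"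
  using assms by (auto simp: commuting_def)

lemma commuting_beside:
  assumes "commuting X a"
  shows "beside l a r \<bullet> (beside l a (X # r) \<bullet> beside (l @ outs a) (cross X X) r)
    = beside l a r \<bullet> beside l a (X # r)"
proof -
  have "beside l (a \<bullet> (beside [] a [X] \<bullet> beside (outs a) (cross X X) [])) r
    = beside l (a \<bullet> beside [] a [X]) r"
    using assms by (simp only: commuting_def)
  then show ?thesis by simp
qed

lemma commuting_iff:
  assumes "rep a (s \<star> \<langle>X\<rangle>) s a'"
  shows "commutes_with_itself C X (obj s) a \<longleftrightarrow> commuting X a'"
proof -
  note [simp] = rep_simps[OF assms]
  have X [simp]: "X \<in> Ob C" using rep_simps(1)[OF assms] by simp
  have "rep (a \<cdot> (a \<otimes> \<one>X) \<cdot> Assoc_inv C (obj s) X X \<cdot> (\<one>(obj s) \<otimes> Sym C X X) \<cdot> Assoc C (obj s) X X)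
      (s \<star> \<langle>X\<rangle> \<star> \<langle>X\<rangle>) s (a' \<bullet> (beside [] a' [X] \<bullet> beside (word s) (cross X X) []))"
    by (rule rep_cong, (rule rep_rules rep_cross assms | (simp; fail))+)
  moreover have "rep (a \<cdot> (a \<otimes> \<one>X)) (s \<star> \<langle>X\<rangle> \<star> \<langle>X\<rangle>) s (a' \<bullet> beside [] a' [X])"
    by (rule rep_cong, (rule rep_rules assms | (simp; fail))+)
  ultimately show ?thesis
    unfolding commutes_with_itself_def commuting_def by (simp add: rep_eq_iff)
qed

lemma commuting_action_iff:
  assumes "rep a (s \<star> \<langle>X\<rangle>) s a'"
  shows "is_commuting_action C X (obj s) a \<longleftrightarrow> commuting X a'"
  using commuting_iff[OF assms] rep_simps[OF assms] by (simp add: is_commuting_action_def hom_iff)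

lemma equivariant_iff:
  assumes "rep f s t f'" "rep a (s \<star> \<langle>X\<rangle>) s a'" "rep b (t \<star> \<langle>X\<rangle>) t b'"
  shows "f \<cdot> a = b \<cdot> (f \<otimes> \<one>X) \<longleftrightarrow> f' \<bullet> a' = b' \<bullet> beside [] f' [X]"
proof (rule rep_eq_iff)
  note [simp] = rep_simps[OF assms(1)] rep_simps[OF assms(2)]
  have [simp]: "X \<in> Ob C" using rep_simps(1)[OF assms(2)] by simp
  show "rep (f \<cdot> a) (s \<star> \<langle>X\<rangle>) t (f' \<bullet> a')"
    by (rule rep_Comp[OF assms(2,1)])
  show "rep (b \<cdot> (f \<otimes> \<one>X)) (s \<star> \<langle>X\<rangle>) t (b' \<bullet> beside [] f' [X])"
    by (rule rep_cong, (rule rep_rules assms | (simp; fail))+)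
qed

text \<open>The Yang-Baxter relation, with a word in place of one of the three strands.\<close>

lemma cross_pull:
  assumes [simp]: "X \<in> Ob C" and "objs m"
  shows "beside [X] (pull m X) [] \<bullet> (beside [] (pull m X) [X] \<bullet> beside m (cross X X) [])
    = beside [] (cross X X) m \<bullet> (beside [X] (pull m X) [] \<bullet> beside [] (pull m X) [X])"
  using assms(2)
proof (induct m)
  case (Cons B m)
  then have [simp]: "B \<in> Ob C" "objs m" by auto
  let ?p = "pull m X" and ?c = "cross X X" and ?d = "cross B X"
  have i: "beside [X, B] ?p [] \<bullet> beside [] ?d (m @ [X]) = beside [] ?d (X # m) \<bullet> beside [B, X] ?p []"
    using interchange[of "[]" ?d "[]" ?p "[]"] by simp
  have n: "beside [X] ?d m \<bullet> (beside [] ?d (X # m) \<bullet> beside [B] ?c m)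
     = beside [] ?c (B # m) \<bullet> (beside [X] ?d m \<bullet> beside [] ?d (X # m))"
  proof -
    have "beside [] (push B [X, X] \<bullet> beside [B] ?c []) m = beside [] (beside [] ?c [B] \<bullet> push B [X, X]) m"
      using push_natural[OF rep_cross, of X X B] by simp
    then show ?thesis by simp
  qed
  have h: "beside [B, X] ?p [] \<bullet> (beside [B] ?p [X] \<bullet> beside (B # m) ?c [])
    = beside [B] ?c m \<bullet> (beside [B, X] ?p [] \<bullet> beside [B] ?p [X])"
  proof -
    have "beside [B] (beside [X] ?p [] \<bullet> (beside [] ?p [X] \<bullet> beside m ?c [])) []
      = beside [B] (beside [] ?c m \<bullet> (beside [X] ?p [] \<bullet> beside [] ?p [X])) []"
      using Cons by simp
    then show ?thesis by simp
  qed
  have "beside [X] (pull (B # m) X) [] \<bullet> (beside [] (pull (B # m) X) [X] \<bullet> beside (B # m) ?c [])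
     = beside [X] ?d m \<bullet> (beside [] ?d (X # m) \<bullet> (beside [B, X] ?p [] \<bullet> (beside [B] ?p [X] \<bullet> beside (B # m) ?c [])))"
    using i[THEN seq_eq_extend] by simp
  also have "\<dots> = beside [X] ?d m \<bullet> (beside [] ?d (X # m) \<bullet> (beside [B] ?c m \<bullet> (beside [B, X] ?p [] \<bullet> beside [B] ?p [X])))"
    by (simp only: h)
  also have "\<dots> = beside [] ?c (B # m) \<bullet> (beside [X] ?d m \<bullet> (beside [] ?d (X # m) \<bullet> (beside [B, X] ?p [] \<bullet> beside [B] ?p [X])))"
    using n[THEN seq_eq_extend] by simp
  also have "\<dots> = beside [] ?c (B # m) \<bullet> (beside [X] (pull (B # m) X) [] \<bullet> beside [] (pull (B # m) X) [X])"
    using i[THEN seq_eq_extend] by simp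
  finally show ?case .
qed simp

lemma pull_append:
  assumes "A \<in> Ob C" "objs l" "objs m"
  shows "pull (l @ m) A = beside [] (pull l A) m \<bullet> beside l (pull m A) []"
  using assms by (induct l) simp_all

end

context linear_symmetric_monoidal_category
begin

text \<open>The right-hand side of the product rule is this action on a tensor square, composed with the
  comultiplication.\<close>

definition leibniz_arrow :: "'o \<Rightarrow> 'o \<Rightarrow> 'm \<Rightarrow> 'o \<Rightarrow> 'm \<Rightarrow> 'm" where
  "leibniz_arrow X A a B b =
     ((\<one>A \<otimes> b) \<cdot> Assoc C A B X) \<oplus>
     ((a \<otimes> \<one>B) \<cdot> Assoc_inv C A X B \<cdot> (\<one>A \<otimes> Sym C B X) \<cdot> Assoc C A B X)"

definition leibniz :: "'o \<Rightarrow> ('o, 'm) diagram \<Rightarrow> ('o, 'm) diagram \<Rightarrow> ('o, 'm) diagram" where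
  "leibniz X a b = beside (outs a) b [] \<boxplus> beside [] a (outs b) \<bullet> beside (outs a) (pull (outs b) X) []"

lemma rep_leibniz:
  assumes "rep a (s \<star> \<langle>X\<rangle>) s a'" "rep b (t \<star> \<langle>X\<rangle>) t b'" "A = obj s" "B = obj t"
  shows "rep (leibniz_arrow X A a B b) (s \<star> t \<star> \<langle>X\<rangle>) (s \<star> t) (leibniz X a' b')"
proof -
  note [simp] = rep_simps[OF assms(1)] rep_simps[OF assms(2)]
  have [simp]: "X \<in> Ob C" using rep_simps(1)[OF assms(1)] by simp
  show ?thesis
    unfolding leibniz_arrow_def leibniz_def assms(3,4)
    by (rule rep_cong, (rule rep_Add rep_pull rep_rules assms | (simp; fail))+)
qed

lemma leibniz_sel [simp]:
  assumes "commuting X a" "commuting X b"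
  shows "good (leibniz X a b)" "outs (leibniz X a b) = outs a @ outs b" "ins (leibniz X a b) = outs a @ outs b @ [X]"
  using commuting_sel[OF assms(1)] commuting_sel[OF assms(2)] by (simp_all add: leibniz_def)

text \<open>Acting twice gives four terms. Those that use one factor twice (\<open>LL\<close> and \<open>RR\<close>) are symmetric because
  the action on that factor commutes with itself, and exchanging the acting wires interchanges the two
  mixed terms (\<open>RL\<close> and \<open>RLc\<close>).\<close>

lemma commuting_leibniz:
  assumes a: "commuting X a" and b: "commuting X b" and r: "rep b0 (t \<star> \<langle>X\<rangle>) t b"
  shows "commuting X (leibniz X a b)"
proof -
  let ?l = "outs a" and ?m = "outs b" and ?c = "cross X X" and ?p = "pull (outs b) X"
  note [simp] = commuting_sel[OF a] commuting_sel[OF b]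
  let ?L = "\<lambda>r. beside ?l b r" and ?a = "\<lambda>r. beside [] a r" and ?P = "\<lambda>r. beside ?l ?p r"
  let ?cc = "beside (?l @ ?m) ?c []"
  have LL: "?L [] \<bullet> (?L [X] \<bullet> ?cc) = ?L [] \<bullet> ?L [X]"
    using commuting_beside[OF b, of ?l "[]"] by simp
  have pb: "?P [] \<bullet> ?L [X] = beside (?l @ [X]) b [] \<bullet> (?P [X] \<bullet> ?cc)"
  proof -
    have "beside ?l (pull ?m X \<bullet> beside [] b [X]) [] = beside ?l (beside [X] b [] \<bullet> pull (?m @ [X]) X) []"
      using pull_natural[OF r, of X] rep_simps[OF r] by simp
    then show ?thesis by (simp add: pull_append)
  qed
  have ab: "?a ?m \<bullet> beside (?l @ [X]) b [] = ?L [] \<bullet> ?a (?m @ [X])"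
    using interchange[of "[]" a "[]" b "[]"] by simp
  have RL: "?a ?m \<bullet> (?P [] \<bullet> ?L [X]) = ?L [] \<bullet> (?a (?m @ [X]) \<bullet> (?P [X] \<bullet> ?cc))"
    by (simp add: pb ab[THEN seq_eq_extend])
  have cc: "?cc \<bullet> ?cc = wire (?l @ ?m @ [X, X])"
    using cross_cross_in[of X X "wire (?l @ ?m @ [X, X])" "?l @ ?m" "[]"] by simp
  have RLc: "?a ?m \<bullet> (?P [] \<bullet> (?L [X] \<bullet> ?cc)) = ?L [] \<bullet> (?a (?m @ [X]) \<bullet> ?P [X])"
    by (simp add: pb[THEN seq_eq_extend] ab[THEN seq_eq_extend] cc)
  have pa: "?P [] \<bullet> ?a (?m @ [X]) = ?a (X # ?m) \<bullet> beside (?l @ [X]) ?p []"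
    using interchange[of "[]" a "[]" ?p "[]"] by simp
  have pp: "beside (?l @ [X]) ?p [] \<bullet> (?P [X] \<bullet> ?cc) = beside ?l ?c ?m \<bullet> (beside (?l @ [X]) ?p [] \<bullet> ?P [X])"
  proof -
    have "beside ?l (beside [X] ?p [] \<bullet> (beside [] ?p [X] \<bullet> beside ?m ?c [])) []
      = beside ?l (beside [] ?c ?m \<bullet> (beside [X] ?p [] \<bullet> beside [] ?p [X])) []"
      using cross_pull[of X ?m] by simp
    then show ?thesis by simp
  qed
  have aa: "?a ?m \<bullet> (?a (X # ?m) \<bullet> beside ?l ?c ?m) = ?a ?m \<bullet> ?a (X # ?m)"
    using commuting_beside[OF a, of "[]" ?m] by simp
  have RR: "?a ?m \<bullet> (?P [] \<bullet> (?a (?m @ [X]) \<bullet> (?P [X] \<bullet> ?cc))) = ?a ?m \<bullet> (?P [] \<bullet> (?a (?m @ [X]) \<bullet> ?P [X]))"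
  proof -
    have "?a ?m \<bullet> (?P [] \<bullet> (?a (?m @ [X]) \<bullet> (?P [X] \<bullet> ?cc)))
      = ?a ?m \<bullet> (?a (X # ?m) \<bullet> (beside ?l ?c ?m \<bullet> (beside (?l @ [X]) ?p [] \<bullet> ?P [X])))"
      by (simp add: pa[THEN seq_eq_extend] pp)
    also have "\<dots> = (?a ?m \<bullet> (?a (X # ?m) \<bullet> beside ?l ?c ?m)) \<bullet> (beside (?l @ [X]) ?p [] \<bullet> ?P [X])"
      by (simp only: seq_assoc)
    also have "\<dots> = ?a ?m \<bullet> (?P [] \<bullet> (?a (?m @ [X]) \<bullet> ?P [X]))"
      by (simp only: aa seq_assoc pa[THEN seq_eq_extend])
    finally show ?thesis .
  qed
  have "leibniz X a b \<bullet> (beside [] (leibniz X a b) [X] \<bullet> ?cc) = leibniz X a b \<bullet> beside [] (leibniz X a b) [X]"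
    unfolding leibniz_def
    by (simp add: LL RL RLc RR plus_ac)
  then show ?thesis
    unfolding commuting_def using a b by simp
qed

lemma leibniz_assoc:
  assumes "commuting X a" "commuting X b" "commuting X c"
  shows "leibniz X (leibniz X a b) c = leibniz X a (leibniz X b c)"
proof -
  note [simp] = commuting_sel[OF assms(1)] commuting_sel[OF assms(2)] commuting_sel[OF assms(3)]
  show ?thesis using assms by (simp add: leibniz_def pull_append plus_assoc)
qed

lemma commuting_none [simp]: "X \<in> Ob C \<Longrightarrow> commuting X (none [X] [])"
  by (simp add: commuting_def)

lemma leibniz_none [simp]:
  assumes "commuting X a"
  shows "leibniz X (none [X] []) a = a" "leibniz X a (none [X] []) = a"
  using commuting_sel[OF assms] by (simp_all add: leibniz_def)

lemma pull_letter:
  assumes x: "rep x0 \<langle>X\<rangle> \<langle>Y\<rangle> x" and "objs v"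
  shows "beside [] x v \<bullet> pull v X = pull v Y \<bullet> beside v x []"
  using assms(2)
proof (induct v)
  note [simp] = rep_simps[OF x]
  have [simp]: "X \<in> Ob C" "Y \<in> Ob C" using rep_simps(1,2)[OF x] by auto
  case (Cons B v)
  then have [simp]: "B \<in> Ob C" "objs v" by auto
  have e1: "beside [] x (B # v) \<bullet> beside [] (cross B X) v = beside [] (cross B Y) v \<bullet> beside [B] x v"
  proof -
    have "beside [] (beside [] x [B] \<bullet> cross B X) v = beside [] (cross B Y \<bullet> beside [B] x []) v"
      using push_natural[OF x, of B] by simp
    then show ?thesis by simp
  qed
  have e2: "beside [B] x v \<bullet> beside [B] (pull v X) [] = beside [B] (pull v Y) [] \<bullet> beside (B # v) x []"
  proof -
    have "beside [B] (beside [] x v \<bullet> pull v X) [] = beside [B] (pull v Y \<bullet> beside v x []) []"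
      using Cons by simp
    then show ?thesis by simp
  qed
  show ?case by (simp add: e1[THEN seq_eq_extend] e2)
qed (use rep_simps[OF x] in simp)

text \<open>Naturality of the Leibniz action in both factors and, through \<open>x\<close>, in the acting object. With \<open>x\<close> a bare wire
  this is equivariance of a tensor product of equivariant maps; the general case gives naturality of the
  comultiplication.\<close>

lemma leibniz_natural:
  assumes "rep f0 s t f" "rep g0 u v g" "rep x0 \<langle>X\<rangle> \<langle>Y\<rangle> x"
    and a: "commuting X a" "outs a = word s" and a': "commuting Y a'" "outs a' = word t"
    and b: "commuting X b" "outs b = word u" and b': "commuting Y b'" "outs b' = word v"
    and fa: "f \<bullet> a = a' \<bullet> (beside [] f [Y] \<bullet> beside (word s) x [])"
    and gb: "g \<bullet> b = b' \<bullet> (beside [] g [Y] \<bullet> beside (word u) x [])"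
  shows "beside [] f (word v) \<bullet> (beside (word s) g [] \<bullet> leibniz X a b)
    = leibniz Y a' b' \<bullet> (beside [] f (word v @ [Y]) \<bullet> (beside (word s) g [Y] \<bullet> beside (word s @ word u) x []))"
proof -
  let ?s = "word s" and ?t = "word t" and ?u = "word u" and ?v = "word v"
  note [simp] = rep_simps[OF assms(1)] rep_simps[OF assms(2)] rep_simps[OF assms(3)]
    commuting_sel[OF a(1)] a(2) commuting_sel[OF a'(1)] a'(2) commuting_sel[OF b(1)] b(2) commuting_sel[OF b'(1)] b'(2)
  have one: "beside [] f ?v \<bullet> (beside ?s g [] \<bullet> beside ?s b [])
    = beside ?t b' [] \<bullet> (beside [] f (?v @ [Y]) \<bullet> (beside ?s g [Y] \<bullet> beside (?s @ ?u) x []))"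
  proof -
    have "beside ?s (g \<bullet> b) [] = beside ?s (b' \<bullet> (beside [] g [Y] \<bullet> beside ?u x [])) []"
      by (simp only: gb)
    moreover have i: "beside [] f ?v \<bullet> beside ?s b' [] = beside ?t b' [] \<bullet> beside [] f (?v @ [Y])"
      using interchange[of "[]" f "[]" b' "[]"] by simp
    ultimately show ?thesis
      by (simp add: i[THEN seq_eq_extend])
  qed
  have ga: "beside ?s g [] \<bullet> beside [] a ?u = beside [] a ?v \<bullet> beside (?s @ [X]) g []"
    using interchange[of "[]" a "[]" g "[]"] by simp
  have fa': "beside [] f ?v \<bullet> beside [] a ?v = beside [] a' ?v \<bullet> (beside [] f (Y # ?v) \<bullet> beside ?s x ?v)"
  proof -
    have "beside [] (f \<bullet> a) ?v = beside [] (a' \<bullet> (beside [] f [Y] \<bullet> beside ?s x [])) ?v"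
      by (simp only: fa)
    then show ?thesis by simp
  qed
  have pg: "beside (?s @ [X]) g [] \<bullet> beside ?s (pull ?u X) [] = beside ?s (pull ?v X) [] \<bullet> beside ?s g [X]"
  proof -
    have "beside ?s (beside [X] g [] \<bullet> pull ?u X) [] = beside ?s (pull ?v X \<bullet> beside [] g [X]) []"
      using pull_natural[OF assms(2), of X] by simp
    then show ?thesis by simp
  qed
  have xp: "beside ?s x ?v \<bullet> beside ?s (pull ?v X) [] = beside ?s (pull ?v Y) [] \<bullet> beside (?s @ ?v) x []"
  proof -
    have "beside ?s (beside [] x ?v \<bullet> pull ?v X) [] = beside ?s (pull ?v Y \<bullet> beside ?v x []) []"
      using pull_letter[OF assms(3), of ?v] by simp
    then show ?thesis by simp
  qed
  have fp: "beside [] f (Y # ?v) \<bullet> beside ?s (pull ?v Y) [] = beside ?t (pull ?v Y) [] \<bullet> beside [] f (?v @ [Y])"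
    using interchange[of "[]" f "[]" "pull ?v Y" "[]"] by simp
  have xg: "beside (?s @ ?v) x [] \<bullet> beside ?s g [X] = beside ?s g [Y] \<bullet> beside (?s @ ?u) x []"
    using interchange[of ?s g "[]" x "[]"] by simp
  have two: "beside [] f ?v \<bullet> (beside ?s g [] \<bullet> (beside [] a ?u \<bullet> beside ?s (pull ?u X) []))
    = beside [] a' ?v \<bullet> (beside ?t (pull ?v Y) [] \<bullet> (beside [] f (?v @ [Y]) \<bullet> (beside ?s g [Y] \<bullet> beside (?s @ ?u) x [])))"
    by (simp add: ga[THEN seq_eq_extend] fa'[THEN seq_eq_extend] pg xp[THEN seq_eq_extend] fp[THEN seq_eq_extend] xg)
  show ?thesis
    by (simp add: leibniz_def one two)
qed

lemma leibniz_cross: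
  assumes ra: "rep a0 (\<langle>A\<rangle> \<star> \<langle>X\<rangle>) \<langle>A\<rangle> a" and rb: "rep b0 (\<langle>B\<rangle> \<star> \<langle>X\<rangle>) \<langle>B\<rangle> b"
  shows "cross A B \<bullet> leibniz X a b = leibniz X b a \<bullet> beside [] (cross A B) [X]"
proof -
  note [simp] = rep_simps[OF ra] rep_simps[OF rb]
  have [simp]: "A \<in> Ob C" "B \<in> Ob C" "X \<in> Ob C"
    using rep_simps(1)[OF ra] rep_simps(1)[OF rb] by auto
  have 1: "cross A B \<bullet> beside [A] b [] = beside [] b [A] \<bullet> (beside [B] (cross A X) [] \<bullet> beside [] (cross A B) [X])"
    using push_natural[OF rb, of A] by simp
  have p: "cross A B \<bullet> beside [] a [B] = beside [B] a [] \<bullet> (beside [] (cross A B) [X] \<bullet> beside [A] (cross X B) [])"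
    using pull_natural[OF ra, of B] by simp
  have 2: "cross A B \<bullet> (beside [] a [B] \<bullet> beside [A] (cross B X) []) = beside [B] a [] \<bullet> beside [] (cross A B) [X]"
    using cross_cross_in[of B X "wire [A, B, X]" "[A]" "[]"]
    by (simp add: p[THEN seq_eq_extend])
  show ?thesis
    by (simp add: leibniz_def 1 2 plus_commute)
qed

end

context symmetric_monoidal_category
begin

text \<open>Oriented form of the interchange law: of two boxes on disjoint wires, the left one is drawn
  after the right one.\<close>

lemma slide:
  assumes "l' = l @ outs F @ drop (length (l @ outs F)) l'" "r = drop (length (l @ outs F)) l' @ ins G @ r'"
  shows "beside l' G r' \<bullet> beside l F r
    = beside l F (drop (length (l @ outs F)) l' @ outs G @ r') \<bullet> beside (l @ ins F @ drop (length (l @ outs F)) l') G r'"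
  using interchange[of l F "drop (length (l @ outs F)) l'" G r'] assms by simp

lemmas slides = slide slide[THEN seq_eq_extend, simplified seq_assoc]

end

section \<open>Comonoids and derivations\<close>

context linear_symmetric_monoidal_category
begin

definition comonoid :: "'o \<Rightarrow> ('o, 'm) diagram \<Rightarrow> ('o, 'm) diagram \<Rightarrow> bool" where
  "comonoid K e D \<longleftrightarrow>
     (\<exists>e0. rep e0 \<langle>K\<rangle> Null e) \<and> (\<exists>D0. rep D0 \<langle>K\<rangle> (\<langle>K\<rangle> \<star> \<langle>K\<rangle>) D) \<and>
     beside [] D [K] \<bullet> D = beside [K] D [] \<bullet> D \<and>
     beside [] e [K] \<bullet> D = wire [K] \<and> beside [K] e [] \<bullet> D = wire [K] \<and>
     cross K K \<bullet> D = D"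

lemma comonoid_sel:
  assumes "comonoid K e D"
  shows "K \<in> Ob C" "good e" "ins e = [K]" "outs e = []" "good D" "ins D = [K]" "outs D = [K, K]"
proof -
  from assms obtain e0 D0 where "rep e0 \<langle>K\<rangle> Null e" "rep D0 \<langle>K\<rangle> (\<langle>K\<rangle> \<star> \<langle>K\<rangle>) D"
    by (auto simp: comonoid_def)
  from rep_simps[OF this(1)] rep_simps[OF this(2)] show
    "K \<in> Ob C" "good e" "ins e = [K]" "outs e = []" "good D" "ins D = [K]" "outs D = [K, K]"
    by auto
qed

lemma comonoid_iff:
  assumes "rep e0 \<langle>K\<rangle> Null e" "rep D0 \<langle>K\<rangle> (\<langle>K\<rangle> \<star> \<langle>K\<rangle>) D"
  shows "is_cocommutative_comonoid C K e0 D0 \<longleftrightarrow> comonoid K e D"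
proof -
  note [simp] = rep_simps[OF assms(1)] rep_simps[OF assms(2)]
  have [simp]: "K \<in> Ob C" using rep_simps(1)[OF assms(1)] by simp
  have "rep (Assoc C K K K \<cdot> (D0 \<otimes> \<one>K) \<cdot> D0) \<langle>K\<rangle> (\<langle>K\<rangle> \<star> (\<langle>K\<rangle> \<star> \<langle>K\<rangle>)) (beside [] D [K] \<bullet> D)"
    by (rule rep_cong, (rule rep_rules assms | (simp; fail))+)
  moreover have "rep ((\<one>K \<otimes> D0) \<cdot> D0) \<langle>K\<rangle> (\<langle>K\<rangle> \<star> (\<langle>K\<rangle> \<star> \<langle>K\<rangle>)) (beside [K] D [] \<bullet> D)"
    by (rule rep_cong, (rule rep_rules assms | (simp; fail))+)
  moreover have "rep (LUnit C K \<cdot> (e0 \<otimes> \<one>K) \<cdot> D0) \<langle>K\<rangle> \<langle>K\<rangle> (beside [] e [K] \<bullet> D)"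
    by (rule rep_cong, (rule rep_rules assms | (simp; fail))+)
  moreover have "rep (RUnit C K \<cdot> (\<one>K \<otimes> e0) \<cdot> D0) \<langle>K\<rangle> \<langle>K\<rangle> (beside [K] e [] \<bullet> D)"
    by (rule rep_cong, (rule rep_rules assms | (simp; fail))+)
  moreover have "rep (Sym C K K \<cdot> D0) \<langle>K\<rangle> (\<langle>K\<rangle> \<star> \<langle>K\<rangle>) (cross K K \<bullet> D)"
    by (rule rep_cong, (rule rep_rules rep_cross assms | (simp; fail))+)
  moreover have "rep (\<one>K) \<langle>K\<rangle> \<langle>K\<rangle> (wire [K])"
    using rep_Ident[of "\<langle>K\<rangle>"] by simp
  ultimately show ?thesis
    using assms unfolding is_cocommutative_comonoid_def comonoid_def
    by (auto simp: rep_eq_iff hom_iff)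
qed

end

locale differential_comonoid = linear_symmetric_monoidal_category C
  for C :: "('o, 'm, 'k :: {comm_semiring_0, comm_monoid_mult}, 'x) linear_smc_scheme" (structure) +
  fixes X P :: 'o and e D d :: "('o, 'm) diagram" and d0 :: 'm
  assumes comonoid: "comonoid P e D"
    and d_rep: "rep d0 (\<langle>P\<rangle> \<star> \<langle>X\<rangle>) \<langle>P\<rangle> d"
    and d_commuting: "commuting X d"
    and d_constant: "e \<bullet> d = none [P, X] []"
    and d_product: "D \<bullet> d = leibniz X d d \<bullet> beside [] D [X]"
begin

lemma sel [simp]:
  "P \<in> Ob C" "X \<in> Ob C" "good e" "ins e = [P]" "outs e = []" "good D" "ins D = [P]" "outs D = [P, P]"
  "good d" "ins d = [P, X]" "outs d = [P]"
  using comonoid_sel[OF comonoid] commuting_sel[OF d_commuting] rep_simps[OF d_rep] by auto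

text \<open>In terms of elements, \<open>\<theta>\<close> sends \<open>(p, v)\<close> to \<open>(d(p', v), p'')\<close>, where \<open>(p', p'')\<close> is the duplicate of
  \<open>p\<close>: one of the two summands of the product rule.\<close>

definition \<theta> :: "('o, 'm) diagram" where
  "\<theta> = beside [] d [P] \<bullet> (beside [P] (cross P X) [] \<bullet> beside [] D [X])"

lemma \<theta>_sel [simp]: "good \<theta>" "ins \<theta> = [P, X]" "outs \<theta> = [P, P]"
  by (simp_all add: \<theta>_def)

lemma coassoc: "beside l D (P # r) \<bullet> beside l D r = beside (l @ [P]) D r \<bullet> beside l D r"
proof -
  have "beside l (beside [] D [P] \<bullet> D) r = beside l (beside [P] D [] \<bullet> D) r"
    using comonoid by (simp only: comonoid_def)
  then show ?thesis by simp
qed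

lemma counit:
  "objs l \<Longrightarrow> objs r \<Longrightarrow> beside l e (P # r) \<bullet> beside l D r = wire (l @ [P] @ r)"
  "objs l \<Longrightarrow> objs r \<Longrightarrow> beside (l @ [P]) e r \<bullet> beside l D r = wire (l @ [P] @ r)"
proof -
  have "beside l (beside [] e [P] \<bullet> D) r = beside l (wire [P]) r"
    "beside l (beside [P] e [] \<bullet> D) r = beside l (wire [P]) r"
    using comonoid by (simp_all only: comonoid_def)
  then show "objs l \<Longrightarrow> objs r \<Longrightarrow> beside l e (P # r) \<bullet> beside l D r = wire (l @ [P] @ r)"
    "objs l \<Longrightarrow> objs r \<Longrightarrow> beside (l @ [P]) e r \<bullet> beside l D r = wire (l @ [P] @ r)" by simp_all
qed

lemma cocomm: "beside l (cross P P) r \<bullet> beside l D r = beside l D r"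
proof -
  have "beside l (cross P P \<bullet> D) r = beside l D r"
    using comonoid by (simp only: comonoid_def)
  then show ?thesis by simp
qed

lemma cocomm3: "beside l (cross P P) (P # r) \<bullet> (beside (l @ [P]) D r \<bullet> beside l D r) = beside (l @ [P]) D r \<bullet> beside l D r"
  by (simp flip: coassoc add: cocomm[THEN seq_eq_extend])

lemma D_rep: "\<exists>D0. rep D0 \<langle>P\<rangle> (\<langle>P\<rangle> \<star> \<langle>P\<rangle>) D" and e_rep: "\<exists>e0. rep e0 \<langle>P\<rangle> Null e"
  using comonoid by (auto simp: comonoid_def)

lemma cross_D:
  "Y \<in> Ob C \<Longrightarrow> beside (l @ [Y]) D r \<bullet> beside l (cross P Y) r
    = beside l (cross P Y) (P # r) \<bullet> (beside (l @ [P]) (cross P Y) r \<bullet> beside l D (Y # r))"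
proof -
  obtain D0 where D0: "rep D0 \<langle>P\<rangle> (\<langle>P\<rangle> \<star> \<langle>P\<rangle>) D" using D_rep by auto
  assume [simp]: "Y \<in> Ob C"
  have "beside l (beside [Y] D [] \<bullet> cross P Y) r
    = beside l (beside [] (cross P Y) [P] \<bullet> (beside [P] (cross P Y) [] \<bullet> beside [] D [Y])) r"
    using pull_natural[OF D0, of Y] by simp
  then show ?thesis by simp
qed

lemma cross_e:
  "Y \<in> Ob C \<Longrightarrow> beside (l @ [Y]) e r \<bullet> beside l (cross P Y) r = beside l e (Y # r)"
proof -
  obtain e0 where e0: "rep e0 \<langle>P\<rangle> Null e" using e_rep by auto
  assume [simp]: "Y \<in> Ob C"
  have "beside l (beside [Y] e [] \<bullet> cross P Y) r = beside l (beside [] e [Y]) r"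
    using pull_natural[OF e0, of Y] by simp
  then show ?thesis by simp
qed

lemma cross_d:
  assumes [simp]: "Y \<in> Ob C"
  shows "beside l (cross P Y) r \<bullet> beside l d (Y # r)
      = beside (l @ [Y]) d r \<bullet> (beside l (cross P Y) (X # r) \<bullet> beside (l @ [P]) (cross X Y) r)"
    "beside l (cross Y P) r \<bullet> beside (l @ [Y]) d r
      = beside l d (Y # r) \<bullet> (beside (l @ [P]) (cross Y X) r \<bullet> beside l (cross Y P) (X # r))"
proof -
  have "beside l (cross P Y \<bullet> beside [] d [Y]) r
      = beside l (beside [Y] d [] \<bullet> (beside [] (cross P Y) [X] \<bullet> beside [P] (cross X Y) [])) r"
    using pull_natural[OF d_rep, of Y] by simp
  then show "beside l (cross P Y) r \<bullet> beside l d (Y # r)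
      = beside (l @ [Y]) d r \<bullet> (beside l (cross P Y) (X # r) \<bullet> beside (l @ [P]) (cross X Y) r)"
    by simp
  have "beside l (cross Y P \<bullet> beside [Y] d []) r
      = beside l (beside [] d [Y] \<bullet> (beside [P] (cross Y X) [] \<bullet> beside [] (cross Y P) [X])) r"
    using push_natural[OF d_rep, of Y] by simp
  then show "beside l (cross Y P) r \<bullet> beside (l @ [Y]) d r
      = beside l d (Y # r) \<bullet> (beside (l @ [P]) (cross Y X) r \<bullet> beside l (cross Y P) (X # r))"
    by simp
qed

lemma product_split: "beside l D r \<bullet> beside l d r = beside (l @ [P]) d r \<bullet> beside l D (X # r) \<boxplus> beside l \<theta> r"
proof -
  have "beside l (D \<bullet> d) r = beside l (beside [P] d [] \<bullet> beside [] D [X] \<boxplus> \<theta>) r"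
    unfolding d_product by (simp add: leibniz_def \<theta>_def)
  then show ?thesis by simp
qed

text \<open>The copies in a threefold duplicate are interchangeable, by coassociativity and cocommutativity.
  So exchanging two directions amounts to exchanging the copies that are differentiated along them.\<close>

lemma \<theta>_\<theta>:
  "beside [P] \<theta> [] \<bullet> (beside [] \<theta> [X] \<bullet> beside [P] (cross X X) [])
    = beside [] (cross P P) [P] \<bullet> (beside [P] \<theta> [] \<bullet> beside [] \<theta> [X])"
proof -
  let ?k = "cross P X" and ?c = "cross X X" and ?s = "cross P P"
  let ?W = "beside [P, P] ?c [P] \<bullet> (beside [P, P, X] ?k [] \<bullet> (beside [P, P] ?k [X] \<bullet> (beside [P] D [X, X] \<bullet> beside [] D [X, X])))"
  \<comment> \<open>All duplications are drawn first, then the crossings, then both differentiations.\<close>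
  have T: "beside [P] \<theta> [] \<bullet> beside [] \<theta> [X]
    = beside [] d [P, P] \<bullet> (beside [P, X] d [P] \<bullet> (beside [P] ?k [X, P] \<bullet>
      (beside [P, P, X] ?k [] \<bullet> (beside [P, P] ?k [X] \<bullet> (beside [P] D [X, X] \<bullet> beside [] D [X, X])))))"
    using cross_D[of X "[P]" "[X]", THEN seq_eq_extend] by (simp add: \<theta>_def slides)
  have c1: "beside [P] D [X, X] \<bullet> (beside [] D [X, X] \<bullet> beside [P] ?c [])
    = beside [P, P, P] ?c [] \<bullet> (beside [P] D [X, X] \<bullet> beside [] D [X, X])"
    by (simp add: slides)
  have c2: "beside [P, P, X] ?k [] \<bullet> (beside [P, P] ?k [X] \<bullet> beside [P, P, P] ?c [])
    = beside [P, P] ?c [P] \<bullet> (beside [P, P, X] ?k [] \<bullet> beside [P, P] ?k [X])"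
  proof -
    have "beside [P, P] (beside [X] (pull [P] X) [] \<bullet> (beside [] (pull [P] X) [X] \<bullet> beside [P] ?c [])) []
      = beside [P, P] (beside [] ?c [P] \<bullet> (beside [X] (pull [P] X) [] \<bullet> beside [] (pull [P] X) [X])) []"
      using cross_pull[of X "[P]"] by simp
    then show ?thesis by simp
  qed
  have lhs: "beside [P] \<theta> [] \<bullet> (beside [] \<theta> [X] \<bullet> beside [P] ?c [])
    = beside [] d [P, P] \<bullet> (beside [P, X] d [P] \<bullet> (beside [P] ?k [X, P] \<bullet> ?W))"
  proof -
    have "beside [P] \<theta> [] \<bullet> (beside [] \<theta> [X] \<bullet> beside [P] ?c [])
      = (beside [P] \<theta> [] \<bullet> beside [] \<theta> [X]) \<bullet> beside [P] ?c []" by simp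
    also have "\<dots> = beside [] d [P, P] \<bullet> (beside [P, X] d [P] \<bullet> (beside [P] ?k [X, P] \<bullet>
      ((beside [P, P, X] ?k [] \<bullet> (beside [P, P] ?k [X] \<bullet> beside [P, P, P] ?c [])) \<bullet> (beside [P] D [X, X] \<bullet> beside [] D [X, X]))))"
      unfolding T by (simp only: seq_assoc c1)
    also have "\<dots> = beside [] d [P, P] \<bullet> (beside [P, X] d [P] \<bullet> (beside [P] ?k [X, P] \<bullet> ?W))"
      by (simp only: c2 seq_assoc)
    finally show ?thesis .
  qed
  \<comment> \<open>The crossing of the outputs is moved down to the duplicates, where cocommutativity absorbs it.\<close>
  have s1: "beside [] ?s [P] \<bullet> beside [] d [P, P] = beside [P] d [P] \<bullet> (beside [] ?s [X, P] \<bullet> beside [P] (cross X P) [P])"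
    using cross_d(1)[of P "[]" "[P]"] by simp
  have s2: "beside [P] (cross X P) [P] \<bullet> beside [P, X] d [P]
    = beside [P] d [X, P] \<bullet> (beside [P, P] ?c [P] \<bullet> beside [P] (cross X P) [X, P])"
    using cross_d(2)[of X "[P]" "[P]"] by simp
  have s3: "beside [] ?s [X, P] \<bullet> beside [P] d [X, P] = beside [] d [P, X, P] \<bullet> (beside [P] ?k [X, P] \<bullet> beside [] ?s [X, X, P])"
    using cross_d(2)[of P "[]" "[X, P]"] by simp
  have s4: "beside [] ?s [X, X, P] \<bullet> ?W = ?W"
  proof -
    have "beside [] ?s [X, X, P] \<bullet> ?W
      = beside [P, P] ?c [P] \<bullet> (beside [P, P, X] ?k [] \<bullet> (beside [P, P] ?k [X] \<bullet>
         (beside [] ?s [P, X, X] \<bullet> (beside [P] D [X, X] \<bullet> beside [] D [X, X]))))"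
      by (simp add: slides)
    then show ?thesis using cocomm3[of "[]" "[X, X]"] by simp
  qed
  have "beside [] ?s [P] \<bullet> (beside [P] \<theta> [] \<bullet> beside [] \<theta> [X])
    = beside [P] d [P] \<bullet> (beside [] ?s [X, P] \<bullet> (beside [P] d [X, P] \<bullet> (beside [P, P] ?c [P] \<bullet>
      (beside [P, P, X] ?k [] \<bullet> (beside [P, P] ?k [X] \<bullet> (beside [P] D [X, X] \<bullet> beside [] D [X, X]))))))"
    unfolding T by (simp add: s1[THEN seq_eq_extend] s2[THEN seq_eq_extend])
  also have "\<dots> = beside [P] d [P] \<bullet> (beside [] d [P, X, P] \<bullet> (beside [P] ?k [X, P] \<bullet> (beside [] ?s [X, X, P] \<bullet> ?W)))"
    by (simp add: s3[THEN seq_eq_extend])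
  also have "\<dots> = beside [] d [P, P] \<bullet> (beside [P, X] d [P] \<bullet> (beside [P] ?k [X, P] \<bullet> ?W))"
    unfolding s4 by (simp add: slides)
  finally show ?thesis unfolding lhs by simp
qed

text \<open>The part of the second derivative in which both directions hit the same copy.\<close>

definition \<kappa> :: "('o, 'm) diagram" where
  "\<kappa> = beside [] d [P] \<bullet> (beside [] d [X, P] \<bullet> (beside [P, X] (cross P X) [] \<bullet>
    (beside [P] (cross P X) [X] \<bullet> beside [] D [X, X])))"

lemma \<kappa>_sel [simp]: "ins \<kappa> = [P, X, X]" "outs \<kappa> = [P, P]"
  by (simp_all add: \<kappa>_def)

lemma \<kappa>_symmetric: "\<kappa> \<bullet> beside [P] (cross X X) [] = \<kappa>"
proof -
  let ?k = "cross P X" and ?c = "cross X X"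
  have c1: "beside [] D [X, X] \<bullet> beside [P] ?c [] = beside [P, P] ?c [] \<bullet> beside [] D [X, X]"
    by (simp add: slides)
  have c2: "beside [P, X] ?k [] \<bullet> (beside [P] ?k [X] \<bullet> beside [P, P] ?c [])
    = beside [P] ?c [P] \<bullet> (beside [P, X] ?k [] \<bullet> beside [P] ?k [X])"
  proof -
    have "beside [P] (beside [X] (pull [P] X) [] \<bullet> (beside [] (pull [P] X) [X] \<bullet> beside [P] ?c [])) []
      = beside [P] (beside [] ?c [P] \<bullet> (beside [X] (pull [P] X) [] \<bullet> beside [] (pull [P] X) [X])) []"
      using cross_pull[of X "[P]"] by simp
    then show ?thesis by simp
  qed
  have c3: "beside [] d [P] \<bullet> (beside [] d [X, P] \<bullet> beside [P] ?c [P]) = beside [] d [P] \<bullet> beside [] d [X, P]"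
    using commuting_beside[OF d_commuting, of "[]" "[P]"] by simp
  have "\<kappa> \<bullet> beside [P] ?c [] = beside [] d [P] \<bullet> (beside [] d [X, P] \<bullet> ((beside [P, X] ?k [] \<bullet>
    (beside [P] ?k [X] \<bullet> beside [P, P] ?c [])) \<bullet> beside [] D [X, X]))"
    unfolding \<kappa>_def by (simp only: seq_assoc c1)
  also have "\<dots> = (beside [] d [P] \<bullet> (beside [] d [X, P] \<bullet> beside [P] ?c [P])) \<bullet>
    (beside [P, X] ?k [] \<bullet> (beside [P] ?k [X] \<bullet> beside [] D [X, X]))"
    unfolding c2 by (simp only: seq_assoc)
  also have "\<dots> = \<kappa>"
    unfolding c3 \<kappa>_def by (simp only: seq_assoc)
  finally show ?thesis .
qed

text \<open>By the product rule for the duplicate of \<open>d(p, v)\<close>, the new direction hits either the copy that has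
  been differentiated already, which gives \<open>\<kappa>\<close>, or the other one.\<close>

lemma \<theta>_d: "\<theta> \<bullet> beside [] d [X]
  = beside [P] d [] \<bullet> (beside [] \<theta> [X] \<bullet> beside [P] (cross X X) []) \<boxplus> \<kappa>"
proof -
  have "\<theta> \<bullet> beside [] d [X] = beside [] d [P] \<bullet> (beside [P] (cross P X) [] \<bullet> (beside [P] d [X] \<bullet> beside [] D [X, X]))
      \<boxplus> beside [] d [P] \<bullet> (beside [P] (cross P X) [] \<bullet> beside [] \<theta> [X])"
    using product_split[of "[]" "[X]"] by (subst (1) \<theta>_def) simp
  also have "beside [] d [P] \<bullet> (beside [P] (cross P X) [] \<bullet> (beside [P] d [X] \<bullet> beside [] D [X, X]))
      = beside [P] d [] \<bullet> (beside [] \<theta> [X] \<bullet> beside [P] (cross X X) [])"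
    using cross_d(1)[of X "[P]" "[]", THEN seq_eq_extend] by (simp add: \<theta>_def slides)
  also have "beside [] d [P] \<bullet> (beside [P] (cross P X) [] \<bullet> beside [] \<theta> [X]) = \<kappa>"
    by (simp add: \<theta>_def \<kappa>_def slides)
  finally show ?thesis .
qed

text \<open>An action \<open>c\<close> of \<open>P\<close> on \<open>Z\<close> induces an action of \<open>X\<close> on \<open>Z \<otimes> P\<close>. In terms of elements it
  sends \<open>(z, p, v)\<close> to \<open>(z, d(p, v)) + (c(z, d(p', v)), p'')\<close>, where \<open>(p', p'')\<close> is the duplicate
  of \<open>p\<close>.\<close>

definition induced :: "('o, 'm) diagram \<Rightarrow> ('o, 'm) diagram" where
  "induced c = beside (outs c) d [] \<boxplus> beside [] c [P] \<bullet> beside (outs c) \<theta> []"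

lemma induced_sel [simp]:
  assumes "commuting P c"
  shows "good (induced c)" "ins (induced c) = outs c @ [P, X]" "outs (induced c) = outs c @ [P]"
  using commuting_sel[OF assms] by (simp_all add: induced_def)

text \<open>Acting twice gives four terms. Exchanging the acting wires turns one mixed term into the other one, up
  to a summand built from the symmetric \<open>\<kappa>\<close>. The term that uses \<open>c\<close> twice is symmetric because, by \<open>\<theta>_\<theta>\<close>,
  the exchange can be moved to the two wires on which \<open>c\<close> acts.\<close>

lemma induced_commuting:
  assumes "commuting P c"
  shows "commuting X (induced c)"
proof -
  note [simp] = commuting_sel[OF assms]
  let ?z = "outs c" and ?cc = "beside (outs c @ [P]) (cross X X) []"
  have LL: "beside ?z d [] \<bullet> (beside ?z d [X] \<bullet> ?cc) = beside ?z d [] \<bullet> beside ?z d [X]"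
    using commuting_beside[OF d_commuting, of ?z "[]"] by simp
  have cd: "beside [] c [P] \<bullet> beside (?z @ [P]) d [] = beside ?z d [] \<bullet> beside [] c [P, X]"
    using interchange[of "[]" c "[]" d "[]"] by simp
  have td: "beside ?z \<theta> [] \<bullet> beside ?z d [X]
    = beside (?z @ [P]) d [] \<bullet> (beside ?z \<theta> [X] \<bullet> ?cc) \<boxplus> beside ?z \<kappa> []"
  proof -
    have "beside ?z (\<theta> \<bullet> beside [] d [X]) []
      = beside ?z (beside [P] d [] \<bullet> (beside [] \<theta> [X] \<bullet> beside [P] (cross X X) []) \<boxplus> \<kappa>) []"
      by (simp only: \<theta>_d)
    then show ?thesis by simp
  qed
  have cc: "?cc \<bullet> ?cc = wire (?z @ [P, X, X])"
    using cross_cross_in[of X X "wire (?z @ [P, X, X])" "?z @ [P]" "[]"] by simp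
  have kc: "beside ?z \<kappa> [] \<bullet> ?cc = beside ?z \<kappa> []"
  proof -
    have "beside ?z (\<kappa> \<bullet> beside [P] (cross X X) []) [] = beside ?z \<kappa> []"
      by (simp only: \<kappa>_symmetric)
    then show ?thesis by simp
  qed
  have RL: "beside [] c [P] \<bullet> (beside ?z \<theta> [] \<bullet> beside ?z d [X])
    = beside ?z d [] \<bullet> (beside [] c [P, X] \<bullet> (beside ?z \<theta> [X] \<bullet> ?cc)) \<boxplus> beside [] c [P] \<bullet> beside ?z \<kappa> []"
    by (simp add: td cd[THEN seq_eq_extend])
  have RLc: "beside [] c [P] \<bullet> (beside ?z \<theta> [] \<bullet> (beside ?z d [X] \<bullet> ?cc))
    = beside ?z d [] \<bullet> (beside [] c [P, X] \<bullet> beside ?z \<theta> [X]) \<boxplus> beside [] c [P] \<bullet> beside ?z \<kappa> []"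
    by (simp add: td[THEN seq_eq_extend] cd[THEN seq_eq_extend] cc kc)
  have ct: "beside ?z \<theta> [] \<bullet> beside [] c [P, X] = beside [] c [P, P] \<bullet> beside (?z @ [P]) \<theta> []"
    using interchange[of "[]" c "[]" \<theta> "[]"] by simp
  have tt: "beside (?z @ [P]) \<theta> [] \<bullet> (beside ?z \<theta> [X] \<bullet> ?cc)
    = beside ?z (cross P P) [P] \<bullet> (beside (?z @ [P]) \<theta> [] \<bullet> beside ?z \<theta> [X])"
  proof -
    have "beside ?z (beside [P] \<theta> [] \<bullet> (beside [] \<theta> [X] \<bullet> beside [P] (cross X X) [])) []
      = beside ?z (beside [] (cross P P) [P] \<bullet> (beside [P] \<theta> [] \<bullet> beside [] \<theta> [X])) []"
      by (simp only: \<theta>_\<theta>)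
    then show ?thesis by simp
  qed
  have cp: "beside [] c [P] \<bullet> (beside [] c [P, P] \<bullet> (beside ?z (cross P P) [P] \<bullet> F))
    = beside [] c [P] \<bullet> (beside [] c [P, P] \<bullet> F)" for F
  proof -
    have "(beside [] c [P] \<bullet> (beside [] c [P, P] \<bullet> beside ?z (cross P P) [P])) \<bullet> F
      = (beside [] c [P] \<bullet> beside [] c [P, P]) \<bullet> F"
      using commuting_beside[OF assms, of "[]" "[P]"] by simp
    then show ?thesis by simp
  qed
  have RR: "beside [] c [P] \<bullet> (beside ?z \<theta> [] \<bullet> (beside [] c [P, X] \<bullet> (beside ?z \<theta> [X] \<bullet> ?cc)))
    = beside [] c [P] \<bullet> (beside ?z \<theta> [] \<bullet> (beside [] c [P, X] \<bullet> beside ?z \<theta> [X]))"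
    by (simp add: ct[THEN seq_eq_extend] tt cp)
  have "induced c \<bullet> (beside [] (induced c) [X] \<bullet> ?cc) = induced c \<bullet> beside [] (induced c) [X]"
    unfolding induced_def by (simp add: LL RL RLc RR plus_ac)
  then show ?thesis
    unfolding commuting_def using assms by simp
qed

lemma rep_\<theta>: "\<exists>f. rep f (\<langle>P\<rangle> \<star> \<langle>X\<rangle>) (\<langle>P\<rangle> \<star> \<langle>P\<rangle>) \<theta>"
proof -
  obtain D0 where D0: "rep D0 \<langle>P\<rangle> (\<langle>P\<rangle> \<star> \<langle>P\<rangle>) D" using D_rep by auto
  have "rep ((d0 \<otimes> \<one>P) \<cdot> Assoc_inv C P X P \<cdot> (\<one>P \<otimes> Sym C P X) \<cdot> Assoc C P P X \<cdot> (D0 \<otimes> \<one>X))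
    (\<langle>P\<rangle> \<star> \<langle>X\<rangle>) (\<langle>P\<rangle> \<star> \<langle>P\<rangle>) \<theta>"
    unfolding \<theta>_def by (rule rep_cong, (rule rep_rules rep_cross D0 d_rep | (simp; fail))+)
  then show ?thesis ..
qed

lemma rep_induced:
  assumes c: "rep c0 (zs \<star> \<langle>P\<rangle>) zs c"
  shows "\<exists>f. rep f (zs \<star> \<langle>P\<rangle> \<star> \<langle>X\<rangle>) (zs \<star> \<langle>P\<rangle>) (induced c)"
proof -
  obtain t where t: "rep t (\<langle>P\<rangle> \<star> \<langle>X\<rangle>) (\<langle>P\<rangle> \<star> \<langle>P\<rangle>) \<theta>" using rep_\<theta> by auto
  note [simp] = rep_simps[OF c]
  have "objs (word zs)" using rep_simps(2)[OF c] by simp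
  then have "rep ((\<one>(obj zs) \<otimes> d0) \<cdot> Assoc C (obj zs) P X \<oplus>
      (c0 \<otimes> \<one>P) \<cdot> Assoc_inv C (obj zs) P P \<cdot> (\<one>(obj zs) \<otimes> t) \<cdot> Assoc C (obj zs) P X)
    (zs \<star> \<langle>P\<rangle> \<star> \<langle>X\<rangle>) (zs \<star> \<langle>P\<rangle>) (induced c)"
    unfolding induced_def by - (rule rep_cong, (rule rep_Add rep_rules t d_rep c | (simp; fail))+)
  then show ?thesis ..
qed

text \<open>By coassociativity, the duplicate on which the induced action relies may be taken before or after the one
  made here.\<close>

lemma duplicate_induced:
  assumes "commuting P c"
  shows "beside (outs c) D [] \<bullet> induced c = leibniz X (induced c) d \<bullet> beside (outs c) D [X]"
proof -
  note [simp] = commuting_sel[OF assms]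
  let ?z = "outs c" and ?k = "cross P X"
  have Dd: "beside ?z D [] \<bullet> beside ?z d [] = beside (?z @ [P]) d [] \<bullet> beside ?z D [X] \<boxplus> beside ?z \<theta> []"
    using product_split[of ?z "[]"] by simp
  have cD: "beside ?z D [] \<bullet> beside [] c [P] = beside [] c [P, P] \<bullet> beside (?z @ [P]) D []"
    using interchange[of "[]" c "[]" D "[]"] by simp
  have Dt: "beside [P] D [] \<bullet> \<theta> = beside [] \<theta> [P] \<bullet> (beside [P] ?k [] \<bullet> beside [] D [X])"
  proof -
    have "beside [P] D [] \<bullet> \<theta> = beside [] d [P, P] \<bullet> (beside [P] ?k [P] \<bullet> (beside [P, P] ?k [] \<bullet>
      (beside [P] D [X] \<bullet> beside [] D [X])))"
      using cross_D[of X "[P]" "[]", THEN seq_eq_extend] by (simp add: \<theta>_def slides)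
    also have "\<dots> = beside [] \<theta> [P] \<bullet> (beside [P] ?k [] \<bullet> beside [] D [X])"
      using coassoc[of "[]" "[X]", symmetric] by (simp add: \<theta>_def slides)
    finally show ?thesis .
  qed
  have zDt: "beside (?z @ [P]) D [] \<bullet> beside ?z \<theta> []
    = beside ?z \<theta> [P] \<bullet> (beside (?z @ [P]) ?k [] \<bullet> beside ?z D [X])"
  proof -
    have "beside ?z (beside [P] D [] \<bullet> \<theta>) [] = beside ?z (beside [] \<theta> [P] \<bullet> (beside [P] ?k [] \<bullet> beside [] D [X])) []"
      by (simp only: Dt)
    then show ?thesis by simp
  qed
  have zt: "beside ?z \<theta> [] = beside ?z d [P] \<bullet> (beside (?z @ [P]) ?k [] \<bullet> beside ?z D [X])"
    by (simp add: \<theta>_def)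
  have "beside ?z D [] \<bullet> induced c = beside (?z @ [P]) d [] \<bullet> beside ?z D [X] \<boxplus>
      (beside ?z d [P] \<bullet> (beside (?z @ [P]) ?k [] \<bullet> beside ?z D [X]) \<boxplus>
       beside [] c [P, P] \<bullet> (beside ?z \<theta> [P] \<bullet> (beside (?z @ [P]) ?k [] \<bullet> beside ?z D [X])))"
    unfolding induced_def by (simp add: Dd cD[THEN seq_eq_extend] zDt plus_assoc) (simp add: zt)
  also have "\<dots> = leibniz X (induced c) d \<bullet> beside ?z D [X]"
    by (simp add: leibniz_def assms) (simp add: induced_def)
  finally show ?thesis .
qed

text \<open>Deleting the second factor is not equivariant; it turns the induced action into the
  right-hand side of a chain rule.\<close>

lemma delete_induced:
  assumes "commuting P c"
  shows "beside (outs c) e [] \<bullet> induced c = c \<bullet> beside (outs c) d []"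
proof -
  note [simp] = commuting_sel[OF assms]
  let ?z = "outs c"
  have ed: "beside ?z e [] \<bullet> beside ?z d [] = none (?z @ [P, X]) ?z"
  proof -
    have "beside ?z (e \<bullet> d) [] = beside ?z (none [P, X] []) []" by (simp only: d_constant)
    then show ?thesis by simp
  qed
  have ce: "beside ?z e [] \<bullet> beside [] c [P] = c \<bullet> beside (?z @ [P]) e []"
    using interchange[of "[]" c "[]" e "[]"] by simp
  have "beside [P] e [] \<bullet> \<theta> = d"
    using cross_e[of X "[P]" "[]", THEN seq_eq_extend] counit(2)[of "[]" "[X]"] by (simp add: \<theta>_def slides)
  then have "beside ?z (beside [P] e [] \<bullet> \<theta>) [] = beside ?z d []" by simp
  then have et: "beside (?z @ [P]) e [] \<bullet> beside ?z \<theta> [] = beside ?z d []" by simp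
  show ?thesis
    by (simp add: induced_def ed ce[THEN seq_eq_extend] et)
qed

text \<open>The chain rule for a map \<open>h\<close>, with \<open>c\<close> in place of the deriving transformation.\<close>

definition chain :: "('o, 'm) diagram \<Rightarrow> ('o, 'm) diagram \<Rightarrow> bool" where
  "chain c h \<longleftrightarrow> h \<bullet> d = c \<bullet> (beside (outs h) d [] \<bullet> (beside [] h [P, X] \<bullet> beside [] D [X]))"

text \<open>Differentiating the graph \<open>(h \<otimes> P) \<circ> D\<close> by the product rule hits either the second copy or \<open>h\<close>. In the
  latter case the chain rule for \<open>h\<close> uses a third copy, and by coassociativity this copy may be taken
  from the second factor of the graph, which is what the induced action does.\<close>

lemma chain_graph_equivariant:
  assumes c: "commuting P c" and h: "good h" "ins h = [P]" "outs h = outs c" "chain c h"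
  shows "(beside [] h [P] \<bullet> D) \<bullet> d = induced c \<bullet> beside [] (beside [] h [P] \<bullet> D) [X]"
proof -
  note [simp] = commuting_sel[OF c] h(1-3)
  let ?z = "outs c" and ?k = "cross P X"
  have hd: "beside [] h [P] \<bullet> beside [] d [P]
    = beside [] c [P] \<bullet> (beside ?z d [P] \<bullet> (beside [] h [P, X, P] \<bullet> beside [] D [X, P]))"
  proof -
    have "beside [] (h \<bullet> d) [P] = beside [] (c \<bullet> (beside (outs h) d [] \<bullet> (beside [] h [P, X] \<bullet> beside [] D [X]))) [P]"
      using h(4) by (simp only: chain_def)
    then show ?thesis by simp
  qed
  have h1: "beside [] h [P] \<bullet> beside [P] d [] = beside ?z d [] \<bullet> beside [] h [P, X]"
    using interchange[of "[]" h "[]" d "[]"] by simp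
  have h2: "beside [] h [P, X, P] \<bullet> beside [P, P] ?k [] = beside (?z @ [P]) ?k [] \<bullet> beside [] h [P, P, X]"
    using interchange[of "[]" h "[P]" ?k "[]"] by simp
  have h3: "beside [] h [P, P, X] \<bullet> beside [P] D [X] = beside ?z D [X] \<bullet> beside [] h [P, X]"
    using interchange[of "[]" h "[]" D "[X]"] by simp
  have "(beside [] h [P] \<bullet> D) \<bullet> d = beside [] h [P] \<bullet> (beside [P] d [] \<bullet> beside [] D [X]) \<boxplus> beside [] h [P] \<bullet> \<theta>"
    using product_split[of "[]" "[]"] by simp
  also have "beside [] h [P] \<bullet> (beside [P] d [] \<bullet> beside [] D [X]) = beside ?z d [] \<bullet> (beside [] h [P, X] \<bullet> beside [] D [X])"
    by (simp add: h1[THEN seq_eq_extend])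
  also have "beside [] h [P] \<bullet> \<theta> = beside [] c [P] \<bullet> (beside ?z d [P] \<bullet> (beside [] h [P, X, P] \<bullet> (beside [P, P] ?k [] \<bullet> (beside [P] D [X] \<bullet> beside [] D [X]))))"
    using coassoc[of "[]" "[X]", symmetric] by (simp add: \<theta>_def hd[THEN seq_eq_extend] slides)
  also have "\<dots> = beside [] c [P] \<bullet> (beside ?z \<theta> [] \<bullet> (beside [] h [P, X] \<bullet> beside [] D [X]))"
    by (simp add: \<theta>_def h2[THEN seq_eq_extend] h3[THEN seq_eq_extend])
  finally show ?thesis
    by (simp add: induced_def)
qed

end

section \<open>Free commuting actions\<close>

context linear_symmetric_monoidal_category
begin

definition free_action :: "'o \<Rightarrow> 'o \<Rightarrow> 'o \<Rightarrow> 'm \<Rightarrow> 'm \<Rightarrow> bool" where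
  "free_action X A P i D \<longleftrightarrow> is_commuting_action C X P D \<and> i \<in> hom C A P \<and>
     (\<forall>B b f. is_commuting_action C X B b \<and> f \<in> hom C A B \<longrightarrow>
        (\<exists>!h. h \<in> hom C P B \<and> h \<cdot> i = f \<and> h \<cdot> D = b \<cdot> (h \<otimes> \<one>X)))"

lemma right_module_iff:
  assumes "rep r (s \<star> \<langle>M\<rangle>) s r'" "rep u Null \<langle>M\<rangle> u'" "rep m (\<langle>M\<rangle> \<star> \<langle>M\<rangle>) \<langle>M\<rangle> m'"
  shows "is_right_module C M u m (obj s) r \<longleftrightarrow>
    r' \<bullet> beside [] r' [M] = r' \<bullet> beside (word s) m' [] \<and> r' \<bullet> beside (word s) u' [] = wire (word s)"
proof -
  note [simp] = rep_simps[OF assms(1)] rep_simps[OF assms(2)] rep_simps[OF assms(3)]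
  have [simp]: "M \<in> Ob C" using rep_simps(2)[OF assms(2)] by simp
  have "rep (r \<cdot> (r \<otimes> \<one>M)) (s \<star> \<langle>M\<rangle> \<star> \<langle>M\<rangle>) s (r' \<bullet> beside [] r' [M])"
    by (rule rep_cong, (rule assms rep_rules | (simp; fail))+)
  moreover have "rep (r \<cdot> (\<one>(obj s) \<otimes> m) \<cdot> Assoc C (obj s) M M) (s \<star> \<langle>M\<rangle> \<star> \<langle>M\<rangle>) s (r' \<bullet> beside (word s) m' [])"
    by (rule rep_cong, (rule assms rep_rules | (simp; fail))+)
  moreover have "rep (r \<cdot> (\<one>(obj s) \<otimes> u)) (s \<star> Null) s (r' \<bullet> beside (word s) u' [])"
    by (rule rep_cong, (rule assms rep_rules | (simp; fail))+)
  moreover have "rep (RUnit C (obj s)) (s \<star> Null) s (wire (word s))"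
    by (rule rep_RUnit) simp_all
  ultimately show ?thesis
    unfolding is_right_module_def by (simp add: rep_eq_iff hom_iff)
qed

lemma module_restriction:
  assumes "is_iso_of_categories (Mod C M u m) (CAct C X) (restrict_ob C \<eta>) (restrict_arr C \<eta>)"
    and "is_right_module C M u m B r"
  shows "is_commuting_action C X B (r \<cdot> (\<one>B \<otimes> \<eta>))"
proof -
  have "bij_betw (restrict_ob C \<eta>) {(A, r). is_right_module C M u m A r} {(A, a). is_commuting_action C X A a}"
    using assms(1) by (simp add: is_iso_of_categories_def Mod_def CAct_def action_category_def)
  from bij_betwE[OF this] show ?thesis using assms(2) by (fastforce simp: restrict_ob_def)
qed

text \<open>Algebraic freeness makes the free module \<open>A \<otimes> SX\<close> on \<open>A\<close> the free commuting action on \<open>A\<close>.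
  The extension of \<open>f : A \<rightarrow> B\<close> is \<open>r \<circ> (f \<otimes> SX)\<close>, where \<open>r\<close> is the module structure that corresponds to
  the given action on \<open>B\<close>. It is unique because, by bijectivity on arrows, every equivariant map is a map
  of modules.\<close>

lemma free_action_tensor:
  assumes X [simp]: "X \<in> Ob C" and A [simp]: "A \<in> Ob C"
    and mon: "is_commutative_monoid C M u m" and eta: "\<eta> \<in> hom C X M"
    and iso: "is_iso_of_categories (Mod C M u m) (CAct C X) (restrict_ob C \<eta>) (restrict_arr C \<eta>)"
  shows "free_action X A (A \<boxtimes> M) ((\<one>A \<otimes> u) \<cdot> RUnit_inv C A) ((\<one>A \<otimes> (m \<cdot> (\<one>M \<otimes> \<eta>))) \<cdot> Assoc C A M X)"
proof -
  let ?Q = "A \<boxtimes> M" and ?s = "\<langle>A\<rangle> \<star> \<langle>M\<rangle>"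
  let ?i = "(\<one>A \<otimes> u) \<cdot> RUnit_inv C A" and ?D = "(\<one>A \<otimes> (m \<cdot> (\<one>M \<otimes> \<eta>))) \<cdot> Assoc C A M X"
  let ?q = "(\<one>A \<otimes> m) \<cdot> Assoc C A M M"
  have M [simp]: "M \<in> Ob C" and u: "u \<in> hom C \<I> M" and m: "m \<in> hom C (M \<boxtimes> M) M"
    using mon by (auto simp: is_commutative_monoid_def)
  obtain u' m' n' where ru: "rep u Null \<langle>M\<rangle> u'" and rm: "rep m (\<langle>M\<rangle> \<star> \<langle>M\<rangle>) \<langle>M\<rangle> m'" and rn: "rep \<eta> \<langle>X\<rangle> \<langle>M\<rangle> n'"
    using rep_exists[of u Null "\<langle>M\<rangle>"] rep_exists[of m "\<langle>M\<rangle> \<star> \<langle>M\<rangle>" "\<langle>M\<rangle>"] rep_exists[of \<eta> "\<langle>X\<rangle>" "\<langle>M\<rangle>"] u m eta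
    by auto
  note [simp] = rep_simps[OF ru] rep_simps[OF rm] rep_simps[OF rn]
  have m_assoc: "m' \<bullet> beside [] m' [M] = m' \<bullet> beside [M] m' []"
    and m_unit: "m' \<bullet> beside [] u' [M] = wire [M]" "m' \<bullet> beside [M] u' [] = wire [M]"
  proof -
    have "is_right_module C M u m (obj \<langle>M\<rangle>) m"
      using mon by (simp add: is_right_module_def is_commutative_monoid_def)
    then show "m' \<bullet> beside [] m' [M] = m' \<bullet> beside [M] m' []" "m' \<bullet> beside [M] u' [] = wire [M]"
      unfolding right_module_iff[OF rm ru rm] by simp_all
    have "rep (m \<cdot> (u \<otimes> \<one>M)) (Null \<star> \<langle>M\<rangle>) \<langle>M\<rangle> (m' \<bullet> beside [] u' [M])"
      by (rule rep_cong, (rule ru rm rep_rules | (simp; fail))+)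
    moreover have "rep (LUnit C M) (Null \<star> \<langle>M\<rangle>) \<langle>M\<rangle> (wire [M])"
      by (rule rep_cong, rule rep_LUnit) simp_all
    moreover have "m \<cdot> (u \<otimes> \<one>M) = LUnit C M"
      using mon by (simp add: is_commutative_monoid_def)
    ultimately show "m' \<bullet> beside [] u' [M] = wire [M]"
      using rep_unique by metis
  qed
  let ?q' = "beside [A] m' []"
  have rq: "rep ?q (?s \<star> \<langle>M\<rangle>) ?s ?q'"
    by (rule rep_cong, (rule rm rep_rules | (simp; fail))+)
  have qmod: "is_right_module C M u m ?Q ?q"
  proof -
    have 1: "beside [A] (m' \<bullet> beside [] m' [M]) [] = beside [A] (m' \<bullet> beside [M] m' []) []"
      "beside [A] (m' \<bullet> beside [M] u' []) [] = beside [A] (wire [M]) []"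
      by (simp_all only: m_assoc m_unit)
    show ?thesis using right_module_iff[OF rq ru rm] 1 by simp
  qed
  have ob: "bij_betw (restrict_ob C \<eta>) {(A, r). is_right_module C M u m A r} {(A, a). is_commuting_action C X A a}"
    using iso by (simp add: is_iso_of_categories_def Mod_def CAct_def action_category_def)
  have ar: "restrict_arr C \<eta> ` Arr (Mod C M u m) = Arr (CAct C X)"
    using iso by (auto simp: is_iso_of_categories_def bij_betw_def)
  have ri: "rep ?i \<langle>A\<rangle> ?s (beside [A] u' [])"
    by (rule rep_cong, (rule ru rep_rules | (simp; fail))+)
  have qD: "?q \<cdot> (\<one>?Q \<otimes> \<eta>) = ?D"
  proof (rule rep_faithful)
    show "rep (?q \<cdot> (\<one>?Q \<otimes> \<eta>)) (?s \<star> \<langle>X\<rangle>) ?s (?q' \<bullet> beside [A, M] n' [])"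
      by (rule rep_cong, (rule rq rn rep_rules | (simp; fail))+)
    show "rep ?D (?s \<star> \<langle>X\<rangle>) ?s (?q' \<bullet> beside [A, M] n' [])"
      by (rule rep_cong, (rule rm rn rep_rules | (simp; fail))+)
  qed
  have act: "is_commuting_action C X ?Q ?D"
    using module_restriction[OF iso qmod] by (simp only: qD)
  have ex1: "\<exists>!h. h \<in> hom C ?Q B \<and> h \<cdot> ?i = f \<and> h \<cdot> ?D = b \<cdot> (h \<otimes> \<one>X)"
    if b: "is_commuting_action C X B b" and f: "f \<in> hom C A B" for B b f
  proof -
    have B [simp]: "B \<in> Ob C" using f hom_Ob by auto
    have "(B, b) \<in> restrict_ob C \<eta> ` {(A, r). is_right_module C M u m A r}"
      using bij_betw_imp_surj_on[OF ob] b by simp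
    then obtain r where r: "is_right_module C M u m B r" and rb: "r \<cdot> (\<one>B \<otimes> \<eta>) = b"
      by (auto simp: restrict_ob_def)
    obtain r' f' where rr: "rep r (\<langle>B\<rangle> \<star> \<langle>M\<rangle>) \<langle>B\<rangle> r'" and rf: "rep f \<langle>A\<rangle> \<langle>B\<rangle> f'"
      using rep_exists[of r "\<langle>B\<rangle> \<star> \<langle>M\<rangle>" "\<langle>B\<rangle>"] rep_exists[of f "\<langle>A\<rangle>" "\<langle>B\<rangle>"] r f
      by (auto simp: is_right_module_def)
    note [simp] = rep_simps[OF rr] rep_simps[OF rf]
    have r1: "r' \<bullet> beside [] r' [M] = r' \<bullet> beside [B] m' []" and r2: "r' \<bullet> beside [B] u' [] = wire [B]"
      using right_module_iff[OF rr ru rm] r by simp_all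
    have rbb: "rep b (\<langle>B\<rangle> \<star> \<langle>X\<rangle>) \<langle>B\<rangle> (r' \<bullet> beside [B] n' [])"
      unfolding rb[symmetric] by (rule rep_cong, (rule rr rn rep_rules | (simp; fail))+)
    let ?h = "r \<cdot> (f \<otimes> \<one>M)" and ?h' = "r' \<bullet> beside [] f' [M]"
    have rh: "rep ?h ?s \<langle>B\<rangle> ?h'"
      by (rule rep_cong, (rule rr rf rep_rules | (simp; fail))+)
    have uf: "beside [] f' [M] \<bullet> beside [A] u' [] = beside [B] u' [] \<bullet> f'"
      using interchange[of "[]" f' "[]" u' "[]"] by simp
    have hi: "?h \<cdot> ?i = f"
    proof (rule rep_faithful)
      show "rep (?h \<cdot> ?i) \<langle>A\<rangle> \<langle>B\<rangle> f'"
        using rep_Comp[OF ri rh] by (simp add: uf r2[THEN seq_eq_extend])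
    qed (rule rf)
    have rD: "rep ?D (?s \<star> \<langle>X\<rangle>) ?s (?q' \<bullet> beside [A, M] n' [])"
      by (rule rep_cong, (rule rm rn rep_rules | (simp; fail))+)
    have fm: "beside [] f' [M] \<bullet> beside [A] m' [] = beside [B] m' [] \<bullet> beside [] f' [M, M]"
      using interchange[of "[]" f' "[]" m' "[]"] by simp
    have rn': "beside [] r' [M] \<bullet> beside [B, M] n' [] = beside [B] n' [] \<bullet> beside [] r' [X]"
      using interchange[of "[]" r' "[]" n' "[]"] by simp
    have fn: "beside [] f' [M, M] \<bullet> beside [A, M] n' [] = beside [B, M] n' [] \<bullet> beside [] f' [M, X]"
      using interchange[of "[]" f' "[M]" n' "[]"] by simp
    have hD: "?h \<cdot> ?D = b \<cdot> (?h \<otimes> \<one>X)"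
      unfolding equivariant_iff[OF rh rD rbb]
      by (simp add: fm[THEN seq_eq_extend] r1[symmetric, THEN seq_eq_extend] fn rn'[THEN seq_eq_extend])
    have uniq: "g = ?h" if g: "g \<in> hom C ?Q B" "g \<cdot> ?i = f" "g \<cdot> ?D = b \<cdot> (g \<otimes> \<one>X)" for g
    proof -
      have "((?Q, ?D), g, (B, b)) \<in> Arr (CAct C X)"
        using g act b by (simp add: CAct_def action_category_def)
      then obtain q2 r2' where mod: "is_right_module C M u m ?Q q2" "is_right_module C M u m B r2'"
        and e: "q2 \<cdot> (\<one>?Q \<otimes> \<eta>) = ?D" "r2' \<cdot> (\<one>B \<otimes> \<eta>) = b" "g \<cdot> q2 = r2' \<cdot> (g \<otimes> \<one>M)"
        unfolding ar[symmetric] by (auto simp: restrict_arr_def restrict_ob_def Mod_def action_category_def)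
      have inj: "r1 = r2" if "is_right_module C M u m E r1" "is_right_module C M u m E r2"
        "r1 \<cdot> (\<one>E \<otimes> \<eta>) = r2 \<cdot> (\<one>E \<otimes> \<eta>)" for E r1 r2
        using inj_onD[OF bij_betw_imp_inj_on[OF ob], of "(E, r1)" "(E, r2)"] that by (simp add: restrict_ob_def)
      have "q2 = ?q" using inj[OF mod(1) qmod] e(1) qD by simp
      moreover have "r2' = r" using inj[OF mod(2) r] e(2) rb by simp
      ultimately have gq: "g \<cdot> ?q = r \<cdot> (g \<otimes> \<one>M)" using e(3) by simp
      obtain g' where rg: "rep g ?s \<langle>B\<rangle> g'" using rep_exists[of g ?s "\<langle>B\<rangle>"] g(1) by auto
      note [simp] = rep_simps[OF rg]
      have g1: "g' \<bullet> ?q' = r' \<bullet> beside [] g' [M]"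
        using gq unfolding equivariant_iff[OF rg rq rr] .
      have g2: "g' \<bullet> beside [A] u' [] = f'"
        using rep_unique[OF rep_Comp[OF ri rg]] rf g(2) by simp
      have mu: "?q' \<bullet> beside [A] u' [M] = wire [A, M]"
      proof -
        have "beside [A] (m' \<bullet> beside [] u' [M]) [] = beside [A] (wire [M]) []" by (simp only: m_unit)
        then show ?thesis by simp
      qed
      have "g' = g' \<bullet> (?q' \<bullet> beside [A] u' [M])"
        by (simp add: mu)
      also have "\<dots> = r' \<bullet> beside [] (g' \<bullet> beside [A] u' []) [M]"
        by (simp add: g1[THEN seq_eq_extend])
      finally have "g' = ?h'" by (simp only: g2)
      then show ?thesis using rep_faithful[OF rg] rh by simp
    qed
    have "?h \<in> hom C ?Q B" using rep_simps[OF rh] by (simp add: hom_iff)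
    with hi hD have ok: "?h \<in> hom C ?Q B \<and> ?h \<cdot> ?i = f \<and> ?h \<cdot> ?D = b \<cdot> (?h \<otimes> \<one>X)" by (intro conjI)
    show ?thesis
    proof (rule ex1I[where a = ?h], rule ok)
      fix g assume "g \<in> hom C ?Q B \<and> g \<cdot> ?i = f \<and> g \<cdot> ?D = b \<cdot> (g \<otimes> \<one>X)"
      then show "g = ?h" by (elim conjE) (rule uniq)
    qed
  qed
  have "?i \<in> hom C A ?Q" using rep_simps[OF ri] by (simp add: hom_iff)
  then show ?thesis unfolding free_action_def using act ex1 by blast
qed

end

locale free_commuting_action = linear_symmetric_monoidal_category C
  for C :: "('o, 'm, 'k :: {comm_semiring_0, comm_monoid_mult}, 'x) linear_smc_scheme" (structure) +
  fixes X A P :: 'o and i d :: "('o, 'm) diagram" and i0 d0 :: 'm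
  assumes biproducts: "has_finite_biproducts C"
    and free: "free_action X A P i0 d0"
    and i_rep: "rep i0 \<langle>A\<rangle> \<langle>P\<rangle> i"
    and action_rep: "rep d0 (\<langle>P\<rangle> \<star> \<langle>X\<rangle>) \<langle>P\<rangle> d"
begin

lemma free_sel [simp]:
  "A \<in> Ob C" "P \<in> Ob C" "X \<in> Ob C" "good i" "ins i = [A]" "outs i = [P]" "good d" "ins d = [P, X]" "outs d = [P]"
  using rep_simps[OF i_rep] rep_simps[OF action_rep] by auto

lemma action_commuting: "commuting X d"
  using free commuting_action_iff[OF action_rep] by (simp add: free_action_def)

lemma extend:
  assumes b: "rep b0 (t \<star> \<langle>X\<rangle>) t b" "commuting X b" and f: "rep f0 \<langle>A\<rangle> t f"
  shows "\<exists>h0 h. rep h0 \<langle>P\<rangle> t h \<and> h \<bullet> i = f \<and> h \<bullet> d = b \<bullet> beside [] h [X]"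
proof -
  have t: "objs (word t)" using rep_simps[OF f] by simp
  have "is_commuting_action C X (obj t) b0"
    using commuting_action_iff[OF b(1)] b(2) by simp
  moreover have "f0 \<in> hom C A (obj t)" using rep_simps[OF f] by (simp add: hom_iff)
  ultimately obtain h0 where h0: "h0 \<in> hom C P (obj t)" "h0 \<cdot> i0 = f0" "h0 \<cdot> d0 = b0 \<cdot> (h0 \<otimes> \<one>X)"
    using free unfolding free_action_def by blast
  obtain h where h: "rep h0 \<langle>P\<rangle> t h" using rep_exists[of h0 "\<langle>P\<rangle>" t] h0(1) t by auto
  have "h \<bullet> i = f" using rep_unique[OF rep_Comp[OF i_rep h]] h0(2) f by simp
  moreover have "h \<bullet> d = b \<bullet> beside [] h [X]"
    using h0(3) equivariant_iff[OF h action_rep b(1)] by simp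
  ultimately show ?thesis using h by blast
qed

lemma equivariant_unique:
  assumes b: "rep b0 (t \<star> \<langle>X\<rangle>) t b" "commuting X b"
    and h: "rep h0 \<langle>P\<rangle> t h" "h \<bullet> d = b \<bullet> beside [] h [X]"
    and k: "rep k0 \<langle>P\<rangle> t k" "k \<bullet> d = b \<bullet> beside [] k [X]"
    and hk: "h \<bullet> i = k \<bullet> i"
  shows "h = k"
proof -
  have act: "is_commuting_action C X (obj t) b0"
    using commuting_action_iff[OF b(1)] b(2) by simp
  have hh: "h0 \<in> hom C P (obj t)" "k0 \<in> hom C P (obj t)" "h0 \<cdot> i0 \<in> hom C A (obj t)"
    using rep_simps[OF h(1)] rep_simps[OF k(1)] rep_simps[OF i_rep] by (simp_all add: hom_iff)
  have e: "h0 \<cdot> i0 = k0 \<cdot> i0"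
    using rep_eq_iff[OF rep_Comp[OF i_rep h(1)] rep_Comp[OF i_rep k(1)]] hk by simp
  have eq: "h0 \<cdot> d0 = b0 \<cdot> (h0 \<otimes> \<one>X)" "k0 \<cdot> d0 = b0 \<cdot> (k0 \<otimes> \<one>X)"
    using equivariant_iff[OF h(1) action_rep b(1)] h(2) equivariant_iff[OF k(1) action_rep b(1)] k(2) by simp_all
  have "h0 = k0"
    using free act hh e eq unfolding free_action_def by metis
  then show ?thesis using rep_unique h(1) k(1) by metis
qed

text \<open>The biproduct equations on which the proof of \<open>recursion\<close> relies, drawn as diagrams.\<close>

lemma biproduct_diagrams:
  assumes "objs (word t)"
  obtains B p1' p2' j1' j2' p1 p2 j1 j2 where "B \<in> Ob C"
    "rep p1' \<langle>B\<rangle> t p1" "rep p2' \<langle>B\<rangle> \<langle>P\<rangle> p2" "rep j1' t \<langle>B\<rangle> j1" "rep j2' \<langle>P\<rangle> \<langle>B\<rangle> j2"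
    "p1 \<bullet> j1 = wire (word t)" "p2 \<bullet> j2 = wire [P]" "p1 \<bullet> j2 = none [P] (word t)" "p2 \<bullet> j1 = none (word t) [P]"
proof -
  obtain B p1' p2' j1' j2' where bp: "is_biproduct C (obj t) P B p1' p2' j1' j2'"
    using biproducts assms unfolding has_finite_biproducts_def by (metis free_sel(2) obj_Ob)
  then have h: "p1' \<in> hom C B (obj t)" "p2' \<in> hom C B P" "j1' \<in> hom C (obj t) B" "j2' \<in> hom C P B"
    by (auto simp: is_biproduct_def)
  then have B: "B \<in> Ob C" using hom_Ob by auto
  obtain p1 p2 j1 j2 where r: "rep p1' \<langle>B\<rangle> t p1" "rep p2' \<langle>B\<rangle> \<langle>P\<rangle> p2" "rep j1' t \<langle>B\<rangle> j1" "rep j2' \<langle>P\<rangle> \<langle>B\<rangle> j2"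
    using rep_exists[of p1' "\<langle>B\<rangle>" t] rep_exists[of p2' "\<langle>B\<rangle>" "\<langle>P\<rangle>"] rep_exists[of j1' t "\<langle>B\<rangle>"]
      rep_exists[of j2' "\<langle>P\<rangle>" "\<langle>B\<rangle>"] h B assms by auto
  have "p1 \<bullet> j1 = wire (word t)"
    using rep_unique[OF rep_Comp[OF r(3) r(1)]] rep_Ident[of t "obj t"] assms bp by (simp add: is_biproduct_def)
  moreover have "p2 \<bullet> j2 = wire [P]"
    using rep_unique[OF rep_Comp[OF r(4) r(2)]] rep_Ident[of "\<langle>P\<rangle>" P] bp by (simp add: is_biproduct_def)
  moreover have "p1 \<bullet> j2 = none [P] (word t)"
    using rep_unique[OF rep_Comp[OF r(4) r(1)]] rep_Zero[of "\<langle>P\<rangle>" t P "obj t"] assms bp by (simp add: is_biproduct_def)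
  moreover have "p2 \<bullet> j1 = none (word t) [P]"
    using rep_unique[OF rep_Comp[OF r(3) r(2)]] rep_Zero[of t "\<langle>P\<rangle>" "obj t" P] assms bp by (simp add: is_biproduct_def)
  ultimately show thesis using that B r by blast
qed

text \<open>Primitive recursion: here \<open>h \<circ> d\<close> is prescribed outright, whereas freeness is an iteration principle.
  As for natural numbers, the pair of \<open>h\<close> and the identity is defined by iteration, with values in a
  biproduct. Symmetry of \<open>g\<close> is what makes the action on the biproduct commute.\<close>

lemma recursion:
  assumes g: "rep g0 (\<langle>P\<rangle> \<star> \<langle>X\<rangle>) t g"
    and sym: "g \<bullet> (beside [] d [X] \<bullet> beside [P] (cross X X) []) = g \<bullet> beside [] d [X]"
  shows recursion_exists: "rep f0 \<langle>A\<rangle> t f \<Longrightarrow> \<exists>h0 h. rep h0 \<langle>P\<rangle> t h \<and> h \<bullet> i = f \<and> h \<bullet> d = g"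
    and recursion_unique: "rep h0 \<langle>P\<rangle> t h \<Longrightarrow> rep k0 \<langle>P\<rangle> t k \<Longrightarrow> h \<bullet> i = k \<bullet> i \<Longrightarrow> h \<bullet> d = g \<Longrightarrow> k \<bullet> d = g \<Longrightarrow> h = k"
proof -
  note [simp] = rep_simps[OF g]
  have t: "objs (word t)" using rep_simps(2)[OF g] .
  obtain B p1' p2' j1' j2' p1 p2 j1 j2 where B [simp]: "B \<in> Ob C" and
    r: "rep p1' \<langle>B\<rangle> t p1" "rep p2' \<langle>B\<rangle> \<langle>P\<rangle> p2" "rep j1' t \<langle>B\<rangle> j1" "rep j2' \<langle>P\<rangle> \<langle>B\<rangle> j2" and
    e: "p1 \<bullet> j1 = wire (word t)" "p2 \<bullet> j2 = wire [P]" "p1 \<bullet> j2 = none [P] (word t)" "p2 \<bullet> j1 = none (word t) [P]"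
    using biproduct_diagrams[OF t] by metis
  note [simp] = rep_simps[OF r(1)] rep_simps[OF r(2)] rep_simps[OF r(3)] rep_simps[OF r(4)]
    e e[THEN seq_eq_extend]
  \<comment> \<open>The action on the biproduct acts by \<open>d\<close> on the second summand and writes \<open>g\<close> into the first.\<close>
  let ?k = "j1 \<bullet> g \<boxplus> j2 \<bullet> d"
  let ?b = "?k \<bullet> beside [] p2 [X]"
  have rk: "rep (j1' \<cdot> g0 \<oplus> j2' \<cdot> d0) (\<langle>P\<rangle> \<star> \<langle>X\<rangle>) \<langle>B\<rangle> ?k"
    by (rule rep_Add[OF rep_Comp[OF g r(3)] rep_Comp[OF action_rep r(4)]])
  have rb: "rep ((j1' \<cdot> g0 \<oplus> j2' \<cdot> d0) \<cdot> (p2' \<otimes> \<one>X)) (\<langle>B\<rangle> \<star> \<langle>X\<rangle>) \<langle>B\<rangle> ?b"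
    by (rule rep_cong, (rule rk r(2) rep_rules | (simp; fail))+)
  have dsym: "d \<bullet> (beside [] d [X] \<bullet> beside [P] (cross X X) []) = d \<bullet> beside [] d [X]"
    using action_commuting by (simp add: commuting_def)
  have p2k: "p2 \<bullet> ?k = d" by simp
  have sl: "beside [] p2 [X, X] \<bullet> beside [B] (cross X X) [] = beside [P] (cross X X) [] \<bullet> beside [] p2 [X, X]"
    using interchange[of "[]" p2 "[]" "cross X X" "[]"] by simp
  have bb: "?b \<bullet> beside [] ?b [X] = ?k \<bullet> (beside [] d [X] \<bullet> beside [] p2 [X, X])"
  proof -
    have "?b \<bullet> beside [] ?b [X] = ?k \<bullet> (beside [] (p2 \<bullet> ?k) [X] \<bullet> beside [] p2 [X, X])"
      by (simp only: seq_assoc beside_seq beside_beside append_Nil append_Cons)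
    then show ?thesis by (simp only: p2k)
  qed
  have cb: "commuting X ?b"
  proof -
    have ksym: "?k \<bullet> (beside [] d [X] \<bullet> beside [P] (cross X X) []) = ?k \<bullet> beside [] d [X]"
      by (simp add: sym dsym)
    have "?b \<bullet> (beside [] ?b [X] \<bullet> beside [B] (cross X X) [])
      = (?k \<bullet> (beside [] d [X] \<bullet> beside [P] (cross X X) [])) \<bullet> beside [] p2 [X, X]"
      using bb by (simp only: seq_assoc[symmetric]) (simp only: seq_assoc sl)
    also have "\<dots> = ?b \<bullet> beside [] ?b [X]"
      unfolding ksym bb by (simp only: seq_assoc)
    finally show ?thesis by (simp add: commuting_def)
  qed
  {
    fix h0 h assume h: "rep h0 \<langle>P\<rangle> t h" "h \<bullet> d = g"
    note [simp] = rep_simps[OF h(1)]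
    let ?H = "j1 \<bullet> h \<boxplus> j2"
    have p2H: "p2 \<bullet> ?H = wire [P]" by simp
    have "?b \<bullet> beside [] ?H [X] = ?k \<bullet> beside [] (p2 \<bullet> ?H) [X]"
      by (simp only: seq_assoc beside_seq)
    then have "?H \<bullet> d = ?b \<bullet> beside [] ?H [X]"
      unfolding p2H by (simp add: h(2))
    moreover have "rep (j1' \<cdot> h0 \<oplus> j2') \<langle>P\<rangle> \<langle>B\<rangle> ?H"
      by (rule rep_Add[OF rep_Comp[OF h(1) r(3)] r(4)])
    ultimately have "\<exists>H0. rep H0 \<langle>P\<rangle> \<langle>B\<rangle> ?H \<and> ?H \<bullet> d = ?b \<bullet> beside [] ?H [X]" by blast
  } note graph = this
  show "h = k" if h: "rep h0 \<langle>P\<rangle> t h" and k: "rep k0 \<langle>P\<rangle> t k" and hk: "h \<bullet> i = k \<bullet> i" "h \<bullet> d = g" "k \<bullet> d = g"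
  proof -
    note [simp] = rep_simps[OF h] rep_simps[OF k]
    have "j1 \<bullet> h \<boxplus> j2 = j1 \<bullet> k \<boxplus> j2"
    proof -
      from graph[OF h hk(2)] graph[OF k hk(3)] obtain H0 K0 where
        H: "rep H0 \<langle>P\<rangle> \<langle>B\<rangle> (j1 \<bullet> h \<boxplus> j2)" "(j1 \<bullet> h \<boxplus> j2) \<bullet> d = ?b \<bullet> beside [] (j1 \<bullet> h \<boxplus> j2) [X]" and
        K: "rep K0 \<langle>P\<rangle> \<langle>B\<rangle> (j1 \<bullet> k \<boxplus> j2)" "(j1 \<bullet> k \<boxplus> j2) \<bullet> d = ?b \<bullet> beside [] (j1 \<bullet> k \<boxplus> j2) [X]"
        by (elim exE conjE)
      show ?thesis
        by (rule equivariant_unique[OF rb cb H K]) (simp add: hk(1))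
    qed
    then have "p1 \<bullet> (j1 \<bullet> h \<boxplus> j2) = p1 \<bullet> (j1 \<bullet> k \<boxplus> j2)" by simp
    then show ?thesis by simp
  qed
  show "\<exists>h0 h. rep h0 \<langle>P\<rangle> t h \<and> h \<bullet> i = f \<and> h \<bullet> d = g" if f: "rep f0 \<langle>A\<rangle> t f"
  proof -
    note [simp] = rep_simps[OF f]
    have "rep (j1' \<cdot> f0 \<oplus> j2' \<cdot> i0) \<langle>A\<rangle> \<langle>B\<rangle> (j1 \<bullet> f \<boxplus> j2 \<bullet> i)"
      by (rule rep_Add[OF rep_Comp[OF f r(3)] rep_Comp[OF i_rep r(4)]])
    from extend[OF rb cb this] obtain H0 H where H: "rep H0 \<langle>P\<rangle> \<langle>B\<rangle> H" "H \<bullet> i = j1 \<bullet> f \<boxplus> j2 \<bullet> i"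
      "H \<bullet> d = ?b \<bullet> beside [] H [X]" by blast
    note [simp] = rep_simps[OF H(1)]
    have "p2 \<bullet> H = wire [P]"
    proof (rule equivariant_unique[OF action_rep action_commuting])
      show "rep (p2' \<cdot> H0) \<langle>P\<rangle> \<langle>P\<rangle> (p2 \<bullet> H)" by (rule rep_Comp[OF H(1) r(2)])
      show "rep (\<one>P) \<langle>P\<rangle> \<langle>P\<rangle> (wire [P])" using rep_Ident[of "\<langle>P\<rangle>" P] by simp
    qed (simp_all add: H)
    then have HX: "beside [] p2 [X] \<bullet> beside [] H [X] = wire [P, X]"
      using beside_seq[of "[]" p2 H "[X]"] by simp
    have "rep (p1' \<cdot> H0) \<langle>P\<rangle> t (p1 \<bullet> H)" by (rule rep_Comp[OF H(1) r(1)])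
    moreover have "(p1 \<bullet> H) \<bullet> i = f" by (simp add: H)
    moreover have "(p1 \<bullet> H) \<bullet> d = g" by (simp add: H HX)
    ultimately show ?thesis by blast
  qed
qed

text \<open>Two maps that agree after composition with \<open>i\<close> and \<open>d\<close> solve the same primitive recursion.\<close>

lemma joint_epi:
  assumes h: "rep h0 \<langle>P\<rangle> t h" and k: "rep k0 \<langle>P\<rangle> t k" and hk: "h \<bullet> i = k \<bullet> i" "h \<bullet> d = k \<bullet> d"
  shows "h = k"
proof (rule recursion_unique[OF _ _ h k hk(1) refl hk(2)[symmetric]])
  note [simp] = rep_simps[OF h]
  show "rep (h0 \<cdot> d0) (\<langle>P\<rangle> \<star> \<langle>X\<rangle>) t (h \<bullet> d)" by (rule rep_Comp[OF action_rep h])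
  show "(h \<bullet> d) \<bullet> (beside [] d [X] \<bullet> beside [P] (cross X X) []) = (h \<bullet> d) \<bullet> beside [] d [X]"
    using action_commuting by (simp add: commuting_def)
qed

end

section \<open>The comonoid structure on a free commuting action\<close>

context linear_symmetric_monoidal_category
begin

lemma leibniz_equivariant:
  assumes f: "rep f0 s t f" and g: "rep g0 u v g"
    and a: "commuting X a" "outs a = word s" and a': "commuting X a'" "outs a' = word t"
    and b: "commuting X b" "outs b = word u" and b': "commuting X b'" "outs b' = word v"
    and fa: "f \<bullet> a = a' \<bullet> beside [] f [X]" and gb: "g \<bullet> b = b' \<bullet> beside [] g [X]"
  shows "beside [] f (word v) \<bullet> (beside (word s) g [] \<bullet> leibniz X a b)
    = leibniz X a' b' \<bullet> (beside [] f (word v @ [X]) \<bullet> beside (word s) g [X])"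
proof -
  note [simp] = rep_simps[OF f] rep_simps[OF g] commuting_sel[OF a(1)] a(2) commuting_sel[OF b(1)] b(2)
  have "rep (\<one>X) \<langle>X\<rangle> \<langle>X\<rangle> (wire [X])" using rep_Ident[of "\<langle>X\<rangle>" X] by simp
  from leibniz_natural[OF f g this a a' b b'] fa gb show ?thesis by simp
qed

end

context free_commuting_action
begin

text \<open>Equivariance of the counit for the zero action on the unit object is the constant rule, and
  equivariance of the comultiplication for the Leibniz action is the product rule. Both maps are therefore
  extensions given by freeness, and both sides of each comonoid law are equivariant maps that agree on
  the generators because the law holds in \<open>A\<close>.\<close>

lemma comonoid_extension:
  assumes base: "comonoid A eA DA"
  obtains e0 D0 e D where "rep e0 \<langle>P\<rangle> Null e" "rep D0 \<langle>P\<rangle> (\<langle>P\<rangle> \<star> \<langle>P\<rangle>) D" "e \<bullet> i = eA"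
    "D \<bullet> i = beside [] i [P] \<bullet> (beside [A] i [] \<bullet> DA)" "differential_comonoid C X P e D d d0"
proof -
  note [simp] = comonoid_sel[OF base]
  obtain eA0 DA0 where rA: "rep eA0 \<langle>A\<rangle> Null eA" "rep DA0 \<langle>A\<rangle> (\<langle>A\<rangle> \<star> \<langle>A\<rangle>) DA"
    using base by (auto simp: comonoid_def)
  have Acoassoc: "beside [] DA [A] \<bullet> DA = beside [A] DA [] \<bullet> DA" and Acounit: "beside [] eA [A] \<bullet> DA = wire [A]"
    and Acocomm: "cross A A \<bullet> DA = DA"
    using base by (simp_all add: comonoid_def)
  note c = action_commuting
  have cdd: "commuting X (leibniz X d d)"
    by (rule commuting_leibniz[OF c c action_rep])
  have rdd: "rep (leibniz_arrow X P d0 P d0) (\<langle>P\<rangle> \<star> \<langle>P\<rangle> \<star> \<langle>X\<rangle>) (\<langle>P\<rangle> \<star> \<langle>P\<rangle>) (leibniz X d d)"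
    by (rule rep_leibniz[OF action_rep action_rep]) simp_all
  have rddd: "rep (leibniz_arrow X (P \<boxtimes> P) (leibniz_arrow X P d0 P d0) P d0) (\<langle>P\<rangle> \<star> \<langle>P\<rangle> \<star> \<langle>P\<rangle> \<star> \<langle>X\<rangle>) (\<langle>P\<rangle> \<star> \<langle>P\<rangle> \<star> \<langle>P\<rangle>) (leibniz X (leibniz X d d) d)"
    by (rule rep_leibniz[OF rdd action_rep]) simp_all
  have cddd: "commuting X (leibniz X (leibniz X d d) d)"
    by (rule commuting_leibniz[OF cdd c action_rep])
  have rone: "rep (\<one>P) \<langle>P\<rangle> \<langle>P\<rangle> (wire [P])" using rep_Ident[of "\<langle>P\<rangle>" P] by simp
  have rnone: "rep (Zero C (\<I> \<boxtimes> X) \<I>) (Null \<star> \<langle>X\<rangle>) Null (none [X] [])"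
    using rep_Zero[of "Null \<star> \<langle>X\<rangle>" Null] by simp
  obtain e0 e where e: "rep e0 \<langle>P\<rangle> Null e" "e \<bullet> i = eA" "e \<bullet> d = none [X] [] \<bullet> beside [] e [X]"
    using extend[OF rnone _ rA(1)] by auto
  note [simp] = rep_simps[OF e(1)]
  have "rep ((i0 \<otimes> i0) \<cdot> DA0) \<langle>A\<rangle> (\<langle>P\<rangle> \<star> \<langle>P\<rangle>) (beside [] i [P] \<bullet> (beside [A] i [] \<bullet> DA))"
    by (rule rep_cong, (rule i_rep rA rep_rules | (simp; fail))+)
  from extend[OF rdd cdd this] obtain D0 D where D: "rep D0 \<langle>P\<rangle> (\<langle>P\<rangle> \<star> \<langle>P\<rangle>) D"
    "D \<bullet> i = beside [] i [P] \<bullet> (beside [A] i [] \<bullet> DA)" "D \<bullet> d = leibniz X d d \<bullet> beside [] D [X]"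
    by blast
  note [simp] = rep_simps[OF D(1)] leibniz_sel[OF c c] leibniz_sel[OF cdd c]
  have iA: "beside [] D [P] \<bullet> (beside [] i [P] \<bullet> F) = beside [] i [P, P] \<bullet> (beside [A] i [P] \<bullet> (beside [] DA [P] \<bullet> F))"
    "beside [A] D [] \<bullet> (beside [A] i [] \<bullet> F) = beside [A] i [P] \<bullet> (beside [A, A] i [] \<bullet> (beside [A] DA [] \<bullet> F))"
    "beside [] e [P] \<bullet> (beside [] i [P] \<bullet> F) = beside [] eA [P] \<bullet> F" for F
  proof -
    have "beside [] (D \<bullet> i) [P] = beside [] (beside [] i [P] \<bullet> (beside [A] i [] \<bullet> DA)) [P]" by (simp only: D)
    then have "beside [] D [P] \<bullet> beside [] i [P] = beside [] i [P, P] \<bullet> (beside [A] i [P] \<bullet> beside [] DA [P])" by simp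
    from this[THEN seq_eq_extend] show "beside [] D [P] \<bullet> (beside [] i [P] \<bullet> F) = beside [] i [P, P] \<bullet> (beside [A] i [P] \<bullet> (beside [] DA [P] \<bullet> F))" by simp
    have "beside [A] (D \<bullet> i) [] = beside [A] (beside [] i [P] \<bullet> (beside [A] i [] \<bullet> DA)) []" by (simp only: D)
    then have "beside [A] D [] \<bullet> beside [A] i [] = beside [A] i [P] \<bullet> (beside [A, A] i [] \<bullet> beside [A] DA [])" by simp
    from this[THEN seq_eq_extend] show "beside [A] D [] \<bullet> (beside [A] i [] \<bullet> F) = beside [A] i [P] \<bullet> (beside [A, A] i [] \<bullet> (beside [A] DA [] \<bullet> F))" by simp
    have "beside [] (e \<bullet> i) [P] = beside [] eA [P]" by (simp only: e)
    then have "beside [] e [P] \<bullet> beside [] i [P] = beside [] eA [P]" by simp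
    from this[THEN seq_eq_extend] show "beside [] e [P] \<bullet> (beside [] i [P] \<bullet> F) = beside [] eA [P] \<bullet> F" .
  qed
  have coassoc: "beside [] D [P] \<bullet> D = beside [P] D [] \<bullet> D"
  proof (rule equivariant_unique[OF rddd cddd])
    show "rep ((D0 \<otimes> \<one>P) \<cdot> D0) \<langle>P\<rangle> (\<langle>P\<rangle> \<star> \<langle>P\<rangle> \<star> \<langle>P\<rangle>) (beside [] D [P] \<bullet> D)"
      by (rule rep_cong, (rule D rep_rules | (simp; fail))+)
    show "rep (Assoc_inv C P P P \<cdot> (\<one>P \<otimes> D0) \<cdot> D0) \<langle>P\<rangle> (\<langle>P\<rangle> \<star> \<langle>P\<rangle> \<star> \<langle>P\<rangle>) (beside [P] D [] \<bullet> D)"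
      by (rule rep_cong, (rule D rep_rules | (simp; fail))+)
    show "(beside [] D [P] \<bullet> D) \<bullet> d = leibniz X (leibniz X d d) d \<bullet> beside [] (beside [] D [P] \<bullet> D) [X]"
    proof -
      have "beside [] D [P] \<bullet> leibniz X d d = leibniz X (leibniz X d d) d \<bullet> beside [] D [P, X]"
        using leibniz_equivariant[OF D(1) rone c _ cdd _ c _ c] D(3) by simp
      from this[THEN seq_eq_extend] show ?thesis
        by (simp add: D(3))
    qed
    show "(beside [P] D [] \<bullet> D) \<bullet> d = leibniz X (leibniz X d d) d \<bullet> beside [] (beside [P] D [] \<bullet> D) [X]"
    proof -
      have "beside [P] D [] \<bullet> leibniz X d d = leibniz X d (leibniz X d d) \<bullet> beside [P] D [X]"
        using leibniz_equivariant[OF rone D(1) c _ c _ c _ cdd] D(3) by simp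
      from this[THEN seq_eq_extend] show ?thesis
        by (simp add: D(3) leibniz_assoc[OF c c c])
    qed
    show "(beside [] D [P] \<bullet> D) \<bullet> i = (beside [P] D [] \<bullet> D) \<bullet> i"
      by (simp add: D(2) iA slides Acoassoc[symmetric])
  qed
  have counit: "beside [] e [P] \<bullet> D = wire [P]"
  proof (rule equivariant_unique[OF action_rep c])
    show "rep (LUnit C P \<cdot> (e0 \<otimes> \<one>P) \<cdot> D0) \<langle>P\<rangle> \<langle>P\<rangle> (beside [] e [P] \<bullet> D)"
      by (rule rep_cong, (rule D e rep_rules | (simp; fail))+)
    show "(beside [] e [P] \<bullet> D) \<bullet> d = d \<bullet> beside [] (beside [] e [P] \<bullet> D) [X]"
    proof -
      have "beside [] e [P] \<bullet> leibniz X d d = d \<bullet> beside [] e [P, X]"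
        using leibniz_equivariant[OF e(1) rone c _ commuting_none _ c _ c] e(3) by (simp add: c)
      from this[THEN seq_eq_extend] show ?thesis
        by (simp add: D(3))
    qed
    show "(beside [] e [P] \<bullet> D) \<bullet> i = wire [P] \<bullet> i"
      using interchange[of "[]" eA "[]" i "[]", THEN seq_eq_extend] by (simp add: D(2) iA Acounit)
    show "rep (\<one>P) \<langle>P\<rangle> \<langle>P\<rangle> (wire [P])" by (rule rone)
  qed simp
  have cocomm: "cross P P \<bullet> D = D"
  proof (rule equivariant_unique[OF rdd cdd])
    show "rep (Sym C P P \<cdot> D0) \<langle>P\<rangle> (\<langle>P\<rangle> \<star> \<langle>P\<rangle>) (cross P P \<bullet> D)"
      by (rule rep_cong, (rule D rep_cross rep_rules | (simp; fail))+)
    show "(cross P P \<bullet> D) \<bullet> d = leibniz X d d \<bullet> beside [] (cross P P \<bullet> D) [X]"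
      using leibniz_cross[OF action_rep action_rep, THEN seq_eq_extend] by (simp add: D)
    show "rep D0 \<langle>P\<rangle> (\<langle>P\<rangle> \<star> \<langle>P\<rangle>) D" "D \<bullet> d = leibniz X d d \<bullet> beside [] D [X]" by (rule D)+
    have ci: "cross P P \<bullet> beside [] i [P] = beside [P] i [] \<bullet> cross A P"
      using pull_natural[OF i_rep, of P] by simp
    have ic: "cross A P \<bullet> beside [A] i [] = beside [] i [A] \<bullet> cross A A"
      using push_natural[OF i_rep, of A] by simp
    show "(cross P P \<bullet> D) \<bullet> i = D \<bullet> i"
      by (simp add: D(2) ci[THEN seq_eq_extend] ic[THEN seq_eq_extend] Acocomm slides)
  qed
  have "beside [P] e [] \<bullet> cross P P = beside [] e [P]"
    using pull_natural[OF e(1), of P] by simp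
  then have "beside [P] e [] \<bullet> (cross P P \<bullet> D) = beside [] e [P] \<bullet> D"
    by (rule seq_eq_extend)
  then have counit': "beside [P] e [] \<bullet> D = wire [P]"
    by (simp only: cocomm counit)
  have "comonoid P e D"
    unfolding comonoid_def using e(1) D(1) coassoc counit counit' cocomm by blast
  moreover have "e \<bullet> d = none [P, X] []"
    by (simp add: e(3))
  ultimately have "differential_comonoid C X P e D d d0"
    using action_rep c D(3) by unfold_locales
  then show thesis using that e D by blast
qed

end

locale free_differential_comonoid =
  free_commuting_action C X A P i d i0 d0 + differential_comonoid C X P e D d d0
  for C :: "('o, 'm, 'k :: {comm_semiring_0, comm_monoid_mult}, 'x) linear_smc_scheme" (structure)
    and X A P i d i0 d0 e D +
  fixes eA DA :: "('o, 'm) diagram"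
  assumes base: "comonoid A eA DA"
    and e_base: "e \<bullet> i = eA"
    and D_base: "D \<bullet> i = beside [] i [P] \<bullet> (beside [A] i [] \<bullet> DA)"
begin

lemma base_sel [simp]: "good eA" "ins eA = [A]" "outs eA = []" "good DA" "ins DA = [A]" "outs DA = [A, A]"
  using comonoid_sel[OF base] by auto

text \<open>A solution of the chain rule with prescribed restriction along \<open>i\<close> is recovered, by deleting
  the second factor, from its graph \<open>(h \<otimes> P) \<circ> D\<close>. The graph is equivariant for the induced action,
  so freeness determines it.\<close>

lemma chain_unique:
  assumes c: "rep c0 (z \<star> \<langle>P\<rangle>) z c" "commuting P c"
    and h: "rep h0 \<langle>P\<rangle> z h" "chain c h" and k: "rep k0 \<langle>P\<rangle> z k" "chain c k"
    and hk: "h \<bullet> i = k \<bullet> i"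
  shows "h = k"
proof -
  note [simp] = rep_simps[OF c(1)] rep_simps[OF h(1)] rep_simps[OF k(1)]
  obtain D0 where D0: "rep D0 \<langle>P\<rangle> (\<langle>P\<rangle> \<star> \<langle>P\<rangle>) D" using D_rep by auto
  obtain g0 where g0: "rep g0 (z \<star> \<langle>P\<rangle> \<star> \<langle>X\<rangle>) (z \<star> \<langle>P\<rangle>) (induced c)" using rep_induced[OF c(1)] by auto
  have graph_i: "(beside [] f [P] \<bullet> D) \<bullet> i = beside [] (f \<bullet> i) [P] \<bullet> (beside [A] i [] \<bullet> DA)" for f
    by (simp add: D_base)
  have "beside [] h [P] \<bullet> D = beside [] k [P] \<bullet> D"
  proof (rule equivariant_unique[OF g0 induced_commuting[OF c(2)]])
    show "rep ((h0 \<otimes> \<one>P) \<cdot> D0) \<langle>P\<rangle> (z \<star> \<langle>P\<rangle>) (beside [] h [P] \<bullet> D)"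
      by (rule rep_cong, (rule h k D0 rep_rules | (simp; fail))+)
    show "rep ((k0 \<otimes> \<one>P) \<cdot> D0) \<langle>P\<rangle> (z \<star> \<langle>P\<rangle>) (beside [] k [P] \<bullet> D)"
      by (rule rep_cong, (rule h k D0 rep_rules | (simp; fail))+)
    show "(beside [] h [P] \<bullet> D) \<bullet> d = induced c \<bullet> beside [] (beside [] h [P] \<bullet> D) [X]"
      by (rule chain_graph_equivariant[OF c(2)]) (simp_all add: h)
    show "(beside [] k [P] \<bullet> D) \<bullet> d = induced c \<bullet> beside [] (beside [] k [P] \<bullet> D) [X]"
      by (rule chain_graph_equivariant[OF c(2)]) (simp_all add: k)
    show "(beside [] h [P] \<bullet> D) \<bullet> i = (beside [] k [P] \<bullet> D) \<bullet> i"
      unfolding graph_i hk ..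
  qed
  moreover have "beside (word z) e [] \<bullet> (beside [] f [P] \<bullet> D) = f" if "rep f0 \<langle>P\<rangle> z f" for f0 f
  proof -
    note [simp] = rep_simps[OF that]
    have "beside (word z) e [] \<bullet> beside [] f [P] = beside [] f [] \<bullet> beside [P] e []"
      using interchange[of "[]" f "[]" e "[]"] by simp
    from this[THEN seq_eq_extend] show ?thesis using counit(2)[of "[]" "[]"] by simp
  qed
  ultimately show ?thesis using h(1) k(1) by metis
qed

text \<open>Freeness gives an equivariant map \<open>w\<close> that has the right restriction to be the graph of a solution. It
  is the graph of its first projection \<open>h\<close> because \<open>(Z \<otimes> D) \<circ> w\<close> and \<open>(w \<otimes> P) \<circ> D\<close> are equivariant for the same
  action (fact \<open>split\<close>), and deleting the middle factor of either then yields \<open>w\<close>. The chain rule for \<open>h\<close> is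
  what remains of the equivariance of \<open>w\<close> after the second factor is deleted.\<close>

lemma chain_exists:
  assumes c: "rep c0 (z \<star> \<langle>P\<rangle>) z c" "commuting P c" and f: "rep f0 \<langle>A\<rangle> z f"
  shows "\<exists>h0 h. rep h0 \<langle>P\<rangle> z h \<and> h \<bullet> i = f \<and> chain c h"
proof -
  let ?z = "word z"
  note [simp] = rep_simps[OF c(1)] rep_simps[OF f]
  have [simp]: "objs ?z" using rep_simps(2)[OF c(1)] .
  obtain e0 D0 where e0: "rep e0 \<langle>P\<rangle> Null e" and D0: "rep D0 \<langle>P\<rangle> (\<langle>P\<rangle> \<star> \<langle>P\<rangle>) D" using e_rep D_rep by auto
  obtain DA0 where DA0: "rep DA0 \<langle>A\<rangle> (\<langle>A\<rangle> \<star> \<langle>A\<rangle>) DA" using base by (auto simp: comonoid_def)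
  obtain g0 where g0: "rep g0 (z \<star> \<langle>P\<rangle> \<star> \<langle>X\<rangle>) (z \<star> \<langle>P\<rangle>) (induced c)" using rep_induced[OF c(1)] by auto
  note ci = induced_commuting[OF c(2)] and dd = d_commuting
  have "rep ((f0 \<otimes> i0) \<cdot> DA0) \<langle>A\<rangle> (z \<star> \<langle>P\<rangle>) (beside [] f [P] \<bullet> (beside [A] i [] \<bullet> DA))"
    by (rule rep_cong, (rule f i_rep DA0 rep_rules | (simp; fail))+)
  from extend[OF g0 ci this] obtain w0 w where w: "rep w0 \<langle>P\<rangle> (z \<star> \<langle>P\<rangle>) w"
    "w \<bullet> i = beside [] f [P] \<bullet> (beside [A] i [] \<bullet> DA)" "w \<bullet> d = induced c \<bullet> beside [] w [X]"
    by blast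
  note [simp] = rep_simps[OF w(1)] induced_sel[OF c(2)]
  let ?h = "beside ?z e [] \<bullet> w"
  have rh: "rep (RUnit C (obj z) \<cdot> (\<one>(obj z) \<otimes> e0) \<cdot> w0) \<langle>P\<rangle> z ?h"
    by (rule rep_cong, (rule w e0 rep_rules | (simp; fail))+)
  have rone: "rep (\<one>P) \<langle>P\<rangle> \<langle>P\<rangle> (wire [P])" using rep_Ident[of "\<langle>P\<rangle>" P] by simp
  have split: "beside ?z D [] \<bullet> w = beside [] w [P] \<bullet> D"
  proof (rule equivariant_unique)
    show "rep (leibniz_arrow X (obj (z \<star> \<langle>P\<rangle>)) g0 P d0) (z \<star> \<langle>P\<rangle> \<star> \<langle>P\<rangle> \<star> \<langle>X\<rangle>) (z \<star> \<langle>P\<rangle> \<star> \<langle>P\<rangle>) (leibniz X (induced c) d)"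
      by (rule rep_leibniz[OF g0 d_rep]) simp_all
    show "commuting X (leibniz X (induced c) d)"
      by (rule commuting_leibniz[OF ci dd d_rep])
    show "rep (Assoc_inv C (obj z) P P \<cdot> (\<one>(obj z) \<otimes> D0) \<cdot> w0) \<langle>P\<rangle> (z \<star> \<langle>P\<rangle> \<star> \<langle>P\<rangle>) (beside ?z D [] \<bullet> w)"
      by (rule rep_cong, (rule w D0 rep_rules | (simp; fail))+)
    show "rep ((w0 \<otimes> \<one>P) \<cdot> D0) \<langle>P\<rangle> (z \<star> \<langle>P\<rangle> \<star> \<langle>P\<rangle>) (beside [] w [P] \<bullet> D)"
      by (rule rep_cong, (rule w D0 rep_rules | (simp; fail))+)
    show "(beside ?z D [] \<bullet> w) \<bullet> d = leibniz X (induced c) d \<bullet> beside [] (beside ?z D [] \<bullet> w) [X]"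
      using duplicate_induced[OF c(2), THEN seq_eq_extend] by (simp add: w)
    show "(beside [] w [P] \<bullet> D) \<bullet> d = leibniz X (induced c) d \<bullet> beside [] (beside [] w [P] \<bullet> D) [X]"
    proof -
      have "beside [] w [P] \<bullet> leibniz X d d = leibniz X (induced c) d \<bullet> beside [] w [P, X]"
        using leibniz_equivariant[OF w(1) rone dd _ ci _ dd _ dd] w(3)
        by (simp add: leibniz_sel[OF dd dd])
      from this[THEN seq_eq_extend] show ?thesis
        by (simp add: d_product)
    qed
    have z1: "beside ?z D [] \<bullet> beside [] f [P] = beside [] f [P, P] \<bullet> beside [A] D []"
      using interchange[of "[]" f "[]" D "[]"] by simp
    have z2: "beside [A] D [] \<bullet> beside [A] i [] = beside [A] i [P] \<bullet> (beside [A, A] i [] \<bullet> beside [A] DA [])"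
    proof -
      have "beside [A] (D \<bullet> i) [] = beside [A] (beside [] i [P] \<bullet> (beside [A] i [] \<bullet> DA)) []" by (simp only: D_base)
      then show ?thesis by simp
    qed
    have z3: "beside [] w [P] \<bullet> beside [] i [P] = beside [] f [P, P] \<bullet> (beside [A] i [P] \<bullet> beside [] DA [P])"
    proof -
      have "beside [] (w \<bullet> i) [P] = beside [] (beside [] f [P] \<bullet> (beside [A] i [] \<bullet> DA)) [P]" by (simp only: w)
      then show ?thesis by simp
    qed
    have Acoassoc: "beside [] DA [A] \<bullet> DA = beside [A] DA [] \<bullet> DA"
      using base by (simp add: comonoid_def)
    show "(beside ?z D [] \<bullet> w) \<bullet> i = (beside [] w [P] \<bullet> D) \<bullet> i"
      by (simp add: w(2) D_base z1[THEN seq_eq_extend] z2[THEN seq_eq_extend] z3[THEN seq_eq_extend] slides Acoassoc[symmetric])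
  qed
  have hi: "?h \<bullet> i = f"
  proof -
    have 1: "beside ?z e [] \<bullet> beside [] f [P] = beside [] f [] \<bullet> beside [A] e []"
      using interchange[of "[]" f "[]" e "[]"] by simp
    have 2: "beside [A] e [] \<bullet> beside [A] i [] = beside [A] eA []"
      using beside_seq[of "[A]" e i "[]"] by (simp add: e_base)
    have 3: "beside [A] eA [] \<bullet> DA = wire [A]" using base by (simp add: comonoid_def)
    show ?thesis by (simp add: w(2) 1[THEN seq_eq_extend] 2[THEN seq_eq_extend] 3)
  qed
  have graph: "beside [] ?h [P] \<bullet> D = w"
  proof -
    have "beside [] ?h [P] \<bullet> D = beside ?z e [P] \<bullet> (beside ?z D [] \<bullet> w)"
      by (simp add: split)
    also have "\<dots> = w"
      using counit(1)[of ?z "[]", THEN seq_eq_extend] by simp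
    finally show ?thesis .
  qed
  have "chain c ?h"
  proof -
    have "?h \<bullet> d = c \<bullet> (beside ?z d [] \<bullet> beside [] w [X])"
      using delete_induced[OF c(2), THEN seq_eq_extend] by (simp add: w(3))
    also have "\<dots> = c \<bullet> (beside ?z d [] \<bullet> beside [] (beside [] ?h [P] \<bullet> D) [X])"
      by (simp only: graph)
    finally show ?thesis unfolding chain_def by simp
  qed
  then show ?thesis using rh hi by blast
qed

end

context differential_comonoid
begin

text \<open>The two summands of the product rule yield those of the Leibniz action. The summand in which \<open>h\<close> is
  differentiated takes the form of a chain rule only after two copies of the argument are exchanged, by
  cocommutativity.\<close>

lemma chain_tensor:
  assumes c: "rep c0 (\<langle>Z\<rangle> \<star> \<langle>P\<rangle>) \<langle>Z\<rangle> c" and c': "rep c0' (\<langle>Z'\<rangle> \<star> \<langle>P\<rangle>) \<langle>Z'\<rangle> c'"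
    and h: "rep h0 \<langle>P\<rangle> \<langle>Z\<rangle> h" "chain c h" and h': "rep h0' \<langle>P\<rangle> \<langle>Z'\<rangle> h'" "chain c' h'"
  shows "chain (leibniz P c c') (beside [] h [Z'] \<bullet> (beside [P] h' [] \<bullet> D))"
proof -
  note [simp] = rep_simps[OF c] rep_simps[OF c'] rep_simps[OF h(1)] rep_simps[OF h'(1)]
  have [simp]: "Z \<in> Ob C" "Z' \<in> Ob C" using rep_simps(2)[OF c] rep_simps(2)[OF c'] by auto
  let ?k = "cross P X"
  have hd: "beside [] h [Z'] \<bullet> beside [] d [Z']
    = beside [] c [Z'] \<bullet> (beside [Z] d [Z'] \<bullet> (beside [] h [P, X, Z'] \<bullet> beside [] D [X, Z']))"
  proof -
    have "beside [] (h \<bullet> d) [Z'] = beside [] (c \<bullet> (beside (outs h) d [] \<bullet> (beside [] h [P, X] \<bullet> beside [] D [X]))) [Z']"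
      using h(2) by (simp only: chain_def)
    then show ?thesis by simp
  qed
  have hd': "beside [P] h' [] \<bullet> beside [P] d []
    = beside [P] c' [] \<bullet> (beside [P, Z'] d [] \<bullet> (beside [P] h' [P, X] \<bullet> beside [P] D [X]))"
  proof -
    have "beside [P] (h' \<bullet> d) [] = beside [P] (c' \<bullet> (beside (outs h') d [] \<bullet> (beside [] h' [P, X] \<bullet> beside [] D [X]))) []"
      using h'(2) by (simp only: chain_def)
    then show ?thesis by simp
  qed
  have one: "beside [] h [Z'] \<bullet> (beside [P] h' [] \<bullet> (beside [P] d [] \<bullet> beside [] D [X]))
    = beside [Z] c' [] \<bullet> (beside [Z, Z'] d [] \<bullet> (beside [] h [Z', P, X] \<bullet> (beside [P] h' [P, X] \<bullet> (beside [] D [P, X] \<bullet> beside [] D [X]))))"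
    using coassoc[of "[]" "[X]"] by (simp add: hd'[THEN seq_eq_extend] slides)
  have x1: "beside [Z] (cross Z' P) [] \<bullet> beside [Z, Z'] d []
    = beside [Z] d [Z'] \<bullet> (beside [Z, P] (cross Z' X) [] \<bullet> beside [Z] (cross Z' P) [X])"
    using cross_d(2)[of Z' "[Z]" "[]"] by simp
  have x2: "beside [P] (cross Z' P) [X] \<bullet> beside [P] h' [P, X] = beside [P, P] h' [X] \<bullet> beside [P] (cross P P) [X]"
  proof -
    have "beside [P] (cross Z' P \<bullet> beside [] h' [P]) [X] = beside [P] (beside [P] h' [] \<bullet> cross P P) [X]"
      using pull_natural[OF h'(1), of P] by simp
    then show ?thesis by simp
  qed
  have x3: "beside [P, P] (cross Z' X) [] \<bullet> beside [P, P] h' [X] = beside [P, P, X] h' [] \<bullet> beside [P, P] ?k []"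
  proof -
    have "beside [P, P] (cross Z' X \<bullet> beside [] h' [X]) [] = beside [P, P] (beside [X] h' [] \<bullet> ?k) []"
      using pull_natural[OF h'(1), of X] by simp
    then show ?thesis by simp
  qed
  have "beside [] c [Z'] \<bullet> (beside [Z] (cross Z' P) [] \<bullet> (beside [Z, Z'] d [] \<bullet> (beside [] h [Z', P, X] \<bullet> (beside [P] h' [P, X] \<bullet> (beside [] D [P, X] \<bullet> beside [] D [X])))))
    = beside [] c [Z'] \<bullet> (beside [Z] d [Z'] \<bullet> (beside [] h [P, X, Z'] \<bullet> (beside [P, P] (cross Z' X) [] \<bullet> (beside [P] (cross Z' P) [X] \<bullet> (beside [P] h' [P, X] \<bullet> (beside [P] D [X] \<bullet> beside [] D [X]))))))"
    using coassoc[of "[]" "[X]"] by (simp only: x1[THEN seq_eq_extend] seq_assoc) (simp add: slides)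
  also have "\<dots> = beside [] c [Z'] \<bullet> (beside [Z] d [Z'] \<bullet> (beside [] h [P, X, Z'] \<bullet> (beside [P, P, X] h' [] \<bullet> (beside [P, P] ?k [] \<bullet> (beside [P] D [X] \<bullet> beside [] D [X])))))"
    using cocomm[of "[P]" "[X]", THEN seq_eq_extend] by (simp add: x2[THEN seq_eq_extend] x3[THEN seq_eq_extend])
  also have "\<dots> = beside [] h [Z'] \<bullet> (beside [P] h' [] \<bullet> \<theta>)"
    using coassoc[of "[]" "[X]", symmetric] by (simp add: \<theta>_def hd[THEN seq_eq_extend] slides)
  finally have two: "beside [] h [Z'] \<bullet> (beside [P] h' [] \<bullet> \<theta>)
    = beside [] c [Z'] \<bullet> (beside [Z] (cross Z' P) [] \<bullet> (beside [Z, Z'] d [] \<bullet> (beside [] h [Z', P, X] \<bullet> (beside [P] h' [P, X] \<bullet> (beside [] D [P, X] \<bullet> beside [] D [X])))))"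
    by simp
  show ?thesis
    unfolding chain_def
    using product_split[of "[]" "[]"] by (simp add: leibniz_def one two)
qed

end

section \<open>The rules as equations between diagrams\<close>

context linear_symmetric_monoidal_category
begin

text \<open>The picture of an arrow whose source and target are drawn as single wires, even if they are tensor
  products.\<close>

definition box :: "'m \<Rightarrow> ('o, 'm) diagram" where
  "box f = picture \<langle>Dom C f\<rangle> f \<langle>Cod C f\<rangle>"

lemma rep_box:
  assumes "f \<in> hom C A B"
  shows "rep f \<langle>A\<rangle> \<langle>B\<rangle> (box f)"
  using assms hom_Ob[OF assms] by (auto simp: box_def hom_iff intro!: rep_picture)

lemma box_sel:
  assumes "f \<in> hom C A B"
  shows "good (box f)" "ins (box f) = [A]" "outs (box f) = [B]"
  using rep_simps[OF rep_box[OF assms]] by auto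

lemma box_Comp: "f \<in> hom C A B \<Longrightarrow> g \<in> hom C B E \<Longrightarrow> box (g \<cdot> f) = box g \<bullet> box f"
  using rep_unique[OF rep_box rep_Comp[OF rep_box rep_box]] Comp_hom by metis

lemma box_Ident: "A \<in> Ob C \<Longrightarrow> box (\<one>A) = wire [A]"
  using rep_unique[OF rep_box rep_Ident[of "\<langle>A\<rangle>"]] Ident_hom by fastforce

lemma box_eq_iff: "f \<in> hom C A B \<Longrightarrow> g \<in> hom C A B \<Longrightarrow> f = g \<longleftrightarrow> box f = box g"
  using rep_eq_iff rep_box by blast

lemma constant_rule_iff:
  assumes d: "rep d0 (\<langle>P\<rangle> \<star> \<langle>X\<rangle>) \<langle>P\<rangle> d" and e: "rep e0 \<langle>P\<rangle> Null e"
  shows "constant_rule C X P d0 e0 \<longleftrightarrow> e \<bullet> d = none [P, X] []"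
  using rep_eq_iff[OF rep_Comp[OF d e] rep_Zero[of "\<langle>P\<rangle> \<star> \<langle>X\<rangle>" Null "P \<boxtimes> X" \<I>]] rep_simps[OF d]
  by (simp add: constant_rule_def)

lemma product_rule_iff:
  assumes d: "rep d0 (\<langle>P\<rangle> \<star> \<langle>X\<rangle>) \<langle>P\<rangle> d" and D: "rep D0 \<langle>P\<rangle> (\<langle>P\<rangle> \<star> \<langle>P\<rangle>) D"
  shows "product_rule C X P d0 D0 \<longleftrightarrow> D \<bullet> d = leibniz X d d \<bullet> beside [] D [X]"
proof -
  note [simp] = rep_simps[OF d] rep_simps[OF D]
  have [simp]: "X \<in> Ob C" "P \<in> Ob C" using rep_simps(1)[OF d] by auto
  note l = rep_leibniz[OF d d, of P P]
  have "rep (leibniz_arrow X P d0 P d0 \<cdot> (D0 \<otimes> \<one>X)) (\<langle>P\<rangle> \<star> \<langle>X\<rangle>) (\<langle>P\<rangle> \<star> \<langle>P\<rangle>) (leibniz X d d \<bullet> beside [] D [X])"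
    by (rule rep_cong, (rule l D rep_rules | (simp; fail))+)
  from rep_eq_iff[OF rep_Comp[OF d D] this] show ?thesis
    by (simp add: product_rule_def leibniz_arrow_def)
qed

lemma linear_rule_iff:
  assumes d: "rep d0 (\<langle>P\<rangle> \<star> \<langle>X\<rangle>) \<langle>P\<rangle> d" and e: "rep e0 \<langle>P\<rangle> Null e" and \<epsilon>: "rep \<epsilon>0 \<langle>P\<rangle> \<langle>X\<rangle> \<epsilon>"
  shows "linear_rule C X d0 e0 \<epsilon>0 \<longleftrightarrow> \<epsilon> \<bullet> d = beside [] e [X]"
proof -
  note [simp] = rep_simps[OF d] rep_simps[OF e]
  have [simp]: "X \<in> Ob C" "P \<in> Ob C" using rep_simps(1)[OF d] by auto
  have "rep (LUnit C X \<cdot> (e0 \<otimes> \<one>X)) (\<langle>P\<rangle> \<star> \<langle>X\<rangle>) \<langle>X\<rangle> (beside [] e [X])"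
    by (rule rep_cong, (rule e rep_rules | (simp; fail))+)
  from rep_eq_iff[OF rep_Comp[OF d \<epsilon>] this] show ?thesis
    by (simp add: linear_rule_def)
qed

lemma chain_rule_iff:
  assumes d: "rep d0 (\<langle>P\<rangle> \<star> \<langle>X\<rangle>) \<langle>P\<rangle> d" and d': "rep d0' (\<langle>Q\<rangle> \<star> \<langle>P\<rangle>) \<langle>Q\<rangle> d'"
    and D: "rep D0 \<langle>P\<rangle> (\<langle>P\<rangle> \<star> \<langle>P\<rangle>) D" and \<delta>: "rep \<delta>0 \<langle>P\<rangle> \<langle>Q\<rangle> \<delta>"
  shows "chain_rule C X P d0 d0' D0 \<delta>0 \<longleftrightarrow>
    \<delta> \<bullet> d = d' \<bullet> (beside [Q] d [] \<bullet> (beside [] \<delta> [P, X] \<bullet> beside [] D [X]))"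
proof -
  note [simp] = rep_simps[OF d] rep_simps[OF d'] rep_simps[OF D] rep_simps[OF \<delta>]
  have [simp]: "X \<in> Ob C" "P \<in> Ob C" "Q \<in> Ob C" using rep_simps(1)[OF d] rep_simps(1)[OF d'] by auto
  have "rep (d0' \<cdot> (\<delta>0 \<otimes> d0) \<cdot> Assoc C P P X \<cdot> (D0 \<otimes> \<one>X)) (\<langle>P\<rangle> \<star> \<langle>X\<rangle>) \<langle>Q\<rangle>
      (d' \<bullet> (beside [] \<delta> [P] \<bullet> (beside [P] d [] \<bullet> beside [] D [X])))"
    by (rule rep_cong, (rule assms rep_rules | (simp; fail))+)
  from rep_eq_iff[OF rep_Comp[OF d \<delta>] this] show ?thesis
    by (simp add: chain_rule_def slides)
qed

lemma comonoid_morphism_iff: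
  assumes e: "rep e0 \<langle>K\<rangle> Null e" and D: "rep D0 \<langle>K\<rangle> (\<langle>K\<rangle> \<star> \<langle>K\<rangle>) D"
    and e': "rep e0' \<langle>K'\<rangle> Null e'" and D': "rep D0' \<langle>K'\<rangle> (\<langle>K'\<rangle> \<star> \<langle>K'\<rangle>) D'" and f: "rep f0 \<langle>K\<rangle> \<langle>K'\<rangle> f"
  shows "is_comonoid_morphism C K e0 D0 K' e0' D0' f0 \<longleftrightarrow>
    e' \<bullet> f = e \<and> D' \<bullet> f = beside [] f [K'] \<bullet> (beside [K] f [] \<bullet> D)"
proof -
  note [simp] = rep_simps[OF f] rep_simps[OF D]
  have [simp]: "K \<in> Ob C" "K' \<in> Ob C" using rep_simps(1,2)[OF f] by auto
  have 1: "rep ((f0 \<otimes> f0) \<cdot> D0) \<langle>K\<rangle> (\<langle>K'\<rangle> \<star> \<langle>K'\<rangle>) (beside [] f [K'] \<bullet> (beside [K] f [] \<bullet> D))"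
    by (rule rep_cong, (rule f D rep_rules | (simp; fail))+)
  have 2: "e0' \<cdot> f0 = e0 \<longleftrightarrow> e' \<bullet> f = e"
    by (rule rep_eq_iff[OF rep_Comp[OF f e'] e])
  have 3: "D0' \<cdot> f0 = (f0 \<otimes> f0) \<cdot> D0 \<longleftrightarrow> D' \<bullet> f = beside [] f [K'] \<bullet> (beside [K] f [] \<bullet> D)"
    by (rule rep_eq_iff[OF rep_Comp[OF f D'] 1])
  have 4: "f0 \<in> hom C K K'" using rep_simps[OF f] by (simp add: hom_iff)
  show ?thesis unfolding is_comonoid_morphism_def using 2 3 4 by blast
qed

text \<open>Two copies of \<open>f\<close> side by side commute with the crossing, by naturality of the symmetry.\<close>

lemma commuting_along:
  assumes b: "commuting Y b" and f: "rep f0 \<langle>X\<rangle> \<langle>Y\<rangle> f"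
  shows "commuting X (b \<bullet> beside (outs b) f [])"
proof -
  note [simp] = commuting_sel[OF b] rep_simps[OF f]
  have [simp]: "X \<in> Ob C" using rep_simps(1)[OF f] by simp
  let ?l = "outs b"
  have 1: "beside ?l f [] \<bullet> beside [] b [X] = beside [] b [Y] \<bullet> beside (?l @ [Y]) f []"
    using interchange[of "[]" b "[]" f "[]"] by simp
  have ff: "beside [Y] f [] \<bullet> (beside [] f [X] \<bullet> cross X X) = cross Y Y \<bullet> (beside [Y] f [] \<bullet> beside [] f [X])"
  proof -
    have a: "cross Y Y \<bullet> beside [Y] f [] = beside [] f [Y] \<bullet> cross Y X"
      using push_natural[OF f, of Y] by simp
    have b: "cross Y X \<bullet> beside [] f [X] = beside [X] f [] \<bullet> cross X X"
      using pull_natural[OF f, of X] by simp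
    show ?thesis
      by (simp add: a[THEN seq_eq_extend] b) (simp add: slides)
  qed
  have 2: "beside (?l @ [Y]) f [] \<bullet> (beside ?l f [X] \<bullet> beside ?l (cross X X) [])
    = beside ?l (cross Y Y) [] \<bullet> (beside (?l @ [Y]) f [] \<bullet> beside ?l f [X])"
  proof -
    have "beside ?l (beside [Y] f [] \<bullet> (beside [] f [X] \<bullet> cross X X)) []
      = beside ?l (cross Y Y \<bullet> (beside [Y] f [] \<bullet> beside [] f [X])) []" by (simp only: ff)
    then show ?thesis by simp
  qed
  have 3: "b \<bullet> (beside [] b [Y] \<bullet> (beside ?l (cross Y Y) [] \<bullet> F)) = b \<bullet> (beside [] b [Y] \<bullet> F)" for F
  proof -
    have "(b \<bullet> (beside [] b [Y] \<bullet> beside ?l (cross Y Y) [])) \<bullet> F = (b \<bullet> beside [] b [Y]) \<bullet> F"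
      using b by (simp only: commuting_def)
    then show ?thesis by simp
  qed
  show ?thesis
    unfolding commuting_def by (simp add: 1[THEN seq_eq_extend] 2 3)
qed

end

section \<open>Modalities in diagrams\<close>

context linear_symmetric_monoidal_category
begin

definition delete :: "('o, 'm, 'y) coalg_mod_scheme \<Rightarrow> 'o \<Rightarrow> ('o, 'm) diagram" where
  "delete T X = picture \<langle>bang_ob T X\<rangle> (counit T X) Null"

definition duplicate :: "('o, 'm, 'y) coalg_mod_scheme \<Rightarrow> 'o \<Rightarrow> ('o, 'm) diagram" where
  "duplicate T X = picture \<langle>bang_ob T X\<rangle> (comult T X) (\<langle>bang_ob T X\<rangle> \<star> \<langle>bang_ob T X\<rangle>)"

lemma functor_hom:
  assumes "is_functor C C Fo Fa"
  shows "A \<in> Ob C \<Longrightarrow> Fo A \<in> Ob C" "f \<in> hom C A B \<Longrightarrow> Fa f \<in> hom C (Fo A) (Fo B)"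
  using assms hom_Ob by (auto simp: is_functor_def)

lemma natural_hom:
  assumes "is_natural C C Fo Fa Go Ga t"
  shows "A \<in> Ob C \<Longrightarrow> t A \<in> hom C (Fo A) (Go A)" "f \<in> hom C A B \<Longrightarrow> t B \<cdot> Fa f = Ga f \<cdot> t A"
  using assms hom_Ob by (auto simp: is_natural_def)

context
  fixes T :: "('o, 'm, 'y) coalg_mod_scheme"
  assumes T: "is_coalgebra_modality C T"
begin

lemma modality_hom:
  "A \<in> Ob C \<Longrightarrow> bang_ob T A \<in> Ob C"
  "f \<in> hom C A B \<Longrightarrow> bang_arr T f \<in> hom C (bang_ob T A) (bang_ob T B)"
  "A \<in> Ob C \<Longrightarrow> dereliction T A \<in> hom C (bang_ob T A) A"
  "A \<in> Ob C \<Longrightarrow> digging T A \<in> hom C (bang_ob T A) (bang_ob T (bang_ob T A))"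
  "A \<in> Ob C \<Longrightarrow> counit T A \<in> hom C (bang_ob T A) \<I>"
  "A \<in> Ob C \<Longrightarrow> comult T A \<in> hom C (bang_ob T A) (bang_ob T A \<boxtimes> bang_ob T A)"
  using T unfolding is_coalgebra_modality_def is_comonad_def
  by (auto dest!: functor_hom natural_hom(1) simp: hom_Ob functor_hom natural_hom)

lemma rep_delete: "A \<in> Ob C \<Longrightarrow> rep (counit T A) \<langle>bang_ob T A\<rangle> Null (delete T A)"
  unfolding delete_def by (rule rep_picture) (simp_all add: modality_hom)

lemma rep_duplicate: "A \<in> Ob C \<Longrightarrow> rep (comult T A) \<langle>bang_ob T A\<rangle> (\<langle>bang_ob T A\<rangle> \<star> \<langle>bang_ob T A\<rangle>) (duplicate T A)"
  unfolding duplicate_def by (rule rep_picture) (simp_all add: modality_hom)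

lemma modality_comonoid: "A \<in> Ob C \<Longrightarrow> comonoid (bang_ob T A) (delete T A) (duplicate T A)"
  using T comonoid_iff[OF rep_delete rep_duplicate] by (simp add: is_coalgebra_modality_def)

lemma modality_functor:
  "A \<in> Ob C \<Longrightarrow> bang_arr T (\<one>A) = \<one>(bang_ob T A)"
  "f \<in> hom C A B \<Longrightarrow> g \<in> hom C B E \<Longrightarrow> bang_arr T (g \<cdot> f) = bang_arr T g \<cdot> bang_arr T f"
proof -
  have F: "is_functor C C (bang_ob T) (bang_arr T)"
    using T by (simp add: is_coalgebra_modality_def is_comonad_def)
  show "A \<in> Ob C \<Longrightarrow> bang_arr T (\<one>A) = \<one>(bang_ob T A)"
    using F unfolding is_functor_def by blast
  assume fg: "f \<in> hom C A B" "g \<in> hom C B E"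
  then have "A \<in> Ob C" "B \<in> Ob C" "E \<in> Ob C" using hom_Ob by auto
  with F fg show "bang_arr T (g \<cdot> f) = bang_arr T g \<cdot> bang_arr T f"
    unfolding is_functor_def by blast
qed

lemma box_modality:
  assumes "f \<in> hom C A B"
  shows "good (box (bang_arr T f))" "ins (box (bang_arr T f)) = [bang_ob T A]" "outs (box (bang_arr T f)) = [bang_ob T B]"
  using box_sel[OF modality_hom(2)[OF assms]] by auto

lemma box_modality_Comp:
  "f \<in> hom C A B \<Longrightarrow> g \<in> hom C B E \<Longrightarrow> box (bang_arr T (g \<cdot> f)) = box (bang_arr T g) \<bullet> box (bang_arr T f)"
  using box_Comp[OF modality_hom(2) modality_hom(2)] modality_functor(2) by metis

lemma modality_natural:
  assumes f: "f \<in> hom C A B"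
  shows "box (dereliction T B) \<bullet> box (bang_arr T f) = box f \<bullet> box (dereliction T A)"
    "box (digging T B) \<bullet> box (bang_arr T f) = box (bang_arr T (bang_arr T f)) \<bullet> box (digging T A)"
    "delete T B \<bullet> box (bang_arr T f) = delete T A"
    "duplicate T B \<bullet> box (bang_arr T f) = beside [] (box (bang_arr T f)) [bang_ob T B] \<bullet>
       (beside [bang_ob T A] (box (bang_arr T f)) [] \<bullet> duplicate T A)"
proof -
  note [simp] = f modality_hom modality_hom(2)[OF f] modality_hom(2)[OF modality_hom(2)[OF f]]
  have o: "A \<in> Ob C" "B \<in> Ob C" using hom_Ob[OF f] by auto
  note [simp] = o
  have n: "dereliction T B \<cdot> bang_arr T f = f \<cdot> dereliction T A"
    "digging T B \<cdot> bang_arr T f = bang_arr T (bang_arr T f) \<cdot> digging T A"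
    "counit T B \<cdot> bang_arr T f = \<one>\<I> \<cdot> counit T A"
    "comult T B \<cdot> bang_arr T f = (bang_arr T f \<otimes> bang_arr T f) \<cdot> comult T A"
  proof -
    have "is_natural C C (bang_ob T) (bang_arr T) (\<lambda>X. X) (\<lambda>f. f) (dereliction T)"
      and "is_natural C C (bang_ob T) (bang_arr T) (\<lambda>X. bang_ob T (bang_ob T X)) (\<lambda>f. bang_arr T (bang_arr T f)) (digging T)"
      and "is_natural C C (bang_ob T) (bang_arr T) (\<lambda>X. \<I>) (\<lambda>f. \<one>\<I>) (counit T)"
      and "is_natural C C (bang_ob T) (bang_arr T) (\<lambda>X. bang_ob T X \<boxtimes> bang_ob T X) (\<lambda>f. bang_arr T f \<otimes> bang_arr T f) (comult T)"
      using T by (simp_all add: is_coalgebra_modality_def is_comonad_def)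
    from this[THEN natural_hom(2), OF f] show "dereliction T B \<cdot> bang_arr T f = f \<cdot> dereliction T A"
      "digging T B \<cdot> bang_arr T f = bang_arr T (bang_arr T f) \<cdot> digging T A"
      "counit T B \<cdot> bang_arr T f = \<one>\<I> \<cdot> counit T A"
      "comult T B \<cdot> bang_arr T f = (bang_arr T f \<otimes> bang_arr T f) \<cdot> comult T A" .
  qed
  show "box (dereliction T B) \<bullet> box (bang_arr T f) = box f \<bullet> box (dereliction T A)"
    using n(1) box_Comp[OF modality_hom(2)[OF f] modality_hom(3)[OF o(2)]] box_Comp[OF modality_hom(3)[OF o(1)] f]
    by simp
  show "box (digging T B) \<bullet> box (bang_arr T f) = box (bang_arr T (bang_arr T f)) \<bullet> box (digging T A)"
    using n(2) box_Comp[OF modality_hom(2)[OF f] modality_hom(4)[OF o(2)]]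
      box_Comp[OF modality_hom(4)[OF o(1)] modality_hom(2)[OF modality_hom(2)[OF f]]]
    by simp
  have "is_comonoid_morphism C (bang_ob T A) (counit T A) (comult T A) (bang_ob T B) (counit T B) (comult T B) (bang_arr T f)"
    unfolding is_comonoid_morphism_def using n(3,4) modality_hom(5)[OF o(1)] Ident_Comp by auto
  then show "delete T B \<bullet> box (bang_arr T f) = delete T A"
    "duplicate T B \<bullet> box (bang_arr T f) = beside [] (box (bang_arr T f)) [bang_ob T B] \<bullet>
       (beside [bang_ob T A] (box (bang_arr T f)) [] \<bullet> duplicate T A)"
    unfolding comonoid_morphism_iff[OF rep_delete[OF o(1)] rep_duplicate[OF o(1)] rep_delete[OF o(2)] rep_duplicate[OF o(2)]
      rep_box[OF modality_hom(2)[OF f]]] by auto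
qed

lemma modality_comonad:
  assumes o: "A \<in> Ob C"
  shows "box (dereliction T (bang_ob T A)) \<bullet> box (digging T A) = wire [bang_ob T A]"
    "box (bang_arr T (dereliction T A)) \<bullet> box (digging T A) = wire [bang_ob T A]"
    "box (digging T (bang_ob T A)) \<bullet> box (digging T A) = box (bang_arr T (digging T A)) \<bullet> box (digging T A)"
proof -
  note h = modality_hom(4)[OF o] modality_hom(1)[OF o]
  have n: "dereliction T (bang_ob T A) \<cdot> digging T A = \<one>(bang_ob T A)"
    "bang_arr T (dereliction T A) \<cdot> digging T A = \<one>(bang_ob T A)"
    "digging T (bang_ob T A) \<cdot> digging T A = bang_arr T (digging T A) \<cdot> digging T A"
    using T o unfolding is_coalgebra_modality_def is_comonad_def by auto
  show "box (dereliction T (bang_ob T A)) \<bullet> box (digging T A) = wire [bang_ob T A]"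
    using box_Comp[OF h(1) modality_hom(3)[OF h(2)]] n(1) box_Ident[OF h(2)] by simp
  show "box (bang_arr T (dereliction T A)) \<bullet> box (digging T A) = wire [bang_ob T A]"
    using box_Comp[OF h(1) modality_hom(2)[OF modality_hom(3)[OF o]]] n(2) box_Ident[OF h(2)] by simp
  show "box (digging T (bang_ob T A)) \<bullet> box (digging T A) = box (bang_arr T (digging T A)) \<bullet> box (digging T A)"
    using box_Comp[OF h(1) modality_hom(4)[OF h(2)]] box_Comp[OF h(1) modality_hom(2)[OF h(1)]] n(3) by simp
qed

lemma digging_comonoid_morphism:
  assumes o: "A \<in> Ob C"
  shows "delete T (bang_ob T A) \<bullet> box (digging T A) = delete T A"
    "duplicate T (bang_ob T A) \<bullet> box (digging T A) = beside [] (box (digging T A)) [bang_ob T (bang_ob T A)] \<bullet>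
       (beside [bang_ob T A] (box (digging T A)) [] \<bullet> duplicate T A)"
  using T o comonoid_morphism_iff[OF rep_delete[OF o] rep_duplicate[OF o]
    rep_delete[OF modality_hom(1)[OF o]] rep_duplicate[OF modality_hom(1)[OF o]] rep_box[OF modality_hom(4)[OF o]]]
  unfolding is_coalgebra_modality_def by auto

end

definition act :: "('o, 'm, 'y) diff_mod_scheme \<Rightarrow> 'o \<Rightarrow> ('o, 'm) diagram" where
  "act T X = picture (\<langle>bang_ob T X\<rangle> \<star> \<langle>X\<rangle>) (deriv T X) \<langle>bang_ob T X\<rangle>"

context
  fixes T :: "('o, 'm, 'y) diff_mod_scheme"
  assumes T: "is_differential_modality C T"
begin

lemma differential_modality_coalgebra: "is_coalgebra_modality C T"
  using T by (simp add: is_differential_modality_def)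

lemma rep_act:
  assumes "A \<in> Ob C"
  shows "rep (deriv T A) (\<langle>bang_ob T A\<rangle> \<star> \<langle>A\<rangle>) \<langle>bang_ob T A\<rangle> (act T A)"
  unfolding act_def
proof (rule rep_picture)
  show "deriv T A \<in> hom C (obj (\<langle>bang_ob T A\<rangle> \<star> \<langle>A\<rangle>)) (obj \<langle>bang_ob T A\<rangle>)"
    using T assms unfolding is_differential_modality_def is_deriving_transformation_def
    by (auto dest: natural_hom(1))
qed (simp_all add: assms modality_hom[OF differential_modality_coalgebra])

lemma act_natural:
  assumes f: "f \<in> hom C A B"
  shows "box (bang_arr T f) \<bullet> act T A = act T B \<bullet> (beside [] (box (bang_arr T f)) [B] \<bullet> beside [bang_ob T A] (box f) [])"
proof -
  have o: "A \<in> Ob C" "B \<in> Ob C" using hom_Ob[OF f] by auto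
  note b = modality_hom(2)[OF differential_modality_coalgebra f]
  have "deriv T B \<cdot> (bang_arr T f \<otimes> f) = bang_arr T f \<cdot> deriv T A"
  proof -
    have "is_natural C C (\<lambda>X. bang_ob T X \<boxtimes> X) (\<lambda>f. bang_arr T f \<otimes> f) (bang_ob T) (bang_arr T) (deriv T)"
      using T by (simp add: is_differential_modality_def is_deriving_transformation_def)
    from natural_hom(2)[OF this f] show ?thesis .
  qed
  moreover have "rep (deriv T B \<cdot> (bang_arr T f \<otimes> f)) (\<langle>bang_ob T A\<rangle> \<star> \<langle>A\<rangle>) \<langle>bang_ob T B\<rangle>
    (act T B \<bullet> (beside [] (box (bang_arr T f)) [B] \<bullet> beside [bang_ob T A] (box f) []))"
    using rep_Comp[OF rep_tensor[OF rep_box[OF b] rep_box[OF f]] rep_act[OF o(2)]] by simp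
  moreover have "rep (bang_arr T f \<cdot> deriv T A) (\<langle>bang_ob T A\<rangle> \<star> \<langle>A\<rangle>) \<langle>bang_ob T B\<rangle> (box (bang_arr T f) \<bullet> act T A)"
    by (rule rep_Comp[OF rep_act[OF o(1)] rep_box[OF b]])
  ultimately show ?thesis using rep_unique by metis
qed

lemma act_linear:
  assumes o: "A \<in> Ob C"
  shows "box (dereliction T A) \<bullet> act T A = beside [] (delete T A) [A]"
  using T o linear_rule_iff[OF rep_act[OF o] rep_delete[OF differential_modality_coalgebra o]
    rep_box[OF modality_hom(3)[OF differential_modality_coalgebra o]]]
  unfolding is_differential_modality_def is_deriving_transformation_def by auto

lemma act_chain:
  assumes o: "A \<in> Ob C"
  shows "box (digging T A) \<bullet> act T A = act T (bang_ob T A) \<bullet> (beside [bang_ob T (bang_ob T A)] (act T A) [] \<bullet>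
    (beside [] (box (digging T A)) [bang_ob T A, A] \<bullet> beside [] (duplicate T A) [A]))"
  using T o chain_rule_iff[OF rep_act[OF o] rep_act[OF modality_hom(1)[OF differential_modality_coalgebra o]]
    rep_duplicate[OF differential_modality_coalgebra o] rep_box[OF modality_hom(4)[OF differential_modality_coalgebra o]]]
  unfolding is_differential_modality_def is_deriving_transformation_def by auto

lemma differential_modality_comonoid:
  assumes o: "A \<in> Ob C"
  shows "differential_comonoid C A (bang_ob T A) (delete T A) (duplicate T A) (act T A) (deriv T A)"
proof (unfold_locales)
  note c = differential_modality_coalgebra and d = rep_act[OF o]
  show "comonoid (bang_ob T A) (delete T A) (duplicate T A)" by (rule modality_comonoid[OF c o])
  show "rep (deriv T A) (\<langle>bang_ob T A\<rangle> \<star> \<langle>A\<rangle>) \<langle>bang_ob T A\<rangle> (act T A)" by (rule d)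
  show "commuting A (act T A)"
    using T o commuting_iff[OF d] unfolding is_differential_modality_def is_deriving_transformation_def by auto
  show "delete T A \<bullet> act T A = none [bang_ob T A, A] []"
    using T o constant_rule_iff[OF d rep_delete[OF c o]]
    unfolding is_differential_modality_def is_deriving_transformation_def by auto
  show "duplicate T A \<bullet> act T A = leibniz A (act T A) (act T A) \<bullet> beside [] (duplicate T A) [A]"
    using T o product_rule_iff[OF d rep_duplicate[OF c o]]
    unfolding is_differential_modality_def is_deriving_transformation_def by auto
qed

end

end

section \<open>The structure maps of the free differential modality\<close>

locale free_modality_data = linear_symmetric_monoidal_category C
  for C :: "('o, 'm, 'k :: {comm_semiring_0, comm_monoid_mult}, 'x) linear_smc_scheme" (structure) +
  fixes S :: "('o, 'm) free_monoids" and T :: "('o, 'm, 'y) coalg_mod_scheme"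
  assumes biproducts: "has_finite_biproducts C"
    and S: "algebraically_free_commutative_monoids C S"
    and T: "is_coalgebra_modality C T"
begin

lemma S_data:
  assumes "X \<in> Ob C"
  shows "is_commutative_monoid C (S_ob S X) (S_unit S X) (S_mult S X)" "S_eta S X \<in> hom C X (S_ob S X)"
    "is_iso_of_categories (Mod C (S_ob S X) (S_unit S X) (S_mult S X)) (CAct C X)
      (restrict_ob C (S_eta S X)) (restrict_arr C (S_eta S X))"
  using S assms unfolding algebraically_free_commutative_monoids_def is_free_commutative_monoid_def by auto

lemma S_hom:
  assumes "X \<in> Ob C"
  shows "S_ob S X \<in> Ob C" "S_unit S X \<in> hom C \<I> (S_ob S X)" "S_mult S X \<in> hom C (S_ob S X \<boxtimes> S_ob S X) (S_ob S X)"
    "S_deriv C S X \<in> hom C (S_ob S X \<boxtimes> X) (S_ob S X)"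
  using S_data[OF assms] by (auto simp: is_commutative_monoid_def S_deriv_def hom_iff)

lemma S_deriv_commuting:
  assumes X: "X \<in> Ob C"
  shows "is_commuting_action C X (S_ob S X) (S_deriv C S X)"
proof -
  have "is_right_module C (S_ob S X) (S_unit S X) (S_mult S X) (S_ob S X) (S_mult S X)"
    using S_data(1)[OF X] by (simp add: is_right_module_def is_commutative_monoid_def)
  from module_restriction[OF S_data(3)[OF X] this] show ?thesis by (simp add: S_deriv_def)
qed

subsection \<open>The functor\<close>

text \<open>The conditions on \<open>Sf\<close> say that it extends the unit of \<open>SY\<close> equivariantly, where \<open>X\<close> acts on \<open>SY\<close> along
  \<open>f\<close>. The action on \<open>SX\<close> is the free one on the unit object up to the isomorphism of \<open>\<I> \<otimes> SX\<close> with \<open>SX\<close>, and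
  conjugating by this isomorphism reduces the claim to freeness.\<close>

lemma S_map_ex1:
  assumes f: "f \<in> hom C X Y"
  shows "\<exists>!g. is_S_map C S X Y f g"
proof -
  have X [simp]: "X \<in> Ob C" and Y [simp]: "Y \<in> Ob C" using hom_Ob[OF f] by auto
  let ?S = "S_ob S X" and ?R = "S_ob S Y" and ?u = "S_unit S X" and ?v = "S_unit S Y"
  let ?d = "S_deriv C S X" and ?e = "S_deriv C S Y"
  note [simp] = S_hom(1)
  have h: "?u \<in> Arr C" "Dom C ?u = \<I>" "Cod C ?u = ?S" "?v \<in> Arr C" "Dom C ?v = \<I>" "Cod C ?v = ?R"
    "?d \<in> Arr C" "Dom C ?d = ?S \<boxtimes> X" "Cod C ?d = ?S" "?e \<in> Arr C" "Dom C ?e = ?R \<boxtimes> Y" "Cod C ?e = ?R"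
    "f \<in> Arr C" "Dom C f = X" "Cod C f = Y"
    using S_hom[OF X] S_hom[OF Y] f by (auto simp: hom_iff)
  note [simp] = h
  let ?i = "(\<one>\<I> \<otimes> ?u) \<cdot> RUnit_inv C \<I>" and ?D = "(\<one>\<I> \<otimes> ?d) \<cdot> Assoc C \<I> ?S X"
  have free: "free_action X \<I> (\<I> \<boxtimes> ?S) ?i ?D"
    using free_action_tensor[OF X _ S_data[OF X], of \<I>] by (simp add: S_deriv_def)
  let ?b = "?e \<cdot> (\<one>?R \<otimes> f)"
  have "is_commuting_action C X ?R ?b"
  proof -
    obtain e' where e': "rep ?e (\<langle>?R\<rangle> \<star> \<langle>Y\<rangle>) \<langle>?R\<rangle> e'" using rep_exists[of ?e "\<langle>?R\<rangle> \<star> \<langle>Y\<rangle>" "\<langle>?R\<rangle>"] by (auto simp: hom_iff)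
    note [simp] = rep_simps[OF e']
    have r: "rep ?b (\<langle>?R\<rangle> \<star> \<langle>X\<rangle>) \<langle>?R\<rangle> (e' \<bullet> beside [?R] (box f) [])"
      by (rule rep_cong, (rule e' rep_box[OF f] rep_rules | (simp; fail))+)
    have "commuting Y e'" using commuting_action_iff[OF e'] S_deriv_commuting[OF Y] by simp
    from commuting_along[OF this rep_box[OF f]] commuting_action_iff[OF r] show ?thesis by simp
  qed
  moreover have "?v \<cdot> (LUnit C \<I> \<cdot> RUnit_inv C \<I>) \<in> hom C \<I> ?R" by (simp add: hom_iff)
  ultimately have ex1: "\<exists>!h. h \<in> hom C (\<I> \<boxtimes> ?S) ?R \<and> h \<cdot> ?i = ?v \<cdot> (LUnit C \<I> \<cdot> RUnit_inv C \<I>) \<and> h \<cdot> ?D = ?b \<cdot> (h \<otimes> \<one>X)"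
    using free unfolding free_action_def by blast
  have iff: "is_S_map C S X Y f g \<longleftrightarrow> g \<cdot> LUnit C ?S \<in> hom C (\<I> \<boxtimes> ?S) ?R \<and>
      (g \<cdot> LUnit C ?S) \<cdot> ?i = ?v \<cdot> (LUnit C \<I> \<cdot> RUnit_inv C \<I>) \<and>
      (g \<cdot> LUnit C ?S) \<cdot> ?D = ?b \<cdot> ((g \<cdot> LUnit C ?S) \<otimes> \<one>X)" if g: "g \<in> hom C ?S ?R" for g
  proof -
    have [simp]: "g \<in> Arr C" "Dom C g = ?S" "Cod C g = ?R" using g by (auto simp: hom_iff)
    let ?w = "LUnit C \<I> \<cdot> RUnit_inv C \<I>" and ?w' = "RUnit C \<I> \<cdot> LUnit_inv C \<I>"
    have i: "(g \<cdot> LUnit C ?S) \<cdot> ?i = (g \<cdot> ?u) \<cdot> ?w"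
      using Comp_eq_extend[OF LUnit_natural_arr[of ?u], of "RUnit_inv C \<I>"] by simp
    have "mutually_inverse C \<I> \<I> ?w ?w'" by (simp add: mutually_inverse_def hom_iff)
    from iso_right_cancel[OF this, of "g \<cdot> ?u" ?v] have "(g \<cdot> ?u) \<cdot> ?w = ?v \<cdot> ?w \<Longrightarrow> g \<cdot> ?u = ?v"
      by (simp del: Comp_assoc_arr)
    then have 1: "g \<cdot> ?u = ?v \<longleftrightarrow> (g \<cdot> LUnit C ?S) \<cdot> ?i = ?v \<cdot> ?w"
      unfolding i by metis
    have "LUnit C ?S \<cdot> ?D = ?d \<cdot> (LUnit C (?S \<boxtimes> X) \<cdot> Assoc C \<I> ?S X)"
      using Comp_eq_extend[OF LUnit_natural_arr[of ?d], of "Assoc C \<I> ?S X"] by simp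
    then have j: "(g \<cdot> LUnit C ?S) \<cdot> ?D = (g \<cdot> ?d) \<cdot> (LUnit C ?S \<otimes> \<one>X)"
      by (simp add: LUnit_tensor)
    have k: "?b \<cdot> ((g \<cdot> LUnit C ?S) \<otimes> \<one>X) = (?e \<cdot> (g \<otimes> f)) \<cdot> (LUnit C ?S \<otimes> \<one>X)"
      by (simp add: TensA_Comp_arr)
    have "mutually_inverse C ((\<I> \<boxtimes> ?S) \<boxtimes> X) (?S \<boxtimes> X) (LUnit C ?S \<otimes> \<one>X) (LUnit_inv C ?S \<otimes> \<one>X)"
      by (simp add: mutually_inverse_def hom_iff TensA_Comp_arr)
    from iso_right_cancel[OF this, of "g \<cdot> ?d" "?e \<cdot> (g \<otimes> f)"]
    have "(g \<cdot> ?d) \<cdot> (LUnit C ?S \<otimes> \<one>X) = (?e \<cdot> (g \<otimes> f)) \<cdot> (LUnit C ?S \<otimes> \<one>X) \<Longrightarrow> g \<cdot> ?d = ?e \<cdot> (g \<otimes> f)"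
      by (simp del: Comp_assoc_arr)
    then have 2: "g \<cdot> ?d = ?e \<cdot> (g \<otimes> f) \<longleftrightarrow> (g \<cdot> LUnit C ?S) \<cdot> ?D = ?b \<cdot> ((g \<cdot> LUnit C ?S) \<otimes> \<one>X)"
      unfolding j k by metis
    have 3: "g \<cdot> LUnit C ?S \<in> hom C (\<I> \<boxtimes> ?S) ?R" by (simp add: hom_iff)
    show ?thesis unfolding is_S_map_def using 1 2 3 g by blast
  qed
  from ex1 obtain h where h: "h \<in> hom C (\<I> \<boxtimes> ?S) ?R" "h \<cdot> ?i = ?v \<cdot> (LUnit C \<I> \<cdot> RUnit_inv C \<I>)" "h \<cdot> ?D = ?b \<cdot> (h \<otimes> \<one>X)"
    by blast
  have hA: "h \<in> Arr C" "Dom C h = \<I> \<boxtimes> ?S" "Cod C h = ?R" using h(1) by (auto simp: hom_iff)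
  show ?thesis
  proof (rule ex1I[where a = "h \<cdot> LUnit_inv C ?S"])
    have "(h \<cdot> LUnit_inv C ?S) \<cdot> LUnit C ?S = h" using hA by simp
    moreover have "h \<cdot> LUnit_inv C ?S \<in> hom C ?S ?R" using hA by (simp add: hom_iff)
    ultimately show "is_S_map C S X Y f (h \<cdot> LUnit_inv C ?S)" using iff h by simp
    fix g assume g: "is_S_map C S X Y f g"
    then have gh: "g \<in> hom C ?S ?R" by (simp add: is_S_map_def)
    have "g \<cdot> LUnit C ?S = h" using iff[OF gh] g ex1 h by blast
    then have "(g \<cdot> LUnit C ?S) \<cdot> LUnit_inv C ?S = h \<cdot> LUnit_inv C ?S" by simp
    then show "g = h \<cdot> LUnit_inv C ?S" using gh by (simp add: hom_iff)
  qed
qed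

definition S_arr :: "'m \<Rightarrow> 'm" where
  "S_arr f = (THE g. is_S_map C S (Dom C f) (Cod C f) f g)"

lemma S_arr: "f \<in> hom C X Y \<Longrightarrow> is_S_map C S X Y f (S_arr f)"
  using theI'[OF S_map_ex1[of f X Y]] by (simp add: S_arr_def hom_iff)

lemma S_arr_eqI: "f \<in> hom C X Y \<Longrightarrow> is_S_map C S X Y f g \<Longrightarrow> S_arr f = g"
  using S_map_ex1 S_arr by blast

lemma S_arr_hom: "f \<in> hom C X Y \<Longrightarrow> S_arr f \<in> hom C (S_ob S X) (S_ob S Y)"
  using S_arr by (simp add: is_S_map_def)

lemma S_arr_Ident: "X \<in> Ob C \<Longrightarrow> S_arr (\<one>X) = \<one>(S_ob S X)"
  by (rule S_arr_eqI[of _ X X]) (use S_hom[of X] in \<open>auto simp: is_S_map_def hom_iff\<close>)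

lemma S_arr_Comp:
  assumes f: "f \<in> hom C X Y" and g: "g \<in> hom C Y Z"
  shows "S_arr (g \<cdot> f) = S_arr g \<cdot> S_arr f"
proof (rule S_arr_eqI[OF Comp_hom[OF f g]])
  have "X \<in> Ob C" "Y \<in> Ob C" "Z \<in> Ob C" using hom_Ob[OF f] hom_Ob[OF g] by auto
  note S_hom[OF this(1)] S_hom[OF this(2)] S_hom[OF this(3)]
  then have t: "S_unit S X \<in> Arr C" "Dom C (S_unit S X) = \<I>" "Cod C (S_unit S X) = S_ob S X"
    "S_deriv C S X \<in> Arr C" "Dom C (S_deriv C S X) = S_ob S X \<boxtimes> X" "Cod C (S_deriv C S X) = S_ob S X"
    "S_deriv C S Y \<in> Arr C" "Dom C (S_deriv C S Y) = S_ob S Y \<boxtimes> Y" "Cod C (S_deriv C S Y) = S_ob S Y"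
    "S_deriv C S Z \<in> Arr C" "Dom C (S_deriv C S Z) = S_ob S Z \<boxtimes> Z" "Cod C (S_deriv C S Z) = S_ob S Z"
    by (auto simp: hom_iff)
  have a: "f \<in> Arr C" "Dom C f = X" "Cod C f = Y" "g \<in> Arr C" "Dom C g = Y" "Cod C g = Z"
    "S_arr f \<in> Arr C" "Dom C (S_arr f) = S_ob S X" "Cod C (S_arr f) = S_ob S Y"
    "S_arr g \<in> Arr C" "Dom C (S_arr g) = S_ob S Y" "Cod C (S_arr g) = S_ob S Z"
    using f g S_arr_hom[OF f] S_arr_hom[OF g] by (auto simp: hom_iff)
  note [simp] = t a
  have e: "S_arr f \<cdot> S_unit S X = S_unit S Y" "S_arr g \<cdot> S_unit S Y = S_unit S Z"
    "S_arr f \<cdot> S_deriv C S X = S_deriv C S Y \<cdot> (S_arr f \<otimes> f)"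
    "S_arr g \<cdot> S_deriv C S Y = S_deriv C S Z \<cdot> (S_arr g \<otimes> g)"
    using S_arr[OF f] S_arr[OF g] by (auto simp: is_S_map_def)
  have "S_arr g \<cdot> (S_deriv C S Y \<cdot> (S_arr f \<otimes> f)) = S_deriv C S Z \<cdot> ((S_arr g \<cdot> S_arr f) \<otimes> (g \<cdot> f))"
    using Comp_eq_extend[OF e(4), of "S_arr f \<otimes> f"] by (simp add: TensA_Comp_arr)
  then show "is_S_map C S X Z (g \<cdot> f) (S_arr g \<cdot> S_arr f)"
    by (simp add: is_S_map_def hom_iff e)
qed

abbreviation K :: "'o \<Rightarrow> 'o" where "K X \<equiv> bang_ob T X"

text \<open>The functor, the unit and the deriving transformation. A prime marks the picture of the arrow of the
  same name.\<close>

definition P :: "'o \<Rightarrow> 'o" where "P X = K X \<boxtimes> S_ob S X"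

definition P_arr :: "'m \<Rightarrow> 'm" where "P_arr f = bang_arr T f \<otimes> S_arr f"

definition \<zeta> :: "'o \<Rightarrow> 'm" where "\<zeta> X = (\<one>(K X) \<otimes> S_unit S X) \<cdot> RUnit_inv C (K X)"

definition d :: "'o \<Rightarrow> 'm" where "d X = (\<one>(K X) \<otimes> S_deriv C S X) \<cdot> Assoc C (K X) (S_ob S X) X"

definition d' :: "'o \<Rightarrow> ('o, 'm) diagram" where "d' X = picture (\<langle>P X\<rangle> \<star> \<langle>X\<rangle>) (d X) \<langle>P X\<rangle>"

lemma K_Ob [simp]: "X \<in> Ob C \<Longrightarrow> K X \<in> Ob C"
  by (rule modality_hom(1)[OF T])

lemma P_Ob [simp]: "X \<in> Ob C \<Longrightarrow> P X \<in> Ob C"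
  by (simp add: P_def S_hom)

lemma P_arr_hom: "f \<in> hom C X Y \<Longrightarrow> P_arr f \<in> hom C (P X) (P Y)"
  unfolding P_arr_def P_def by (rule TensA_hom[OF modality_hom(2)[OF T] S_arr_hom])

lemma P_arr_Ident: "X \<in> Ob C \<Longrightarrow> P_arr (\<one>X) = \<one>(P X)"
  by (simp add: P_arr_def P_def S_arr_Ident modality_functor(1)[OF T] S_hom)

lemma P_arr_Comp: "f \<in> hom C X Y \<Longrightarrow> g \<in> hom C Y Z \<Longrightarrow> P_arr (g \<cdot> f) = P_arr g \<cdot> P_arr f"
  unfolding P_arr_def
  by (simp add: S_arr_Comp modality_functor(2)[OF T] TensA_Comp[OF modality_hom(2)[OF T] modality_hom(2)[OF T] S_arr_hom S_arr_hom])

lemma \<zeta>_hom: "X \<in> Ob C \<Longrightarrow> \<zeta> X \<in> hom C (K X) (P X)"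
  using S_hom[of X] by (simp add: \<zeta>_def P_def hom_iff)

lemma d_hom: "X \<in> Ob C \<Longrightarrow> d X \<in> hom C (P X \<boxtimes> X) (P X)"
  using S_hom[of X] by (simp add: d_def P_def hom_iff)

lemma rep_\<zeta>: "X \<in> Ob C \<Longrightarrow> rep (\<zeta> X) \<langle>K X\<rangle> \<langle>P X\<rangle> (box (\<zeta> X))"
  by (rule rep_box[OF \<zeta>_hom])

lemma rep_d: "X \<in> Ob C \<Longrightarrow> rep (d X) (\<langle>P X\<rangle> \<star> \<langle>X\<rangle>) \<langle>P X\<rangle> (d' X)"
  unfolding d'_def by (rule rep_picture) (simp_all add: d_hom)

lemma P_free:
  assumes "X \<in> Ob C"
  shows "free_commuting_action C X (K X) (P X) (box (\<zeta> X)) (d' X) (\<zeta> X) (d X)"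
proof unfold_locales
  show "free_action X (K X) (P X) (\<zeta> X) (d X)"
    unfolding P_def \<zeta>_def d_def S_deriv_def by (rule free_action_tensor[OF assms K_Ob[OF assms] S_data[OF assms]])
qed (use biproducts rep_\<zeta> rep_d assms in auto)

lemma \<zeta>_natural:
  assumes f: "f \<in> hom C X Y"
  shows "box (P_arr f) \<bullet> box (\<zeta> X) = box (\<zeta> Y) \<bullet> box (bang_arr T f)"
proof -
  have [simp]: "X \<in> Ob C" "Y \<in> Ob C" using hom_Ob[OF f] by auto
  note [simp] = S_hom(1)
  let ?t = "bang_arr T f" and ?s = "S_arr f"
  note t = rep_box[OF modality_hom(2)[OF T f]] and s = rep_box[OF S_arr_hom[OF f]]
  obtain u v where u: "rep (S_unit S X) Null \<langle>S_ob S X\<rangle> u" and v: "rep (S_unit S Y) Null \<langle>S_ob S Y\<rangle> v"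
    using rep_exists[of "S_unit S X" Null "\<langle>S_ob S X\<rangle>"] rep_exists[of "S_unit S Y" Null "\<langle>S_ob S Y\<rangle>"] S_hom(2) by auto
  note [simp] = rep_simps[OF t] rep_simps[OF s] rep_simps[OF u] rep_simps[OF v]
  have su: "box ?s \<bullet> u = v"
    using rep_unique[OF rep_Comp[OF u s]] v S_arr[OF f] by (simp add: is_S_map_def)
  have su': "beside [K X] (box ?s) [] \<bullet> beside [K X] u [] = beside [K X] v []"
    using beside_seq[of "[K X]" "box ?s" u "[]"] by (simp add: su)
  have "P_arr f \<cdot> \<zeta> X = \<zeta> Y \<cdot> ?t"
  proof (rule rep_faithful)
    show "rep (P_arr f \<cdot> \<zeta> X) \<langle>K X\<rangle> (\<langle>K Y\<rangle> \<star> \<langle>S_ob S Y\<rangle>) (beside [] (box ?t) [S_ob S Y] \<bullet> beside [K X] v [])"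
      unfolding su'[symmetric] P_arr_def \<zeta>_def
      by (rule rep_cong, (rule t s u rep_rules | (simp; fail))+)
    have i: "beside [K Y] v [] \<bullet> box ?t = beside [] (box ?t) [S_ob S Y] \<bullet> beside [K X] v []"
      using interchange[of "[]" "box ?t" "[]" v "[]"] by simp
    show "rep (\<zeta> Y \<cdot> ?t) \<langle>K X\<rangle> (\<langle>K Y\<rangle> \<star> \<langle>S_ob S Y\<rangle>) (beside [] (box ?t) [S_ob S Y] \<bullet> beside [K X] v [])"
      unfolding i[symmetric] \<zeta>_def
      by (rule rep_cong, (rule t v rep_rules | (simp; fail))+)
  qed
  then show ?thesis
    using box_Comp[OF \<zeta>_hom P_arr_hom[OF f]] box_Comp[OF modality_hom(2)[OF T f] \<zeta>_hom] by simp
qed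

lemma d_natural_arr:
  assumes f: "f \<in> hom C X Y"
  shows "P_arr f \<cdot> d X = d Y \<cdot> (P_arr f \<otimes> f)"
proof -
  have [simp]: "X \<in> Ob C" "Y \<in> Ob C" using hom_Ob[OF f] by auto
  note [simp] = S_hom(1)
  let ?t = "bang_arr T f" and ?s = "S_arr f"
  note t = rep_box[OF modality_hom(2)[OF T f]] and s = rep_box[OF S_arr_hom[OF f]] and ff = rep_box[OF f]
  obtain a b where a: "rep (S_deriv C S X) (\<langle>S_ob S X\<rangle> \<star> \<langle>X\<rangle>) \<langle>S_ob S X\<rangle> a"
    and b: "rep (S_deriv C S Y) (\<langle>S_ob S Y\<rangle> \<star> \<langle>Y\<rangle>) \<langle>S_ob S Y\<rangle> b"
    using rep_exists[of "S_deriv C S X" "\<langle>S_ob S X\<rangle> \<star> \<langle>X\<rangle>" "\<langle>S_ob S X\<rangle>"]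
      rep_exists[of "S_deriv C S Y" "\<langle>S_ob S Y\<rangle> \<star> \<langle>Y\<rangle>" "\<langle>S_ob S Y\<rangle>"] S_hom(4) by auto
  note [simp] = rep_simps[OF t] rep_simps[OF s] rep_simps[OF a] rep_simps[OF b] rep_simps[OF ff]
  have "box ?s \<bullet> a = b \<bullet> (beside [] (box ?s) [Y] \<bullet> beside [S_ob S X] (box f) [])"
    using rep_unique[OF rep_Comp[OF a s]] rep_Comp[OF rep_tensor[OF s ff] b] S_arr[OF f] by (simp add: is_S_map_def)
  then have sa: "beside [K X] (box ?s) [] \<bullet> beside [K X] a []
    = beside [K X] b [] \<bullet> (beside [K X] (box ?s) [Y] \<bullet> beside [K X, S_ob S X] (box f) [])"
    using beside_seq[of "[K X]" "box ?s" a "[]"] by simp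
  show ?thesis
  proof (rule rep_faithful)
    show "rep (P_arr f \<cdot> d X) (\<langle>K X\<rangle> \<star> \<langle>S_ob S X\<rangle> \<star> \<langle>X\<rangle>) (\<langle>K Y\<rangle> \<star> \<langle>S_ob S Y\<rangle>)
      (beside [] (box ?t) [S_ob S Y] \<bullet> (beside [K X] (box ?s) [] \<bullet> beside [K X] a []))"
      unfolding P_arr_def d_def
      by (rule rep_cong, (rule t s a rep_rules | (simp; fail))+)
    have i: "beside [K Y] b [] \<bullet> beside [] (box ?t) [S_ob S Y, Y] = beside [] (box ?t) [S_ob S Y] \<bullet> beside [K X] b []"
      using interchange[of "[]" "box ?t" "[]" b "[]"] by simp
    have "rep (d Y \<cdot> (P_arr f \<otimes> f)) (\<langle>K X\<rangle> \<star> \<langle>S_ob S X\<rangle> \<star> \<langle>X\<rangle>) (\<langle>K Y\<rangle> \<star> \<langle>S_ob S Y\<rangle>)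
      (beside [K Y] b [] \<bullet> (beside [] (box ?t) [S_ob S Y, Y] \<bullet> (beside [K X] (box ?s) [Y] \<bullet> beside [K X, S_ob S X] (box f) [])))"
      unfolding P_arr_def d_def
      by (rule rep_cong, (rule t s b ff rep_rules | (simp; fail))+)
    then show "rep (d Y \<cdot> (P_arr f \<otimes> f)) (\<langle>K X\<rangle> \<star> \<langle>S_ob S X\<rangle> \<star> \<langle>X\<rangle>) (\<langle>K Y\<rangle> \<star> \<langle>S_ob S Y\<rangle>)
      (beside [] (box ?t) [S_ob S Y] \<bullet> (beside [K X] (box ?s) [] \<bullet> beside [K X] a []))"
      by (simp add: sa i[THEN seq_eq_extend])
  qed
qed

lemma d_natural:
  assumes f: "f \<in> hom C X Y"
  shows "box (P_arr f) \<bullet> d' X = d' Y \<bullet> (beside [] (box (P_arr f)) [Y] \<bullet> beside [P X] (box f) [])"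
proof -
  have o: "X \<in> Ob C" "Y \<in> Ob C" using hom_Ob[OF f] by auto
  note p = rep_box[OF P_arr_hom[OF f]]
  show ?thesis
    using rep_unique[OF rep_Comp[OF rep_d[OF o(1)] p]] rep_Comp[OF rep_tensor[OF p rep_box[OF f]] rep_d[OF o(2)]]
    by (simp add: d_natural_arr[OF f])
qed

subsection \<open>The comonoid structure\<close>

definition e :: "'o \<Rightarrow> 'm" where
  "e X = (THE h. h \<in> hom C (P X) \<I> \<and> h \<cdot> \<zeta> X = counit T X \<and> constant_rule C X (P X) (d X) h)"

definition \<Delta> :: "'o \<Rightarrow> 'm" where
  "\<Delta> X = (THE h. h \<in> hom C (P X) (P X \<boxtimes> P X) \<and> h \<cdot> \<zeta> X = (\<zeta> X \<otimes> \<zeta> X) \<cdot> comult T X \<and> product_rule C X (P X) (d X) h)"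

definition e' :: "'o \<Rightarrow> ('o, 'm) diagram" where "e' X = picture \<langle>P X\<rangle> (e X) Null"

definition \<Delta>' :: "'o \<Rightarrow> ('o, 'm) diagram" where "\<Delta>' X = picture \<langle>P X\<rangle> (\<Delta> X) (\<langle>P X\<rangle> \<star> \<langle>P X\<rangle>)"

lemma eq_The_iff: "\<exists>!h. Q h \<Longrightarrow> Q h \<longleftrightarrow> h = (THE h. Q h)"
  by (metis theI')

text \<open>The maps constructed by extending the comonoid \<open>!X\<close> satisfy the descriptions. They are the only ones:
  \<open>\<zeta>\<close> and \<open>d\<close> are jointly epimorphic, and the product rule is an equivariance.\<close>

lemma comonoid_structure:
  assumes X: "X \<in> Ob C"
  shows e_iff: "h \<in> hom C (P X) \<I> \<and> h \<cdot> \<zeta> X = counit T X \<and> constant_rule C X (P X) (d X) h \<longleftrightarrow> h = e X"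
    and \<Delta>_iff: "h \<in> hom C (P X) (P X \<boxtimes> P X) \<and> h \<cdot> \<zeta> X = (\<zeta> X \<otimes> \<zeta> X) \<cdot> comult T X \<and>
      product_rule C X (P X) (d X) h \<longleftrightarrow> h = \<Delta> X"
    and rep_e: "rep (e X) \<langle>P X\<rangle> Null (e' X)" and rep_\<Delta>: "rep (\<Delta> X) \<langle>P X\<rangle> (\<langle>P X\<rangle> \<star> \<langle>P X\<rangle>) (\<Delta>' X)"
    and P_comonoid: "free_differential_comonoid C X (K X) (P X) (box (\<zeta> X)) (d' X) (\<zeta> X) (d X) (e' X) (\<Delta>' X)
      (delete T X) (duplicate T X)"
proof -
  interpret free_commuting_action C X "K X" "P X" "box (\<zeta> X)" "d' X" "\<zeta> X" "d X" by (rule P_free[OF X])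
  obtain e0 D0 ee D where ee: "rep e0 \<langle>P X\<rangle> Null ee" "rep D0 \<langle>P X\<rangle> (\<langle>P X\<rangle> \<star> \<langle>P X\<rangle>) D" "ee \<bullet> box (\<zeta> X) = delete T X"
    "D \<bullet> box (\<zeta> X) = beside [] (box (\<zeta> X)) [P X] \<bullet> (beside [K X] (box (\<zeta> X)) [] \<bullet> duplicate T X)"
    "differential_comonoid C X (P X) ee D (d' X) (d X)"
    by (rule comonoid_extension[OF modality_comonoid[OF T X]])
  interpret dc: differential_comonoid C X "P X" ee D "d' X" "d X" by (rule ee(5))
  note rT = rep_delete[OF T X] rep_duplicate[OF T X] and r = rep_\<zeta>[OF X] rep_d[OF X]
  let ?Q = "\<lambda>h. h \<in> hom C (P X) \<I> \<and> h \<cdot> \<zeta> X = counit T X \<and> constant_rule C X (P X) (d X) h"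
  let ?R = "\<lambda>h. h \<in> hom C (P X) (P X \<boxtimes> P X) \<and> h \<cdot> \<zeta> X = (\<zeta> X \<otimes> \<zeta> X) \<cdot> comult T X \<and> product_rule C X (P X) (d X) h"
  have Q: "?Q h \<longleftrightarrow> h' \<bullet> box (\<zeta> X) = delete T X \<and> h' \<bullet> d' X = none [P X, X] []" if h: "rep h \<langle>P X\<rangle> Null h'" for h h'
  proof -
    have "h \<in> hom C (P X) \<I>" using rep_simps[OF h] by (simp add: hom_iff)
    moreover have "h \<cdot> \<zeta> X = counit T X \<longleftrightarrow> h' \<bullet> box (\<zeta> X) = delete T X"
      by (rule rep_eq_iff[OF rep_Comp[OF r(1) h] rT(1)])
    ultimately show ?thesis using constant_rule_iff[OF r(2) h] by simp
  qed
  have \<zeta>\<zeta>: "rep ((\<zeta> X \<otimes> \<zeta> X) \<cdot> comult T X) \<langle>K X\<rangle> (\<langle>P X\<rangle> \<star> \<langle>P X\<rangle>)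
      (beside [] (box (\<zeta> X)) [P X] \<bullet> (beside [K X] (box (\<zeta> X)) [] \<bullet> duplicate T X))"
    using rep_Comp[OF rT(2) rep_tensor[OF r(1) r(1)]] by simp
  have R: "?R h \<longleftrightarrow> h' \<bullet> box (\<zeta> X) = beside [] (box (\<zeta> X)) [P X] \<bullet> (beside [K X] (box (\<zeta> X)) [] \<bullet> duplicate T X) \<and>
      h' \<bullet> d' X = leibniz X (d' X) (d' X) \<bullet> beside [] h' [X]" if h: "rep h \<langle>P X\<rangle> (\<langle>P X\<rangle> \<star> \<langle>P X\<rangle>) h'" for h h'
  proof -
    have "h \<in> hom C (P X) (P X \<boxtimes> P X)" using rep_simps[OF h] by (simp add: hom_iff)
    moreover have "h \<cdot> \<zeta> X = (\<zeta> X \<otimes> \<zeta> X) \<cdot> comult T X \<longleftrightarrow> h' \<bullet> box (\<zeta> X) = beside [] (box (\<zeta> X)) [P X] \<bullet> (beside [K X] (box (\<zeta> X)) [] \<bullet> duplicate T X)"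
      by (rule rep_eq_iff[OF rep_Comp[OF r(1) h] \<zeta>\<zeta>])
    ultimately show ?thesis using product_rule_iff[OF r(2) h] by simp
  qed
  have Q0: "?Q e0" using Q[OF ee(1)] ee(3) dc.d_constant by blast
  have R0: "?R D0" using R[OF ee(2)] ee(4) dc.d_product by blast
  have exQ: "\<exists>!h. ?Q h"
  proof (rule ex1I[where a = e0], rule Q0)
    fix h assume h: "?Q h"
    then obtain h' where h': "rep h \<langle>P X\<rangle> Null h'" using rep_exists[of h "\<langle>P X\<rangle>" Null] X by auto
    have "h' = ee" using h ee(3) dc.d_constant unfolding Q[OF h'] by (intro joint_epi[OF h' ee(1)]) simp_all
    then show "h = e0" using rep_faithful h' ee(1) by blast
  qed
  have exR: "\<exists>!h. ?R h"
  proof (rule ex1I[where a = D0], rule R0)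
    fix h assume h: "?R h"
    then obtain h' where h': "rep h \<langle>P X\<rangle> (\<langle>P X\<rangle> \<star> \<langle>P X\<rangle>) h'" using rep_exists[of h "\<langle>P X\<rangle>" "\<langle>P X\<rangle> \<star> \<langle>P X\<rangle>"] X by auto
    note hR = h[unfolded R[OF h']]
    have "h' = D"
    proof (rule equivariant_unique)
      show "rep (leibniz_arrow X (P X) (d X) (P X) (d X)) (\<langle>P X\<rangle> \<star> \<langle>P X\<rangle> \<star> \<langle>X\<rangle>) (\<langle>P X\<rangle> \<star> \<langle>P X\<rangle>) (leibniz X (d' X) (d' X))"
        by (rule rep_leibniz[OF r(2) r(2)]) simp_all
      show "commuting X (leibniz X (d' X) (d' X))"
        by (rule commuting_leibniz[OF action_commuting action_commuting r(2)])
    qed (use hR ee h' dc.d_product in simp_all)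
    then show "h = D0" using rep_faithful h' ee(2) by blast
  qed
  show e1: "?Q h \<longleftrightarrow> h = e X" for h unfolding e_def by (rule eq_The_iff[OF exQ])
  show D1: "?R h \<longleftrightarrow> h = \<Delta> X" for h unfolding \<Delta>_def by (rule eq_The_iff[OF exR])
  have "e X = e0" "\<Delta> X = D0" using e1 D1 Q0 R0 by auto
  then have ed: "e' X = ee" "\<Delta>' X = D" using ee(1,2) by (simp_all add: e'_def \<Delta>'_def rep_def)
  show "rep (e X) \<langle>P X\<rangle> Null (e' X)" "rep (\<Delta> X) \<langle>P X\<rangle> (\<langle>P X\<rangle> \<star> \<langle>P X\<rangle>) (\<Delta>' X)"
    using ee(1,2) ed \<open>e X = e0\<close> \<open>\<Delta> X = D0\<close> by simp_all
  show "free_differential_comonoid C X (K X) (P X) (box (\<zeta> X)) (d' X) (\<zeta> X) (d X) (e' X) (\<Delta>' X) (delete T X) (duplicate T X)"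
    unfolding ed by unfold_locales (use ee(3,4) modality_comonoid[OF T X] in simp_all)
qed

subsection \<open>The comonad structure\<close>

definition \<epsilon> :: "'o \<Rightarrow> 'm" where
  "\<epsilon> X = (THE h. h \<in> hom C (P X) X \<and> h \<cdot> \<zeta> X = dereliction T X \<and> linear_rule C X (d X) (e X) h)"

definition \<delta> :: "'o \<Rightarrow> 'm" where
  "\<delta> X = (THE h. h \<in> hom C (P X) (P (P X)) \<and> h \<cdot> \<zeta> X = (\<zeta> (P X) \<cdot> bang_arr T (\<zeta> X)) \<cdot> digging T X \<and>
     chain_rule C X (P X) (d X) (d (P X)) (\<Delta> X) h)"

text \<open>The linear rule prescribes \<open>\<epsilon> \<circ> d\<close>, so \<open>\<epsilon>\<close> is defined by primitive recursion; the constant rule makes the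
  prescribed value trivially symmetric. For \<open>\<delta>\<close>, the chain lemmas are applied to the action of \<open>P X\<close> on
  \<open>P (P X)\<close> by the deriving transformation itself.\<close>

lemma comonad_structure:
  assumes X: "X \<in> Ob C"
  shows \<epsilon>_iff: "h \<in> hom C (P X) X \<and> h \<cdot> \<zeta> X = dereliction T X \<and> linear_rule C X (d X) (e X) h \<longleftrightarrow> h = \<epsilon> X"
    and \<delta>_iff: "h \<in> hom C (P X) (P (P X)) \<and> h \<cdot> \<zeta> X = (\<zeta> (P X) \<cdot> bang_arr T (\<zeta> X)) \<cdot> digging T X \<and>
      chain_rule C X (P X) (d X) (d (P X)) (\<Delta> X) h \<longleftrightarrow> h = \<delta> X"
proof -
  interpret free_differential_comonoid C X "K X" "P X" "box (\<zeta> X)" "d' X" "\<zeta> X" "d X" "e' X" "\<Delta>' X" "delete T X" "duplicate T X"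
    by (rule P_comonoid[OF X])
  note rT = modality_hom(3,4)[OF T X] and r = rep_\<zeta>[OF X] rep_d[OF X] rep_e[OF X] rep_\<Delta>[OF X]
  note z2 = Comp_hom[OF modality_hom(2)[OF T \<zeta>_hom[OF X]] \<zeta>_hom[OF P_Ob[OF X]]]
  note z3 = Comp_hom[OF rT(2) z2]
  let ?Q = "\<lambda>h. h \<in> hom C (P X) X \<and> h \<cdot> \<zeta> X = dereliction T X \<and> linear_rule C X (d X) (e X) h"
  let ?R = "\<lambda>h. h \<in> hom C (P X) (P (P X)) \<and> h \<cdot> \<zeta> X = (\<zeta> (P X) \<cdot> bang_arr T (\<zeta> X)) \<cdot> digging T X \<and>
     chain_rule C X (P X) (d X) (d (P X)) (\<Delta> X) h"
  have Q: "?Q h \<longleftrightarrow> h' \<bullet> box (\<zeta> X) = box (dereliction T X) \<and> h' \<bullet> d' X = beside [] (e' X) [X]" if h: "rep h \<langle>P X\<rangle> \<langle>X\<rangle> h'" for h h'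
  proof -
    have "h \<in> hom C (P X) X" using rep_simps[OF h] by (simp add: hom_iff)
    moreover have "h \<cdot> \<zeta> X = dereliction T X \<longleftrightarrow> h' \<bullet> box (\<zeta> X) = box (dereliction T X)"
      by (rule rep_eq_iff[OF rep_Comp[OF r(1) h] rep_box[OF rT(1)]])
    ultimately show ?thesis using linear_rule_iff[OF r(2,3) h] by simp
  qed
  have R: "?R h \<longleftrightarrow> h' \<bullet> box (\<zeta> X) = box ((\<zeta> (P X) \<cdot> bang_arr T (\<zeta> X)) \<cdot> digging T X) \<and> chain (d' (P X)) h'"
    if h: "rep h \<langle>P X\<rangle> \<langle>P (P X)\<rangle> h'" for h h'
  proof -
    have "h \<in> hom C (P X) (P (P X))" using rep_simps[OF h] by (simp add: hom_iff)
    moreover have "h \<cdot> \<zeta> X = (\<zeta> (P X) \<cdot> bang_arr T (\<zeta> X)) \<cdot> digging T X \<longleftrightarrow> h' \<bullet> box (\<zeta> X) = box ((\<zeta> (P X) \<cdot> bang_arr T (\<zeta> X)) \<cdot> digging T X)"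
      by (rule rep_eq_iff[OF rep_Comp[OF r(1) h] rep_box[OF z3]])
    ultimately show ?thesis using chain_rule_iff[OF r(2) rep_d[OF P_Ob[OF X]] r(4) h] rep_simps[OF h] by (simp add: chain_def)
  qed
  have ed: "beside [] (e' X) [X] \<bullet> beside [] (d' X) [X] = none [P X, X, X] [X]"
    using beside_seq[of "[]" "e' X" "d' X" "[X]"] X by (simp add: d_constant)
  have re: "rep (LUnit C X \<cdot> (e X \<otimes> \<one>X)) (\<langle>P X\<rangle> \<star> \<langle>X\<rangle>) \<langle>X\<rangle> (beside [] (e' X) [X])"
    by (rule rep_cong, (rule r(3) rep_rules | (simp add: X; fail))+)
  have es: "beside [] (e' X) [X] \<bullet> (beside [] (d' X) [X] \<bullet> beside [P X] (cross X X) []) = beside [] (e' X) [X] \<bullet> beside [] (d' X) [X]"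
    using X by (simp add: ed[THEN seq_eq_extend] ed)
  from recursion_exists[OF re es rep_box[OF rT(1)]] obtain h0 h where
    h: "rep h0 \<langle>P X\<rangle> \<langle>X\<rangle> h" "h \<bullet> box (\<zeta> X) = box (dereliction T X)" "h \<bullet> d' X = beside [] (e' X) [X]" by blast
  have exQ: "\<exists>!h. ?Q h"
  proof (rule ex1I[where a = h0])
    show "?Q h0" using Q[OF h(1)] h(2,3) by blast
    fix k assume k: "?Q k"
    then obtain k' where k': "rep k \<langle>P X\<rangle> \<langle>X\<rangle> k'" using rep_exists[of k "\<langle>P X\<rangle>" "\<langle>X\<rangle>"] X by auto
    have "k' = h" using k h(2,3) unfolding Q[OF k'] by (intro joint_epi[OF k' h(1)]) simp_all
    then show "k = h0" using rep_faithful k' h(1) by blast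
  qed
  then show "?Q h \<longleftrightarrow> h = \<epsilon> X" for h unfolding \<epsilon>_def by (rule eq_The_iff)
  note c = rep_d[OF P_Ob[OF X]] free_commuting_action.action_commuting[OF P_free[OF P_Ob[OF X]]]
  from chain_exists[OF c rep_box[OF z3]] obtain g0 g where
    g: "rep g0 \<langle>P X\<rangle> \<langle>P (P X)\<rangle> g" "g \<bullet> box (\<zeta> X) = box ((\<zeta> (P X) \<cdot> bang_arr T (\<zeta> X)) \<cdot> digging T X)" "chain (d' (P X)) g" by blast
  have exR: "\<exists>!h. ?R h"
  proof (rule ex1I[where a = g0])
    show "?R g0" using R[OF g(1)] g(2,3) by blast
    fix k assume k: "?R k"
    then obtain k' where k': "rep k \<langle>P X\<rangle> \<langle>P (P X)\<rangle> k'" using rep_exists[of k "\<langle>P X\<rangle>" "\<langle>P (P X)\<rangle>"] X by auto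
    have "k' = g" using k g(2,3) unfolding R[OF k'] by (intro chain_unique[OF c k' _ g(1)]) simp_all
    then show "k = g0" using rep_faithful k' g(1) by blast
  qed
  then show "?R h \<longleftrightarrow> h = \<delta> X" for h unfolding \<delta>_def by (rule eq_The_iff)
qed

end

section \<open>The free differential modality\<close>

context free_modality_data
begin

definition free_modality :: "('o, 'm) diff_mod" where
  "free_modality = \<lparr>bang_ob = P, bang_arr = P_arr, dereliction = \<epsilon>, digging = \<delta>, counit = e, comult = \<Delta>, deriv = d\<rparr>"

lemma free_modality_sel [simp]:
  "bang_ob free_modality = P" "bang_arr free_modality = P_arr" "dereliction free_modality = \<epsilon>"
  "digging free_modality = \<delta>" "counit free_modality = e" "comult free_modality = \<Delta>" "deriv free_modality = d"
  by (simp_all add: free_modality_def)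

lemma \<zeta>_sel: "X \<in> Ob C \<Longrightarrow> good (box (\<zeta> X))" "X \<in> Ob C \<Longrightarrow> ins (box (\<zeta> X)) = [K X]" "X \<in> Ob C \<Longrightarrow> outs (box (\<zeta> X)) = [P X]"
  using box_sel[OF \<zeta>_hom] by auto

lemma d'_sel: "X \<in> Ob C \<Longrightarrow> good (d' X)" "X \<in> Ob C \<Longrightarrow> ins (d' X) = [P X, X]" "X \<in> Ob C \<Longrightarrow> outs (d' X) = [P X]"
  using rep_simps[OF rep_d] by auto

lemma e'_sel: "X \<in> Ob C \<Longrightarrow> good (e' X)" "X \<in> Ob C \<Longrightarrow> ins (e' X) = [P X]" "X \<in> Ob C \<Longrightarrow> outs (e' X) = []"
  using rep_simps[OF rep_e] by auto

lemma \<Delta>'_sel: "X \<in> Ob C \<Longrightarrow> good (\<Delta>' X)" "X \<in> Ob C \<Longrightarrow> ins (\<Delta>' X) = [P X]" "X \<in> Ob C \<Longrightarrow> outs (\<Delta>' X) = [P X, P X]"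
  using rep_simps[OF rep_\<Delta>] by auto

lemma \<epsilon>_hom: "X \<in> Ob C \<Longrightarrow> \<epsilon> X \<in> hom C (P X) X"
  and \<delta>_hom: "X \<in> Ob C \<Longrightarrow> \<delta> X \<in> hom C (P X) (P (P X))"
  using \<epsilon>_iff[of X "\<epsilon> X"] \<delta>_iff[of X "\<delta> X"] by auto

lemma \<epsilon>_sel: "X \<in> Ob C \<Longrightarrow> good (box (\<epsilon> X))" "X \<in> Ob C \<Longrightarrow> ins (box (\<epsilon> X)) = [P X]" "X \<in> Ob C \<Longrightarrow> outs (box (\<epsilon> X)) = [X]"
  using box_sel[OF \<epsilon>_hom] by auto

lemma \<delta>_sel: "X \<in> Ob C \<Longrightarrow> good (box (\<delta> X))" "X \<in> Ob C \<Longrightarrow> ins (box (\<delta> X)) = [P X]" "X \<in> Ob C \<Longrightarrow> outs (box (\<delta> X)) = [P (P X)]"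
  using box_sel[OF \<delta>_hom] by auto

lemmas sels = \<zeta>_sel d'_sel e'_sel \<Delta>'_sel \<epsilon>_sel \<delta>_sel

lemma d'_commuting: "X \<in> Ob C \<Longrightarrow> commuting X (d' X)"
  using free_commuting_action.action_commuting[OF P_free] .

lemma e'_eqs:
  assumes "X \<in> Ob C"
  shows "e' X \<bullet> box (\<zeta> X) = delete T X" "e' X \<bullet> d' X = none [P X, X] []"
  using free_differential_comonoid.e_base[OF P_comonoid[OF assms]]
    differential_comonoid.d_constant[OF free_differential_comonoid.axioms(2)[OF P_comonoid[OF assms]]] by auto

lemma \<Delta>'_eqs:
  assumes "X \<in> Ob C"
  shows "\<Delta>' X \<bullet> box (\<zeta> X) = beside [] (box (\<zeta> X)) [P X] \<bullet> (beside [K X] (box (\<zeta> X)) [] \<bullet> duplicate T X)"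
    "\<Delta>' X \<bullet> d' X = leibniz X (d' X) (d' X) \<bullet> beside [] (\<Delta>' X) [X]"
  using free_differential_comonoid.D_base[OF P_comonoid[OF assms]]
    differential_comonoid.d_product[OF free_differential_comonoid.axioms(2)[OF P_comonoid[OF assms]]] by auto

lemma \<epsilon>_eqs:
  assumes X: "X \<in> Ob C"
  shows "box (\<epsilon> X) \<bullet> box (\<zeta> X) = box (dereliction T X)" "box (\<epsilon> X) \<bullet> d' X = beside [] (e' X) [X]"
proof -
  have h: "\<epsilon> X \<cdot> \<zeta> X = dereliction T X" "linear_rule C X (d X) (e X) (\<epsilon> X)"
    using \<epsilon>_iff[OF X, of "\<epsilon> X"] by auto
  show "box (\<epsilon> X) \<bullet> box (\<zeta> X) = box (dereliction T X)"
    using box_Comp[OF \<zeta>_hom[OF X] \<epsilon>_hom[OF X]] h(1) by simp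
  show "box (\<epsilon> X) \<bullet> d' X = beside [] (e' X) [X]"
    using h(2) linear_rule_iff[OF rep_d[OF X] rep_e[OF X] rep_box[OF \<epsilon>_hom[OF X]]] by simp
qed

lemma \<delta>_eqs:
  assumes X: "X \<in> Ob C"
  shows "box (\<delta> X) \<bullet> box (\<zeta> X) = box (\<zeta> (P X)) \<bullet> (box (bang_arr T (\<zeta> X)) \<bullet> box (digging T X))"
    "box (\<delta> X) \<bullet> d' X = d' (P X) \<bullet> (beside [P (P X)] (d' X) [] \<bullet>
      (beside [] (box (\<delta> X)) [P X, X] \<bullet> beside [] (\<Delta>' X) [X]))"
proof -
  have h: "\<delta> X \<cdot> \<zeta> X = (\<zeta> (P X) \<cdot> bang_arr T (\<zeta> X)) \<cdot> digging T X" "chain_rule C X (P X) (d X) (d (P X)) (\<Delta> X) (\<delta> X)"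
    using \<delta>_iff[OF X, of "\<delta> X"] by auto
  note t = modality_hom(2)[OF T \<zeta>_hom[OF X]] \<zeta>_hom[OF P_Ob[OF X]]
  have "box ((\<zeta> (P X) \<cdot> bang_arr T (\<zeta> X)) \<cdot> digging T X) = (box (\<zeta> (P X)) \<bullet> box (bang_arr T (\<zeta> X))) \<bullet> box (digging T X)"
    using box_Comp[OF modality_hom(4)[OF T X] Comp_hom[OF t]] box_Comp[OF t] by simp
  then show "box (\<delta> X) \<bullet> box (\<zeta> X) = box (\<zeta> (P X)) \<bullet> (box (bang_arr T (\<zeta> X)) \<bullet> box (digging T X))"
    using box_Comp[OF \<zeta>_hom[OF X] \<delta>_hom[OF X]] h(1) by simp
  show "box (\<delta> X) \<bullet> d' X = d' (P X) \<bullet> (beside [P (P X)] (d' X) [] \<bullet>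
      (beside [] (box (\<delta> X)) [P X, X] \<bullet> beside [] (\<Delta>' X) [X]))"
    using h(2) chain_rule_iff[OF rep_d[OF X] rep_d[OF P_Ob[OF X]] rep_\<Delta>[OF X] rep_box[OF \<delta>_hom[OF X]]] by simp
qed

subsection \<open>Uniqueness principles\<close>

text \<open>Every law below compares two maps out of \<open>P X\<close>. On generators, that is, after composition with \<open>\<zeta>\<close>, it
  follows from the same law for the given modality. How the two sides behave after composition with \<open>d\<close>
  decides which of the following three principles applies: a common value, a common action, or a common
  chain rule.\<close>

lemma P_joint_epi:
  assumes "X \<in> Ob C" "rep h0 \<langle>P X\<rangle> t h" "rep k0 \<langle>P X\<rangle> t k" "h \<bullet> box (\<zeta> X) = k \<bullet> box (\<zeta> X)" "h \<bullet> d' X = k \<bullet> d' X"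
  shows "h = k"
  by (rule free_commuting_action.joint_epi[OF P_free[OF assms(1)] assms(2-5)])

lemma P_equivariant_unique:
  assumes "X \<in> Ob C" "rep b0 (t \<star> \<langle>X\<rangle>) t b" "commuting X b" "rep h0 \<langle>P X\<rangle> t h" "rep k0 \<langle>P X\<rangle> t k"
    "h \<bullet> box (\<zeta> X) = k \<bullet> box (\<zeta> X)" "h \<bullet> d' X = b \<bullet> beside [] h [X]" "k \<bullet> d' X = b \<bullet> beside [] k [X]"
  shows "h = k"
  by (rule free_commuting_action.equivariant_unique[OF P_free[OF assms(1)] assms(2,3,4,7,5,8,6)])

lemma P_chain_unique:
  assumes "X \<in> Ob C" "rep c0 (\<langle>Z\<rangle> \<star> \<langle>P X\<rangle>) \<langle>Z\<rangle> c" "commuting (P X) c" "rep h0 \<langle>P X\<rangle> \<langle>Z\<rangle> h" "rep k0 \<langle>P X\<rangle> \<langle>Z\<rangle> k"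
    "h \<bullet> box (\<zeta> X) = k \<bullet> box (\<zeta> X)"
    "h \<bullet> d' X = c \<bullet> (beside [Z] (d' X) [] \<bullet> (beside [] h [P X, X] \<bullet> beside [] (\<Delta>' X) [X]))"
    "k \<bullet> d' X = c \<bullet> (beside [Z] (d' X) [] \<bullet> (beside [] k [P X, X] \<bullet> beside [] (\<Delta>' X) [X]))"
  shows "h = k"
proof -
  interpret free_differential_comonoid C X "K X" "P X" "box (\<zeta> X)" "d' X" "\<zeta> X" "d X" "e' X" "\<Delta>' X" "delete T X" "duplicate T X"
    by (rule P_comonoid[OF assms(1)])
  show ?thesis
    by (rule chain_unique[OF assms(2,3,4) _ assms(5) _ assms(6)])
      (use assms(7,8) rep_simps[OF assms(4)] rep_simps[OF assms(5)] in \<open>simp_all add: chain_def\<close>)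
qed

subsection \<open>Naturality\<close>

context
  fixes f X Y assumes f: "f \<in> hom C X Y"
begin

lemma nat_Ob [simp]: "X \<in> Ob C" "Y \<in> Ob C"
  using hom_Ob[OF f] by auto

lemma nat_sel [simp]:
  "good (box f)" "ins (box f) = [X]" "outs (box f) = [Y]"
  "good (box (P_arr f))" "ins (box (P_arr f)) = [P X]" "outs (box (P_arr f)) = [P Y]"
  using box_sel[OF f] box_sel[OF P_arr_hom[OF f]] by auto

lemma e'_natural: "e' Y \<bullet> box (P_arr f) = e' X"
proof (rule P_joint_epi[OF nat_Ob(1) rep_Comp[OF rep_box[OF P_arr_hom[OF f]] rep_e[OF nat_Ob(2)]] rep_e[OF nat_Ob(1)]])
  show "(e' Y \<bullet> box (P_arr f)) \<bullet> box (\<zeta> X) = e' X \<bullet> box (\<zeta> X)"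
    by (simp add: \<zeta>_natural[OF f] e'_eqs[THEN seq_eq_extend] e'_eqs modality_natural(3)[OF T f])
  show "(e' Y \<bullet> box (P_arr f)) \<bullet> d' X = e' X \<bullet> d' X"
    by (simp add: d_natural[OF f] e'_eqs[THEN seq_eq_extend] e'_eqs)
qed

lemma \<Delta>'_natural: "\<Delta>' Y \<bullet> box (P_arr f) = beside [] (box (P_arr f)) [P Y] \<bullet> (beside [P X] (box (P_arr f)) [] \<bullet> \<Delta>' X)"
proof (rule P_equivariant_unique[OF nat_Ob(1)])
  let ?F = "box (P_arr f)" and ?t = "box (bang_arr T f)"
  note c = d'_commuting[OF nat_Ob(1)] d'_commuting[OF nat_Ob(2)] and r = rep_d[OF nat_Ob(2)]
  note F = rep_box[OF P_arr_hom[OF f]]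
  note [simp] = sels leibniz_sel[OF c(2,2)] leibniz_sel[OF c(1,1)] box_modality[OF T f]
  have cb: "commuting Y (leibniz Y (d' Y) (d' Y))" by (rule commuting_leibniz[OF c(2,2) r])
  have rb: "rep (leibniz_arrow Y (P Y) (d Y) (P Y) (d Y)) (\<langle>P Y\<rangle> \<star> \<langle>P Y\<rangle> \<star> \<langle>Y\<rangle>) (\<langle>P Y\<rangle> \<star> \<langle>P Y\<rangle>) (leibniz Y (d' Y) (d' Y))"
    by (rule rep_leibniz[OF r r]) simp_all
  show "rep (leibniz_arrow Y (P Y) (d Y) (P Y) (d Y) \<cdot> (\<one>(P Y \<boxtimes> P Y) \<otimes> f)) (\<langle>P Y\<rangle> \<star> \<langle>P Y\<rangle> \<star> \<langle>X\<rangle>) (\<langle>P Y\<rangle> \<star> \<langle>P Y\<rangle>)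
      (leibniz Y (d' Y) (d' Y) \<bullet> beside [P Y, P Y] (box f) [])"
    by (rule rep_cong, (rule rb rep_box[OF f] rep_rules | (simp; fail))+)
  show "commuting X (leibniz Y (d' Y) (d' Y) \<bullet> beside [P Y, P Y] (box f) [])"
    using commuting_along[OF cb rep_box[OF f]] by simp
  show "rep (\<Delta> Y \<cdot> P_arr f) \<langle>P X\<rangle> (\<langle>P Y\<rangle> \<star> \<langle>P Y\<rangle>) (\<Delta>' Y \<bullet> ?F)"
    by (rule rep_Comp[OF F rep_\<Delta>]) simp
  show "rep ((P_arr f \<otimes> P_arr f) \<cdot> \<Delta> X) \<langle>P X\<rangle> (\<langle>P Y\<rangle> \<star> \<langle>P Y\<rangle>) (beside [] ?F [P Y] \<bullet> (beside [P X] ?F [] \<bullet> \<Delta>' X))"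
    by (rule rep_cong, (rule F rep_\<Delta>[OF nat_Ob(1)] rep_rules | (simp; fail))+)
  have z: "beside [] ?F [P Y] \<bullet> beside [] (box (\<zeta> X)) [P Y] = beside [] (box (\<zeta> Y)) [P Y] \<bullet> beside [] ?t [P Y]"
    "beside [K X] ?F [] \<bullet> beside [K X] (box (\<zeta> X)) [] = beside [K X] (box (\<zeta> Y)) [] \<bullet> beside [K X] ?t []"
    by (simp_all only: beside_seq[symmetric] \<zeta>_natural[OF f])
  show "(\<Delta>' Y \<bullet> ?F) \<bullet> box (\<zeta> X) = (beside [] ?F [P Y] \<bullet> (beside [P X] ?F [] \<bullet> \<Delta>' X)) \<bullet> box (\<zeta> X)"
    using comonoid_sel[OF modality_comonoid[OF T nat_Ob(1)]]
    by (simp add: \<zeta>_natural[OF f] \<Delta>'_eqs[THEN seq_eq_extend] \<Delta>'_eqs modality_natural(4)[OF T f] slides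
        z[THEN seq_eq_extend])
  show "(\<Delta>' Y \<bullet> ?F) \<bullet> d' X = (leibniz Y (d' Y) (d' Y) \<bullet> beside [P Y, P Y] (box f) []) \<bullet> beside [] (\<Delta>' Y \<bullet> ?F) [X]"
    by (simp add: d_natural[OF f] \<Delta>'_eqs[THEN seq_eq_extend] slides)
  have "beside [] ?F [P Y] \<bullet> (beside [P X] ?F [] \<bullet> leibniz X (d' X) (d' X))
    = leibniz Y (d' Y) (d' Y) \<bullet> (beside [] ?F [P Y, Y] \<bullet> (beside [P X] ?F [Y] \<bullet> beside [P X, P X] (box f) []))"
    using leibniz_natural[OF F F rep_box[OF f] c(1) _ c(2) _ c(1) _ c(2)] d_natural[OF f] by simp
  from this[THEN seq_eq_extend]
  show "(beside [] ?F [P Y] \<bullet> (beside [P X] ?F [] \<bullet> \<Delta>' X)) \<bullet> d' X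
    = (leibniz Y (d' Y) (d' Y) \<bullet> beside [P Y, P Y] (box f) []) \<bullet> beside [] (beside [] ?F [P Y] \<bullet> (beside [P X] ?F [] \<bullet> \<Delta>' X)) [X]"
    by (simp add: \<Delta>'_eqs slides)
qed

lemma \<epsilon>_natural: "box (\<epsilon> Y) \<bullet> box (P_arr f) = box f \<bullet> box (\<epsilon> X)"
proof (rule P_joint_epi[OF nat_Ob(1) rep_Comp[OF rep_box[OF P_arr_hom[OF f]] rep_box[OF \<epsilon>_hom]]
    rep_Comp[OF rep_box[OF \<epsilon>_hom] rep_box[OF f]]])
  note [simp] = sels
  show "(box (\<epsilon> Y) \<bullet> box (P_arr f)) \<bullet> box (\<zeta> X) = (box f \<bullet> box (\<epsilon> X)) \<bullet> box (\<zeta> X)"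
    by (simp add: \<zeta>_natural[OF f] \<epsilon>_eqs[THEN seq_eq_extend] \<epsilon>_eqs modality_natural(1)[OF T f])
  have "beside [] (e' Y) [Y] \<bullet> beside [] (box (P_arr f)) [Y] = beside [] (e' X) [Y]"
    by (simp only: beside_seq[symmetric] e'_natural)
  moreover have "beside [] (e' X) [Y] \<bullet> beside [P X] (box f) [] = box f \<bullet> beside [] (e' X) [X]"
    using interchange[of "[]" "e' X" "[]" "box f" "[]"] by simp
  ultimately show "(box (\<epsilon> Y) \<bullet> box (P_arr f)) \<bullet> d' X = (box f \<bullet> box (\<epsilon> X)) \<bullet> d' X"
    by (simp add: d_natural[OF f] \<epsilon>_eqs[THEN seq_eq_extend] \<epsilon>_eqs) (metis seq_assoc)
qed simp_all

lemma \<delta>_natural: "box (\<delta> Y) \<bullet> box (P_arr f) = box (P_arr (P_arr f)) \<bullet> box (\<delta> X)"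
proof (rule P_chain_unique[OF nat_Ob(1)])
  let ?F = "box (P_arr f)" and ?G = "box (P_arr (P_arr f))" and ?t = "box (bang_arr T f)"
  note F = P_arr_hom[OF f] and G = P_arr_hom[OF P_arr_hom[OF f]] and r = rep_d[OF P_Ob[OF nat_Ob(2)]]
  note [simp] = sels box_sel[OF G] box_modality[OF T f] box_sel[OF modality_hom(4)[OF T nat_Ob(1)]]
  show "rep (d (P Y) \<cdot> (\<one>(P (P Y)) \<otimes> P_arr f)) (\<langle>P (P Y)\<rangle> \<star> \<langle>P X\<rangle>) \<langle>P (P Y)\<rangle> (d' (P Y) \<bullet> beside [P (P Y)] ?F [])"
    by (rule rep_cong, (rule r rep_box[OF F] rep_rules | (simp; fail))+)
  show "commuting (P X) (d' (P Y) \<bullet> beside [P (P Y)] ?F [])"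
    using commuting_along[OF d'_commuting[OF P_Ob[OF nat_Ob(2)]] rep_box[OF F]] by simp
  show "rep (\<delta> Y \<cdot> P_arr f) \<langle>P X\<rangle> \<langle>P (P Y)\<rangle> (box (\<delta> Y) \<bullet> ?F)"
    by (rule rep_Comp[OF rep_box[OF F] rep_box[OF \<delta>_hom]]) simp
  show "rep (P_arr (P_arr f) \<cdot> \<delta> X) \<langle>P X\<rangle> \<langle>P (P Y)\<rangle> (?G \<bullet> box (\<delta> X))"
    by (rule rep_Comp[OF rep_box[OF \<delta>_hom] rep_box[OF G]]) simp
  have "box (bang_arr T (\<zeta> Y)) \<bullet> box (bang_arr T (bang_arr T f)) = box (bang_arr T (P_arr f)) \<bullet> box (bang_arr T (\<zeta> X))"
  proof -
    have "\<zeta> Y \<cdot> bang_arr T f = P_arr f \<cdot> \<zeta> X"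
      using \<zeta>_natural[OF f] box_eq_iff[OF Comp_hom[OF modality_hom(2)[OF T f] \<zeta>_hom] Comp_hom[OF \<zeta>_hom F]]
        box_Comp[OF modality_hom(2)[OF T f] \<zeta>_hom] box_Comp[OF \<zeta>_hom F] by simp
    then show ?thesis
      using box_modality_Comp[OF T modality_hom(2)[OF T f] \<zeta>_hom] box_modality_Comp[OF T \<zeta>_hom F] by simp
  qed
  from this[THEN seq_eq_extend]
  show "(box (\<delta> Y) \<bullet> ?F) \<bullet> box (\<zeta> X) = (?G \<bullet> box (\<delta> X)) \<bullet> box (\<zeta> X)"
    by (simp add: \<zeta>_natural[OF f] \<delta>_eqs[THEN seq_eq_extend] \<delta>_eqs modality_natural(2)[OF T f]
        \<zeta>_natural[OF F, THEN seq_eq_extend])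
  have dF: "beside [P (P Y)] ?F [] \<bullet> beside [P (P Y)] (d' X) []
    = beside [P (P Y)] (d' Y) [] \<bullet> (beside [P (P Y)] ?F [Y] \<bullet> beside [P (P Y), P X] (box f) [])"
    using beside_seq[of "[P (P Y)]" ?F "d' X" "[]"] by (simp add: d_natural[OF f])
  have DF: "beside [] (\<Delta>' Y) [Y] \<bullet> beside [] ?F [Y] = beside [] ?F [P Y, Y] \<bullet> (beside [P X] ?F [Y] \<bullet> beside [] (\<Delta>' X) [Y])"
    using beside_seq[of "[]" "\<Delta>' Y" ?F "[Y]"] by (simp add: \<Delta>'_natural)
  show "(box (\<delta> Y) \<bullet> ?F) \<bullet> d' X = (d' (P Y) \<bullet> beside [P (P Y)] ?F []) \<bullet>
      (beside [P (P Y)] (d' X) [] \<bullet> (beside [] (box (\<delta> Y) \<bullet> ?F) [P X, X] \<bullet> beside [] (\<Delta>' X) [X]))"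
    by (simp add: d_natural[OF f] \<delta>_eqs[THEN seq_eq_extend] dF[THEN seq_eq_extend] DF[THEN seq_eq_extend])
      (simp add: slides)
  show "(?G \<bullet> box (\<delta> X)) \<bullet> d' X = (d' (P Y) \<bullet> beside [P (P Y)] ?F []) \<bullet>
      (beside [P (P Y)] (d' X) [] \<bullet> (beside [] (?G \<bullet> box (\<delta> X)) [P X, X] \<bullet> beside [] (\<Delta>' X) [X]))"
    by (simp add: \<delta>_eqs d_natural[OF F, THEN seq_eq_extend]) (simp add: slides)
qed

end

subsection \<open>The comonad laws\<close>

context
  fixes X assumes X [simp]: "X \<in> Ob C"
begin

lemma comonad_sel [simp]:
  "good (box (bang_arr T (\<zeta> X)))" "ins (box (bang_arr T (\<zeta> X))) = [K (K X)]" "outs (box (bang_arr T (\<zeta> X))) = [K (P X)]"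
  "good (box (digging T X))" "ins (box (digging T X)) = [K X]" "outs (box (digging T X)) = [K (K X)]"
  using box_modality[OF T \<zeta>_hom[OF X]] box_sel[OF modality_hom(4)[OF T X]] by auto

lemma \<Delta>'_counit:
  "beside [] (e' X) [P X, X] \<bullet> beside [] (\<Delta>' X) [X] = wire [P X, X]"
  "beside [P X] (e' X) [X] \<bullet> beside [] (\<Delta>' X) [X] = wire [P X, X]"
  and \<Delta>'_coassoc: "beside [] (\<Delta>' X) [P X, X] \<bullet> beside [] (\<Delta>' X) [X] = beside [P X] (\<Delta>' X) [X] \<bullet> beside [] (\<Delta>' X) [X]"
proof -
  interpret free_differential_comonoid C X "K X" "P X" "box (\<zeta> X)" "d' X" "\<zeta> X" "d X" "e' X" "\<Delta>' X" "delete T X" "duplicate T X"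
    by (rule P_comonoid[OF X])
  show "beside [] (e' X) [P X, X] \<bullet> beside [] (\<Delta>' X) [X] = wire [P X, X]"
    "beside [P X] (e' X) [X] \<bullet> beside [] (\<Delta>' X) [X] = wire [P X, X]"
    "beside [] (\<Delta>' X) [P X, X] \<bullet> beside [] (\<Delta>' X) [X] = beside [P X] (\<Delta>' X) [X] \<bullet> beside [] (\<Delta>' X) [X]"
    using counit[of "[]" "[X]"] coassoc[of "[]" "[X]"] by simp_all
qed

lemma \<delta>_counit: "e' (P X) \<bullet> box (\<delta> X) = e' X"
proof (rule P_joint_epi[OF X rep_Comp[OF rep_box[OF \<delta>_hom[OF X]] rep_e[OF P_Ob[OF X]]] rep_e[OF X]])
  note [simp] = sels
  show "(e' (P X) \<bullet> box (\<delta> X)) \<bullet> box (\<zeta> X) = e' X \<bullet> box (\<zeta> X)"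
    by (simp add: \<delta>_eqs e'_eqs[THEN seq_eq_extend] e'_eqs modality_natural(3)[OF T \<zeta>_hom[OF X], THEN seq_eq_extend]
        digging_comonoid_morphism(1)[OF T X])
  show "(e' (P X) \<bullet> box (\<delta> X)) \<bullet> d' X = e' X \<bullet> d' X"
    by (simp add: \<delta>_eqs e'_eqs[THEN seq_eq_extend] e'_eqs)
qed

text \<open>The two sides solve the same chain rule, whose coefficient is the Leibniz action of \<open>P X\<close> on the tensor
  square of \<open>P (P X)\<close>: the left-hand side by the product rule at \<open>P X\<close>, the right-hand side as a tensor product
  of two solutions.\<close>

lemma \<delta>_comult:
  "\<Delta>' (P X) \<bullet> box (\<delta> X) = beside [] (box (\<delta> X)) [P (P X)] \<bullet> (beside [P X] (box (\<delta> X)) [] \<bullet> \<Delta>' X)"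
proof -
  interpret free_differential_comonoid C X "K X" "P X" "box (\<zeta> X)" "d' X" "\<zeta> X" "d X" "e' X" "\<Delta>' X" "delete T X" "duplicate T X"
    by (rule P_comonoid[OF X])
  let ?c = "d' (P X)" and ?\<delta> = "box (\<delta> X)" and ?Q = "P (P X)" and ?t = "box (bang_arr T (\<zeta> X))" and ?g = "box (digging T X)"
  note [simp] = sels
  note cc = d'_commuting[OF P_Ob[OF X]] and r = rep_d[OF P_Ob[OF X]] and \<delta> = rep_box[OF \<delta>_hom[OF X]]
  note [simp] = leibniz_sel[OF cc cc]
  have ch: "chain ?c ?\<delta>" by (simp add: chain_def \<delta>_eqs)
  show ?thesis
  proof (rule chain_unique)
    show "rep (leibniz_arrow (P X) ?Q (d (P X)) ?Q (d (P X))) (\<langle>?Q\<rangle> \<star> \<langle>?Q\<rangle> \<star> \<langle>P X\<rangle>) (\<langle>?Q\<rangle> \<star> \<langle>?Q\<rangle>) (leibniz (P X) ?c ?c)"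
      by (rule rep_leibniz[OF r r]) simp_all
    show "commuting (P X) (leibniz (P X) ?c ?c)" by (rule commuting_leibniz[OF cc cc r])
    show "rep (\<Delta> (P X) \<cdot> \<delta> X) \<langle>P X\<rangle> (\<langle>?Q\<rangle> \<star> \<langle>?Q\<rangle>) (\<Delta>' (P X) \<bullet> ?\<delta>)"
      by (rule rep_Comp[OF \<delta> rep_\<Delta>]) simp
    show "rep ((\<delta> X \<otimes> \<delta> X) \<cdot> \<Delta> X) \<langle>P X\<rangle> (\<langle>?Q\<rangle> \<star> \<langle>?Q\<rangle>) (beside [] ?\<delta> [?Q] \<bullet> (beside [P X] ?\<delta> [] \<bullet> \<Delta>' X))"
      by (rule rep_cong, (rule \<delta> rep_\<Delta>[OF X] rep_rules | (simp; fail))+)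
    show "chain (leibniz (P X) ?c ?c) (\<Delta>' (P X) \<bullet> ?\<delta>)"
      by (simp add: chain_def \<delta>_eqs \<Delta>'_eqs[THEN seq_eq_extend]) (simp add: slides)
    show "chain (leibniz (P X) ?c ?c) (beside [] ?\<delta> [?Q] \<bullet> (beside [P X] ?\<delta> [] \<bullet> \<Delta>' X))"
      by (rule chain_tensor[OF r r \<delta> ch \<delta> ch])
    have z: "beside [] ?\<delta> [?Q] \<bullet> beside [] (box (\<zeta> X)) [?Q] = beside [] (box (\<zeta> (P X))) [?Q] \<bullet> (beside [] ?t [?Q] \<bullet> beside [] ?g [?Q])"
      "beside [K X] ?\<delta> [] \<bullet> beside [K X] (box (\<zeta> X)) [] = beside [K X] (box (\<zeta> (P X))) [] \<bullet> (beside [K X] ?t [] \<bullet> beside [K X] ?g [])"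
      using beside_seq[of "[]" ?\<delta> "box (\<zeta> X)" "[?Q]"] beside_seq[of "[K X]" ?\<delta> "box (\<zeta> X)" "[]"] by (simp_all add: \<delta>_eqs)
    show "(\<Delta>' (P X) \<bullet> ?\<delta>) \<bullet> box (\<zeta> X) = (beside [] ?\<delta> [?Q] \<bullet> (beside [P X] ?\<delta> [] \<bullet> \<Delta>' X)) \<bullet> box (\<zeta> X)"
      using comonoid_sel[OF modality_comonoid[OF T K_Ob[OF X]]] comonoid_sel[OF modality_comonoid[OF T P_Ob[OF X]]]
      by (simp add: \<delta>_eqs \<Delta>'_eqs[THEN seq_eq_extend] \<Delta>'_eqs modality_natural(4)[OF T \<zeta>_hom[OF X], THEN seq_eq_extend]
          digging_comonoid_morphism(2)[OF T X] slides z[THEN seq_eq_extend])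
  qed
qed

lemma \<epsilon>_\<delta>: "box (\<epsilon> (P X)) \<bullet> box (\<delta> X) = wire [P X]"
proof (rule P_joint_epi[OF X rep_Comp[OF rep_box[OF \<delta>_hom[OF X]] rep_box[OF \<epsilon>_hom[OF P_Ob[OF X]]]]])
  note [simp] = sels
  show "rep (\<one>(P X)) \<langle>P X\<rangle> \<langle>P X\<rangle> (wire [P X])" using rep_Ident[of "\<langle>P X\<rangle>" "P X"] by simp
  show "(box (\<epsilon> (P X)) \<bullet> box (\<delta> X)) \<bullet> box (\<zeta> X) = wire [P X] \<bullet> box (\<zeta> X)"
    by (simp add: \<delta>_eqs \<epsilon>_eqs[THEN seq_eq_extend] modality_natural(1)[OF T \<zeta>_hom[OF X], THEN seq_eq_extend]
        modality_comonad(1)[OF T X])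
  have i: "beside [] (e' (P X)) [P X] \<bullet> beside [P (P X)] (d' X) [] = d' X \<bullet> beside [] (e' (P X)) [P X, X]"
    using interchange[of "[]" "e' (P X)" "[]" "d' X" "[]"] by simp
  have j: "beside [] (e' (P X)) [P X, X] \<bullet> beside [] (box (\<delta> X)) [P X, X] = beside [] (e' X) [P X, X]"
    by (simp only: beside_seq[symmetric] \<delta>_counit)
  show "(box (\<epsilon> (P X)) \<bullet> box (\<delta> X)) \<bullet> d' X = wire [P X] \<bullet> d' X"
    by (simp add: \<delta>_eqs \<epsilon>_eqs[THEN seq_eq_extend] i[THEN seq_eq_extend] j[THEN seq_eq_extend] \<Delta>'_counit)
qed

text \<open>Naturality of \<open>d\<close> and the linear rule collapse the chain rule for \<open>\<delta>\<close> to equivariance for \<open>d\<close>, which the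
  identity satisfies too.\<close>

lemma P_\<epsilon>_\<delta>: "box (P_arr (\<epsilon> X)) \<bullet> box (\<delta> X) = wire [P X]"
proof (rule P_equivariant_unique[OF X rep_d[OF X] d'_commuting[OF X]])
  note [simp] = sels box_sel[OF P_arr_hom[OF \<epsilon>_hom[OF X]]]
  show "rep (P_arr (\<epsilon> X) \<cdot> \<delta> X) \<langle>P X\<rangle> \<langle>P X\<rangle> (box (P_arr (\<epsilon> X)) \<bullet> box (\<delta> X))"
    by (rule rep_Comp[OF rep_box[OF \<delta>_hom[OF X]] rep_box[OF P_arr_hom[OF \<epsilon>_hom[OF X]]]])
  show "rep (\<one>(P X)) \<langle>P X\<rangle> \<langle>P X\<rangle> (wire [P X])" using rep_Ident[of "\<langle>P X\<rangle>" "P X"] by simp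
  have "\<epsilon> X \<cdot> \<zeta> X = dereliction T X" using \<epsilon>_iff[OF X, of "\<epsilon> X"] by simp
  then have "box (bang_arr T (\<epsilon> X)) \<bullet> box (bang_arr T (\<zeta> X)) = box (bang_arr T (dereliction T X))"
    using box_modality_Comp[OF T \<zeta>_hom[OF X] \<epsilon>_hom[OF X]] by simp
  from this[THEN seq_eq_extend]
  show "(box (P_arr (\<epsilon> X)) \<bullet> box (\<delta> X)) \<bullet> box (\<zeta> X) = wire [P X] \<bullet> box (\<zeta> X)"
    by (simp add: \<delta>_eqs \<zeta>_natural[OF \<epsilon>_hom[OF X], THEN seq_eq_extend] modality_comonad(2)[OF T X])
  have ed: "beside [P (P X)] (box (\<epsilon> X)) [] \<bullet> beside [P (P X)] (d' X) [] = beside [P (P X)] (e' X) [X]"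
    using beside_seq[of "[P (P X)]" "box (\<epsilon> X)" "d' X" "[]"] by (simp add: \<epsilon>_eqs)
  have i: "beside [P (P X)] (e' X) [X] \<bullet> beside [] (box (\<delta> X)) [P X, X] = beside [] (box (\<delta> X)) [X] \<bullet> beside [P X] (e' X) [X]"
    using interchange[of "[]" "box (\<delta> X)" "[]" "e' X" "[X]"] by simp
  show "(box (P_arr (\<epsilon> X)) \<bullet> box (\<delta> X)) \<bullet> d' X = d' X \<bullet> beside [] (box (P_arr (\<epsilon> X)) \<bullet> box (\<delta> X)) [X]"
    by (simp add: \<delta>_eqs d_natural[OF \<epsilon>_hom[OF X], THEN seq_eq_extend] ed[THEN seq_eq_extend] i[THEN seq_eq_extend] \<Delta>'_counit)
qed (simp add: sels)

text \<open>Both sides satisfy the chain rule for the deriving transformation at \<open>P (P X)\<close>, restricted along \<open>\<delta>\<close> to an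
  action of \<open>P X\<close>.\<close>

lemma \<delta>_\<delta>: "box (\<delta> (P X)) \<bullet> box (\<delta> X) = box (P_arr (\<delta> X)) \<bullet> box (\<delta> X)"
proof (rule P_chain_unique[OF X])
  let ?Q = "P (P X)" and ?\<delta> = "box (\<delta> X)"
  let ?R = "P ?Q"
  note r = rep_d[OF P_Ob[OF P_Ob[OF X]]] and \<delta> = rep_box[OF \<delta>_hom[OF X]] and D = P_arr_hom[OF \<delta>_hom[OF X]]
  note [simp] = sels box_sel[OF D]
  note h = modality_hom(2)[OF T \<zeta>_hom[OF X]] modality_hom(4)[OF T X]
  note [simp] = box_sel[OF modality_hom(4)[OF T K_Ob[OF X]]] box_modality[OF T h(2)]
  show "rep (d ?Q \<cdot> (\<one>?R \<otimes> \<delta> X)) (\<langle>?R\<rangle> \<star> \<langle>P X\<rangle>) \<langle>?R\<rangle> (d' ?Q \<bullet> beside [?R] ?\<delta> [])"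
    by (rule rep_cong, (rule r \<delta> rep_rules | (simp; fail))+)
  show "commuting (P X) (d' ?Q \<bullet> beside [?R] ?\<delta> [])"
    using commuting_along[OF d'_commuting[OF P_Ob[OF P_Ob[OF X]]] \<delta>] by simp
  show "rep (\<delta> (P X) \<cdot> \<delta> X) \<langle>P X\<rangle> \<langle>?R\<rangle> (box (\<delta> (P X)) \<bullet> ?\<delta>)"
    by (rule rep_Comp[OF \<delta> rep_box[OF \<delta>_hom[OF P_Ob[OF X]]]])
  show "rep (P_arr (\<delta> X) \<cdot> \<delta> X) \<langle>P X\<rangle> \<langle>?R\<rangle> (box (P_arr (\<delta> X)) \<bullet> ?\<delta>)"
    by (rule rep_Comp[OF \<delta> rep_box[OF D]])
  have t\<delta>: "box (bang_arr T (\<delta> X)) \<bullet> box (bang_arr T (\<zeta> X))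
    = box (bang_arr T (\<zeta> (P X))) \<bullet> (box (bang_arr T (bang_arr T (\<zeta> X))) \<bullet> box (bang_arr T (digging T X)))"
  proof -
    have "\<delta> X \<cdot> \<zeta> X = (\<zeta> (P X) \<cdot> bang_arr T (\<zeta> X)) \<cdot> digging T X" using \<delta>_iff[OF X, of "\<delta> X"] by simp
    then show ?thesis
      using box_modality_Comp[OF T \<zeta>_hom[OF X] \<delta>_hom[OF X]] box_modality_Comp[OF T h(2) Comp_hom[OF h(1) \<zeta>_hom[OF P_Ob[OF X]]]]
        box_modality_Comp[OF T h(1) \<zeta>_hom[OF P_Ob[OF X]]] by simp
  qed
  show "(box (\<delta> (P X)) \<bullet> ?\<delta>) \<bullet> box (\<zeta> X) = (box (P_arr (\<delta> X)) \<bullet> ?\<delta>) \<bullet> box (\<zeta> X)"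
    by (simp add: \<delta>_eqs \<delta>_eqs[THEN seq_eq_extend] modality_natural(2)[OF T \<zeta>_hom[OF X], THEN seq_eq_extend] modality_comonad(3)[OF T X]
        \<zeta>_natural[OF \<delta>_hom[OF X], THEN seq_eq_extend] t\<delta>[THEN seq_eq_extend])
  have dd: "beside [?R] ?\<delta> [] \<bullet> beside [?R] (d' X) [] = beside [?R] (d' (P X)) [] \<bullet> (beside [?R, ?Q] (d' X) [] \<bullet>
      (beside [?R] ?\<delta> [P X, X] \<bullet> beside [?R] (\<Delta>' X) [X]))"
    using beside_seq[of "[?R]" ?\<delta> "d' X" "[]"] by (simp add: \<delta>_eqs)
  have D\<delta>: "beside [] (\<Delta>' (P X)) [P X, X] \<bullet> beside [] ?\<delta> [P X, X]
    = beside [] ?\<delta> [?Q, P X, X] \<bullet> (beside [P X] ?\<delta> [P X, X] \<bullet> beside [] (\<Delta>' X) [P X, X])"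
    using beside_seq[of "[]" "\<Delta>' (P X)" ?\<delta> "[P X, X]"] by (simp add: \<delta>_comult)
  have "(box (\<delta> (P X)) \<bullet> ?\<delta>) \<bullet> d' X = d' ?Q \<bullet> (beside [?R] (d' (P X)) [] \<bullet> (beside [] (box (\<delta> (P X))) [?Q, P X] \<bullet>
      (beside [] (\<Delta>' (P X)) [P X] \<bullet> (beside [?Q] (d' X) [] \<bullet> (beside [] ?\<delta> [P X, X] \<bullet> beside [] (\<Delta>' X) [X])))))"
    by (simp add: \<delta>_eqs \<delta>_eqs[THEN seq_eq_extend])
  also have "beside [] (\<Delta>' (P X)) [P X] \<bullet> (beside [?Q] (d' X) [] \<bullet> (beside [] ?\<delta> [P X, X] \<bullet> beside [] (\<Delta>' X) [X]))
    = beside [?Q, ?Q] (d' X) [] \<bullet> (beside [] (\<Delta>' (P X)) [P X, X] \<bullet> (beside [] ?\<delta> [P X, X] \<bullet> beside [] (\<Delta>' X) [X]))"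
    by (simp add: slides)
  also have "\<dots> = beside [?Q, ?Q] (d' X) [] \<bullet> (beside [] ?\<delta> [?Q, P X, X] \<bullet> (beside [P X] ?\<delta> [P X, X] \<bullet>
      (beside [P X] (\<Delta>' X) [X] \<bullet> beside [] (\<Delta>' X) [X])))"
    by (simp add: D\<delta>[THEN seq_eq_extend] \<Delta>'_coassoc)
  also have "d' ?Q \<bullet> (beside [?R] (d' (P X)) [] \<bullet> (beside [] (box (\<delta> (P X))) [?Q, P X] \<bullet> \<dots>))
    = (d' ?Q \<bullet> beside [?R] ?\<delta> []) \<bullet>
      (beside [?R] (d' X) [] \<bullet> (beside [] (box (\<delta> (P X)) \<bullet> ?\<delta>) [P X, X] \<bullet> beside [] (\<Delta>' X) [X]))"
    by (simp add: dd[THEN seq_eq_extend]) (simp add: slides)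
  finally show "(box (\<delta> (P X)) \<bullet> ?\<delta>) \<bullet> d' X = (d' ?Q \<bullet> beside [?R] ?\<delta> []) \<bullet>
      (beside [?R] (d' X) [] \<bullet> (beside [] (box (\<delta> (P X)) \<bullet> ?\<delta>) [P X, X] \<bullet> beside [] (\<Delta>' X) [X]))" .
  show "(box (P_arr (\<delta> X)) \<bullet> ?\<delta>) \<bullet> d' X = (d' ?Q \<bullet> beside [?R] ?\<delta> []) \<bullet>
      (beside [?R] (d' X) [] \<bullet> (beside [] (box (P_arr (\<delta> X)) \<bullet> ?\<delta>) [P X, X] \<bullet> beside [] (\<Delta>' X) [X]))"
    by (simp add: \<delta>_eqs d_natural[OF \<delta>_hom[OF X], THEN seq_eq_extend]) (simp add: slides)
qed

end

subsection \<open>The differential modality\<close>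

lemma natural_box:
  assumes "\<And>A. A \<in> Ob C \<Longrightarrow> t A \<in> hom C (Fo A) (Go A)"
    and "\<And>f A B. f \<in> hom C A B \<Longrightarrow> Fa f \<in> hom C (Fo A) (Fo B)" "\<And>f A B. f \<in> hom C A B \<Longrightarrow> Ga f \<in> hom C (Go A) (Go B)"
    and "\<And>f A B. f \<in> hom C A B \<Longrightarrow> box (t B) \<bullet> box (Fa f) = box (Ga f) \<bullet> box (t A)"
  shows "is_natural C C Fo Fa Go Ga t"
proof -
  have "t B \<cdot> Fa f = Ga f \<cdot> t A" if f: "f \<in> hom C A B" for f A B
  proof -
    have o: "A \<in> Ob C" "B \<in> Ob C" using hom_Ob[OF f] by auto
    note h = assms(2,3)[OF f] assms(1)[OF o(1)] assms(1)[OF o(2)]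
    show ?thesis
      unfolding box_eq_iff[OF Comp_hom[OF h(1,4)] Comp_hom[OF h(3,2)]] box_Comp[OF h(1,4)] box_Comp[OF h(3,2)]
      by (rule assms(4)[OF f])
  qed
  then show ?thesis using assms(1) by (auto simp: is_natural_def)
qed

lemma free_modality_coalgebra: "is_coalgebra_modality C free_modality"
  unfolding is_coalgebra_modality_def is_comonad_def free_modality_sel
proof (intro conjI ballI)
  show "is_functor C C P P_arr"
    unfolding is_functor_def using P_arr_hom P_arr_Ident P_arr_Comp by auto
  show "is_natural C C P P_arr (\<lambda>X. X) (\<lambda>f. f) \<epsilon>"
    by (rule natural_box[OF \<epsilon>_hom P_arr_hom _ \<epsilon>_natural]) simp_all
  show "is_natural C C P P_arr (\<lambda>X. P (P X)) (\<lambda>f. P_arr (P_arr f)) \<delta>"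
    by (rule natural_box[OF \<delta>_hom P_arr_hom _ \<delta>_natural]) (simp_all add: P_arr_hom)
  show "is_natural C C P P_arr (\<lambda>X. \<I>) (\<lambda>f. \<one>\<I>) e"
    unfolding is_natural_def
  proof (intro conjI ballI)
    show h: "e A \<in> hom C (P A) \<I>" if "A \<in> Ob C" for A using e_iff[OF that, of "e A"] by simp
    fix A B f assume o: "A \<in> Ob C" "B \<in> Ob C" and f: "f \<in> hom C A B"
    have "e B \<cdot> P_arr f = e A"
      by (rule rep_faithful[OF rep_cong[OF rep_Comp[OF rep_box[OF P_arr_hom[OF f]] rep_e[OF o(2)]] e'_natural[OF f]] rep_e[OF o(1)]])
    then show "e B \<cdot> P_arr f = \<one>\<I> \<cdot> e A" using h[OF o(1)] Ident_Comp by simp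
  qed
  show "is_natural C C P P_arr (\<lambda>X. P X \<boxtimes> P X) (\<lambda>f. P_arr f \<otimes> P_arr f) \<Delta>"
    unfolding is_natural_def
  proof (intro conjI ballI)
    show "\<Delta> A \<in> hom C (P A) (P A \<boxtimes> P A)" if "A \<in> Ob C" for A using \<Delta>_iff[OF that, of "\<Delta> A"] by simp
    fix A B f assume o: "A \<in> Ob C" "B \<in> Ob C" and f: "f \<in> hom C A B"
    note F = rep_box[OF P_arr_hom[OF f]]
    have "rep ((P_arr f \<otimes> P_arr f) \<cdot> \<Delta> A) \<langle>P A\<rangle> (\<langle>P B\<rangle> \<star> \<langle>P B\<rangle>) (\<Delta>' B \<bullet> box (P_arr f))"
      using rep_Comp[OF rep_\<Delta>[OF o(1)] rep_tensor[OF F F]] by (simp add: \<Delta>'_natural[OF f])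
    then show "\<Delta> B \<cdot> P_arr f = (P_arr f \<otimes> P_arr f) \<cdot> \<Delta> A"
      by (rule rep_faithful[OF rep_Comp[OF F rep_\<Delta>[OF o(2)]]])
  qed
next
  fix X assume X: "X \<in> Ob C"
  note o = P_Ob[OF X]
  note h = \<delta>_hom[OF X] \<epsilon>_hom[OF X] \<epsilon>_hom[OF o] \<delta>_hom[OF o]
  note i = Ident_hom[OF o]
  show "\<epsilon> (P X) \<cdot> \<delta> X = \<one>(P X)"
    by (simp add: box_eq_iff[OF Comp_hom[OF h(1,3)] i] box_Comp[OF h(1,3)] box_Ident[OF o] \<epsilon>_\<delta>[OF X])
  show "P_arr (\<epsilon> X) \<cdot> \<delta> X = \<one>(P X)"
    by (simp add: box_eq_iff[OF Comp_hom[OF h(1) P_arr_hom[OF h(2)]] i] box_Comp[OF h(1) P_arr_hom[OF h(2)]] box_Ident[OF o] P_\<epsilon>_\<delta>[OF X])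
  show "\<delta> (P X) \<cdot> \<delta> X = P_arr (\<delta> X) \<cdot> \<delta> X"
    by (simp add: box_eq_iff[OF Comp_hom[OF h(1,4)] Comp_hom[OF h(1) P_arr_hom[OF h(1)]]] box_Comp[OF h(1,4)]
        box_Comp[OF h(1) P_arr_hom[OF h(1)]] \<delta>_\<delta>[OF X])
  show "is_cocommutative_comonoid C (P X) (e X) (\<Delta> X)"
    using comonoid_iff[OF rep_e[OF X] rep_\<Delta>[OF X]]
      differential_comonoid.comonoid[OF free_differential_comonoid.axioms(2)[OF P_comonoid[OF X]]] by simp
  show "is_comonoid_morphism C (P X) (e X) (\<Delta> X) (P (P X)) (e (P X)) (\<Delta> (P X)) (\<delta> X)"
    using comonoid_morphism_iff[OF rep_e[OF X] rep_\<Delta>[OF X] rep_e[OF o] rep_\<Delta>[OF o] rep_box[OF h(1)]]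
      \<delta>_counit[OF X] \<delta>_comult[OF X] by simp
qed

lemma free_modality_differential: "is_differential_modality C free_modality"
  unfolding is_differential_modality_def is_deriving_transformation_def free_modality_sel
proof (intro conjI ballI)
  show "is_coalgebra_modality C free_modality" by (rule free_modality_coalgebra)
  show "is_natural C C (\<lambda>X. P X \<boxtimes> X) (\<lambda>f. P_arr f \<otimes> f) P P_arr d"
    unfolding is_natural_def using d_hom d_natural_arr by auto
  fix X assume X: "X \<in> Ob C"
  show "constant_rule C X (P X) (d X) (e X)" using e_iff[OF X, of "e X"] by simp
  show "product_rule C X (P X) (d X) (\<Delta> X)" using \<Delta>_iff[OF X, of "\<Delta> X"] by simp
  show "linear_rule C X (d X) (e X) (\<epsilon> X)" using \<epsilon>_iff[OF X, of "\<epsilon> X"] by simp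
  show "chain_rule C X (P X) (d X) (d (P X)) (\<Delta> X) (\<delta> X)" using \<delta>_iff[OF X, of "\<delta> X"] by simp
  show "commutes_with_itself C X (P X) (d X)" using commuting_iff[OF rep_d[OF X]] d'_commuting[OF X] by simp
qed

lemma \<zeta>_coalgebra_morphism: "is_coalgebra_modality_morphism C T free_modality \<zeta>"
  unfolding is_coalgebra_modality_morphism_def is_comonad_morphism_def free_modality_sel hcomp_self_def
proof (intro conjI ballI)
  show "is_natural C C (bang_ob T) (bang_arr T) P P_arr \<zeta>"
    by (rule natural_box[OF \<zeta>_hom modality_hom(2)[OF T] P_arr_hom \<zeta>_natural[symmetric]])
  fix X assume X: "X \<in> Ob C"
  show "\<epsilon> X \<cdot> \<zeta> X = dereliction T X" using \<epsilon>_iff[OF X, of "\<epsilon> X"] by simp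
  show "\<delta> X \<cdot> \<zeta> X = (\<zeta> (P X) \<cdot> bang_arr T (\<zeta> X)) \<cdot> digging T X" using \<delta>_iff[OF X, of "\<delta> X"] by simp
  show "is_comonoid_morphism C (bang_ob T X) (counit T X) (comult T X) (P X) (e X) (\<Delta> X) (\<zeta> X)"
    using e_iff[OF X, of "e X"] \<Delta>_iff[OF X, of "\<Delta> X"] \<zeta>_hom[OF X] by (simp add: is_comonoid_morphism_def)
qed

end

subsection \<open>The universal property\<close>

context free_modality_data
begin

context
  fixes T' :: "('o, 'm, 'z) diff_mod_scheme" and \<psi> :: "'o \<Rightarrow> 'm"
  assumes T': "is_differential_modality C T'"
    and \<psi>: "is_coalgebra_modality_morphism C T T' \<psi>"
begin

abbreviation Q :: "'o \<Rightarrow> 'o" where "Q X \<equiv> bang_ob T' X"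

lemmas T'c = differential_modality_coalgebra[OF T']

lemma Q_Ob [simp]: "X \<in> Ob C \<Longrightarrow> Q X \<in> Ob C"
  by (rule modality_hom(1)[OF T'c])

lemma \<psi>_hom: "X \<in> Ob C \<Longrightarrow> \<psi> X \<in> hom C (K X) (Q X)"
  using \<psi> by (simp add: is_coalgebra_modality_morphism_def is_comonoid_morphism_def)

lemma \<psi>_natural:
  assumes f: "f \<in> hom C X Y"
  shows "box (\<psi> Y) \<bullet> box (bang_arr T f) = box (bang_arr T' f) \<bullet> box (\<psi> X)"
proof -
  have o: "X \<in> Ob C" "Y \<in> Ob C" using hom_Ob[OF f] by auto
  have "is_natural C C (bang_ob T) (bang_arr T) (bang_ob T') (bang_arr T') \<psi>"
    using \<psi> by (simp add: is_coalgebra_modality_morphism_def is_comonad_morphism_def)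
  from natural_hom(2)[OF this f] show ?thesis
    using box_Comp[OF modality_hom(2)[OF T f] \<psi>_hom[OF o(2)]] box_Comp[OF \<psi>_hom[OF o(1)] modality_hom(2)[OF T'c f]] by simp
qed

lemma \<psi>_eqs:
  assumes X: "X \<in> Ob C"
  shows "box (dereliction T' X) \<bullet> box (\<psi> X) = box (dereliction T X)"
    "box (digging T' X) \<bullet> box (\<psi> X) = box (\<psi> (Q X)) \<bullet> (box (bang_arr T (\<psi> X)) \<bullet> box (digging T X))"
    "delete T' X \<bullet> box (\<psi> X) = delete T X"
    "duplicate T' X \<bullet> box (\<psi> X) = beside [] (box (\<psi> X)) [Q X] \<bullet> (beside [K X] (box (\<psi> X)) [] \<bullet> duplicate T X)"
proof -
  note h = \<psi>_hom[OF X] \<psi>_hom[OF Q_Ob[OF X]] and t = modality_hom[OF T'c] modality_hom[OF T]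
  have e: "dereliction T' X \<cdot> \<psi> X = dereliction T X"
    "digging T' X \<cdot> \<psi> X = (\<psi> (Q X) \<cdot> bang_arr T (\<psi> X)) \<cdot> digging T X"
    using \<psi> X by (simp_all add: is_coalgebra_modality_morphism_def is_comonad_morphism_def hcomp_self_def)
  show "box (dereliction T' X) \<bullet> box (\<psi> X) = box (dereliction T X)"
    using box_Comp[OF h(1) t(3)[OF X]] e(1) by simp
  show "box (digging T' X) \<bullet> box (\<psi> X) = box (\<psi> (Q X)) \<bullet> (box (bang_arr T (\<psi> X)) \<bullet> box (digging T X))"
    using box_Comp[OF h(1) t(4)[OF X]] e(2) box_Comp[OF t(10)[OF X] Comp_hom[OF t(8)[OF h(1)] h(2)]]
      box_Comp[OF t(8)[OF h(1)] h(2)] by simp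
  have "is_comonoid_morphism C (K X) (counit T X) (comult T X) (Q X) (counit T' X) (comult T' X) (\<psi> X)"
    using \<psi> X by (simp add: is_coalgebra_modality_morphism_def)
  then show "delete T' X \<bullet> box (\<psi> X) = delete T X"
    "duplicate T' X \<bullet> box (\<psi> X) = beside [] (box (\<psi> X)) [Q X] \<bullet> (beside [K X] (box (\<psi> X)) [] \<bullet> duplicate T X)"
    using comonoid_morphism_iff[OF rep_delete[OF T X] rep_duplicate[OF T X] rep_delete[OF T'c X] rep_duplicate[OF T'c X] rep_box[OF h(1)]]
    by auto
qed

text \<open>By the interchange rule, the deriving transformation of \<open>T'\<close> is a commuting action, so freeness of \<open>P X\<close>
  applies to it. This already gives uniqueness of the comparison; what remains to be shown is that the
  extensions respect the whole structure.\<close>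

lemma comparison_ex1:
  assumes X: "X \<in> Ob C"
  shows "\<exists>!h. h \<in> hom C (P X) (Q X) \<and> h \<cdot> \<zeta> X = \<psi> X \<and> h \<cdot> d X = deriv T' X \<cdot> (h \<otimes> \<one>X)"
proof -
  interpret differential_comonoid C X "Q X" "delete T' X" "duplicate T' X" "act T' X" "deriv T' X"
    by (rule differential_modality_comonoid[OF T' X])
  have "is_commuting_action C X (Q X) (deriv T' X)"
    using commuting_action_iff[OF d_rep] d_commuting by simp
  then show ?thesis
    using free_commuting_action.free[OF P_free[OF X]] \<psi>_hom[OF X] unfolding free_action_def by blast
qed

definition \<chi> :: "'o \<Rightarrow> 'm" where
  "\<chi> X = (THE h. h \<in> hom C (P X) (Q X) \<and> h \<cdot> \<zeta> X = \<psi> X \<and> h \<cdot> d X = deriv T' X \<cdot> (h \<otimes> \<one>X))"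

lemma \<chi>_hom: "X \<in> Ob C \<Longrightarrow> \<chi> X \<in> hom C (P X) (Q X)"
  and \<chi>_\<zeta>: "X \<in> Ob C \<Longrightarrow> \<chi> X \<cdot> \<zeta> X = \<psi> X"
  and \<chi>_d: "X \<in> Ob C \<Longrightarrow> \<chi> X \<cdot> d X = deriv T' X \<cdot> (\<chi> X \<otimes> \<one>X)"
  using theI'[OF comparison_ex1] by (simp_all add: \<chi>_def)

lemma \<chi>_eqs:
  assumes X: "X \<in> Ob C"
  shows "box (\<chi> X) \<bullet> box (\<zeta> X) = box (\<psi> X)" "box (\<chi> X) \<bullet> d' X = act T' X \<bullet> beside [] (box (\<chi> X)) [X]"
  using box_Comp[OF \<zeta>_hom[OF X] \<chi>_hom[OF X]] \<chi>_\<zeta>[OF X]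
    equivariant_iff[OF rep_box[OF \<chi>_hom[OF X]] rep_d[OF X] rep_act[OF T' X]] \<chi>_d[OF X] by simp_all

lemma \<chi>_sel: "X \<in> Ob C \<Longrightarrow> good (box (\<chi> X))" "X \<in> Ob C \<Longrightarrow> ins (box (\<chi> X)) = [P X]" "X \<in> Ob C \<Longrightarrow> outs (box (\<chi> X)) = [Q X]"
  using box_sel[OF \<chi>_hom] by auto

lemma act_sel: "X \<in> Ob C \<Longrightarrow> good (act T' X)" "X \<in> Ob C \<Longrightarrow> ins (act T' X) = [Q X, X]" "X \<in> Ob C \<Longrightarrow> outs (act T' X) = [Q X]"
  using rep_simps[OF rep_act[OF T']] by auto

lemmas \<chi>_sels = sels \<chi>_sel act_sel

lemma act_commuting: "X \<in> Ob C \<Longrightarrow> commuting X (act T' X)"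
  using differential_comonoid.d_commuting[OF differential_modality_comonoid[OF T']] .

lemma \<chi>_natural:
  assumes f: "f \<in> hom C X Y"
  shows "box (\<chi> Y) \<bullet> box (P_arr f) = box (bang_arr T' f) \<bullet> box (\<chi> X)"
proof -
  have X [simp]: "X \<in> Ob C" and Y [simp]: "Y \<in> Ob C" using hom_Ob[OF f] by auto
  note F = rep_box[OF P_arr_hom[OF f]] and G = rep_box[OF modality_hom(2)[OF T'c f]] and ff = rep_box[OF f]
  note \<chi> = rep_box[OF \<chi>_hom] and a = rep_act[OF T' Y]
  note [simp] = \<chi>_sels box_sel[OF f] box_sel[OF P_arr_hom[OF f]] box_modality[OF T'c f]
  show ?thesis
  proof (rule P_equivariant_unique[OF X])
    show "rep (deriv T' Y \<cdot> (\<one>(Q Y) \<otimes> f)) (\<langle>Q Y\<rangle> \<star> \<langle>X\<rangle>) \<langle>Q Y\<rangle> (act T' Y \<bullet> beside [Q Y] (box f) [])"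
      by (rule rep_cong, (rule a ff rep_rules | (simp; fail))+)
    show "commuting X (act T' Y \<bullet> beside [Q Y] (box f) [])"
      using commuting_along[OF act_commuting[OF Y] ff] by simp
    show "rep (\<chi> Y \<cdot> P_arr f) \<langle>P X\<rangle> \<langle>Q Y\<rangle> (box (\<chi> Y) \<bullet> box (P_arr f))" by (rule rep_Comp[OF F \<chi>[OF Y]])
    show "rep (bang_arr T' f \<cdot> \<chi> X) \<langle>P X\<rangle> \<langle>Q Y\<rangle> (box (bang_arr T' f) \<bullet> box (\<chi> X))" by (rule rep_Comp[OF \<chi>[OF X] G])
    show "(box (\<chi> Y) \<bullet> box (P_arr f)) \<bullet> box (\<zeta> X) = (box (bang_arr T' f) \<bullet> box (\<chi> X)) \<bullet> box (\<zeta> X)"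
      by (simp add: \<zeta>_natural[OF f] \<chi>_eqs \<chi>_eqs[THEN seq_eq_extend] \<psi>_natural[OF f])
    show "(box (\<chi> Y) \<bullet> box (P_arr f)) \<bullet> d' X
        = (act T' Y \<bullet> beside [Q Y] (box f) []) \<bullet> beside [] (box (\<chi> Y) \<bullet> box (P_arr f)) [X]"
      by (simp add: d_natural[OF f] \<chi>_eqs[THEN seq_eq_extend]) (simp add: slides)
    show "(box (bang_arr T' f) \<bullet> box (\<chi> X)) \<bullet> d' X
        = (act T' Y \<bullet> beside [Q Y] (box f) []) \<bullet> beside [] (box (bang_arr T' f) \<bullet> box (\<chi> X)) [X]"
      by (simp add: \<chi>_eqs act_natural[OF T' f, THEN seq_eq_extend]) (simp add: slides)
  qed
qed

context
  fixes X assumes X [simp]: "X \<in> Ob C"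
begin

lemma \<chi>_counit: "delete T' X \<bullet> box (\<chi> X) = e' X"
proof (rule P_joint_epi[OF X rep_Comp[OF rep_box[OF \<chi>_hom[OF X]] rep_delete[OF T'c X]] rep_e[OF X]])
  interpret differential_comonoid C X "Q X" "delete T' X" "duplicate T' X" "act T' X" "deriv T' X"
    by (rule differential_modality_comonoid[OF T' X])
  note [simp] = \<chi>_sels
  show "(delete T' X \<bullet> box (\<chi> X)) \<bullet> box (\<zeta> X) = e' X \<bullet> box (\<zeta> X)"
    by (simp add: \<chi>_eqs \<psi>_eqs e'_eqs)
  show "(delete T' X \<bullet> box (\<chi> X)) \<bullet> d' X = e' X \<bullet> d' X"
    by (simp add: \<chi>_eqs d_constant[THEN seq_eq_extend] e'_eqs)
qed

lemma \<chi>_comult: "duplicate T' X \<bullet> box (\<chi> X) = beside [] (box (\<chi> X)) [Q X] \<bullet> (beside [P X] (box (\<chi> X)) [] \<bullet> \<Delta>' X)"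
proof -
  interpret differential_comonoid C X "Q X" "delete T' X" "duplicate T' X" "act T' X" "deriv T' X"
    by (rule differential_modality_comonoid[OF T' X])
  let ?\<chi> = "box (\<chi> X)"
  note \<chi> = rep_box[OF \<chi>_hom[OF X]] and c = d_commuting d'_commuting[OF X]
  note [simp] = \<chi>_sels leibniz_sel[OF c(1,1)] leibniz_sel[OF c(2,2)] box_sel[OF \<psi>_hom[OF X]]
  show ?thesis
  proof (rule P_equivariant_unique[OF X])
    show "rep (leibniz_arrow X (Q X) (deriv T' X) (Q X) (deriv T' X)) (\<langle>Q X\<rangle> \<star> \<langle>Q X\<rangle> \<star> \<langle>X\<rangle>) (\<langle>Q X\<rangle> \<star> \<langle>Q X\<rangle>) (leibniz X (act T' X) (act T' X))"
      by (rule rep_leibniz[OF d_rep d_rep]) simp_all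
    show "commuting X (leibniz X (act T' X) (act T' X))" by (rule commuting_leibniz[OF c(1,1) d_rep])
    show "rep (comult T' X \<cdot> \<chi> X) \<langle>P X\<rangle> (\<langle>Q X\<rangle> \<star> \<langle>Q X\<rangle>) (duplicate T' X \<bullet> ?\<chi>)"
      by (rule rep_Comp[OF \<chi> rep_duplicate[OF T'c X]])
    show "rep ((\<chi> X \<otimes> \<chi> X) \<cdot> \<Delta> X) \<langle>P X\<rangle> (\<langle>Q X\<rangle> \<star> \<langle>Q X\<rangle>) (beside [] ?\<chi> [Q X] \<bullet> (beside [P X] ?\<chi> [] \<bullet> \<Delta>' X))"
      by (rule rep_cong, (rule \<chi> rep_\<Delta>[OF X] rep_rules | (simp; fail))+)
    have z: "beside [] ?\<chi> [Q X] \<bullet> beside [] (box (\<zeta> X)) [Q X] = beside [] (box (\<psi> X)) [Q X]"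
      "beside [K X] ?\<chi> [] \<bullet> beside [K X] (box (\<zeta> X)) [] = beside [K X] (box (\<psi> X)) []"
      by (simp_all only: beside_seq[symmetric] \<chi>_eqs[OF X])
    show "(duplicate T' X \<bullet> ?\<chi>) \<bullet> box (\<zeta> X) = (beside [] ?\<chi> [Q X] \<bullet> (beside [P X] ?\<chi> [] \<bullet> \<Delta>' X)) \<bullet> box (\<zeta> X)"
      by (simp add: \<chi>_eqs \<psi>_eqs \<Delta>'_eqs slides z[THEN seq_eq_extend])
    show "(duplicate T' X \<bullet> ?\<chi>) \<bullet> d' X = leibniz X (act T' X) (act T' X) \<bullet> beside [] (duplicate T' X \<bullet> ?\<chi>) [X]"
      by (simp add: \<chi>_eqs d_product[THEN seq_eq_extend])
    have "beside [] ?\<chi> [Q X] \<bullet> (beside [P X] ?\<chi> [] \<bullet> leibniz X (d' X) (d' X))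
        = leibniz X (act T' X) (act T' X) \<bullet> (beside [] ?\<chi> [Q X, X] \<bullet> beside [P X] ?\<chi> [X])"
      using leibniz_equivariant[OF \<chi> \<chi> c(2) _ c(1) _ c(2) _ c(1)] \<chi>_eqs(2)[OF X] by simp
    from this[THEN seq_eq_extend]
    show "(beside [] ?\<chi> [Q X] \<bullet> (beside [P X] ?\<chi> [] \<bullet> \<Delta>' X)) \<bullet> d' X
        = leibniz X (act T' X) (act T' X) \<bullet> beside [] (beside [] ?\<chi> [Q X] \<bullet> (beside [P X] ?\<chi> [] \<bullet> \<Delta>' X)) [X]"
      by (simp add: \<Delta>'_eqs)
  qed
qed

lemma \<chi>_dereliction: "box (dereliction T' X) \<bullet> box (\<chi> X) = box (\<epsilon> X)"
proof (rule P_joint_epi[OF X rep_Comp[OF rep_box[OF \<chi>_hom[OF X]] rep_box[OF modality_hom(3)[OF T'c X]]] rep_box[OF \<epsilon>_hom[OF X]]])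
  note [simp] = \<chi>_sels
  show "(box (dereliction T' X) \<bullet> box (\<chi> X)) \<bullet> box (\<zeta> X) = box (\<epsilon> X) \<bullet> box (\<zeta> X)"
    by (simp add: \<chi>_eqs \<psi>_eqs \<epsilon>_eqs)
  have "beside [] (delete T' X) [X] \<bullet> beside [] (box (\<chi> X)) [X] = beside [] (e' X) [X]"
    by (simp only: beside_seq[symmetric] \<chi>_counit)
  then show "(box (dereliction T' X) \<bullet> box (\<chi> X)) \<bullet> d' X = box (\<epsilon> X) \<bullet> d' X"
    by (simp add: \<chi>_eqs act_linear[OF T' X, THEN seq_eq_extend] \<epsilon>_eqs)
qed

text \<open>Both sides satisfy the chain rule for the deriving transformation of \<open>T'\<close> at \<open>Q X\<close>, restricted along \<open>\<chi>\<close>.\<close>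

lemma \<chi>_digging: "box (digging T' X) \<bullet> box (\<chi> X) = box (\<chi> (Q X)) \<bullet> (box (P_arr (\<chi> X)) \<bullet> box (\<delta> X))"
proof -
  interpret differential_comonoid C X "Q X" "delete T' X" "duplicate T' X" "act T' X" "deriv T' X"
    by (rule differential_modality_comonoid[OF T' X])
  let ?R = "Q (Q X)" and ?\<chi> = "box (\<chi> X)" and ?\<chi>\<chi> = "box (\<chi> (Q X)) \<bullet> (box (P_arr (\<chi> X)) \<bullet> box (\<delta> X))"
  note \<chi> = rep_box[OF \<chi>_hom[OF X]] and F = P_arr_hom[OF \<chi>_hom[OF X]] and a = rep_act[OF T' Q_Ob[OF X]]
  note g = modality_hom(4)[OF T'c X] and t = modality_hom(2)[OF T \<zeta>_hom[OF X]]
  note [simp] = \<chi>_sels box_sel[OF F] box_sel[OF g] box_sel[OF t] box_sel[OF modality_hom(4)[OF T X]]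
  show ?thesis
  proof (rule P_chain_unique[OF X])
    show "rep (deriv T' (Q X) \<cdot> (\<one>?R \<otimes> \<chi> X)) (\<langle>?R\<rangle> \<star> \<langle>P X\<rangle>) \<langle>?R\<rangle> (act T' (Q X) \<bullet> beside [?R] ?\<chi> [])"
      by (rule rep_cong, (rule a \<chi> rep_rules | (simp; fail))+)
    show "commuting (P X) (act T' (Q X) \<bullet> beside [?R] ?\<chi> [])"
      using commuting_along[OF act_commuting[OF Q_Ob[OF X]] \<chi>] by simp
    show "rep (digging T' X \<cdot> \<chi> X) \<langle>P X\<rangle> \<langle>?R\<rangle> (box (digging T' X) \<bullet> ?\<chi>)"
      by (rule rep_Comp[OF \<chi> rep_box[OF g]])
    show "rep (\<chi> (Q X) \<cdot> (P_arr (\<chi> X) \<cdot> \<delta> X)) \<langle>P X\<rangle> \<langle>?R\<rangle> ?\<chi>\<chi>"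
      by (rule rep_Comp[OF rep_Comp[OF rep_box[OF \<delta>_hom[OF X]] rep_box[OF F]] rep_box[OF \<chi>_hom[OF Q_Ob[OF X]]]])
    have "box (bang_arr T (\<chi> X)) \<bullet> box (bang_arr T (\<zeta> X)) = box (bang_arr T (\<psi> X))"
      using box_modality_Comp[OF T \<zeta>_hom[OF X] \<chi>_hom[OF X]] \<chi>_\<zeta>[OF X] by simp
    from this[THEN seq_eq_extend]
    show "(box (digging T' X) \<bullet> ?\<chi>) \<bullet> box (\<zeta> X) = ?\<chi>\<chi> \<bullet> box (\<zeta> X)"
      by (simp add: \<chi>_eqs \<psi>_eqs \<delta>_eqs \<zeta>_natural[OF \<chi>_hom[OF X], THEN seq_eq_extend] \<chi>_eqs[THEN seq_eq_extend])
    have cd: "beside [?R] ?\<chi> [] \<bullet> beside [?R] (d' X) [] = beside [?R] (act T' X) [] \<bullet> beside [?R] ?\<chi> [X]"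
      using beside_seq[of "[?R]" ?\<chi> "d' X" "[]"] by (simp add: \<chi>_eqs)
    have Dc: "beside [] (duplicate T' X) [X] \<bullet> beside [] ?\<chi> [X] = beside [] ?\<chi> [Q X, X] \<bullet> (beside [P X] ?\<chi> [X] \<bullet> beside [] (\<Delta>' X) [X])"
      using beside_seq[of "[]" "duplicate T' X" ?\<chi> "[X]"] by (simp add: \<chi>_comult)
    show "(box (digging T' X) \<bullet> ?\<chi>) \<bullet> d' X = (act T' (Q X) \<bullet> beside [?R] ?\<chi> []) \<bullet>
        (beside [?R] (d' X) [] \<bullet> (beside [] (box (digging T' X) \<bullet> ?\<chi>) [P X, X] \<bullet> beside [] (\<Delta>' X) [X]))"
      by (simp add: \<chi>_eqs act_chain[OF T' X, THEN seq_eq_extend] Dc cd[THEN seq_eq_extend]) (simp add: slides)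
    show "?\<chi>\<chi> \<bullet> d' X = (act T' (Q X) \<bullet> beside [?R] ?\<chi> []) \<bullet>
        (beside [?R] (d' X) [] \<bullet> (beside [] ?\<chi>\<chi> [P X, X] \<bullet> beside [] (\<Delta>' X) [X]))"
      by (simp add: \<delta>_eqs d_natural[OF \<chi>_hom[OF X], THEN seq_eq_extend] \<chi>_eqs[THEN seq_eq_extend]) (simp add: slides)
  qed
qed

end

lemma \<chi>_differential_morphism: "is_differential_modality_morphism C free_modality T' \<chi>"
  unfolding is_differential_modality_morphism_def is_coalgebra_modality_morphism_def is_comonad_morphism_def
    free_modality_sel hcomp_self_def
proof (intro conjI ballI)
  show "is_natural C C P P_arr (bang_ob T') (bang_arr T') \<chi>"
    by (rule natural_box[OF \<chi>_hom P_arr_hom modality_hom(2)[OF T'c] \<chi>_natural])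
  fix X assume X: "X \<in> Ob C"
  note h = \<chi>_hom[OF X] \<chi>_hom[OF Q_Ob[OF X]] P_arr_hom[OF \<chi>_hom[OF X]] \<delta>_hom[OF X]
  note t = modality_hom(3,4)[OF T'c X]
  show "dereliction T' X \<cdot> \<chi> X = \<epsilon> X"
    unfolding box_eq_iff[OF Comp_hom[OF h(1) t(1)] \<epsilon>_hom[OF X]] box_Comp[OF h(1) t(1)] by (rule \<chi>_dereliction[OF X])
  show "digging T' X \<cdot> \<chi> X = (\<chi> (Q X) \<cdot> P_arr (\<chi> X)) \<cdot> \<delta> X"
    unfolding box_eq_iff[OF Comp_hom[OF h(1) t(2)] Comp_hom[OF h(4) Comp_hom[OF h(3,2)]]] box_Comp[OF h(1) t(2)]
      box_Comp[OF h(4) Comp_hom[OF h(3,2)]] box_Comp[OF h(3,2)] seq_assoc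
    by (rule \<chi>_digging[OF X])
  show "is_comonoid_morphism C (P X) (e X) (\<Delta> X) (Q X) (counit T' X) (comult T' X) (\<chi> X)"
    using comonoid_morphism_iff[OF rep_e[OF X] rep_\<Delta>[OF X] rep_delete[OF T'c X] rep_duplicate[OF T'c X] rep_box[OF h(1)]]
      \<chi>_counit[OF X] \<chi>_comult[OF X] by simp
  show "\<chi> X \<cdot> d X = deriv T' X \<cdot> (\<chi> X \<otimes> \<one>X)" by (rule \<chi>_d[OF X])
qed

lemma \<chi>_unique:
  assumes "is_differential_modality_morphism C free_modality T' \<chi>'" "\<And>X. X \<in> Ob C \<Longrightarrow> \<chi>' X \<cdot> \<zeta> X = \<psi> X" "X \<in> Ob C"
  shows "\<chi>' X = \<chi> X"
proof -
  have "\<chi>' X \<in> hom C (P X) (Q X)" "\<chi>' X \<cdot> d X = deriv T' X \<cdot> (\<chi>' X \<otimes> \<one>X)"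
    using assms(1,3) by (auto simp: is_differential_modality_morphism_def is_coalgebra_modality_morphism_def is_comonoid_morphism_def)
  with assms(2)[OF assms(3)] have "\<chi>' X \<in> hom C (P X) (Q X) \<and> \<chi>' X \<cdot> \<zeta> X = \<psi> X \<and> \<chi>' X \<cdot> d X = deriv T' X \<cdot> (\<chi>' X \<otimes> \<one>X)"
    by (intro conjI)
  from the1_equality[OF comparison_ex1[OF assms(3)] this] show ?thesis by (simp only: \<chi>_def)
qed

lemma comparison:
  "\<exists>\<chi>. is_differential_modality_morphism C free_modality T' \<chi> \<and> (\<forall>X\<in>Ob C. \<chi> X \<cdot> \<zeta> X = \<psi> X) \<and>
     (\<forall>\<chi>'. is_differential_modality_morphism C free_modality T' \<chi>' \<and> (\<forall>X\<in>Ob C. \<chi>' X \<cdot> \<zeta> X = \<psi> X) \<longrightarrow>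
       (\<forall>X\<in>Ob C. \<chi>' X = \<chi> X))"
  using \<chi>_differential_morphism \<chi>_\<zeta> \<chi>_unique by blast

end

lemma free_modality_free: "is_free_differential_modality C T free_modality \<zeta>"
  unfolding is_free_differential_modality_def
  by (intro conjI allI impI; (elim conjE)?) (rule free_modality_differential \<zeta>_coalgebra_morphism comparison, assumption?, assumption?)+

end

theorem theorem62:
  fixes C :: "('o, 'm, 'k :: {comm_semiring_0, comm_monoid_mult}) linear_smc" (structure)
    and S :: "('o, 'm) free_monoids"
    and T :: "('o, 'm) coalg_mod"
  assumes "linear_symmetric_monoidal_category C"
    and "has_finite_biproducts C"
    and "algebraically_free_commutative_monoids C S"
    and "is_coalgebra_modality C T"
  shows "\<exists>(T\<^sub>d :: ('o, 'm) diff_mod) \<zeta>.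
    is_free_differential_modality C T T\<^sub>d \<zeta> \<and>
    (\<forall>X\<in>Ob C. bang_ob T\<^sub>d X = bang_ob T X \<boxtimes> S_ob S X) \<and>
    (\<forall>X\<in>Ob C. \<forall>Y\<in>Ob C. \<forall>f\<in>hom C X Y.
       (\<exists>!g. is_S_map C S X Y f g) \<and>
       bang_arr T\<^sub>d f = bang_arr T f \<otimes> (THE g. is_S_map C S X Y f g)) \<and>
    (\<forall>X\<in>Ob C. deriv T\<^sub>d X =
       (\<one>(bang_ob T X) \<otimes> S_deriv C S X) \<cdot> Assoc C (bang_ob T X) (S_ob S X) X) \<and>
    (\<forall>X\<in>Ob C. \<zeta> X = (\<one>(bang_ob T X) \<otimes> S_unit S X) \<cdot> RUnit_inv C (bang_ob T X)) \<and>
    (\<forall>X\<in>Ob C. \<forall>h.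
       h \<in> hom C (bang_ob T\<^sub>d X) \<I> \<and>
       h \<cdot> \<zeta> X = counit T X \<and>
       constant_rule C X (bang_ob T\<^sub>d X) (deriv T\<^sub>d X) h
       \<longleftrightarrow> h = counit T\<^sub>d X) \<and>
    (\<forall>X\<in>Ob C. \<forall>h.
       h \<in> hom C (bang_ob T\<^sub>d X) (bang_ob T\<^sub>d X \<boxtimes> bang_ob T\<^sub>d X) \<and>
       h \<cdot> \<zeta> X = (\<zeta> X \<otimes> \<zeta> X) \<cdot> comult T X \<and>
       product_rule C X (bang_ob T\<^sub>d X) (deriv T\<^sub>d X) h
       \<longleftrightarrow> h = comult T\<^sub>d X) \<and>
    (\<forall>X\<in>Ob C. \<forall>h.
       h \<in> hom C (bang_ob T\<^sub>d X) X \<and>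
       h \<cdot> \<zeta> X = dereliction T X \<and>
       linear_rule C X (deriv T\<^sub>d X) (counit T\<^sub>d X) h
       \<longleftrightarrow> h = dereliction T\<^sub>d X) \<and>
    (\<forall>X\<in>Ob C. \<forall>h.
       h \<in> hom C (bang_ob T\<^sub>d X) (bang_ob T\<^sub>d (bang_ob T\<^sub>d X)) \<and>
       h \<cdot> \<zeta> X = hcomp_self C T T\<^sub>d \<zeta> X \<cdot> digging T X \<and>
       chain_rule C X (bang_ob T\<^sub>d X) (deriv T\<^sub>d X) (deriv T\<^sub>d (bang_ob T\<^sub>d X)) (comult T\<^sub>d X) h
       \<longleftrightarrow> h = digging T\<^sub>d X)"
proof -
  interpret free_modality_data C S T
    using assms by (intro free_modality_data.intro free_modality_data_axioms.intro)
  show ?thesis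
  proof (intro exI conjI)
    show "is_free_differential_modality C T free_modality \<zeta>" by (rule free_modality_free)
    show "\<forall>X\<in>Ob C. bang_ob free_modality X = bang_ob T X \<boxtimes> S_ob S X"
      by (simp add: P_def)
    show "\<forall>X\<in>Ob C. \<forall>Y\<in>Ob C. \<forall>f\<in>hom C X Y. (\<exists>!g. is_S_map C S X Y f g) \<and>
        bang_arr free_modality f = bang_arr T f \<otimes> (THE g. is_S_map C S X Y f g)"
    proof (intro ballI conjI)
      fix X Y f assume f: "f \<in> hom C X Y"
      show "\<exists>!g. is_S_map C S X Y f g" by (rule S_map_ex1[OF f])
      show "bang_arr free_modality f = bang_arr T f \<otimes> (THE g. is_S_map C S X Y f g)"
        using f by (simp add: P_arr_def S_arr_def hom_iff)
    qed
    show "\<forall>X\<in>Ob C. deriv free_modality X = (\<one>(bang_ob T X) \<otimes> S_deriv C S X) \<cdot> Assoc C (bang_ob T X) (S_ob S X) X"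
      by (simp add: d_def)
    show "\<forall>X\<in>Ob C. \<zeta> X = (\<one>(bang_ob T X) \<otimes> S_unit S X) \<cdot> RUnit_inv C (bang_ob T X)"
      by (simp add: \<zeta>_def)
  qed (intro ballI allI, simp only: free_modality_sel hcomp_self_def e_iff \<Delta>_iff \<epsilon>_iff \<delta>_iff)+
qed

end
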